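(* Let $\Lambda$ be a row-finite $k$-graph with no sources. Let $(T,\sigma)$ be a self-similar $k$-regular $\Lambda$-system of maps, and let $X$ be the associated $\Lambda$-system of correspondences. Then $\mathcal{O}_X\cong C^*(\Lambda)$ as $C^*$-algebras.
   Context: **$k$-graphs.** A $k$-graph is a countable small category $\Lambda$ with a degree functor $d:\Lambda\to\mathbb{N}^k$ having the unique factorization property: if $d(\lambda)=m+n$ then $\lambda=\mu\nu$ for unique $\mu,\nu$ with $d(\mu)=m$, $d(\nu)=n$. Put $\Lambda^n=d^{-1}(n)$; $\Lambda^0$ is identified with the objects (vertices); $r,s$ are range and source; $\lambda\mu$ is defined when $s(\lambda)=r(\mu)$. Write $u\Lambda v=\{\lambda: r(\lambda)=u,s(\lambda)=v\}$, $v\Lambda^n=\{\lambda\in\Lambda^n:r(\lambda)=v\}$. Row-finite with no sources: $v\Lambda^n$ is finite and nonempty for all $v\in\Lambda^0$, $n\in\mathbb{N}^k$. $C^*(\Lambda)$ is the universal $C^*$-algebra generated by partial isometries $\{s_\lambda\}_{\lambda\in\Lambda}$ such that the $p_v:=s_v$ ($v\in\Lambda^0$) are mutually orthogonal projections, $s_\lambda s_\mu=s_{\lambda\mu}$ if $s(\lambda)=r(\mu)$, $s_\lambda^*s_\lambda=p_{s(\lambda)}$, and $p_v=\sum_{\lambda\in v\Lambda^n}s_\lambda s_\lambda^*$ for all $v,n$. **Infinite paths.** $\Omega_k$ is the $k$-graph $\{(m,n)\in\mathbb{N}^k\times\mathbb{N}^k:m\le n\}$ with $r(m,n)=m$, $s(m,n)=n$,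 $d(m,n)=n-m$. $\Lambda^\infty$ is the set of degree-preserving functors $x:\Omega_k\to\Lambda$, with $r(x)=x(0,0)$, $v\Lambda^\infty=\{x:r(x)=v\}$, and topology generated by the sets $\lambda\Lambda^\infty=\{\lambda x: x\in s(\lambda)\Lambda^\infty\}$, $\lambda\in\Lambda$. For $\lambda\in u\Lambda v$, $\tau_\lambda:v\Lambda^\infty\to u\Lambda^\infty$ is $\tau_\lambda(x)=\lambda x$. **$\Lambda$-systems of maps.** A $\Lambda$-system of maps $(T,\sigma)$ consists of locally compact Hausdorff spaces $T_v$ ($v\in\Lambda^0$), $T=\bigsqcup_{v}T_v$ (topological disjoint union), and continuous maps $\sigma_\lambda:T_v\to T_u$ for $\lambda\in u\Lambda v$, with $\sigma_\lambda\circ\sigma_\mu=\sigma_{\lambda\mu}$ if $s(\lambda)=r(\mu)$ and $\sigma_v=\mathrm{id}_{T_v}$ for $v\in\Lambda^0$. It is $k$-regular if every $\sigma_\lambda$ is proper (inverse images of compact sets are compact) and it is $k$-dense, i.e. $T_v=\overline{\bigcup_{\lambda\in v\Lambda^n}\sigma_\lambda(T_{s(\lambda)})}$ for all $v\in\Lambda^0$, $n\in\mathbb{N}^k$. A continuous map $\Phi:\Lambda^\infty\to T$ is intertwining if $\Phi\circ\tau_\lambda=\sigma_\lambda\circ\Phi$ on $s(\lambda)\Lambda^\infty$ for all $\lambda\in\Lambda$ (in particular $\Phi(v\Lambda^\infty)\subset T_v$). $(T,\sigma)$ is self-similar if there is a surjective intertwining map $\Phi:\Lambda^\infty\to T$.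 **Associated correspondences.** For $\lambda\in u\Lambda v$, $X_\lambda$ is $C_0(T_v)$ as a Hilbert module over itself ($\langle\xi,\eta\rangle=\overline{\xi}\eta$), with left $C_0(T_u)$-action $f\cdot\xi=(f\circ\sigma_\lambda)\xi$. The multiplication $X_\lambda\times X_\mu\to X_{\lambda\mu}$ (for $s(\lambda)=r(\mu)$) is $\xi\eta=(\xi\circ\sigma_\mu)\eta$. These form the associated $\Lambda$-system of correspondences $X=\bigsqcup_\lambda X_\lambda$. **The algebra $\mathcal{O}_X$.** Let $A=\bigoplus_{v\in\Lambda^0}C_0(T_v)$ ($c_0$-direct sum), and regard each $X_\lambda$ as an $A$-correspondence. For $n\in\mathbb{N}^k$ put $Y_n=\bigoplus_{\lambda\in\Lambda^n}X_\lambda$, with left action $\varphi_n$ of $A$; so $Y_0=A$. With the multiplication inherited from $X$ (products of elements of $X_\lambda$ and $X_\mu$ being $0$ if $s(\lambda)\ne r(\mu)$), $Y=\bigsqcup_nY_n$ is a product system over $\mathbb{N}^k$. A representation $\psi$ of $Y$ in a $C^*$-algebra $B$ is a family of linear maps $\psi_n:Y_n\to B$ with $\psi_0$ a homomorphism, $\psi_n(x)\psi_m(y)=\psi_{n+m}(xy)$ and $\psi_n(x)^*\psi_n(y)=\psi_0(\langle x,y\rangle_A)$; $\psi^{(n)}:\mathcal{K}(Y_n)\to B$ is the homomorphism sending the rank-one operator $z\mapsto x\langle y,z\rangle_A$ to $\psi_n(x)\psi_n(y)^*$. When $(T,\sigma)$ is $k$-regular, $\varphi_n$ maps $A$ into $\mathcal{K}(Y_n)$,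 and $\psi$ is Cuntz-Pimsner covariant if $\psi^{(n)}\circ\varphi_n=\psi_0$ for all $n\in\mathbb{N}^k$. $\mathcal{O}_X:=\mathcal{O}_Y$ is the $C^*$-algebra generated by a universal Cuntz-Pimsner covariant representation of $Y$. *)

theory Defs
  imports "HOL-Analysis.Analysis"
begin

section \<open>C*-algebras\<close>

text \<open>Not necessarily unital, and the zero algebra is allowed.\<close>

class cstar_algebra = real_normed_algebra + banach +
  fixes scaleC :: "complex \<Rightarrow> 'a \<Rightarrow> 'a"  (infixr "*\<^sub>C" 75)
    and adj :: "'a \<Rightarrow> 'a"
  assumes scaleC_add_right: "c *\<^sub>C (x + y) = c *\<^sub>C x + c *\<^sub>C y"
    and scaleC_add_left: "(b + c) *\<^sub>C x = b *\<^sub>C x + c *\<^sub>C x"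
    and scaleC_scaleC: "b *\<^sub>C c *\<^sub>C x = (b * c) *\<^sub>C x"
    and scaleC_of_real: "complex_of_real r *\<^sub>C x = r *\<^sub>R x"
    and mult_scaleC_left: "(c *\<^sub>C x) * y = c *\<^sub>C (x * y)"
    and mult_scaleC_right: "x * (c *\<^sub>C y) = c *\<^sub>C (x * y)"
    and norm_scaleC: "norm (c *\<^sub>C x) = cmod c * norm x"
    and adj_add: "adj (x + y) = adj x + adj y"
    and adj_scaleC: "adj (c *\<^sub>C x) = cnj c *\<^sub>C adj x"
    and adj_mult: "adj (x * y) = adj y * adj x"
    and adj_adj: "adj (adj x) = x"
    and cstar_identity: "norm (adj x * x) = (norm x)\<^sup>2"

instantiation complex :: cstar_algebra
begin
definition scaleC_complex :: "complex \<Rightarrow> complex \<Rightarrow> complex" where "scaleC_complex c x = c * x"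
definition adj_complex :: "complex \<Rightarrow> complex" where "adj_complex x = cnj x"
instance
  by standard
    (auto simp: scaleC_complex_def adj_complex_def algebra_simps norm_mult power2_eq_square
       scaleR_conv_of_real)
end

definition star_hom :: "('a::cstar_algebra \<Rightarrow> 'b::cstar_algebra) \<Rightarrow> bool" where
  "star_hom \<pi> \<longleftrightarrow>
     (\<forall>x y. \<pi> (x + y) = \<pi> x + \<pi> y) \<and> (\<forall>c x. \<pi> (c *\<^sub>C x) = c *\<^sub>C \<pi> x) \<and>
     (\<forall>x y. \<pi> (x * y) = \<pi> x * \<pi> y) \<and> (\<forall>x. \<pi> (adj x) = adj (\<pi> x))"

definition star_isomorphic :: "'a::cstar_algebra itself \<Rightarrow> 'b::cstar_algebra itself \<Rightarrow> bool" where
  "star_isomorphic _ _ \<longleftrightarrow> (\<exists>\<pi> :: 'a \<Rightarrow> 'b. star_hom \<pi> \<and> bij \<pi>)"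

definition cstar_subalgebra :: "'a::cstar_algebra set \<Rightarrow> bool" where
  "cstar_subalgebra S \<longleftrightarrow>
     closed S \<and> 0 \<in> S \<and> (\<forall>x\<in>S. \<forall>y\<in>S. x + y \<in> S \<and> x * y \<in> S) \<and>
     (\<forall>c. \<forall>x\<in>S. c *\<^sub>C x \<in> S) \<and> (\<forall>x\<in>S. adj x \<in> S)"

definition generates_cstar :: "'a::cstar_algebra set \<Rightarrow> bool" where
  "generates_cstar G \<longleftrightarrow> cstar_subalgebra hull G = UNIV"

definition projection :: "'a::cstar_algebra \<Rightarrow> bool" where
  "projection p \<longleftrightarrow> p * p = p \<and> adj p = p"

definition partial_isometry :: "'a::cstar_algebra \<Rightarrow> bool" where
  "partial_isometry s \<longleftrightarrow> s * adj s * s = s"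


section \<open>Higher-rank graphs\<close>

text \<open>Categories are given by their arrows, objects being identified with their identity arrows;
  thus \<open>rng\<close> and \<open>src\<close> take values in the identity arrows. The composite
  \<open>cmp \<Lambda> \<alpha> \<beta>\<close> is meaningful when \<open>src \<Lambda> \<alpha> = rng \<Lambda> \<beta>\<close>. The rank \<open>k\<close> is \<open>CARD('k)\<close>.\<close>

record ('e, 'k) kgraph =
  arrows :: "'e set"
  rng :: "'e \<Rightarrow> 'e"
  src :: "'e \<Rightarrow> 'e"
  cmp :: "'e \<Rightarrow> 'e \<Rightarrow> 'e"
  deg :: "'e \<Rightarrow> nat ^ 'k"

locale k_graph =
  fixes \<Lambda> :: "('e, 'k::finite) kgraph"
  assumes countable_arrows: "countable (arrows \<Lambda>)"
    and rng_arrow: "\<alpha> \<in> arrows \<Lambda> \<Longrightarrow> rng \<Lambda> \<alpha> \<in> arrows \<Lambda>"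
    and src_arrow: "\<alpha> \<in> arrows \<Lambda> \<Longrightarrow> src \<Lambda> \<alpha> \<in> arrows \<Lambda>"
    and rng_rng: "\<alpha> \<in> arrows \<Lambda> \<Longrightarrow> rng \<Lambda> (rng \<Lambda> \<alpha>) = rng \<Lambda> \<alpha>"
    and src_rng: "\<alpha> \<in> arrows \<Lambda> \<Longrightarrow> src \<Lambda> (rng \<Lambda> \<alpha>) = rng \<Lambda> \<alpha>"
    and rng_src: "\<alpha> \<in> arrows \<Lambda> \<Longrightarrow> rng \<Lambda> (src \<Lambda> \<alpha>) = src \<Lambda> \<alpha>"
    and src_src: "\<alpha> \<in> arrows \<Lambda> \<Longrightarrow> src \<Lambda> (src \<Lambda> \<alpha>) = src \<Lambda> \<alpha>"
    and cmp_arrow: "\<lbrakk>\<alpha> \<in> arrows \<Lambda>; \<beta> \<in> arrows \<Lambda>; src \<Lambda> \<alpha> = rng \<Lambda> \<beta>\<rbrakk> \<Longrightarrow> cmp \<Lambda> \<alpha> \<beta> \<in> arrows \<Lambda>"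
    and rng_cmp: "\<lbrakk>\<alpha> \<in> arrows \<Lambda>; \<beta> \<in> arrows \<Lambda>; src \<Lambda> \<alpha> = rng \<Lambda> \<beta>\<rbrakk> \<Longrightarrow> rng \<Lambda> (cmp \<Lambda> \<alpha> \<beta>) = rng \<Lambda> \<alpha>"
    and src_cmp: "\<lbrakk>\<alpha> \<in> arrows \<Lambda>; \<beta> \<in> arrows \<Lambda>; src \<Lambda> \<alpha> = rng \<Lambda> \<beta>\<rbrakk> \<Longrightarrow> src \<Lambda> (cmp \<Lambda> \<alpha> \<beta>) = src \<Lambda> \<beta>"
    and cmp_assoc: "\<lbrakk>\<alpha> \<in> arrows \<Lambda>; \<beta> \<in> arrows \<Lambda>; \<gamma> \<in> arrows \<Lambda>; src \<Lambda> \<alpha> = rng \<Lambda> \<beta>; src \<Lambda> \<beta> = rng \<Lambda> \<gamma>\<rbrakk>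
        \<Longrightarrow> cmp \<Lambda> (cmp \<Lambda> \<alpha> \<beta>) \<gamma> = cmp \<Lambda> \<alpha> (cmp \<Lambda> \<beta> \<gamma>)"
    and cmp_rng: "\<alpha> \<in> arrows \<Lambda> \<Longrightarrow> cmp \<Lambda> (rng \<Lambda> \<alpha>) \<alpha> = \<alpha>"
    and cmp_src: "\<alpha> \<in> arrows \<Lambda> \<Longrightarrow> cmp \<Lambda> \<alpha> (src \<Lambda> \<alpha>) = \<alpha>"
    and deg_cmp: "\<lbrakk>\<alpha> \<in> arrows \<Lambda>; \<beta> \<in> arrows \<Lambda>; src \<Lambda> \<alpha> = rng \<Lambda> \<beta>\<rbrakk>
        \<Longrightarrow> deg \<Lambda> (cmp \<Lambda> \<alpha> \<beta>) = deg \<Lambda> \<alpha> + deg \<Lambda> \<beta>"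
    and factorization: "\<lbrakk>\<alpha> \<in> arrows \<Lambda>; deg \<Lambda> \<alpha> = m + n\<rbrakk> \<Longrightarrow>
        \<exists>!(\<beta>, \<gamma>). \<beta> \<in> arrows \<Lambda> \<and> \<gamma> \<in> arrows \<Lambda> \<and> src \<Lambda> \<beta> = rng \<Lambda> \<gamma> \<and> cmp \<Lambda> \<beta> \<gamma> = \<alpha> \<and>
                  deg \<Lambda> \<beta> = m \<and> deg \<Lambda> \<gamma> = n"

definition of_degree :: "('e, 'k::finite) kgraph \<Rightarrow> nat ^ 'k \<Rightarrow> 'e set" where
  "of_degree \<Lambda> n = {\<alpha> \<in> arrows \<Lambda>. deg \<Lambda> \<alpha> = n}"

abbreviation vertices :: "('e, 'k::finite) kgraph \<Rightarrow> 'e set" where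
  "vertices \<Lambda> \<equiv> of_degree \<Lambda> 0"

definition of_degree_at :: "('e, 'k::finite) kgraph \<Rightarrow> 'e \<Rightarrow> nat ^ 'k \<Rightarrow> 'e set" where
  "of_degree_at \<Lambda> v n = {\<alpha> \<in> of_degree \<Lambda> n. rng \<Lambda> \<alpha> = v}"

text \<open>The arrows of degree zero are exactly the identity arrows.\<close>

lemma (in k_graph) vertices_eq_identities: "vertices \<Lambda> = {\<alpha> \<in> arrows \<Lambda>. rng \<Lambda> \<alpha> = \<alpha> \<and> src \<Lambda> \<alpha> = \<alpha>}"
proof (intro equalityI subsetI)
  fix l assume "l \<in> vertices \<Lambda>"
  then have l: "l \<in> arrows \<Lambda>" "deg \<Lambda> l = 0" by (auto simp: of_degree_def)
  have dr: "deg \<Lambda> (rng \<Lambda> l) = 0" "deg \<Lambda> (src \<Lambda> l) = 0"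
    using deg_cmp[of "rng \<Lambda> l" l] deg_cmp[of l "src \<Lambda> l"] l rng_arrow src_arrow src_rng rng_src
      cmp_rng cmp_src by auto
  have "\<exists>!(\<beta>, \<gamma>). \<beta> \<in> arrows \<Lambda> \<and> \<gamma> \<in> arrows \<Lambda> \<and> src \<Lambda> \<beta> = rng \<Lambda> \<gamma> \<and> cmp \<Lambda> \<beta> \<gamma> = l \<and>
                  deg \<Lambda> \<beta> = 0 \<and> deg \<Lambda> \<gamma> = 0"
    by (rule factorization) (use l in auto)
  moreover have "rng \<Lambda> l \<in> arrows \<Lambda> \<and> src \<Lambda> (rng \<Lambda> l) = rng \<Lambda> l \<and> cmp \<Lambda> (rng \<Lambda> l) l = l"
    "src \<Lambda> l \<in> arrows \<Lambda> \<and> src \<Lambda> l = rng \<Lambda> (src \<Lambda> l) \<and> cmp \<Lambda> l (src \<Lambda> l) = l"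
    using l rng_arrow src_arrow src_rng rng_src cmp_rng cmp_src by auto
  ultimately have "(rng \<Lambda> l, l) = (l, src \<Lambda> l)"
    using l dr by (elim ex1E) (smt (verit, best) case_prodI)
  then show "l \<in> {\<alpha> \<in> arrows \<Lambda>. rng \<Lambda> \<alpha> = \<alpha> \<and> src \<Lambda> \<alpha> = \<alpha>}" using l by auto
next
  fix l assume "l \<in> {\<alpha> \<in> arrows \<Lambda>. rng \<Lambda> \<alpha> = \<alpha> \<and> src \<Lambda> \<alpha> = \<alpha>}"
  then show "l \<in> vertices \<Lambda>" using deg_cmp[of l l] cmp_rng[of l] by (auto simp: of_degree_def)
qed

definition row_finite_no_sources :: "('e, 'k::finite) kgraph \<Rightarrow> bool" where
  "row_finite_no_sources \<Lambda> \<longleftrightarrow>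
     (\<forall>v\<in>vertices \<Lambda>. \<forall>n. finite (of_degree_at \<Lambda> v n) \<and> of_degree_at \<Lambda> v n \<noteq> {})"


section \<open>The C*-algebra of a higher-rank graph\<close>

definition ck_family :: "('e, 'k::finite) kgraph \<Rightarrow> ('e \<Rightarrow> 'b::cstar_algebra) \<Rightarrow> bool" where
  "ck_family \<Lambda> s \<longleftrightarrow>
     (\<forall>\<alpha>\<in>arrows \<Lambda>. partial_isometry (s \<alpha>)) \<and>
     (\<forall>v\<in>vertices \<Lambda>. projection (s v)) \<and>
     (\<forall>v\<in>vertices \<Lambda>. \<forall>w\<in>vertices \<Lambda>. v \<noteq> w \<longrightarrow> s v * s w = 0) \<and>
     (\<forall>\<alpha>\<in>arrows \<Lambda>. \<forall>\<beta>\<in>arrows \<Lambda>. src \<Lambda> \<alpha> = rng \<Lambda> \<beta> \<longrightarrow> s \<alpha> * s \<beta> = s (cmp \<Lambda> \<alpha> \<beta>)) \<and>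
     (\<forall>\<alpha>\<in>arrows \<Lambda>. adj (s \<alpha>) * s \<alpha> = s (src \<Lambda> \<alpha>)) \<and>
     (\<forall>v\<in>vertices \<Lambda>. \<forall>n. s v = (\<Sum>\<alpha>\<in>of_degree_at \<Lambda> v n. s \<alpha> * adj (s \<alpha>)))"

text \<open>\<open>universal_ck_family TYPE('b) \<Lambda> s\<close>: the C*-algebra \<open>'c\<close> is generated by the family \<open>s\<close>, which
  is universal with respect to families in the C*-algebra \<open>'b\<close>. HOL cannot quantify over the type
  \<open>'b\<close> inside a formula, so universality is indexed by the target: \<open>('c, s)\<close> is
  \<open>C\<^sup>*(\<Lambda>)\<close> if this holds for every \<open>'b\<close>. Assuming it only for some \<open>'b\<close> is
  assuming less. The map \<open>\<pi>\<close> is unique because \<open>s\<close> generates.\<close>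

definition universal_ck_family ::
    "'b::cstar_algebra itself \<Rightarrow> ('e, 'k::finite) kgraph \<Rightarrow> ('e \<Rightarrow> 'c::cstar_algebra) \<Rightarrow> bool" where
  "universal_ck_family _ \<Lambda> s \<longleftrightarrow>
     ck_family \<Lambda> s \<and> generates_cstar (s ` arrows \<Lambda>) \<and>
     (\<forall>t :: 'e \<Rightarrow> 'b. ck_family \<Lambda> t \<longrightarrow>
        (\<exists>\<pi> :: 'c \<Rightarrow> 'b. star_hom \<pi> \<and> (\<forall>\<alpha>\<in>arrows \<Lambda>. \<pi> (s \<alpha>) = t \<alpha>)))"


section \<open>Infinite paths\<close>

text \<open>The objects \<open>m\<close> of \<open>\<Omega>\<^sub>k\<close> appear as the identity arrows \<open>(m, m)\<close>.\<close>

definition Omega :: "((nat ^ 'k) \<times> (nat ^ 'k), 'k::finite) kgraph" where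
  "Omega = \<lparr> arrows = {(m, n). m \<le> n},
             rng = (\<lambda>(m, n). (m, m)),
             src = (\<lambda>(m, n). (n, n)),
             cmp = (\<lambda>(m, n) (n', p). (m, p)),
             deg = (\<lambda>(m, n). n - m) \<rparr>"

definition degree_preserving_functor ::
    "('f, 'k::finite) kgraph \<Rightarrow> ('e, 'k) kgraph \<Rightarrow> ('f \<Rightarrow> 'e) \<Rightarrow> bool" where
  "degree_preserving_functor \<Gamma> \<Lambda> x \<longleftrightarrow>
     (\<forall>a\<in>arrows \<Gamma>. x a \<in> arrows \<Lambda> \<and> rng \<Lambda> (x a) = x (rng \<Gamma> a) \<and> src \<Lambda> (x a) = x (src \<Gamma> a) \<and>
                  deg \<Lambda> (x a) = deg \<Gamma> a) \<and>
     (\<forall>a\<in>arrows \<Gamma>. \<forall>b\<in>arrows \<Gamma>. src \<Gamma> a = rng \<Gamma> b \<longrightarrow> x (cmp \<Gamma> a b) = cmp \<Lambda> (x a) (x b))"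

type_synonym ('e, 'k) inf_path = "(nat ^ 'k) \<times> (nat ^ 'k) \<Rightarrow> 'e"

definition inf_paths :: "('e, 'k::finite) kgraph \<Rightarrow> ('e, 'k) inf_path set" where
  "inf_paths \<Lambda> = {x \<in> extensional (arrows Omega). degree_preserving_functor Omega \<Lambda> x}"

definition inf_paths_at :: "('e, 'k::finite) kgraph \<Rightarrow> 'e \<Rightarrow> ('e, 'k) inf_path set" where
  "inf_paths_at \<Lambda> v = {x \<in> inf_paths \<Lambda>. x (0, 0) = v}"

text \<open>For \<open>x\<close> with range \<open>src \<Lambda> \<alpha>\<close>, \<open>\<alpha>x\<close> is the unique infinite path with initial segment \<open>\<alpha>\<close>
  whose shift by \<open>deg \<Lambda> \<alpha>\<close> is \<open>x\<close>.\<close>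

definition prepend :: "('e, 'k::finite) kgraph \<Rightarrow> 'e \<Rightarrow> ('e, 'k) inf_path \<Rightarrow> ('e, 'k) inf_path" where
  "prepend \<Lambda> \<alpha> x = (THE y. y \<in> inf_paths \<Lambda> \<and> y (0, deg \<Lambda> \<alpha>) = \<alpha> \<and>
      (\<forall>m n. m \<le> n \<longrightarrow> y (deg \<Lambda> \<alpha> + m, deg \<Lambda> \<alpha> + n) = x (m, n)))"

definition cylinder :: "('e, 'k::finite) kgraph \<Rightarrow> 'e \<Rightarrow> ('e, 'k) inf_path set" where
  "cylinder \<Lambda> \<alpha> = prepend \<Lambda> \<alpha> ` inf_paths_at \<Lambda> (src \<Lambda> \<alpha>)"

definition inf_path_space :: "('e, 'k::finite) kgraph \<Rightarrow> ('e, 'k) inf_path topology" where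
  "inf_path_space \<Lambda> = topology_generated_by (cylinder \<Lambda> ` arrows \<Lambda>)"


section \<open>Systems of maps\<close>

locale lambda_system = k_graph \<Lambda>
  for \<Lambda> :: "('e, 'k::finite) kgraph" +
  fixes T :: "'e \<Rightarrow> 't topology" and \<sigma> :: "'e \<Rightarrow> 't \<Rightarrow> 't"
  assumes locally_compact: "v \<in> vertices \<Lambda> \<Longrightarrow> locally_compact_space (T v)"
    and Hausdorff: "v \<in> vertices \<Lambda> \<Longrightarrow> Hausdorff_space (T v)"
    and continuous_maps: "\<alpha> \<in> arrows \<Lambda> \<Longrightarrow> continuous_map (T (src \<Lambda> \<alpha>)) (T (rng \<Lambda> \<alpha>)) (\<sigma> \<alpha>)"
    and maps_cmp: "\<lbrakk>\<alpha> \<in> arrows \<Lambda>; \<beta> \<in> arrows \<Lambda>; src \<Lambda> \<alpha> = rng \<Lambda> \<beta>; t \<in> topspace (T (src \<Lambda> \<beta>))\<rbrakk>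
        \<Longrightarrow> \<sigma> \<alpha> (\<sigma> \<beta> t) = \<sigma> (cmp \<Lambda> \<alpha> \<beta>) t"
    and maps_vertex: "\<lbrakk>v \<in> vertices \<Lambda>; t \<in> topspace (T v)\<rbrakk> \<Longrightarrow> \<sigma> v t = t"

definition k_dense :: "('e, 'k::finite) kgraph \<Rightarrow> ('e \<Rightarrow> 't topology) \<Rightarrow> ('e \<Rightarrow> 't \<Rightarrow> 't) \<Rightarrow> bool" where
  "k_dense \<Lambda> T \<sigma> \<longleftrightarrow>
     (\<forall>v\<in>vertices \<Lambda>. \<forall>n.
        topspace (T v) = T v closure_of (\<Union>\<alpha>\<in>of_degree_at \<Lambda> v n. \<sigma> \<alpha> ` topspace (T (src \<Lambda> \<alpha>))))"

text \<open>Properness is spelled out because the library's \<open>proper_map\<close> means closed with compact fibres.\<close>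

definition k_regular :: "('e, 'k::finite) kgraph \<Rightarrow> ('e \<Rightarrow> 't topology) \<Rightarrow> ('e \<Rightarrow> 't \<Rightarrow> 't) \<Rightarrow> bool" where
  "k_regular \<Lambda> T \<sigma> \<longleftrightarrow>
     (\<forall>\<alpha>\<in>arrows \<Lambda>. \<forall>K. compactin (T (rng \<Lambda> \<alpha>)) K \<longrightarrow>
        compactin (T (src \<Lambda> \<alpha>)) {t \<in> topspace (T (src \<Lambda> \<alpha>)). \<sigma> \<alpha> t \<in> K}) \<and>
     k_dense \<Lambda> T \<sigma>"

text \<open>The point \<open>t\<close> of \<open>T\<^sub>v\<close> is the point \<open>(v, t)\<close> of the disjoint union.\<close>

definition total_space :: "('e, 'k::finite) kgraph \<Rightarrow> ('e \<Rightarrow> 't topology) \<Rightarrow> ('e \<times> 't) topology" where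
  "total_space \<Lambda> T = sum_topology T (vertices \<Lambda>)"

definition intertwining :: "('e, 'k::finite) kgraph \<Rightarrow> ('e \<Rightarrow> 't topology) \<Rightarrow> ('e \<Rightarrow> 't \<Rightarrow> 't) \<Rightarrow>
    (('e, 'k) inf_path \<Rightarrow> 'e \<times> 't) \<Rightarrow> bool" where
  "intertwining \<Lambda> T \<sigma> \<Phi> \<longleftrightarrow>
     continuous_map (inf_path_space \<Lambda>) (total_space \<Lambda> T) \<Phi> \<and>
     (\<forall>\<alpha>\<in>arrows \<Lambda>. \<forall>x\<in>inf_paths_at \<Lambda> (src \<Lambda> \<alpha>).
        \<exists>t\<in>topspace (T (src \<Lambda> \<alpha>)). \<Phi> x = (src \<Lambda> \<alpha>, t) \<and> \<Phi> (prepend \<Lambda> \<alpha> x) = (rng \<Lambda> \<alpha>, \<sigma> \<alpha> t))"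

definition self_similar :: "('e, 'k::finite) kgraph \<Rightarrow> ('e \<Rightarrow> 't topology) \<Rightarrow> ('e \<Rightarrow> 't \<Rightarrow> 't) \<Rightarrow> bool" where
  "self_similar \<Lambda> T \<sigma> \<longleftrightarrow>
     (\<exists>\<Phi>. intertwining \<Lambda> T \<sigma> \<Phi> \<and> \<Phi> ` inf_paths \<Lambda> = topspace (total_space \<Lambda> T))"


section \<open>The product system of a system of maps\<close>

text \<open>Functions on \<open>T\<^sub>v\<close> are extended by zero to the whole type.\<close>

definition C0 :: "'t topology \<Rightarrow> ('t \<Rightarrow> complex) set" where
  "C0 X = {f. continuous_map X euclidean f \<and>
              (\<forall>\<epsilon>>0. compactin X {t \<in> topspace X. \<epsilon> \<le> cmod (f t)}) \<and>
              (\<forall>t. t \<notin> topspace X \<longrightarrow> f t = 0)}"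

text \<open>Elements of \<open>A\<close> are families indexed by vertices, elements of \<open>Y\<^sub>n\<close> are families indexed by
  arrows of degree \<open>n\<close>; both are extended by zero to all indices.\<close>

type_synonym ('e, 't) family = "'e \<Rightarrow> 't \<Rightarrow> complex"

definition sup_norm :: "('e, 't) family \<Rightarrow> real" where
  "sup_norm a = (SUP (v, t). cmod (a v t))"

definition coeff_algebra :: "('e, 'k::finite) kgraph \<Rightarrow> ('e \<Rightarrow> 't topology) \<Rightarrow> ('e, 't) family set" where
  "coeff_algebra \<Lambda> T =
     {a. (\<forall>v\<in>vertices \<Lambda>. a v \<in> C0 (T v)) \<and> (\<forall>v. v \<notin> vertices \<Lambda> \<longrightarrow> a v = (\<lambda>_. 0)) \<and>
         (\<forall>\<epsilon>>0. finite {v \<in> vertices \<Lambda>. \<epsilon> \<le> (SUP t. cmod (a v t))})}"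

text \<open>The Hilbert module direct sum of the \<open>X\<^sub>\<alpha>\<close>, \<open>\<alpha> \<in> \<Lambda>\<^sup>n\<close>: families for which the sum of the
  \<open>\<langle>y\<^sub>\<alpha>, y\<^sub>\<alpha>\<rangle>\<close> converges in norm in \<open>A\<close>. As an \<open>A\<close>-correspondence, \<open>X\<^sub>\<alpha>\<close> has
  inner product with values in the summand of \<open>A\<close> at \<open>src \<Lambda> \<alpha>\<close>.\<close>

definition Y_module :: "('e, 'k::finite) kgraph \<Rightarrow> ('e \<Rightarrow> 't topology) \<Rightarrow> nat ^ 'k \<Rightarrow> ('e, 't) family set" where
  "Y_module \<Lambda> T n =
     {y. (\<forall>\<alpha>\<in>of_degree \<Lambda> n. y \<alpha> \<in> C0 (T (src \<Lambda> \<alpha>))) \<and>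
         (\<forall>\<alpha>. \<alpha> \<notin> of_degree \<Lambda> n \<longrightarrow> y \<alpha> = (\<lambda>_. 0)) \<and>
         (\<exists>a\<in>coeff_algebra \<Lambda> T.
            uniform_limit UNIV (\<lambda>F (v, t). \<Sum>\<alpha>\<in>{\<alpha>\<in>F. src \<Lambda> \<alpha> = v}. cnj (y \<alpha> t) * y \<alpha> t)
              (\<lambda>(v, t). a v t) (finite_subsets_at_top (of_degree \<Lambda> n)))}"

definition Y_inner :: "('e, 'k::finite) kgraph \<Rightarrow> nat ^ 'k \<Rightarrow> ('e, 't) family \<Rightarrow> ('e, 't) family \<Rightarrow>
    ('e, 't) family" where
  "Y_inner \<Lambda> n x y = (\<lambda>v t. \<Sum>\<^sub>\<infinity>\<alpha>\<in>{\<alpha>\<in>of_degree \<Lambda> n. src \<Lambda> \<alpha> = v}. cnj (x \<alpha> t) * y \<alpha> t)"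

definition Y_norm :: "('e, 'k::finite) kgraph \<Rightarrow> nat ^ 'k \<Rightarrow> ('e, 't) family \<Rightarrow> real" where
  "Y_norm \<Lambda> n y = sqrt (sup_norm (Y_inner \<Lambda> n y y))"

definition right_action :: "('e, 'k::finite) kgraph \<Rightarrow> ('e, 't) family \<Rightarrow> ('e, 't) family \<Rightarrow>
    ('e, 't) family" where
  "right_action \<Lambda> x a = (\<lambda>\<alpha> t. x \<alpha> t * a (src \<Lambda> \<alpha>) t)"

text \<open>Operators on \<open>Y\<^sub>n\<close> are extended by zero outside \<open>Y\<^sub>n\<close>.\<close>

definition left_action :: "('e, 'k::finite) kgraph \<Rightarrow> ('e \<Rightarrow> 't topology) \<Rightarrow> ('e \<Rightarrow> 't \<Rightarrow> 't) \<Rightarrow>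
    nat ^ 'k \<Rightarrow> ('e, 't) family \<Rightarrow> ('e, 't) family \<Rightarrow> ('e, 't) family" where
  "left_action \<Lambda> T \<sigma> n a =
     (\<lambda>y. if y \<in> Y_module \<Lambda> T n then (\<lambda>\<alpha> t. a (rng \<Lambda> \<alpha>) (\<sigma> \<alpha> t) * y \<alpha> t) else (\<lambda>_ _. 0))"

text \<open>The component at \<open>\<gamma>\<close> of the product of \<open>x \<in> Y\<^sub>m\<close> and \<open>y \<in> Y\<^sub>n\<close>; by unique factorization
  the sum has one term if \<open>\<gamma>\<close> has degree \<open>m + n\<close>, and none otherwise.\<close>

definition Y_mult :: "('e, 'k::finite) kgraph \<Rightarrow> ('e \<Rightarrow> 't \<Rightarrow> 't) \<Rightarrow> nat ^ 'k \<Rightarrow> nat ^ 'k \<Rightarrow>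
    ('e, 't) family \<Rightarrow> ('e, 't) family \<Rightarrow> ('e, 't) family" where
  "Y_mult \<Lambda> \<sigma> m n x y =
     (\<lambda>\<gamma> t. \<Sum>(\<alpha>, \<beta>)\<in>{(\<alpha>, \<beta>). \<alpha> \<in> of_degree \<Lambda> m \<and> \<beta> \<in> of_degree \<Lambda> n \<and> src \<Lambda> \<alpha> = rng \<Lambda> \<beta> \<and>
                              cmp \<Lambda> \<alpha> \<beta> = \<gamma>}. x \<alpha> (\<sigma> \<beta> t) * y \<beta> t)"

definition rank_one :: "('e, 'k::finite) kgraph \<Rightarrow> ('e \<Rightarrow> 't topology) \<Rightarrow> nat ^ 'k \<Rightarrow>
    ('e, 't) family \<Rightarrow> ('e, 't) family \<Rightarrow> ('e, 't) family \<Rightarrow> ('e, 't) family" where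
  "rank_one \<Lambda> T n x y =
     (\<lambda>z. if z \<in> Y_module \<Lambda> T n then right_action \<Lambda> x (Y_inner \<Lambda> n y z) else (\<lambda>_ _. 0))"

text \<open>The closed linear span of the rank-one operators, for the operator norm.\<close>

definition compact_operators :: "('e, 'k::finite) kgraph \<Rightarrow> ('e \<Rightarrow> 't topology) \<Rightarrow> nat ^ 'k \<Rightarrow>
    (('e, 't) family \<Rightarrow> ('e, 't) family) set" where
  "compact_operators \<Lambda> T n =
     {S. (\<forall>z\<in>Y_module \<Lambda> T n. S z \<in> Y_module \<Lambda> T n) \<and>
         (\<forall>z. z \<notin> Y_module \<Lambda> T n \<longrightarrow> S z = (\<lambda>_ _. 0)) \<and>
         (\<forall>\<epsilon>>0. \<exists>N::nat. \<exists>x y. (\<forall>i<N. x i \<in> Y_module \<Lambda> T n \<and> y i \<in> Y_module \<Lambda> T n) \<and>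
            (\<forall>z\<in>Y_module \<Lambda> T n.
               Y_norm \<Lambda> n (\<lambda>\<alpha> t. S z \<alpha> t - (\<Sum>i<N. rank_one \<Lambda> T n (x i) (y i) z \<alpha> t))
                 \<le> \<epsilon> * Y_norm \<Lambda> n z))}"


section \<open>Cuntz-Pimsner covariant representations\<close>

definition representation :: "('e, 'k::finite) kgraph \<Rightarrow> ('e \<Rightarrow> 't topology) \<Rightarrow> ('e \<Rightarrow> 't \<Rightarrow> 't) \<Rightarrow>
    (nat ^ 'k \<Rightarrow> ('e, 't) family \<Rightarrow> 'b::cstar_algebra) \<Rightarrow> bool" where
  "representation \<Lambda> T \<sigma> \<psi> \<longleftrightarrow>
     (\<forall>n. \<forall>x\<in>Y_module \<Lambda> T n. \<forall>y\<in>Y_module \<Lambda> T n. \<psi> n (\<lambda>\<alpha> t. x \<alpha> t + y \<alpha> t) = \<psi> n x + \<psi> n y) \<and>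
     (\<forall>n c. \<forall>x\<in>Y_module \<Lambda> T n. \<psi> n (\<lambda>\<alpha> t. c * x \<alpha> t) = c *\<^sub>C \<psi> n x) \<and>
     (\<forall>a\<in>coeff_algebra \<Lambda> T. \<forall>b\<in>coeff_algebra \<Lambda> T. \<psi> 0 (\<lambda>v t. a v t * b v t) = \<psi> 0 a * \<psi> 0 b) \<and>
     (\<forall>a\<in>coeff_algebra \<Lambda> T. \<psi> 0 (\<lambda>v t. cnj (a v t)) = adj (\<psi> 0 a)) \<and>
     (\<forall>n m. \<forall>x\<in>Y_module \<Lambda> T n. \<forall>y\<in>Y_module \<Lambda> T m. \<psi> n x * \<psi> m y = \<psi> (n + m) (Y_mult \<Lambda> \<sigma> n m x y)) \<and>
     (\<forall>n. \<forall>x\<in>Y_module \<Lambda> T n. \<forall>y\<in>Y_module \<Lambda> T n. adj (\<psi> n x) * \<psi> n y = \<psi> 0 (Y_inner \<Lambda> n x y))"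

text \<open>\<open>\<kappa>\<close> is a *-homomorphism on \<open>K(Y\<^sub>n)\<close> with
  \<open>\<kappa> (rank_one x y) = \<psi>\<^sub>n(x) \<psi>\<^sub>n(y)\<^sup>*\<close>. For a representation \<open>\<psi>\<close> there is exactly one such
  \<open>\<kappa>\<close> on \<open>K(Y\<^sub>n)\<close>, usually written \<open>\<psi>\<^bsup>(n)\<^esup>\<close>. In the clause on adjoints, \<open>R\<close> is the
  adjoint of \<open>S\<close>.\<close>

definition induced_hom :: "('e, 'k::finite) kgraph \<Rightarrow> ('e \<Rightarrow> 't topology) \<Rightarrow>
    (nat ^ 'k \<Rightarrow> ('e, 't) family \<Rightarrow> 'b::cstar_algebra) \<Rightarrow> nat ^ 'k \<Rightarrow>
    ((('e, 't) family \<Rightarrow> ('e, 't) family) \<Rightarrow> 'b) \<Rightarrow> bool" where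
  "induced_hom \<Lambda> T \<psi> n \<kappa> \<longleftrightarrow>
     (\<forall>S\<in>compact_operators \<Lambda> T n. \<forall>R\<in>compact_operators \<Lambda> T n.
        \<kappa> (\<lambda>z \<alpha> t. S z \<alpha> t + R z \<alpha> t) = \<kappa> S + \<kappa> R \<and>
        \<kappa> (S \<circ> R) = \<kappa> S * \<kappa> R \<and>
        ((\<forall>x\<in>Y_module \<Lambda> T n. \<forall>y\<in>Y_module \<Lambda> T n. Y_inner \<Lambda> n (S x) y = Y_inner \<Lambda> n x (R y)) \<longrightarrow>
           \<kappa> R = adj (\<kappa> S))) \<and>
     (\<forall>c. \<forall>S\<in>compact_operators \<Lambda> T n. \<kappa> (\<lambda>z \<alpha> t. c * S z \<alpha> t) = c *\<^sub>C \<kappa> S) \<and>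
     (\<forall>x\<in>Y_module \<Lambda> T n. \<forall>y\<in>Y_module \<Lambda> T n. \<kappa> (rank_one \<Lambda> T n x y) = \<psi> n x * adj (\<psi> n y))"

definition cp_covariant :: "('e, 'k::finite) kgraph \<Rightarrow> ('e \<Rightarrow> 't topology) \<Rightarrow> ('e \<Rightarrow> 't \<Rightarrow> 't) \<Rightarrow>
    (nat ^ 'k \<Rightarrow> ('e, 't) family \<Rightarrow> 'b::cstar_algebra) \<Rightarrow> bool" where
  "cp_covariant \<Lambda> T \<sigma> \<psi> \<longleftrightarrow>
     (\<forall>n. \<exists>\<kappa>. induced_hom \<Lambda> T \<psi> n \<kappa> \<and>
        (\<forall>a\<in>coeff_algebra \<Lambda> T. \<kappa> (left_action \<Lambda> T \<sigma> n a) = \<psi> 0 a))"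

text \<open>\<open>universal_cp_representation TYPE('b) \<Lambda> T \<sigma> \<psi>\<close>: the C*-algebra \<open>'c\<close> is generated by the covariant
  representation \<open>\<psi>\<close>, which is universal with respect to covariant representations in \<open>'b\<close>;
  as for \<^const>\<open>universal_ck_family\<close>, the target \<open>'b\<close> is a parameter.\<close>

definition universal_cp_representation :: "'b::cstar_algebra itself \<Rightarrow> ('e, 'k::finite) kgraph \<Rightarrow>
    ('e \<Rightarrow> 't topology) \<Rightarrow> ('e \<Rightarrow> 't \<Rightarrow> 't) \<Rightarrow>
    (nat ^ 'k \<Rightarrow> ('e, 't) family \<Rightarrow> 'c::cstar_algebra) \<Rightarrow> bool" where
  "universal_cp_representation _ \<Lambda> T \<sigma> \<psi> \<longleftrightarrow>
     representation \<Lambda> T \<sigma> \<psi> \<and> cp_covariant \<Lambda> T \<sigma> \<psi> \<and>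
     generates_cstar (\<Union>n. \<psi> n ` Y_module \<Lambda> T n) \<and>
     (\<forall>\<rho> :: nat ^ 'k \<Rightarrow> ('e, 't) family \<Rightarrow> 'b. representation \<Lambda> T \<sigma> \<rho> \<and> cp_covariant \<Lambda> T \<sigma> \<rho> \<longrightarrow>
        (\<exists>\<pi> :: 'c \<Rightarrow> 'b. star_hom \<pi> \<and> (\<forall>n. \<forall>y\<in>Y_module \<Lambda> T n. \<pi> (\<psi> n y) = \<rho> n y)))"

end

theory Submission
  imports Defs
begin

text \<open>
Self-similarity makes every fibre \<open>T\<^sub>v\<close> compact: since \<open>\<Lambda>\<close> is row-finite, the set of infinite paths with
range \<open>v\<close> is compact by Koenig's lemma, and \<open>\<Phi>\<close> maps it onto \<open>T\<^sub>v\<close>. So \<open>A\<close> contains the characteristic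
functions of the fibres, and the summand \<open>X\<^sub>\<alpha>\<close> of \<open>Y\<^sub>n\<close> contains the constant function \<open>1\<^sub>\<alpha>\<close>. These elements
correspond to the generators of \<open>C\<^sup>*(\<Lambda>)\<close>, and the two universal properties give homomorphisms in both
directions.

From \<open>C\<^sup>*(\<Lambda>)\<close> to \<open>O\<^sub>X\<close>: put \<open>gen \<alpha> = \<psi>(1\<^sub>\<alpha>)\<close>. Two elements \<open>1\<^sub>\<alpha>\<close>, \<open>1\<^sub>\<beta>\<close> of the same degree are orthogonal unless
\<open>\<alpha> = \<beta>\<close>, and the left action of \<open>1\<^sub>v\<close> on \<open>Y\<^sub>n\<close> is the finite sum of the rank-one operators of the \<open>1\<^sub>\<alpha>\<close> with
\<open>\<alpha> \<in> v\<Lambda>\<^sup>n\<close>. Covariance therefore turns into the Cuntz-Krieger relation (\<open>ck_family_gen\<close>).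

From \<open>O\<^sub>X\<close> to \<open>C\<^sup>*(\<Lambda>)\<close>: a continuous function \<open>f\<close> on \<open>T\<^sub>v\<close> gives an element \<open>iota v f\<close>, the limit of the Riemann
sums of \<open>f \<circ> \<Phi>\<close> over the cylinders of the \<open>\<alpha> \<in> v\<Lambda>\<^sup>n\<close>, in which the projection \<open>s\<^sub>\<alpha>s\<^sub>\<alpha>\<^sup>*\<close> plays the part of the
cylinder of \<open>\<alpha>\<close>. The limit exists because \<open>f \<circ> \<Phi>\<close> oscillates little on the cylinders of all long paths
(\<open>small_oscillation\<close>) and because the projections of one degree are orthogonal. As \<open>\<Phi>\<close> intertwines, \<open>iota\<close>
satisfies \<open>iota(f) s\<^sub>\<beta> = s\<^sub>\<beta> iota(f \<circ> \<sigma>\<^sub>\<beta>)\<close> (\<open>iota_s\<close>), which is what makes \<open>rho n y = \<Sum> s\<^sub>\<alpha> iota(y\<^sub>\<alpha>)\<close> a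
representation of \<open>Y\<close>. Its covariance involves the homomorphism \<open>kappa n\<close> on the compact operators of \<open>Y\<^sub>n\<close>,
defined by \<open>kappa n S * rho n w = rho n (S w)\<close>; such an element exists because a finite-rank operator of
operator norm at most \<open>C\<close> is sent to an element of norm at most \<open>C\<close> (\<open>norm_ketbra_le\<close>).

The composite on \<open>C\<^sup>*(\<Lambda>)\<close> fixes the generators because \<open>rho n 1\<^sub>\<alpha> = s\<^sub>\<alpha>\<close>. For the composite on \<open>O\<^sub>X\<close> it has to be
seen that the homomorphism \<open>\<pi>\<close> with \<open>\<pi> s\<^sub>\<alpha> = gen \<alpha>\<close> takes \<open>iota v f\<close> to \<open>\<psi>(f)\<close> (\<open>hom_iota\<close>). By covariance \<open>\<psi>(f)\<close> is the
sum of the \<open>gen \<alpha> \<psi>(f \<circ> \<sigma>\<^sub>\<alpha>) (gen \<alpha>)\<^sup>*\<close> over \<open>\<alpha> \<in> v\<Lambda>\<^sup>n\<close>, and for large \<open>n\<close> all the functions \<open>f \<circ> \<sigma>\<^sub>\<alpha>\<close> are nearly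
constant; replacing them by constants gives the image of the Riemann sum of degree \<open>n\<close>.

The C*-algebra theory used on the way (homomorphisms are contractive, projections with sum a projection are
orthogonal, norms of orthogonal sums) is obtained from the C*-identity and from one square root, found as
the fixed point of a contraction (\<open>fixpoint_half_square\<close>).
\<close>

section \<open>Elementary C*-algebra theory\<close>

lemma scaleC_one [simp]: "1 *\<^sub>C (x::'a::cstar_algebra) = x"
  using scaleC_of_real[of 1 x] by simp

lemma scaleC_zero_right [simp]: "c *\<^sub>C (0::'a::cstar_algebra) = 0"
  using scaleC_add_right[of c 0 "0::'a"] by simp

lemma scaleC_zero_left [simp]: "0 *\<^sub>C (x::'a::cstar_algebra) = 0"
  using scaleC_of_real[of 0 x] by simp

lemma scaleC_minus1: "(-1) *\<^sub>C (x::'a::cstar_algebra) = - x"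
  using scaleC_of_real[of "-1" x] by simp

lemma scaleC_minus_right: "c *\<^sub>C (- x::'a::cstar_algebra) = - (c *\<^sub>C x)"
  using scaleC_add_right[of c x "-x"] by (simp add: minus_unique)

lemma scaleC_minus_left: "(- c) *\<^sub>C (x::'a::cstar_algebra) = - (c *\<^sub>C x)"
  using scaleC_add_left[of c "-c" x] by (simp add: minus_unique)

lemma scaleC_diff_right: "c *\<^sub>C (x - y::'a::cstar_algebra) = c *\<^sub>C x - c *\<^sub>C y"
  using scaleC_add_right[of c x "-y"] by (simp add: scaleC_minus_right)

lemma scaleC_diff_left: "(b - c) *\<^sub>C (x::'a::cstar_algebra) = b *\<^sub>C x - c *\<^sub>C x"
  using scaleC_add_left[of b "-c" x] by (simp add: scaleC_minus_left)

lemma scaleC_sum_right: "c *\<^sub>C (\<Sum>i\<in>I. f i) = (\<Sum>i\<in>I. c *\<^sub>C (f i :: 'a::cstar_algebra))"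
  by (induction I rule: infinite_finite_induct) (auto simp: scaleC_add_right)

lemma adj_zero [simp]: "adj (0::'a::cstar_algebra) = 0"
  using adj_add[of "0::'a" 0] by simp

lemma adj_minus [simp]: "adj (- x::'a::cstar_algebra) = - adj x"
  using adj_add[of x "-x"] by (simp add: minus_unique)

lemma adj_diff: "adj (x - y::'a::cstar_algebra) = adj x - adj y"
  using adj_add[of x "-y"] by simp

lemma adj_sum: "adj (\<Sum>i\<in>I. f i) = (\<Sum>i\<in>I. adj (f i :: 'a::cstar_algebra))"
  by (induction I rule: infinite_finite_induct) (auto simp: adj_add)

lemma adj_scaleR: "adj (r *\<^sub>R x::'a::cstar_algebra) = r *\<^sub>R adj x"
  by (metis adj_scaleC complex_cnj_complex_of_real scaleC_of_real)

lemma norm_adj [simp]: "norm (adj x) = norm (x::'a::cstar_algebra)"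
proof -
  have le: "norm y \<le> norm (adj y)" for y :: 'a
  proof (cases "y = 0")
    case False
    have "norm y * norm y \<le> norm (adj y) * norm y"
      by (metis cstar_identity norm_mult_ineq power2_eq_square)
    then show ?thesis using False by simp
  qed simp
  from le[of x] le[of "adj x"] show ?thesis by (simp add: adj_adj)
qed

lemma bounded_linear_adj: "bounded_linear (adj :: 'a::cstar_algebra \<Rightarrow> 'a)"
  by (rule bounded_linear_intro[where K = 1]) (auto simp: adj_add adj_scaleR)

lemma bounded_linear_scaleC: "bounded_linear ((*\<^sub>C) c :: 'a::cstar_algebra \<Rightarrow> 'a)"
proof (rule bounded_linear_intro[where K = "cmod c"])
  fix r and x :: 'a
  show "c *\<^sub>C r *\<^sub>R x = r *\<^sub>R c *\<^sub>C x"
    by (simp add: scaleC_of_real[symmetric] scaleC_scaleC mult.commute)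
qed (auto simp: scaleC_add_right norm_scaleC mult.commute)

lemmas tendsto_adj [tendsto_intros] = bounded_linear.tendsto[OF bounded_linear_adj]
lemmas tendsto_scaleC [tendsto_intros] = bounded_linear.tendsto[OF bounded_linear_scaleC]
lemmas continuous_on_adj [continuous_intros] = bounded_linear.continuous_on[OF bounded_linear_adj]

lemma norm_mult_adj: "norm (x * adj x) = (norm (x::'a::cstar_algebra))\<^sup>2"
  by (metis adj_adj cstar_identity norm_adj)

lemma norm_square_selfadj: "adj x = x \<Longrightarrow> norm (x * x) = (norm (x::'a::cstar_algebra))\<^sup>2"
  by (metis cstar_identity)

lemma adj_mult_self_eq_0: "adj x * x = 0 \<longleftrightarrow> (x::'a::cstar_algebra) = 0"
  by (metis cstar_identity mult_zero_right norm_eq_zero power_zero_numeral zero_eq_power2)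

lemma norm_projection_le: "projection p \<Longrightarrow> norm (p::'a::cstar_algebra) \<le> 1"
proof -
  assume "projection p"
  then have "norm p = norm p * norm p"
    by (metis cstar_identity power2_eq_square projection_def)
  then show ?thesis by (metis mult_cancel_left2 norm_zero order_refl zero_le_one)
qed

text \<open>In a unital algebra \<open>g\<close> would be \<open>1 - sqrt (1 - h)\<close>: the equation says \<open>(1 - g)\<^sup>2 = 1 - h\<close> without mentioning
the unit. The map \<open>g \<mapsto> (h + g\<^sup>2) / 2\<close> is a contraction of the ball of radius \<open>1 - sqrt (1 - norm h)\<close>. It preserves
self-adjointness and commutation with everything that commutes with \<open>h\<close>, so the fixed point can be sought
in the closed set of elements with these properties.\<close>

lemma fixpoint_half_square:
  fixes h :: "'a::cstar_algebra"
  assumes sa: "adj h = h" and less: "norm h < 1"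
  obtains g where "adj g = g" "g + g = h + g * g" "\<And>z. z * h = h * z \<Longrightarrow> z * g = g * z"
proof -
  define r where "r = 1 - sqrt (1 - norm h)"
  have r: "0 \<le> r" "r < 1" using less by (auto simp: r_def)
  have rr: "norm h + r * r = 2 * r"
    using less by (simp add: r_def algebra_simps)
  define S where "S = {g::'a. norm g \<le> r \<and> adj g = g \<and> (\<forall>z. z * h = h * z \<longrightarrow> z * g = g * z)}"
  define f where "f = (\<lambda>g::'a. (1/2) *\<^sub>R (h + g * g))"
  have "S = (\<Inter>z\<in>{z. z * h = h * z}. {g. z * g = g * z}) \<inter> {g. adj g = g} \<inter> {g. norm g \<le> r}"
    by (auto simp: S_def)
  also have "closed \<dots>"
    by (intro closed_Int closed_INT closed_Collect_eq closed_Collect_le ballI continuous_intros)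
  finally have "complete S" by (simp add: complete_eq_closed)
  moreover have "S \<noteq> {}" using r by (auto simp: S_def intro!: exI[of _ 0])
  moreover have "f ` S \<subseteq> S"
  proof (intro image_subsetI)
    fix g assume g: "g \<in> S"
    have "norm (h + g * g) \<le> norm h + norm g * norm g"
      using norm_triangle_ineq[of h "g * g"] norm_mult_ineq[of g g] by linarith
    also have "\<dots> \<le> 2 * r" using g r mult_mono[of "norm g" r "norm g" r] by (auto simp: S_def rr[symmetric])
    finally have "norm (f g) \<le> r" by (simp add: f_def)
    moreover have "adj g = g" using g by (auto simp: S_def)
    then have "adj (f g) = f g" using sa by (simp add: f_def adj_scaleR adj_add adj_mult)
    moreover have "z * f g = f g * z" if "z * h = h * z" for z
    proof -
      have "z * g = g * z" using g that by (auto simp: S_def)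
      then have "z * (g * g) = g * g * z" by (metis mult.assoc)
      then show ?thesis using that by (simp add: f_def distrib_left distrib_right)
    qed
    ultimately show "f g \<in> S" by (auto simp: S_def)
  qed
  moreover have "dist (f x) (f y) \<le> r * dist x y" if "x \<in> S" "y \<in> S" for x y
  proof -
    have "f x - f y = (1/2) *\<^sub>R (x * (x - y) + (x - y) * y)"
      by (simp add: f_def algebra_simps)
    then have "norm (f x - f y) \<le> (norm (x * (x - y)) + norm ((x - y) * y)) / 2"
      using norm_triangle_ineq[of "x * (x - y)" "(x - y) * y"] by simp
    also have "\<dots> \<le> (norm x * norm (x - y) + norm (x - y) * norm y) / 2"
      by (simp add: add_mono norm_mult_ineq)
    also have "\<dots> \<le> (r * norm (x - y) + norm (x - y) * r) / 2"
      using that by (intro divide_right_mono add_mono mult_mono) (auto simp: S_def r)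
    finally show ?thesis by (simp add: dist_norm mult.commute)
  qed
  ultimately have "\<exists>!x. x \<in> S \<and> f x = x"
    using Banach_fix[of S r f] r by blast
  then obtain g where g: "g \<in> S" "f g = g" by blast
  have "g + g = h + g * g"
  proof -
    have "g = (1/2) *\<^sub>R (h + g * g)" using g by (simp add: f_def)
    then have "2 *\<^sub>R g = h + g * g" by (metis divide_self_if mult.commute mult_2_right
          scaleR_one scaleR_scaleR times_divide_eq_right zero_neq_numeral mult.right_neutral)
    then show ?thesis by (simp add: scaleR_2)
  qed
  moreover have "adj g = g" "\<And>z. z * h = h * z \<Longrightarrow> z * g = g * z"
    using g(1) unfolding S_def by blast+
  ultimately show thesis using that by blast
qed

text \<open>In a unital algebra the hypothesis reads \<open>k\<^sup>2 + (1 - g)\<^sup>2 = 1\<close>, so \<open>k\<close> is the mean of the two unitaries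
\<open>k \<plusminus> \<i>(1 - g)\<close>. Multiplying them by \<open>k\<close> avoids the unit: the products have norm \<open>norm k\<close> and mean \<open>k\<^sup>2\<close>.\<close>

lemma norm_le_1_of_squares:
  fixes k g :: "'a::cstar_algebra"
  assumes k: "adj k = k" and g: "adj g = g" and comm: "k * g = g * k"
    and eq: "k * k + g * g = g + g"
  shows "norm k \<le> 1"
proof -
  have iso: "norm (k * k + c *\<^sub>C (k - g * k)) = norm k" if "c = \<i> \<or> c = - \<i>" for c
  proof -
    define w where "w = k * k + c *\<^sub>C (k - g * k)"
    have kk: "k * (k * x) + g * (g * x) = g * x + g * x" for x
      using eq by (metis distrib_right mult.assoc)
    have gk: "g * (k * x) = k * (g * x)" for x by (metis comm mult.assoc)
    have aw: "adj w = k * k + cnj c *\<^sub>C (k - k * g)"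
      by (simp add: w_def adj_add adj_diff adj_scaleC adj_mult k g)
    have cc: "cnj c = - c" "c * c = - 1" using that by auto
    have cx: "c *\<^sub>C c *\<^sub>C x = - x" for x :: 'a using cc by (simp add: scaleC_scaleC scaleC_minus1)
    have "adj w * w = k * (k * (k * k)) + k * k - k * (g * k) - k * (g * k) + k * (g * (g * k))"
      unfolding aw unfolding w_def using cc
      by (simp add: distrib_left distrib_right mult_scaleC_left mult_scaleC_right cx scaleC_add_right
          scaleC_minus_left left_diff_distrib right_diff_distrib mult.assoc comm[symmetric] gk scaleC_diff_right)
    also have "\<dots> = k * (k * (k * k) + g * (g * k) - g * k - g * k) + k * k"
      by (simp add: distrib_left right_diff_distrib)
    also have "\<dots> = k * k" by (simp add: kk)
    finally have "(norm w)\<^sup>2 = (norm k)\<^sup>2" by (metis cstar_identity k)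
    then show ?thesis by (simp add: w_def)
  qed
  have "2 *\<^sub>R (k * k) = (k * k + \<i> *\<^sub>C (k - g * k)) + (k * k + (- \<i>) *\<^sub>C (k - g * k))"
    by (simp add: scaleC_minus_left scaleR_2)
  also have "norm \<dots> \<le> norm k + norm k"
    by (rule norm_triangle_mono; rule eq_refl; rule iso) simp_all
  finally have "2 * norm (k * k) \<le> norm k + norm k" by simp
  then have "norm k * norm k \<le> norm k" using norm_square_selfadj[OF k] by (simp add: power2_eq_square)
  then show ?thesis by (cases "k = 0") auto
qed

lemma star_homD:
  assumes "star_hom \<pi>"
  shows "\<pi> (x + y) = \<pi> x + \<pi> y" "\<pi> (c *\<^sub>C x) = c *\<^sub>C \<pi> x" "\<pi> (x * y) = \<pi> x * \<pi> y" "\<pi> (adj x) = adj (\<pi> x)"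
  using assms by (auto simp: star_hom_def)

lemma star_hom_zero: "star_hom \<pi> \<Longrightarrow> \<pi> 0 = 0"
  using star_homD(1)[of \<pi> 0 0] by simp

lemma star_hom_sum:
  assumes "star_hom \<pi>"
  shows "\<pi> (\<Sum>i\<in>I. f i) = (\<Sum>i\<in>I. \<pi> (f i))"
  by (induction I rule: infinite_finite_induct) (simp_all add: star_homD[OF assms] star_hom_zero[OF assms])

lemma star_hom_scaleR: "star_hom \<pi> \<Longrightarrow> \<pi> (r *\<^sub>R x) = r *\<^sub>R \<pi> x"
  by (metis scaleC_of_real star_homD(2))

text \<open>For self-adjoint \<open>y\<close> with \<open>norm y < 1\<close> take \<open>g = 1 - sqrt (1 - y\<^sup>2)\<close>. The relation \<open>y\<^sup>2 + g\<^sup>2 = 2g\<close> is algebraic and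
hence holds for the images, which bounds the norm of \<open>\<pi> y\<close>. The C*-identity reduces the general case to
this one.\<close>

lemma star_hom_norm_le:
  fixes \<pi> :: "'a::cstar_algebra \<Rightarrow> 'b::cstar_algebra"
  assumes hom: "star_hom \<pi>"
  shows "norm (\<pi> x) \<le> norm x"
proof -
  note h = star_homD[OF hom]
  have sa: "norm (\<pi> y) \<le> 1" if y: "adj y = y" "norm y < 1" for y
  proof -
    have "adj (y * y) = y * y" "norm (y * y) < 1"
      using y by (auto simp: adj_mult norm_square_selfadj power2_eq_square intro: mult_left_le_one_le le_less_trans)
         (metis mult_left_le_one_le less_eq_real_def norm_ge_zero order_le_less_trans)
    then obtain g where g: "adj g = g" "g + g = y * y + g * g" "\<And>z. z * (y * y) = (y * y) * z \<Longrightarrow> z * g = g * z"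
      using fixpoint_half_square by metis
    have "y * g = g * y" by (rule g(3)) (simp add: mult.assoc)
    then show ?thesis
      using norm_le_1_of_squares[of "\<pi> y" "\<pi> g"] y g by (metis h(1) h(3) h(4))
  qed
  have le: "norm (\<pi> y) \<le> norm y" if y: "adj y = y" for y
  proof (rule dense_ge)
    fix m assume m: "norm y < m"
    then have m0: "0 < m" using norm_ge_zero le_less_trans by blast
    have "norm (\<pi> ((1/m) *\<^sub>R y)) \<le> 1"
      by (rule sa) (use y m m0 in \<open>auto simp: adj_scaleR divide_simps\<close>)
    then show "norm (\<pi> y) \<le> m" using m0 by (simp add: star_hom_scaleR[OF hom] divide_simps)
  qed
  have "(norm (\<pi> x))\<^sup>2 \<le> (norm x)\<^sup>2"
    using le[of "adj x * x"] by (simp add: adj_mult adj_adj h cstar_identity)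
  then show ?thesis by simp
qed

lemma bounded_linear_star_hom:
  assumes "star_hom \<pi>"
  shows "bounded_linear \<pi>"
  by (rule bounded_linear_intro[where K = 1])
     (simp_all add: star_homD[OF assms] star_hom_scaleR[OF assms] star_hom_norm_le[OF assms])

lemma generated_induct:
  assumes "generates_cstar G" "cstar_subalgebra S" "G \<subseteq> S"
  shows "x \<in> S"
  using assms hull_minimal[of G S cstar_subalgebra] by (auto simp: generates_cstar_def)

lemma star_homs_eq_on_generators:
  assumes "generates_cstar G" "star_hom \<pi>" "star_hom \<rho>" "\<And>g. g \<in> G \<Longrightarrow> \<pi> g = \<rho> g"
  shows "\<pi> x = \<rho> x"
proof -
  have "x \<in> {x. \<pi> x = \<rho> x}"
  proof (rule generated_induct[OF assms(1)])
    show "cstar_subalgebra {x. \<pi> x = \<rho> x}"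
      unfolding cstar_subalgebra_def
      by (auto simp: star_homD[OF assms(2)] star_homD[OF assms(3)] star_hom_zero[OF assms(2)] star_hom_zero[OF assms(3)]
          intro!: closed_Collect_eq linear_continuous_on bounded_linear_star_hom assms(2,3))
  qed (use assms in auto)
  then show ?thesis by simp
qed

lemma star_hom_comp: "star_hom \<pi> \<Longrightarrow> star_hom \<rho> \<Longrightarrow> star_hom (\<rho> \<circ> \<pi>)"
  by (auto simp: star_hom_def)

lemma star_hom_id: "star_hom (\<lambda>x. x)"
  by (auto simp: star_hom_def)

text \<open>The elements \<open>x\<close> with \<open>x z = 0\<close> and \<open>x\<^sup>* z = 0\<close> form a C*-subalgebra, which then contains \<open>z\<^sup>*\<close>.\<close>

lemma zero_if_annihilated_by_generators:
  assumes gen: "generates_cstar G" and ann: "\<And>g. g \<in> G \<Longrightarrow> g * z = 0 \<and> adj g * z = 0"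
  shows "z = (0::'a::cstar_algebra)"
proof -
  have "adj z \<in> {x. x * z = 0 \<and> adj x * z = 0}"
  proof (rule generated_induct[OF gen])
    have "closed {x. x * z = 0 \<and> adj x * z = 0}"
      by (intro closed_Collect_conj closed_Collect_eq continuous_intros)
    then show "cstar_subalgebra {x. x * z = 0 \<and> adj x * z = 0}"
      unfolding cstar_subalgebra_def
      by (auto simp: distrib_right mult.assoc adj_add adj_mult adj_adj mult_scaleC_left adj_scaleC)
  qed (use ann in auto)
  then show ?thesis by (simp add: adj_mult_self_eq_0)
qed

section \<open>Orthogonality\<close>

text \<open>The element \<open>x\<close> is the mean of \<open>x \<plusminus> \<i>y\<close>, and by commutation both of these have the square norm
\<open>norm (x\<^sup>2 + y\<^sup>2)\<close>.\<close>

lemma norm_square_le_sum_of_squares: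
  fixes x y :: "'a::cstar_algebra"
  assumes x: "adj x = x" and y: "adj y = y" and comm: "x * y = y * x"
  shows "norm (x * x) \<le> norm (x * x + y * y)"
proof -
  have n: "(norm (x + c *\<^sub>C y))\<^sup>2 = norm (x * x + y * y)" if "c = \<i> \<or> c = - \<i>" for c
  proof -
    have cc: "cnj c = - c" "c * c = - 1" using that by auto
    then have cx: "c *\<^sub>C c *\<^sub>C z = - z" for z :: 'a by (simp add: scaleC_scaleC scaleC_minus1)
    have "adj (x + c *\<^sub>C y) * (x + c *\<^sub>C y) = x * x + y * y"
      by (simp add: adj_add adj_scaleC x y distrib_left left_diff_distrib mult_scaleC_left mult_scaleC_right
          scaleC_add_right scaleC_diff_right scaleC_minus_left cx cc comm)
    then show ?thesis by (metis cstar_identity)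
  qed
  have ns: "norm (x + c *\<^sub>C y) = sqrt (norm (x * x + y * y))" if "c = \<i> \<or> c = - \<i>" for c
    using n[OF that] real_sqrt_abs[of "norm (x + c *\<^sub>C y)"] by simp
  have "norm (x + \<i> *\<^sub>C y) = sqrt (norm (x * x + y * y))" "norm (x + (-\<i>) *\<^sub>C y) = sqrt (norm (x * x + y * y))"
    by (rule ns, simp)+
  moreover have "2 *\<^sub>R x = (x + \<i> *\<^sub>C y) + (x + (- \<i>) *\<^sub>C y)"
    by (simp add: scaleC_minus_left scaleR_2)
  ultimately have "norm (2 *\<^sub>R x) \<le> sqrt (norm (x * x + y * y)) + sqrt (norm (x * x + y * y))"
    using norm_triangle_ineq[of "x + \<i> *\<^sub>C y" "x + (- \<i>) *\<^sub>C y"] by (simp only:)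
  then have "norm x \<le> sqrt (norm (x * x + y * y))" by simp
  then have "(norm x)\<^sup>2 \<le> norm (x * x + y * y)"
    using power_mono[of "norm x" "sqrt (norm (x * x + y * y))" 2] by simp
  then show ?thesis by (simp add: norm_square_selfadj[OF x])
qed

text \<open>In the corner with unit \<open>e\<close> the two bounds say \<open>x \<ge> 0\<close> and \<open>x \<le> 0\<close>. Positivity is used in the form of
commuting self-adjoint square roots of \<open>\<delta>e + x\<close> and \<open>\<delta>e - x\<close>: the sum of their squares is \<open>2\<delta>e\<close>, which
bounds each square.\<close>

lemma zero_if_unit_plus_minus_contractive:
  fixes e x :: "'a::cstar_algebra"
  assumes e: "projection e" and x: "adj x = x" "e * x = x" "x * e = x"
    and plus: "norm (e + x) \<le> 1" and minus: "norm (e - x) \<le> 1"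
  shows "x = 0"
proof -
  have ee: "e * e = e" "adj e = e" using e by (auto simp: projection_def)
  have le1: "norm e \<le> 1" using norm_projection_le[OF e] .
  have root: "\<exists>f. adj f = f \<and> f * f = \<delta> *\<^sub>R e + y \<and> (\<forall>z. z * e = e * z \<longrightarrow> z * y = y * z \<longrightarrow> z * f = f * z)"
    if \<delta>: "0 < \<delta>" and y: "adj y = y" "e * y = y" "y * e = y" "norm (e - y) \<le> 1" for \<delta> y
  proof -
    \<comment> \<open>\<open>\<delta>e + y = (1 + \<delta>)(e - h)\<close>, and \<open>e - h\<close> is the square of \<open>e - eg\<close>.\<close>
    define h where "h = (1 / (1 + \<delta>)) *\<^sub>R (e - y)"
    have "norm h < 1" using \<delta> y by (simp add: h_def divide_simps)
    moreover have "adj h = h" by (simp add: h_def adj_scaleR adj_diff ee y)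
    ultimately obtain g where g: "adj g = g" "g + g = h + g * g" "\<And>z. z * h = h * z \<Longrightarrow> z * g = g * z"
      using fixpoint_half_square by metis
    have eh: "e * h = h" "h * e = h" by (simp_all add: h_def algebra_simps ee y)
    have eg: "e * g = g * e" using eh by (intro g(3)) simp
    define f where "f = sqrt (1 + \<delta>) *\<^sub>R (e - e * g)"
    have "(e - e * g) * (e - e * g) = e - e * (g + g) + e * (g * g)"
    proof -
      have "e * g * e = e * g" using eg ee by (metis mult.assoc)
      moreover have "e * g * (e * g) = e * (g * g)" using eg ee by (metis mult.assoc)
      moreover have "e * (e * g) = e * g" using ee by (metis mult.assoc)
      ultimately show ?thesis by (simp add: left_diff_distrib right_diff_distrib distrib_left ee)
    qed
    also have "\<dots> = e - h" unfolding g(2) by (simp add: algebra_simps eh)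
    finally have "f * f = (1 + \<delta>) *\<^sub>R (e - h)" using \<delta> by (simp add: f_def)
    also have "\<dots> = \<delta> *\<^sub>R e + y" using \<delta> by (simp add: h_def scaleR_diff_right scaleR_add_left)
    finally have "f * f = \<delta> *\<^sub>R e + y" .
    moreover have "adj f = f" using eg by (simp add: f_def adj_scaleR adj_diff adj_mult ee g)
    moreover have "z * f = f * z" if "z * e = e * z" "z * y = y * z" for z
    proof -
      have "z * h = h * z" using that by (simp add: h_def algebra_simps)
      then have "z * g = g * z" by (rule g(3))
      then have "z * (e * g) = e * g * z" using that by (metis mult.assoc)
      then show ?thesis using that by (simp add: f_def algebra_simps)
    qed
    ultimately show ?thesis by blast
  qed
  have "norm x \<le> 3 * \<delta>" if \<delta>: "0 < \<delta>" for \<delta>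
  proof -
    obtain f where f: "adj f = f" "f * f = \<delta> *\<^sub>R e + x" "\<And>z. z * e = e * z \<Longrightarrow> z * x = x * z \<Longrightarrow> z * f = f * z"
      using root[OF \<delta> x minus] by blast
    have "adj (- x) = - x" "e * - x = - x" "- x * e = - x" "norm (e - - x) \<le> 1"
      using x plus by simp_all
    then obtain g where g: "adj g = g" "g * g = \<delta> *\<^sub>R e + - x" "\<And>z. z * e = e * z \<Longrightarrow> z * - x = - x * z \<Longrightarrow> z * g = g * z"
      using root[OF \<delta>, of "-x"] by blast
    have "f * e = e * f" "x * f = f * x" using f(3)[of e] f(3)[of x] x by simp_all
    then have "f * g = g * f" by (intro g(3)) simp_all
    then have "norm (f * f) \<le> norm (f * f + g * g)" using f g by (intro norm_square_le_sum_of_squares)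
    also have "f * f + g * g = (2 * \<delta>) *\<^sub>R e" by (simp add: f g) (metis scaleR_2 scaleR_scaleR)
    also have "norm \<dots> \<le> 2 * \<delta>" using le1 \<delta> by simp
    finally have "norm (\<delta> *\<^sub>R e + x) \<le> 2 * \<delta>" using f by simp
    then have "norm x \<le> 2 * \<delta> + norm (\<delta> *\<^sub>R e)"
      using norm_triangle_ineq4[of "\<delta> *\<^sub>R e + x" "\<delta> *\<^sub>R e"] by simp
    also have "norm (\<delta> *\<^sub>R e) \<le> \<delta>" using le1 \<delta> by simp
    finally show ?thesis by simp
  qed
  then have "norm x \<le> 0" by (metis field_le_epsilon add_0 divide_pos_pos mult.commute
        nonzero_mult_div_cancel_left times_divide_eq_right zero_less_numeral zero_neq_numeral)
  then show ?thesis by simp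
qed

text \<open>Compress by \<open>e = p\<^sub>j\<close>. The compressions \<open>x\<^sub>l = e p\<^sub>l e\<close> are positive with sum \<open>e = x\<^sub>j\<close>, so the other ones add up to
zero and hence vanish. Positivity enters through the estimate \<open>norm (e - x\<^sub>l) \<le> 1\<close>.\<close>

lemma projections_orthogonal_if_sum_projection:
  fixes p :: "'i \<Rightarrow> 'a::cstar_algebra"
  assumes fin: "finite I" and proj: "\<And>i. i \<in> I \<Longrightarrow> projection (p i)"
    and sub: "\<And>i. i \<in> I \<Longrightarrow> (\<Sum>j\<in>I. p j) * p i = p i"
    and ij: "i \<in> I" "j \<in> I" "i \<noteq> j"
  shows "p i * p j = 0"
proof -
  have pp: "p l * p l = p l" "adj (p l) = p l" if "l \<in> I" for l
    using proj[OF that] by (auto simp: projection_def)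
  define e where "e = p j"
  have e: "e * e = e" "adj e = e" "projection e" using pp ij proj by (auto simp: e_def)
  define x where "x l = e * p l * e" for l
  define J where "J = I - {i, j}"
  have contr: "norm (e - x l) \<le> 1" if "l \<in> I" for l
  proof -
    define q where "q = e - p l * e"
    have epp: "e * (p l * (p l * e)) = e * (p l * e)" using pp that by (metis mult.assoc)
    have "adj q * q = e - x l"
    proof -
      have aq: "adj q = e - e * p l" by (simp add: q_def adj_diff adj_mult e pp that)
      show ?thesis unfolding aq unfolding q_def x_def by (simp add: algebra_simps e mult.assoc epp)
    qed
    moreover have "norm q \<le> 1"
    proof -
      \<comment> \<open>The second term is \<open>(1 - 2p\<^sub>l)e\<close>, with \<open>1 - 2p\<^sub>l\<close> unitary.\<close>
      have "2 *\<^sub>R q = e + (e - 2 *\<^sub>R (p l * e))" by (simp add: q_def scaleR_2)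
      moreover have "adj (e - 2 *\<^sub>R (p l * e)) * (e - 2 *\<^sub>R (p l * e)) = e"
      proof -
        have aq: "adj (e - 2 *\<^sub>R (p l * e)) = e - 2 *\<^sub>R (e * p l)"
          by (simp add: adj_diff adj_mult adj_scaleR e pp that)
        show ?thesis unfolding aq by (simp add: algebra_simps e mult.assoc epp flip: scaleR_add_left)
      qed
      then have "(norm (e - 2 *\<^sub>R (p l * e)))\<^sup>2 \<le> 1\<^sup>2"
        using norm_projection_le[OF e(3)] cstar_identity[of "e - 2 *\<^sub>R (p l * e)"] by simp
      then have "norm (e - 2 *\<^sub>R (p l * e)) \<le> 1"
        using power2_le_imp_le[of "norm (e - 2 *\<^sub>R (p l * e))" 1] by simp
      ultimately have "norm (2 *\<^sub>R q) \<le> 1 + 1"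
        using norm_projection_le[OF e(3)] norm_triangle_ineq[of e "e - 2 *\<^sub>R (p l * e)"] by simp
      then show ?thesis by simp
    qed
    ultimately show ?thesis
      by (metis cstar_identity norm_ge_zero power_le_one)
  qed
  have xs: "adj (x i) = x i" "e * x i = x i" "x i * e = x i"
  proof -
    show "adj (x i) = x i" using pp ij by (simp add: x_def adj_mult e mult.assoc)
    show "e * x i = x i" unfolding x_def using e by (metis mult.assoc)
    show "x i * e = x i" unfolding x_def using e by (metis mult.assoc)
  qed
  have "e * ((\<Sum>l\<in>I. p l) * e) = e" using sub ij e by (simp add: e_def)
  moreover have "e * ((\<Sum>l\<in>I. p l) * e) = (\<Sum>l\<in>I. x l)"
    by (simp add: sum_distrib_left sum_distrib_right x_def mult.assoc)
  moreover have "(\<Sum>l\<in>I. x l) = x i + (x j + (\<Sum>l\<in>J. x l))"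
    using fin ij sum.remove[of I i x] sum.remove[of "I - {i}" j x]
    by (simp add: J_def Diff_insert2[symmetric] insert_commute)
  moreover have "x j = e" by (simp add: x_def e_def[symmetric] e)
  ultimately have "x i + (\<Sum>l\<in>J. x l) = 0" by (simp add: algebra_simps)
  then have xi: "x i = - (\<Sum>l\<in>J. x l)" by (simp add: eq_neg_iff_add_eq_0)
  \<comment> \<open>Scaled by \<open>c\<close>, \<open>e + c x\<^sub>i\<close> becomes the mean of the contractions \<open>e\<close> and \<open>e - x\<^sub>l\<close>, \<open>l \<in> J\<close>.\<close>
  define c where "c = 1 / real (card J + 1)"
  have c: "0 < c" "c \<le> 1" by (simp_all add: c_def)
  have "c *\<^sub>R x i = 0"
  proof (rule zero_if_unit_plus_minus_contractive[OF e(3)])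
    have "norm (real (card J + 1) *\<^sub>R e + x i) \<le> real (card J + 1)"
    proof -
      have "real (card J + 1) *\<^sub>R e + x i = e + (\<Sum>l\<in>J. e - x l)"
        by (simp add: xi sum_subtractf scaleR_add_left sum_constant_scaleR)
      also have "norm \<dots> \<le> 1 + (\<Sum>l\<in>J. 1)"
        by (rule norm_triangle_mono[OF norm_projection_le[OF e(3)] sum_norm_le]) (auto simp: J_def contr)
      finally show ?thesis by simp
    qed
    moreover have "e + c *\<^sub>R x i = c *\<^sub>R (real (card J + 1) *\<^sub>R e + x i)"
      by (simp add: c_def scaleR_add_right)
    ultimately show "norm (e + c *\<^sub>R x i) \<le> 1" using c by (simp add: c_def divide_simps)
    have "e - c *\<^sub>R x i = (1 - c) *\<^sub>R e + c *\<^sub>R (e - x i)" by (simp add: algebra_simps)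
    also have "norm \<dots> \<le> (1 - c) * 1 + c * 1"
      using c contr[OF ij(1)] norm_projection_le[OF e(3)]
      by (intro norm_triangle_mono) (auto intro!: mult_left_le mult_left_mono)
    finally show "norm (e - c *\<^sub>R x i) \<le> 1" by simp
  qed (use xs in \<open>auto simp: adj_scaleR\<close>)
  then have "x i = 0" using c by simp
  moreover have "adj (p i * e) * (p i * e) = x i"
    using pp ij by (simp add: x_def adj_mult e) (metis mult.assoc)
  ultimately show ?thesis by (simp add: e_def adj_mult_self_eq_0)
qed

section \<open>Norm estimates\<close>

lemma le_if_power_two_le:
  fixes a M K :: real
  assumes "0 \<le> M" and bound: "\<And>m::nat. a ^ (2 ^ m) \<le> K * M ^ (2 ^ m)"
  shows "a \<le> M"
proof (rule ccontr)
  assume "\<not> a \<le> M"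
  then have aM: "M < a" by simp
  show False
  proof (cases "M = 0")
    case True
    then show ?thesis using bound[of 0] aM by simp
  next
    case False
    then have M: "0 < M" using assms by simp
    then have "1 < a / M" using aM by simp
    then obtain n where n: "K < (a / M) ^ n" using real_arch_pow by blast
    have "n \<le> 2 ^ n" by (simp add: less_imp_le)
    then have "(a / M) ^ n \<le> (a / M) ^ (2 ^ n)" using \<open>1 < a / M\<close> by (intro power_increasing) auto
    then have "K < a ^ (2 ^ n) / M ^ (2 ^ n)" using n by (simp add: power_divide)
    then show False using bound[of n] M by (simp add: field_simps)
  qed
qed

text \<open>Squaring a sum of orthogonal self-adjoint elements gives the sum of their squares. After \<open>m\<close> squarings the
triangle inequality loses only the factor \<open>card I\<close> in the power \<open>2\<^sup>m\<close> of the norm.\<close>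

lemma norm_sum_orthogonal_selfadj:
  fixes h :: "'i \<Rightarrow> 'a::cstar_algebra"
  assumes fin: "finite I" and "\<And>i. i \<in> I \<Longrightarrow> adj (h i) = h i"
    and "\<And>i j. i \<in> I \<Longrightarrow> j \<in> I \<Longrightarrow> i \<noteq> j \<Longrightarrow> h i * h j = 0"
    and "\<And>i. i \<in> I \<Longrightarrow> norm (h i) \<le> M" and M: "0 \<le> M"
  shows "norm (\<Sum>i\<in>I. h i) \<le> M"
proof (rule le_if_power_two_le[OF M])
  fix m :: nat
  show "norm (\<Sum>i\<in>I. h i) ^ (2 ^ m) \<le> real (card I) * M ^ (2 ^ m)"
    using assms(2-)
  proof (induction m arbitrary: h M)
    case 0
    then show ?case using sum_norm_le[of I h "\<lambda>_. M"] by simp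
  next
    case (Suc m)
    have sq: "(\<Sum>i\<in>I. h i) * (\<Sum>i\<in>I. h i) = (\<Sum>i\<in>I. h i * h i)"
    proof -
      have "(\<Sum>i\<in>I. h i) * (\<Sum>i\<in>I. h i) = (\<Sum>i\<in>I. \<Sum>j\<in>I. h i * h j)"
        by (simp add: sum_product)
      also have "\<dots> = (\<Sum>i\<in>I. \<Sum>j\<in>I. if j = i then h i * h i else 0)"
        using Suc.prems(2) by (intro sum.cong) auto
      finally show ?thesis using fin by (simp add: sum.delta)
    qed
    have "adj (\<Sum>i\<in>I. h i) = (\<Sum>i\<in>I. h i)" using Suc.prems by (simp add: adj_sum)
    then have "norm (\<Sum>i\<in>I. h i) ^ (2 ^ Suc m) = norm (\<Sum>i\<in>I. h i * h i) ^ (2 ^ m)"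
      by (simp add: sq[symmetric] norm_square_selfadj power_mult)
    also have "\<dots> \<le> real (card I) * (M\<^sup>2) ^ (2 ^ m)"
    proof (rule Suc.IH)
      fix i assume i: "i \<in> I"
      then show "adj (h i * h i) = h i * h i" by (simp add: adj_mult Suc.prems)
      show "norm (h i * h i) \<le> M\<^sup>2"
        using Suc.prems(1,3)[OF i] by (simp add: norm_square_selfadj power_mono)
    next
      fix i j assume "i \<in> I" "j \<in> I" "i \<noteq> j"
      then have "h i * h j = 0" by (rule Suc.prems)
      then show "h i * h i * (h j * h j) = 0" by (metis mult.assoc mult_zero_left mult_zero_right)
    qed simp
    finally show ?case by (simp add: power_mult)
  qed
qed

lemma norm_sum_orthogonal:
  fixes a :: "'i \<Rightarrow> 'a::cstar_algebra"
  assumes fin: "finite I"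
    and l: "\<And>i j. i \<in> I \<Longrightarrow> j \<in> I \<Longrightarrow> i \<noteq> j \<Longrightarrow> adj (a i) * a j = 0"
    and r: "\<And>i j. i \<in> I \<Longrightarrow> j \<in> I \<Longrightarrow> i \<noteq> j \<Longrightarrow> a i * adj (a j) = 0"
    and b: "\<And>i. i \<in> I \<Longrightarrow> norm (a i) \<le> M" and M: "0 \<le> M"
  shows "norm (\<Sum>i\<in>I. a i) \<le> M"
proof -
  have "adj (\<Sum>i\<in>I. a i) * (\<Sum>i\<in>I. a i) = (\<Sum>i\<in>I. \<Sum>j\<in>I. adj (a i) * a j)"
    by (simp add: adj_sum sum_product)
  also have "\<dots> = (\<Sum>i\<in>I. \<Sum>j\<in>I. if j = i then adj (a i) * a i else 0)"
    using l by (intro sum.cong) auto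
  also have "\<dots> = (\<Sum>i\<in>I. adj (a i) * a i)" using fin by (simp add: sum.delta)
  finally have "(norm (\<Sum>i\<in>I. a i))\<^sup>2 = norm (\<Sum>i\<in>I. adj (a i) * a i)" by (metis cstar_identity)
  also have "\<dots> \<le> M\<^sup>2"
  proof (rule norm_sum_orthogonal_selfadj[OF fin])
    fix i j assume "i \<in> I" "j \<in> I" "i \<noteq> j"
    then have "a i * adj (a j) = 0" by (rule r)
    then show "adj (a i) * a i * (adj (a j) * a j) = 0"
      by (metis mult.assoc mult_zero_left mult_zero_right)
  qed (use b M in \<open>auto simp: adj_mult adj_adj cstar_identity power_mono\<close>)
  finally show ?thesis using M by (simp add: power2_le_iff_abs_le)
qed

text \<open>The norm of a self-adjoint element is its spectral radius. The power \<open>h\<^bsup>n+1\<^esup>\<close> appears as \<open>((*) h ^^ n) h\<close> because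
there is no unit to start from.\<close>

lemma norm_le_if_powers_bounded:
  fixes h :: "'a::cstar_algebra"
  assumes sa: "adj h = h" and M: "0 \<le> M"
    and bound: "\<And>n. norm (((*) h ^^ n) h) \<le> K * M ^ Suc n"
  shows "norm h \<le> M"
proof -
  define P where "P n = ((*) h ^^ n) h" for n
  have P0: "P 0 = h" and PS: "P (Suc n) = h * P n" for n by (simp_all add: P_def)
  have add: "P m * P n = P (Suc (m + n))" for m n
    by (induction m) (simp_all add: PS P0 mult.assoc)
  have Ph: "P n * h = h * P n" for n
    by (induction n) (simp_all add: PS P0 mult.assoc)
  have adjP: "adj (P n) = P n" for n
    by (induction n) (simp_all add: PS P0 adj_mult sa Ph)
  have "norm h ^ (2 ^ m) = norm (P (2 ^ m - 1))" for m :: nat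
  proof (induction m)
    case (Suc m)
    have "1 \<le> (2::nat) ^ m" by simp
    then have "Suc ((2 ^ m - 1) + (2 ^ m - 1)) = 2 ^ Suc m - (1::nat)"
      unfolding power_Suc by linarith
    then show ?case using norm_square_selfadj[OF adjP, of "2 ^ m - 1"] Suc
      by (simp add: add power_mult mult.commute[of 2])
  qed (simp add: P0)
  moreover have "norm (P (2 ^ m - 1)) \<le> K * M ^ (2 ^ m)" for m :: nat
    using bound[of "2 ^ m - 1"] by (simp add: P_def del: power_Suc)
  ultimately show ?thesis
    using le_if_power_two_le[OF M, of "norm h" K] by simp
qed

section \<open>Factorizations and infinite paths in higher-rank graphs\<close>

lemma nat_vec_le_add: "m \<le> m + (n :: nat ^ 'k::finite)"
  by (simp add: less_eq_vec_def)

lemma nat_vec_zero_le: "0 \<le> (n :: nat ^ 'k::finite)"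
  by (simp add: less_eq_vec_def)

lemma nat_vec_add_diff: "m \<le> n \<Longrightarrow> m + (n - m) = (n :: nat ^ 'k::finite)"
  by (simp add: less_eq_vec_def vec_eq_iff)

lemma nat_vec_add_le_cancel: "l + m \<le> l + n \<longleftrightarrow> m \<le> (n :: nat ^ 'k::finite)"
  by (simp add: less_eq_vec_def)

lemma le_vec_mono: "M \<le> N \<Longrightarrow> n \<le> vec M \<Longrightarrow> n \<le> (vec N :: nat ^ 'k::finite)"
  by (auto simp: less_eq_vec_def intro: order_trans)

lemma ex_le_vec: "\<exists>N. n \<le> (vec N :: nat ^ 'k::finite)"
proof
  show "n \<le> vec (Max (range (($) n)))"
    by (simp add: less_eq_vec_def)
qed

lemma vec_zero: "(vec 0 :: nat ^ 'k::finite) = 0"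
  by (simp add: vec_eq_iff)

context k_graph
begin

lemma vertices_iff: "v \<in> vertices \<Lambda> \<longleftrightarrow> v \<in> arrows \<Lambda> \<and> rng \<Lambda> v = v \<and> src \<Lambda> v = v"
  using vertices_eq_identities by auto

lemma rng_vertex: "\<alpha> \<in> arrows \<Lambda> \<Longrightarrow> rng \<Lambda> \<alpha> \<in> vertices \<Lambda>"
  by (simp add: vertices_iff rng_arrow rng_rng src_rng)

lemma src_vertex: "\<alpha> \<in> arrows \<Lambda> \<Longrightarrow> src \<Lambda> \<alpha> \<in> vertices \<Lambda>"
  by (simp add: vertices_iff src_arrow rng_src src_src)

lemma of_degree_arrow: "\<alpha> \<in> of_degree \<Lambda> n \<Longrightarrow> \<alpha> \<in> arrows \<Lambda>"
  by (simp add: of_degree_def)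

lemma vertex_facts: "v \<in> vertices \<Lambda> \<Longrightarrow> v \<in> arrows \<Lambda>" "v \<in> vertices \<Lambda> \<Longrightarrow> rng \<Lambda> v = v" "v \<in> vertices \<Lambda> \<Longrightarrow> src \<Lambda> v = v"
  using vertices_iff by auto

lemma of_degree_at_subset: "of_degree_at \<Lambda> v n \<subseteq> of_degree \<Lambda> n"
  by (auto simp: of_degree_at_def)

lemma of_degree_atD:
  assumes "\<alpha> \<in> of_degree_at \<Lambda> v n"
  shows "\<alpha> \<in> arrows \<Lambda>" "rng \<Lambda> \<alpha> = v" "deg \<Lambda> \<alpha> = n" "\<alpha> \<in> of_degree \<Lambda> n"
  using assms by (auto simp: of_degree_at_def of_degree_def)

lemma of_degree_at_zero: "v \<in> vertices \<Lambda> \<Longrightarrow> of_degree_at \<Lambda> v 0 = {v}"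
  using vertices_iff by (auto simp: of_degree_at_def)

lemma factorization_exists:
  assumes "\<alpha> \<in> arrows \<Lambda>" "m \<le> deg \<Lambda> \<alpha>"
  obtains \<beta> \<gamma> where "\<beta> \<in> arrows \<Lambda>" "\<gamma> \<in> arrows \<Lambda>" "src \<Lambda> \<beta> = rng \<Lambda> \<gamma>" "cmp \<Lambda> \<beta> \<gamma> = \<alpha>"
    "deg \<Lambda> \<beta> = m" "deg \<Lambda> \<gamma> = deg \<Lambda> \<alpha> - m"
  using factorization[OF assms(1), of m "deg \<Lambda> \<alpha> - m"] nat_vec_add_diff[OF assms(2)] by auto

lemma factorization_unique:
  assumes "\<beta> \<in> arrows \<Lambda>" "\<gamma> \<in> arrows \<Lambda>" "src \<Lambda> \<beta> = rng \<Lambda> \<gamma>"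
    and "\<beta>' \<in> arrows \<Lambda>" "\<gamma>' \<in> arrows \<Lambda>" "src \<Lambda> \<beta>' = rng \<Lambda> \<gamma>'"
    and eq: "cmp \<Lambda> \<beta> \<gamma> = cmp \<Lambda> \<beta>' \<gamma>'" and deg: "deg \<Lambda> \<beta> = deg \<Lambda> \<beta>'"
  shows "\<beta> = \<beta>'" "\<gamma> = \<gamma>'"
proof -
  have d: "deg \<Lambda> (cmp \<Lambda> \<beta> \<gamma>) = deg \<Lambda> \<beta> + deg \<Lambda> \<gamma>" "deg \<Lambda> (cmp \<Lambda> \<beta> \<gamma>) = deg \<Lambda> \<beta> + deg \<Lambda> \<gamma>'"
    using assms deg_cmp by metis+
  then have dg: "deg \<Lambda> \<gamma>' = deg \<Lambda> \<gamma>" by simp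
  from factorization[OF cmp_arrow[OF assms(1-3)] d(1)]
  have "(\<beta>, \<gamma>) = (\<beta>', \<gamma>')"
    using assms dg by (elim ex1E) (smt (verit, best) case_prodI)
  then show "\<beta> = \<beta>'" "\<gamma> = \<gamma>'" by auto
qed

lemma cmp_left_cancel:
  assumes "\<alpha> \<in> arrows \<Lambda>" "\<beta> \<in> arrows \<Lambda>" "\<gamma> \<in> arrows \<Lambda>" "src \<Lambda> \<alpha> = rng \<Lambda> \<beta>" "src \<Lambda> \<alpha> = rng \<Lambda> \<gamma>"
    and "cmp \<Lambda> \<alpha> \<beta> = cmp \<Lambda> \<alpha> \<gamma>"
  shows "\<beta> = \<gamma>"
  using factorization_unique(2)[of \<alpha> \<beta> \<alpha> \<gamma>] assms by auto

definition initial where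
  "initial \<beta> \<alpha> \<longleftrightarrow> \<beta> \<in> arrows \<Lambda> \<and> (\<exists>\<gamma>\<in>arrows \<Lambda>. src \<Lambda> \<beta> = rng \<Lambda> \<gamma> \<and> cmp \<Lambda> \<beta> \<gamma> = \<alpha>)"

lemma initialI: "\<beta> \<in> arrows \<Lambda> \<Longrightarrow> \<gamma> \<in> arrows \<Lambda> \<Longrightarrow> src \<Lambda> \<beta> = rng \<Lambda> \<gamma> \<Longrightarrow> initial \<beta> (cmp \<Lambda> \<beta> \<gamma>)"
  by (auto simp: initial_def)

lemma initial_arrow: "initial \<beta> \<alpha> \<Longrightarrow> \<beta> \<in> arrows \<Lambda>" "initial \<beta> \<alpha> \<Longrightarrow> \<alpha> \<in> arrows \<Lambda>"
  by (auto simp: initial_def cmp_arrow)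

lemma initial_rng: "initial \<beta> \<alpha> \<Longrightarrow> rng \<Lambda> \<beta> = rng \<Lambda> \<alpha>"
  by (auto simp: initial_def rng_cmp)

lemma initial_refl: "\<alpha> \<in> arrows \<Lambda> \<Longrightarrow> initial \<alpha> \<alpha>"
  unfolding initial_def by (metis cmp_src rng_src src_arrow)

lemma initial_trans:
  assumes "initial \<gamma> \<beta>" "initial \<beta> \<alpha>"
  shows "initial \<gamma> \<alpha>"
proof -
  obtain \<delta> where d: "\<gamma> \<in> arrows \<Lambda>" "\<delta> \<in> arrows \<Lambda>" "src \<Lambda> \<gamma> = rng \<Lambda> \<delta>" "cmp \<Lambda> \<gamma> \<delta> = \<beta>"
    using assms by (auto simp: initial_def)
  obtain \<epsilon> where e: "\<epsilon> \<in> arrows \<Lambda>" "src \<Lambda> \<beta> = rng \<Lambda> \<epsilon>" "cmp \<Lambda> \<beta> \<epsilon> = \<alpha>"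
    using assms by (auto simp: initial_def)
  have "src \<Lambda> \<delta> = rng \<Lambda> \<epsilon>" using d e src_cmp by metis
  then have "cmp \<Lambda> \<gamma> (cmp \<Lambda> \<delta> \<epsilon>) = \<alpha>" "cmp \<Lambda> \<delta> \<epsilon> \<in> arrows \<Lambda>" "src \<Lambda> \<gamma> = rng \<Lambda> (cmp \<Lambda> \<delta> \<epsilon>)"
    using d e cmp_assoc cmp_arrow rng_cmp by auto
  then show ?thesis using d by (auto simp: initial_def)
qed

lemma initial_unique:
  assumes "initial \<beta> \<alpha>" "initial \<beta>' \<alpha>" "deg \<Lambda> \<beta> = deg \<Lambda> \<beta>'"
  shows "\<beta> = \<beta>'"
proof -
  obtain \<gamma> where "\<beta> \<in> arrows \<Lambda>" "\<gamma> \<in> arrows \<Lambda>" "src \<Lambda> \<beta> = rng \<Lambda> \<gamma>" "cmp \<Lambda> \<beta> \<gamma> = \<alpha>"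
    using assms(1) by (auto simp: initial_def)
  moreover obtain \<gamma>' where "\<beta>' \<in> arrows \<Lambda>" "\<gamma>' \<in> arrows \<Lambda>" "src \<Lambda> \<beta>' = rng \<Lambda> \<gamma>'" "cmp \<Lambda> \<beta>' \<gamma>' = \<alpha>"
    using assms(2) by (auto simp: initial_def)
  ultimately show ?thesis by - (rule factorization_unique(1)[of \<beta> \<gamma> \<beta>' \<gamma>']; simp add: assms(3))
qed

lemma initial_exists:
  assumes "\<alpha> \<in> arrows \<Lambda>" "m \<le> deg \<Lambda> \<alpha>"
  obtains \<beta> where "initial \<beta> \<alpha>" "deg \<Lambda> \<beta> = m"
proof -
  obtain \<beta> \<gamma> where "\<beta> \<in> arrows \<Lambda>" "\<gamma> \<in> arrows \<Lambda>" "src \<Lambda> \<beta> = rng \<Lambda> \<gamma>" "cmp \<Lambda> \<beta> \<gamma> = \<alpha>" "deg \<Lambda> \<beta> = m"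
    using factorization_exists[OF assms] by blast
  then show thesis using that initialI by blast
qed

lemma initial_initial:
  assumes "initial \<beta> \<alpha>" "initial \<gamma> \<alpha>" "deg \<Lambda> \<beta> \<le> deg \<Lambda> \<gamma>"
  shows "initial \<beta> \<gamma>"
proof -
  obtain \<beta>' where "initial \<beta>' \<gamma>" "deg \<Lambda> \<beta>' = deg \<Lambda> \<beta>"
    using initial_exists assms initial_arrow by metis
  then show ?thesis using initial_unique initial_trans assms by metis
qed

lemma inf_path_arrow:
  assumes "x \<in> inf_paths \<Lambda>" "m \<le> n"
  shows "x (m, n) \<in> arrows \<Lambda>" "rng \<Lambda> (x (m, n)) = x (m, m)" "src \<Lambda> (x (m, n)) = x (n, n)"
    "deg \<Lambda> (x (m, n)) = n - m"
proof -
  have "(m, n) \<in> arrows Omega" using assms by (simp add: Omega_def)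
  then have "x (m, n) \<in> arrows \<Lambda> \<and> rng \<Lambda> (x (m, n)) = x (rng Omega (m, n)) \<and>
    src \<Lambda> (x (m, n)) = x (src Omega (m, n)) \<and> deg \<Lambda> (x (m, n)) = deg Omega (m, n)"
    using assms(1) unfolding inf_paths_def degree_preserving_functor_def by blast
  then show "x (m, n) \<in> arrows \<Lambda>" "rng \<Lambda> (x (m, n)) = x (m, m)" "src \<Lambda> (x (m, n)) = x (n, n)"
    "deg \<Lambda> (x (m, n)) = n - m"
    by (simp_all add: Omega_def)
qed

lemma inf_path_cmp:
  assumes "x \<in> inf_paths \<Lambda>" "m \<le> n" "n \<le> p"
  shows "cmp \<Lambda> (x (m, n)) (x (n, p)) = x (m, p)"
proof -
  have "(m, n) \<in> arrows Omega" "(n, p) \<in> arrows Omega" "src Omega (m, n) = rng Omega (n, p)"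
    using assms by (auto simp: Omega_def)
  then have "x (cmp Omega (m, n) (n, p)) = cmp \<Lambda> (x (m, n)) (x (n, p))"
    using assms unfolding inf_paths_def degree_preserving_functor_def by blast
  then show ?thesis by (simp add: Omega_def)
qed

lemma inf_pathsI:
  assumes ext: "x \<in> extensional (arrows Omega)"
    and arr: "\<And>m n. m \<le> n \<Longrightarrow> x (m, n) \<in> arrows \<Lambda>"
    and rng: "\<And>m n. m \<le> n \<Longrightarrow> rng \<Lambda> (x (m, n)) = x (m, m)"
    and src: "\<And>m n. m \<le> n \<Longrightarrow> src \<Lambda> (x (m, n)) = x (n, n)"
    and deg: "\<And>m n. m \<le> n \<Longrightarrow> deg \<Lambda> (x (m, n)) = n - m"
    and cmp: "\<And>l m n. l \<le> m \<Longrightarrow> m \<le> n \<Longrightarrow> cmp \<Lambda> (x (l, m)) (x (m, n)) = x (l, n)"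
  shows "x \<in> inf_paths \<Lambda>"
proof -
  have "x a \<in> arrows \<Lambda> \<and> rng \<Lambda> (x a) = x (rng Omega a) \<and> src \<Lambda> (x a) = x (src Omega a) \<and>
    deg \<Lambda> (x a) = deg Omega a" if a: "a \<in> arrows Omega" for a
  proof -
    obtain m n where "a = (m, n)" "m \<le> n" using a by (auto simp: Omega_def)
    then show ?thesis by (simp add: Omega_def arr rng src deg)
  qed
  moreover have "x (cmp Omega a b) = cmp \<Lambda> (x a) (x b)"
    if ab: "a \<in> arrows Omega" "b \<in> arrows Omega" "src Omega a = rng Omega b" for a b
  proof -
    obtain l m where a: "a = (l, m)" "l \<le> m" using ab(1) by (auto simp: Omega_def)
    obtain m' n where b: "b = (m', n)" "m' \<le> n" using ab(2) by (auto simp: Omega_def)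
    have "m' = m" using ab(3) a b by (simp add: Omega_def)
    then show ?thesis using a b cmp by (simp add: Omega_def)
  qed
  ultimately show ?thesis using ext unfolding inf_paths_def degree_preserving_functor_def by blast
qed

lemma inf_path_vertex: "x \<in> inf_paths \<Lambda> \<Longrightarrow> x (n, n) \<in> vertices \<Lambda>"
  using inf_path_arrow[of x n n] by (simp add: of_degree_def)

lemma inf_path_initial: "x \<in> inf_paths \<Lambda> \<Longrightarrow> m \<le> n \<Longrightarrow> initial (x (0, m)) (x (0, n))"
  using inf_path_cmp[of x 0 m n] inf_path_arrow[of x 0 m] inf_path_arrow[of x m n] nat_vec_zero_le[of m]
    initialI[of "x (0, m)" "x (m, n)"] by simp

lemma inf_path_deg: "x \<in> inf_paths \<Lambda> \<Longrightarrow> deg \<Lambda> (x (0, n)) = n"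
  by (simp add: inf_path_arrow nat_vec_zero_le)

lemma inf_path_of_degree_at: "x \<in> inf_paths_at \<Lambda> v \<Longrightarrow> x (0, n) \<in> of_degree_at \<Lambda> v n"
  by (auto simp: inf_paths_at_def of_degree_at_def of_degree_def inf_path_arrow inf_path_deg nat_vec_zero_le)

lemma inf_path_eqI:
  assumes x: "x \<in> inf_paths \<Lambda>" and y: "y \<in> inf_paths \<Lambda>" and eq: "\<And>n. x (0, n) = y (0, n)"
  shows "x = y"
proof (rule extensionalityI[of _ "arrows Omega"])
  fix a :: "(nat ^ 'k) \<times> (nat ^ 'k)" assume "a \<in> arrows Omega"
  then obtain m n where a: "a = (m, n)" "m \<le> n" by (auto simp: Omega_def)
  have e: "cmp \<Lambda> (x (0, m)) (x (m, n)) = cmp \<Lambda> (x (0, m)) (y (m, n))"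
    using inf_path_cmp[OF x, of 0 m n] inf_path_cmp[OF y, of 0 m n] a eq by (simp add: nat_vec_zero_le)
  have "src \<Lambda> (x (0, m)) = rng \<Lambda> (x (m, n))"
    by (simp add: inf_path_arrow(2,3)[OF x] a(2) nat_vec_zero_le)
  moreover have "src \<Lambda> (x (0, m)) = rng \<Lambda> (y (m, n))"
    unfolding eq by (simp add: inf_path_arrow(2,3)[OF y] a(2) nat_vec_zero_le)
  ultimately show "x a = y a" unfolding a(1)
    by (rule cmp_left_cancel[OF inf_path_arrow(1)[OF x nat_vec_zero_le] inf_path_arrow(1)[OF x a(2)]
          inf_path_arrow(1)[OF y a(2)] _ _ e])
qed (use x y in \<open>auto simp: inf_paths_def\<close>)

text \<open>By unique factorization the segment of \<open>x\<close> from \<open>m\<close> to \<open>n\<close> has to be the arrow that leads from \<open>p m\<close> to \<open>p n\<close>.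
So infinite paths can be built from, and compared by, their initial segments alone.\<close>

lemma inf_path_of_initial_segments:
  assumes deg: "\<And>n. deg \<Lambda> (p n) = n" and ini: "\<And>m n. m \<le> n \<Longrightarrow> initial (p m) (p n)"
  obtains x where "x \<in> inf_paths \<Lambda>" "\<And>n. x (0, n) = p n"
proof -
  have arr: "p n \<in> arrows \<Lambda>" for n using ini[of n n] initial_arrow by auto
  have "\<exists>\<gamma>. \<gamma> \<in> arrows \<Lambda> \<and> src \<Lambda> (p m) = rng \<Lambda> \<gamma> \<and> cmp \<Lambda> (p m) \<gamma> = p n" if "m \<le> n" for m n
    using ini[OF that] unfolding initial_def by blast
  then obtain g where g: "\<And>m n. m \<le> n \<Longrightarrow> g m n \<in> arrows \<Lambda>" "\<And>m n. m \<le> n \<Longrightarrow> src \<Lambda> (p m) = rng \<Lambda> (g m n)"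
    "\<And>m n. m \<le> n \<Longrightarrow> cmp \<Lambda> (p m) (g m n) = p n" by metis
  have gsrc: "src \<Lambda> (g m n) = src \<Lambda> (p n)" if "m \<le> n" for m n
    using g that arr src_cmp by metis
  have gdiag: "g n n = src \<Lambda> (p n)" for n
    by (rule cmp_left_cancel[OF arr g(1)[OF order_refl] src_arrow[OF arr] g(2)[OF order_refl] rng_src[OF arr, symmetric]])
      (simp add: g(3) cmp_src[OF arr])
  have gdeg: "deg \<Lambda> (g m n) = n - m" if "m \<le> n" for m n
  proof -
    have "m + deg \<Lambda> (g m n) = m + (n - m)"
      using deg_cmp[OF arr g(1,2)[OF that]] g(3)[OF that] deg nat_vec_add_diff[OF that] by metis
    then show ?thesis by simp
  qed
  have gcmp: "g l n = cmp \<Lambda> (g l m) (g m n)" if "l \<le> m" "m \<le> n" for l m n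
  proof (rule cmp_left_cancel[of "p l"])
    have ln: "l \<le> n" using that by simp
    have "src \<Lambda> (g l m) = rng \<Lambda> (g m n)" using g that gsrc by metis
    then show "cmp \<Lambda> (g l m) (g m n) \<in> arrows \<Lambda>" "src \<Lambda> (p l) = rng \<Lambda> (cmp \<Lambda> (g l m) (g m n))"
      "cmp \<Lambda> (p l) (g l n) = cmp \<Lambda> (p l) (cmp \<Lambda> (g l m) (g m n))"
      using g that arr ln cmp_arrow rng_cmp cmp_assoc by metis+
    show "g l n \<in> arrows \<Lambda>" "src \<Lambda> (p l) = rng \<Lambda> (g l n)" using g ln by auto
  qed (rule arr)
  have p0: "p 0 \<in> vertices \<Lambda>" using arr[of 0] deg[of 0] by (simp add: of_degree_def)
  have g0: "g 0 n = p n" for n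
  proof -
    have "rng \<Lambda> (p n) = rng \<Lambda> (p 0)" using ini[OF nat_vec_zero_le] initial_rng by metis
    also have "\<dots> = p 0" using p0 vertices_iff by blast
    finally have "rng \<Lambda> (p n) = p 0" .
    then have "cmp \<Lambda> (p 0) (p n) = p n" "src \<Lambda> (p 0) = rng \<Lambda> (p n)"
      using cmp_rng[OF arr, of n] p0 vertices_iff by auto
    then show ?thesis
      using cmp_left_cancel[OF arr g(1)[OF nat_vec_zero_le] arr g(2)[OF nat_vec_zero_le], of n n]
        g(3)[OF nat_vec_zero_le, of n] by simp
  qed
  define x where "x = (\<lambda>a\<in>arrows Omega. g (fst a) (snd a))"
  have x_eq: "x (m, n) = g m n" if "m \<le> n" for m n using that by (simp add: x_def Omega_def)
  have "x \<in> inf_paths \<Lambda>"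
  proof (rule inf_pathsI)
    fix m n :: "nat ^ 'k" assume mn: "m \<le> n"
    show "rng \<Lambda> (x (m, n)) = x (m, m)" using g(2)[OF mn] gdiag[of m] by (simp add: x_eq mn)
    show "src \<Lambda> (x (m, n)) = x (n, n)" using gsrc[OF mn] gdiag[of n] by (simp add: x_eq mn)
    fix l assume lm: "l \<le> m"
    show "cmp \<Lambda> (x (l, m)) (x (m, n)) = x (l, n)"
      using gcmp[OF lm mn] lm mn by (simp add: x_eq)
  qed (simp_all add: x_eq g(1) gdeg, simp add: x_def)
  moreover have "x (0, n) = p n" for n using g0 by (simp add: x_eq nat_vec_zero_le)
  ultimately show thesis using that by blast
qed

text \<open>The initial segment of degree \<open>n\<close> of the path to be constructed is the one of \<open>\<alpha> x(0,n)\<close>, which has degree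
\<open>deg \<Lambda> \<alpha> + n \<ge> n\<close>.\<close>

lemma prepend_exists:
  assumes a: "\<alpha> \<in> arrows \<Lambda>" and x: "x \<in> inf_paths_at \<Lambda> (src \<Lambda> \<alpha>)"
  obtains y where "y \<in> inf_paths \<Lambda>" "\<And>n. y (0, deg \<Lambda> \<alpha> + n) = cmp \<Lambda> \<alpha> (x (0, n))"
proof -
  have xi: "x \<in> inf_paths \<Lambda>" "x (0, 0) = src \<Lambda> \<alpha>" using x by (auto simp: inf_paths_at_def)
  have x0: "x (0, n) \<in> arrows \<Lambda>" "src \<Lambda> \<alpha> = rng \<Lambda> (x (0, n))" for n
    using inf_path_arrow[OF xi(1) nat_vec_zero_le, of n] xi(2) by auto
  define q where "q n = cmp \<Lambda> \<alpha> (x (0, n))" for n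
  have qarr: "q n \<in> arrows \<Lambda>" for n using x0 a by (auto simp: q_def cmp_arrow)
  have qdeg: "deg \<Lambda> (q n) = deg \<Lambda> \<alpha> + n" for n
    using deg_cmp[OF a x0] inf_path_deg[OF xi(1)] by (simp add: q_def)
  have qini: "initial (q m) (q n)" if "m \<le> n" for m n
  proof -
    have "q n = cmp \<Lambda> (q m) (x (m, n))"
      unfolding q_def
      using inf_path_cmp[OF xi(1) nat_vec_zero_le that] x0 a inf_path_arrow[OF xi(1)] that nat_vec_zero_le cmp_assoc
      by metis
    moreover have "src \<Lambda> (q m) = rng \<Lambda> (x (m, n))"
      unfolding q_def using src_cmp x0 a inf_path_arrow[OF xi(1)] that nat_vec_zero_le by metis
    ultimately show ?thesis using initialI qarr inf_path_arrow[OF xi(1) that] by metis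
  qed
  have "\<exists>\<beta>. initial \<beta> (q n) \<and> deg \<Lambda> \<beta> = n" for n
    using initial_exists[OF qarr, of n n] qdeg[of n] nat_vec_le_add[of n "deg \<Lambda> \<alpha>"] by (auto simp: add.commute)
  then obtain p where p: "\<And>n. initial (p n) (q n)" "\<And>n. deg \<Lambda> (p n) = n" by metis
  have "initial (p m) (p n)" if "m \<le> n" for m n
    using initial_initial[of "p m" "q n" "p n"] p qini[OF that] initial_trans that by metis
  then obtain y where y: "y \<in> inf_paths \<Lambda>" "\<And>n. y (0, n) = p n"
    using inf_path_of_initial_segments[of p] p by metis
  have "p (deg \<Lambda> \<alpha> + n) = q n" for n
  proof -
    have "n \<le> deg \<Lambda> \<alpha> + n" by (metis add.commute nat_vec_le_add)
    then show ?thesis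
      using initial_unique[of "p (deg \<Lambda> \<alpha> + n)" "q (deg \<Lambda> \<alpha> + n)" "q n"] p qini qdeg by metis
  qed
  then show thesis using that y by (metis q_def)
qed

lemma prepend_unique:
  assumes a: "\<alpha> \<in> arrows \<Lambda>" and x: "x \<in> inf_paths_at \<Lambda> (src \<Lambda> \<alpha>)"
    and y: "y \<in> inf_paths \<Lambda>" "\<And>n. y (0, deg \<Lambda> \<alpha> + n) = cmp \<Lambda> \<alpha> (x (0, n))"
  shows "prepend \<Lambda> \<alpha> x = y"
  unfolding prepend_def
proof (rule the_equality)
  let ?d = "deg \<Lambda> \<alpha>"
  have xi: "x \<in> inf_paths \<Lambda>" "x (0, 0) = src \<Lambda> \<alpha>" using x by (auto simp: inf_paths_at_def)
  have x0: "x (0, n) \<in> arrows \<Lambda>" "src \<Lambda> \<alpha> = rng \<Lambda> (x (0, n))" for n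
    using inf_path_arrow[OF xi(1) nat_vec_zero_le, of n] xi(2) by auto
  have yd: "y (0, ?d) = \<alpha>" using y(2)[of 0] xi(2) cmp_src[OF a] by simp
  have shift: "y (?d + m, ?d + n) = x (m, n)" if "m \<le> n" for m n
  proof (rule cmp_left_cancel[of "y (0, ?d + m)"])
    have le: "?d + m \<le> ?d + n" using that by (simp add: nat_vec_add_le_cancel)
    show "y (0, ?d + m) \<in> arrows \<Lambda>" "y (?d + m, ?d + n) \<in> arrows \<Lambda>" "x (m, n) \<in> arrows \<Lambda>"
      "src \<Lambda> (y (0, ?d + m)) = rng \<Lambda> (y (?d + m, ?d + n))"
      using inf_path_arrow[OF y(1)] inf_path_arrow[OF xi(1)] that le nat_vec_zero_le by metis+
    show "src \<Lambda> (y (0, ?d + m)) = rng \<Lambda> (x (m, n))"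
      unfolding y(2) using src_cmp[OF a x0] inf_path_arrow[OF xi(1)] that nat_vec_zero_le by metis
    have "cmp \<Lambda> (y (0, ?d + m)) (y (?d + m, ?d + n)) = cmp \<Lambda> \<alpha> (x (0, n))"
      using inf_path_cmp[OF y(1) nat_vec_zero_le le] y(2) by simp
    also have "\<dots> = cmp \<Lambda> (cmp \<Lambda> \<alpha> (x (0, m))) (x (m, n))"
      using inf_path_cmp[OF xi(1) nat_vec_zero_le that] cmp_assoc[OF a x0(1) _ x0(2)] inf_path_arrow[OF xi(1)]
        that nat_vec_zero_le by metis
    finally show "cmp \<Lambda> (y (0, ?d + m)) (y (?d + m, ?d + n)) = cmp \<Lambda> (y (0, ?d + m)) (x (m, n))"
      using y(2) by simp
  qed
  show "y \<in> inf_paths \<Lambda> \<and> y (0, ?d) = \<alpha> \<and> (\<forall>m n. m \<le> n \<longrightarrow> y (?d + m, ?d + n) = x (m, n))"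
    using y yd shift by blast
  fix z assume z: "z \<in> inf_paths \<Lambda> \<and> z (0, ?d) = \<alpha> \<and> (\<forall>m n. m \<le> n \<longrightarrow> z (?d + m, ?d + n) = x (m, n))"
  show "z = y"
  proof (rule inf_path_eqI)
    fix n
    have "z (0, ?d + n) = cmp \<Lambda> (z (0, ?d)) (z (?d + 0, ?d + n))"
      using z inf_path_cmp[of z 0 ?d "?d + n"] by (simp add: nat_vec_zero_le nat_vec_le_add)
    then have "z (0, ?d + n) = y (0, ?d + n)" using z y(2) nat_vec_zero_le by metis
    moreover have "n \<le> ?d + n" by (metis add.commute nat_vec_le_add)
    ultimately show "z (0, n) = y (0, n)"
      using initial_unique inf_path_initial inf_path_deg z y(1) by metis
  qed (use z y in auto)
qed

lemma prepend_in:
  assumes a: "\<alpha> \<in> arrows \<Lambda>" and x: "x \<in> inf_paths_at \<Lambda> (src \<Lambda> \<alpha>)"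
  shows "prepend \<Lambda> \<alpha> x \<in> inf_paths \<Lambda>" "prepend \<Lambda> \<alpha> x (0, deg \<Lambda> \<alpha> + n) = cmp \<Lambda> \<alpha> (x (0, n))"
  using prepend_exists[OF a x] prepend_unique[OF a x] by metis+

lemma cylinder_eq:
  assumes a: "\<alpha> \<in> arrows \<Lambda>"
  shows "cylinder \<Lambda> \<alpha> = {y \<in> inf_paths \<Lambda>. y (0, deg \<Lambda> \<alpha>) = \<alpha>}"
proof (intro equalityI subsetI)
  fix y assume "y \<in> cylinder \<Lambda> \<alpha>"
  then obtain x where x: "x \<in> inf_paths_at \<Lambda> (src \<Lambda> \<alpha>)" "y = prepend \<Lambda> \<alpha> x" by (auto simp: cylinder_def)
  then show "y \<in> {y \<in> inf_paths \<Lambda>. y (0, deg \<Lambda> \<alpha>) = \<alpha>}"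
    using prepend_in[OF a x(1)] prepend_in(2)[OF a x(1), of 0] cmp_src[OF a] by (auto simp: inf_paths_at_def)
next
  fix y assume "y \<in> {y \<in> inf_paths \<Lambda>. y (0, deg \<Lambda> \<alpha>) = \<alpha>}"
  then have y: "y \<in> inf_paths \<Lambda>" "y (0, deg \<Lambda> \<alpha>) = \<alpha>" by auto
  let ?d = "deg \<Lambda> \<alpha>"
  define x where "x = (\<lambda>a\<in>arrows Omega. y (?d + fst a, ?d + snd a))"
  have x_eq: "x (m, n) = y (?d + m, ?d + n)" if "m \<le> n" for m n using that by (simp add: x_def Omega_def)
  have "x \<in> inf_paths \<Lambda>"
  proof (rule inf_pathsI)
    fix l m n :: "nat ^ 'k" assume "l \<le> m" "m \<le> n"
    then show "cmp \<Lambda> (x (l, m)) (x (m, n)) = x (l, n)"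
      using inf_path_cmp[OF y(1), of "?d + l" "?d + m" "?d + n"] by (simp add: x_eq nat_vec_add_le_cancel)
  qed (simp_all add: x_eq inf_path_arrow[OF y(1)] nat_vec_add_le_cancel, simp add: x_def)
  moreover have "x (0, 0) = src \<Lambda> \<alpha>"
    using inf_path_arrow(3)[OF y(1), of 0 ?d] y(2) x_eq[of 0 0] by (simp add: nat_vec_zero_le)
  ultimately have x: "x \<in> inf_paths_at \<Lambda> (src \<Lambda> \<alpha>)" by (simp add: inf_paths_at_def)
  have "prepend \<Lambda> \<alpha> x = y"
  proof (rule prepend_unique[OF a x y(1)])
    fix n
    show "y (0, ?d + n) = cmp \<Lambda> \<alpha> (x (0, n))"
      using inf_path_cmp[OF y(1) nat_vec_zero_le nat_vec_le_add, of ?d n] x_eq[of 0 n] y(2)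
      by (simp add: nat_vec_zero_le)
  qed
  then show "y \<in> cylinder \<Lambda> \<alpha>" using x by (auto simp: cylinder_def)
qed

lemma cylinder_vertex: "v \<in> vertices \<Lambda> \<Longrightarrow> cylinder \<Lambda> v = inf_paths_at \<Lambda> v"
  using vertices_iff[of v] cylinder_eq[of v] by (auto simp: of_degree_def inf_paths_at_def)

lemma cylinder_subset:
  assumes "initial \<beta> \<alpha>"
  shows "cylinder \<Lambda> \<alpha> \<subseteq> cylinder \<Lambda> \<beta>"
proof
  fix y assume "y \<in> cylinder \<Lambda> \<alpha>"
  then have y: "y \<in> inf_paths \<Lambda>" "y (0, deg \<Lambda> \<alpha>) = \<alpha>"
    using cylinder_eq[OF initial_arrow(2)[OF assms]] by auto
  have "deg \<Lambda> \<beta> \<le> deg \<Lambda> \<alpha>"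
    using assms deg_cmp nat_vec_le_add unfolding initial_def by metis
  then have "initial (y (0, deg \<Lambda> \<beta>)) \<alpha>" using inf_path_initial[OF y(1)] y(2) by metis
  then have "y (0, deg \<Lambda> \<beta>) = \<beta>" using assms initial_unique inf_path_deg[OF y(1)] by metis
  then show "y \<in> cylinder \<Lambda> \<beta>" using cylinder_eq[OF initial_arrow(1)[OF assms]] y by auto
qed

lemma cylinder_subset_paths_at: "\<alpha> \<in> arrows \<Lambda> \<Longrightarrow> cylinder \<Lambda> \<alpha> \<subseteq> inf_paths_at \<Lambda> (rng \<Lambda> \<alpha>)"
  using cylinder_subset[of "rng \<Lambda> \<alpha>" \<alpha>] cylinder_vertex[OF rng_vertex, of \<alpha>]
  unfolding initial_def by (metis cmp_rng rng_arrow src_rng)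

lemma cylinder_path: "x \<in> inf_paths \<Lambda> \<Longrightarrow> x \<in> cylinder \<Lambda> (x (0, n))"
  by (subst cylinder_eq) (auto simp: inf_path_arrow nat_vec_zero_le inf_path_deg)

lemma cylinder_prepend:
  assumes "\<beta> \<in> arrows \<Lambda>" "\<gamma> \<in> arrows \<Lambda>" "src \<Lambda> \<beta> = rng \<Lambda> \<gamma>" "y \<in> cylinder \<Lambda> (cmp \<Lambda> \<beta> \<gamma>)"
  obtains x where "x \<in> cylinder \<Lambda> \<gamma>" "x \<in> inf_paths_at \<Lambda> (src \<Lambda> \<beta>)" "y = prepend \<Lambda> \<beta> x"
proof -
  have "y \<in> cylinder \<Lambda> \<beta>" using cylinder_subset[OF initialI[OF assms(1-3)]] assms by auto
  then obtain x where x: "x \<in> inf_paths_at \<Lambda> (src \<Lambda> \<beta>)" "y = prepend \<Lambda> \<beta> x" by (auto simp: cylinder_def)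
  have "cmp \<Lambda> \<beta> (x (0, deg \<Lambda> \<gamma>)) = y (0, deg \<Lambda> (cmp \<Lambda> \<beta> \<gamma>))"
    using prepend_in(2)[OF assms(1) x(1)] x(2) deg_cmp[OF assms(1-3)] by simp
  also have "\<dots> = cmp \<Lambda> \<beta> \<gamma>" using assms(4) cylinder_eq[OF cmp_arrow[OF assms(1-3)]] by auto
  finally have "x (0, deg \<Lambda> \<gamma>) = \<gamma>"
    using assms x inf_path_arrow[of x 0 "deg \<Lambda> \<gamma>"] nat_vec_zero_le[of "deg \<Lambda> \<gamma>"]
    by - (rule cmp_left_cancel[of \<beta>]; simp add: inf_paths_at_def)
  then show thesis using that x cylinder_eq[OF assms(2)] by (auto simp: inf_paths_at_def)
qed

lemma topspace_inf_path_space: "topspace (inf_path_space \<Lambda>) = inf_paths \<Lambda>"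
proof -
  have "inf_paths \<Lambda> \<subseteq> \<Union> (cylinder \<Lambda> ` arrows \<Lambda>)"
    using cylinder_path[of _ 0] inf_path_arrow(1)[OF _ nat_vec_zero_le] by fast
  then show ?thesis using cylinder_eq by (auto simp: inf_path_space_def)
qed

text \<open>The cylinders of the initial segments of \<open>x\<close> shrink as the degree grows. Working with the degrees \<open>(N,...,N)\<close>
makes these cylinders linearly ordered, which takes care of finite intersections.\<close>

lemma open_contains_cylinder:
  assumes "openin (inf_path_space \<Lambda>) U" "x \<in> U"
  obtains n where "cylinder \<Lambda> (x (0, n)) \<subseteq> U"
proof -
  have xi: "x \<in> inf_paths \<Lambda>" using openin_subset[OF assms(1)] assms(2) by (auto simp: topspace_inf_path_space)
  have "generate_topology_on (cylinder \<Lambda> ` arrows \<Lambda>) U"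
    using assms(1) by (simp add: inf_path_space_def openin_topology_generated_by_iff)
  then have "x \<in> U \<longrightarrow> (\<exists>N. cylinder \<Lambda> (x (0, vec N)) \<subseteq> U)"
  proof (induction rule: generate_topology_on.induct)
    case (Int a b)
    have mono: "cylinder \<Lambda> (x (0, vec (max M N))) \<subseteq> cylinder \<Lambda> (x (0, vec M))" for M N
      by (rule cylinder_subset[OF inf_path_initial[OF xi le_vec_mono[OF max.cobounded1 order_refl]]])
    show ?case
    proof
      assume "x \<in> a \<inter> b"
      then obtain M N where "cylinder \<Lambda> (x (0, vec M)) \<subseteq> a" "cylinder \<Lambda> (x (0, vec N)) \<subseteq> b"
        using Int by auto
      then have "cylinder \<Lambda> (x (0, vec (max M N))) \<subseteq> a \<inter> b"
        using mono[of M N] mono[of N M] by (auto simp: max.commute)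
      then show "\<exists>N. cylinder \<Lambda> (x (0, vec N)) \<subseteq> a \<inter> b" by blast
    qed
  next
    case (Basis s)
    then obtain \<alpha> where \<alpha>: "\<alpha> \<in> arrows \<Lambda>" "s = cylinder \<Lambda> \<alpha>" by auto
    obtain N where N: "deg \<Lambda> \<alpha> \<le> vec N" using ex_le_vec by blast
    show ?case
    proof
      assume "x \<in> s"
      then have "x (0, deg \<Lambda> \<alpha>) = \<alpha>" using \<alpha> cylinder_eq by auto
      then have "cylinder \<Lambda> (x (0, vec N)) \<subseteq> s" using cylinder_subset[OF inf_path_initial[OF xi N]] \<alpha> by simp
      then show "\<exists>N. cylinder \<Lambda> (x (0, vec N)) \<subseteq> s" by blast
    qed
  qed blast+
  then show thesis using that assms(2) by blast
qed

end

locale row_finite_k_graph = k_graph \<Lambda> for \<Lambda> :: "('e, 'k::finite) kgraph" +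
  assumes row_finite: "row_finite_no_sources \<Lambda>"
begin

lemma finite_of_degree_at: "v \<in> vertices \<Lambda> \<Longrightarrow> finite (of_degree_at \<Lambda> v n)"
  and of_degree_at_nonempty: "v \<in> vertices \<Lambda> \<Longrightarrow> of_degree_at \<Lambda> v n \<noteq> {}"
  using row_finite by (auto simp: row_finite_no_sources_def)

text \<open>Koenig's lemma for a property that passes to extensions. Call \<open>\<alpha>\<close> bad if it has extensions by \<open>(M,...,M)\<close>
without the property for all \<open>M\<close>. Since \<open>\<alpha>\<close> has only finitely many extensions by \<open>(1,...,1)\<close>, one of them is
bad if \<open>\<alpha>\<close> is. If the conclusion fails then \<open>v\<close> is bad, and iteration yields an infinite path all of whose
initial segments lack the property.\<close>

lemma koenig:
  assumes v: "v \<in> vertices \<Lambda>" and her: "\<And>\<alpha> \<beta>. initial \<beta> \<alpha> \<Longrightarrow> P \<beta> \<Longrightarrow> P \<alpha>"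
    and loc: "\<And>x. x \<in> inf_paths_at \<Lambda> v \<Longrightarrow> \<exists>n. P (x (0, n))"
  shows "\<exists>N. \<forall>n \<alpha>. vec N \<le> n \<longrightarrow> \<alpha> \<in> of_degree_at \<Lambda> v n \<longrightarrow> P \<alpha>"
proof (rule ccontr)
  assume "\<not> ?thesis"
  then have neg: "\<exists>n \<alpha>. vec N \<le> n \<and> \<alpha> \<in> of_degree_at \<Lambda> v n \<and> \<not> P \<alpha>" for N by blast
  define bad where "bad \<alpha> \<longleftrightarrow> \<alpha> \<in> arrows \<Lambda> \<and> (\<forall>M. \<exists>\<beta>. initial \<alpha> \<beta> \<and> deg \<Lambda> \<beta> = deg \<Lambda> \<alpha> + vec M \<and> \<not> P \<beta>)" for \<alpha>
  have bad_v: "bad v"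
    unfolding bad_def
  proof (intro conjI allI)
    show "v \<in> arrows \<Lambda>" using v vertices_iff by blast
    fix M
    obtain n \<alpha> where n: "vec M \<le> n" "\<alpha> \<in> of_degree_at \<Lambda> v n" "\<not> P \<alpha>" using neg by blast
    obtain \<beta> where b: "initial \<beta> \<alpha>" "deg \<Lambda> \<beta> = vec M"
      using initial_exists[of \<alpha> "vec M"] of_degree_atD[OF n(2)] n(1) by metis
    then have "\<not> P \<beta>" "rng \<Lambda> \<beta> = v" using her n of_degree_atD initial_rng by metis+
    moreover have "initial v \<beta>"
      using b calculation unfolding initial_def by (metis cmp_rng rng_arrow src_rng)
    ultimately show "\<exists>\<beta>. initial v \<beta> \<and> deg \<Lambda> \<beta> = deg \<Lambda> v + vec M \<and> \<not> P \<beta>"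
      using b v by (auto simp: of_degree_def)
  qed
  have step: "\<exists>\<beta>. bad \<beta> \<and> initial \<alpha> \<beta> \<and> deg \<Lambda> \<beta> = deg \<Lambda> \<alpha> + vec 1" if bad: "bad \<alpha>" for \<alpha>
  proof (rule ccontr)
    have a: "\<alpha> \<in> arrows \<Lambda>" using bad by (simp add: bad_def)
    let ?E = "of_degree_at \<Lambda> (src \<Lambda> \<alpha>) (vec 1)"
    assume no: "\<nexists>\<beta>. bad \<beta> \<and> initial \<alpha> \<beta> \<and> deg \<Lambda> \<beta> = deg \<Lambda> \<alpha> + vec 1"
    have "\<exists>M. \<forall>\<beta>. initial (cmp \<Lambda> \<alpha> \<gamma>) \<beta> \<and> deg \<Lambda> \<beta> = deg \<Lambda> \<alpha> + vec 1 + vec M \<longrightarrow> P \<beta>" if "\<gamma> \<in> ?E" for \<gamma>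
    proof -
      have g: "\<gamma> \<in> arrows \<Lambda>" "src \<Lambda> \<alpha> = rng \<Lambda> \<gamma>" "deg \<Lambda> (cmp \<Lambda> \<alpha> \<gamma>) = deg \<Lambda> \<alpha> + vec 1"
        using of_degree_atD[OF that] deg_cmp[OF a] by auto
      then have "\<not> bad (cmp \<Lambda> \<alpha> \<gamma>)" using no initialI[OF a] by blast
      then show ?thesis using g cmp_arrow[OF a] unfolding bad_def by auto
    qed
    then obtain M where M: "\<And>\<gamma> \<beta>. \<gamma> \<in> ?E \<Longrightarrow> initial (cmp \<Lambda> \<alpha> \<gamma>) \<beta> \<Longrightarrow> deg \<Lambda> \<beta> = deg \<Lambda> \<alpha> + vec 1 + vec (M \<gamma>) \<Longrightarrow> P \<beta>"
      by metis
    define N where "N = Max (M ` ?E)"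
    have N: "M \<gamma> \<le> N" if "\<gamma> \<in> ?E" for \<gamma>
      unfolding N_def using that finite_of_degree_at[OF src_vertex[OF a]] by (intro Max_ge) auto
    obtain \<beta> where b: "initial \<alpha> \<beta>" "deg \<Lambda> \<beta> = deg \<Lambda> \<alpha> + vec (Suc N)" "\<not> P \<beta>"
      using bad unfolding bad_def by blast
    obtain \<delta> where d: "\<delta> \<in> arrows \<Lambda>" "src \<Lambda> \<alpha> = rng \<Lambda> \<delta>" "cmp \<Lambda> \<alpha> \<delta> = \<beta>"
      using b(1) by (auto simp: initial_def)
    have dd: "deg \<Lambda> \<delta> = vec (Suc N)" using deg_cmp[OF a d(1,2)] d(3) b(2) by simp
    have "(vec 1 :: nat ^ 'k) \<le> vec (Suc N)" by (simp add: less_eq_vec_def)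
    then obtain \<gamma> \<epsilon> where g: "\<gamma> \<in> arrows \<Lambda>" "\<epsilon> \<in> arrows \<Lambda>" "src \<Lambda> \<gamma> = rng \<Lambda> \<epsilon>" "cmp \<Lambda> \<gamma> \<epsilon> = \<delta>"
      "deg \<Lambda> \<gamma> = vec 1" using factorization_exists[OF d(1)] dd by metis
    have "rng \<Lambda> \<gamma> = src \<Lambda> \<alpha>" using rng_cmp[OF g(1-3)] g(4) d(2) by simp
    then have gE: "\<gamma> \<in> ?E" using g by (simp add: of_degree_at_def of_degree_def)
    have ag: "initial (cmp \<Lambda> \<alpha> \<gamma>) \<beta>"
      using cmp_assoc[OF a g(1,2)] g d(3) \<open>rng \<Lambda> \<gamma> = src \<Lambda> \<alpha>\<close> cmp_arrow[OF a g(1)] src_cmp[OF a g(1)]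
      unfolding initial_def by metis
    have dag: "deg \<Lambda> (cmp \<Lambda> \<alpha> \<gamma>) = deg \<Lambda> \<alpha> + vec 1"
      using deg_cmp[OF a g(1)] \<open>rng \<Lambda> \<gamma> = src \<Lambda> \<alpha>\<close> g(5) by simp
    have "deg \<Lambda> \<alpha> + vec 1 + vec (M \<gamma>) \<le> deg \<Lambda> \<beta>"
      using N[OF gE] b(2) by (simp add: less_eq_vec_def)
    then obtain \<beta>' where b': "initial \<beta>' \<beta>" "deg \<Lambda> \<beta>' = deg \<Lambda> \<alpha> + vec 1 + vec (M \<gamma>)"
      using initial_exists initial_arrow(2)[OF b(1)] by metis
    then have "initial (cmp \<Lambda> \<alpha> \<gamma>) \<beta>'"
      using initial_initial[OF ag b'(1)] dag nat_vec_le_add by metis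
    then have "P \<beta>'" using M gE b' by blast
    then show False using her b' b by blast
  qed
  have "\<exists>f. \<forall>n. (bad (f n) \<and> initial v (f n) \<and> deg \<Lambda> (f n) = vec n) \<and> initial (f n) (f (Suc n))"
  proof (rule dependent_nat_choice)
    show "\<exists>\<alpha>. bad \<alpha> \<and> initial v \<alpha> \<and> deg \<Lambda> \<alpha> = vec 0"
      using bad_v v initial_refl vertices_iff by (intro exI[of _ v]) (auto simp: vec_zero of_degree_def)
    fix \<alpha> n assume *: "bad \<alpha> \<and> initial v \<alpha> \<and> deg \<Lambda> \<alpha> = vec n"
    then obtain \<beta> where b: "bad \<beta>" "initial \<alpha> \<beta>" "deg \<Lambda> \<beta> = deg \<Lambda> \<alpha> + vec 1" using step by blast
    moreover have "(vec n :: nat ^ 'k) + vec 1 = vec (Suc n)" by (simp add: vec_eq_iff)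
    ultimately show "\<exists>\<beta>. (bad \<beta> \<and> initial v \<beta> \<and> deg \<Lambda> \<beta> = vec (Suc n)) \<and> initial \<alpha> \<beta>"
      using * initial_trans by metis
  qed
  then obtain f where f: "\<And>n. bad (f n)" "\<And>n. initial v (f n)" "\<And>n. deg \<Lambda> (f n) = vec n"
    "\<And>n. initial (f n) (f (Suc n))" by metis
  have fini: "initial (f m) (f n)" if "m \<le> n" for m n
    using that
  proof (induction rule: dec_induct)
    case base
    then show ?case using f(1) initial_refl by (auto simp: bad_def)
  next
    case (step n)
    then show ?case using f(4) initial_trans by blast
  qed
  obtain N where N: "\<And>n. n \<le> (vec (N n) :: nat ^ 'k)" using ex_le_vec by metis
  have "\<exists>\<beta>. initial \<beta> (f (N n)) \<and> deg \<Lambda> \<beta> = n" for n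
    using initial_exists[of "f (N n)" n] N f by (metis bad_def)
  then obtain p where p: "\<And>n. initial (p n) (f (N n))" "\<And>n. deg \<Lambda> (p n) = n" by metis
  have "initial (p m) (p n)" if "m \<le> n" for m n
  proof (rule initial_initial)
    show "initial (p m) (f (max (N m) (N n)))" "initial (p n) (f (max (N m) (N n)))"
      using p fini initial_trans by (meson max.cobounded1 max.cobounded2)+
  qed (use p that in auto)
  then obtain x where x: "x \<in> inf_paths \<Lambda>" "\<And>n. x (0, n) = p n"
    using inf_path_of_initial_segments[of p] p by metis
  have "initial v (f (N 0))" "deg \<Lambda> v = 0" using f v by (auto simp: of_degree_def)
  then have "p 0 = v" using p initial_unique by metis
  then have "x \<in> inf_paths_at \<Lambda> v" using x by (simp add: inf_paths_at_def)
  then obtain n where "P (p n)" using loc x by metis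
  then have "P (f (N n))" using her p by blast
  moreover obtain \<beta> where "initial (f (N n)) \<beta>" "deg \<Lambda> \<beta> = deg \<Lambda> (f (N n))" "\<not> P \<beta>"
    using f(1)[of "N n"] unfolding bad_def by (metis add.right_neutral vec_zero)
  ultimately show False
    using initial_unique[of "f (N n)" \<beta> \<beta>] initial_refl initial_arrow(2) by metis
qed

lemma inf_paths_at_nonempty:
  assumes "v \<in> vertices \<Lambda>"
  shows "inf_paths_at \<Lambda> v \<noteq> {}"
proof
  assume empty: "inf_paths_at \<Lambda> v = {}"
  have "\<exists>N. \<forall>n \<alpha>. vec N \<le> n \<longrightarrow> \<alpha> \<in> of_degree_at \<Lambda> v n \<longrightarrow> False"
    by (rule koenig[OF assms]) (simp_all add: empty)
  then show False using of_degree_at_nonempty[OF assms] order_refl by blast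
qed

lemma cylinder_nonempty: "\<alpha> \<in> arrows \<Lambda> \<Longrightarrow> cylinder \<Lambda> \<alpha> \<noteq> {}"
  using inf_paths_at_nonempty src_vertex by (auto simp: cylinder_def)

text \<open>Koenig's lemma, applied to the paths whose cylinder lies in a member of the given cover, provides finitely
many such cylinders of one degree that contain every path.\<close>

lemma compactin_inf_paths_at:
  assumes v: "v \<in> vertices \<Lambda>"
  shows "compactin (inf_path_space \<Lambda>) (inf_paths_at \<Lambda> v)"
  unfolding compactin_def
proof (intro conjI allI impI)
  show "inf_paths_at \<Lambda> v \<subseteq> topspace (inf_path_space \<Lambda>)"
    by (auto simp: topspace_inf_path_space inf_paths_at_def)
  fix \<U> assume U: "(\<forall>U\<in>\<U>. openin (inf_path_space \<Lambda>) U) \<and> inf_paths_at \<Lambda> v \<subseteq> \<Union>\<U>"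
  define P where "P \<alpha> \<longleftrightarrow> (\<exists>U\<in>\<U>. cylinder \<Lambda> \<alpha> \<subseteq> U)" for \<alpha>
  have her: "P \<alpha>" if "initial \<beta> \<alpha>" "P \<beta>" for \<alpha> \<beta>
    using cylinder_subset[OF that(1)] that(2) unfolding P_def by blast
  have loc: "\<exists>n. P (x (0, n))" if x: "x \<in> inf_paths_at \<Lambda> v" for x
  proof -
    obtain U where U': "U \<in> \<U>" "x \<in> U" using U x by blast
    then obtain n where "cylinder \<Lambda> (x (0, n)) \<subseteq> U" using open_contains_cylinder[of U x] U by blast
    then show ?thesis using U' unfolding P_def by blast
  qed
  obtain N where N: "\<And>n \<alpha>. vec N \<le> n \<Longrightarrow> \<alpha> \<in> of_degree_at \<Lambda> v n \<Longrightarrow> P \<alpha>"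
    using koenig[where P = P, OF v] her loc by blast
  have "\<forall>\<alpha>\<in>of_degree_at \<Lambda> v (vec N). \<exists>U. U \<in> \<U> \<and> cylinder \<Lambda> \<alpha> \<subseteq> U"
    using N[OF order_refl] unfolding P_def by blast
  then obtain W where W: "\<And>\<alpha>. \<alpha> \<in> of_degree_at \<Lambda> v (vec N) \<Longrightarrow> W \<alpha> \<in> \<U> \<and> cylinder \<Lambda> \<alpha> \<subseteq> W \<alpha>"
    using bchoice[of "of_degree_at \<Lambda> v (vec N)" "\<lambda>\<alpha> U. U \<in> \<U> \<and> cylinder \<Lambda> \<alpha> \<subseteq> U"] by blast
  have "x \<in> \<Union> (W ` of_degree_at \<Lambda> v (vec N))" if "x \<in> inf_paths_at \<Lambda> v" for x
    using inf_path_of_degree_at[OF that, of "vec N"] W cylinder_path[of x "vec N"] that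
    by (auto simp: inf_paths_at_def)
  then show "\<exists>\<F>. finite \<F> \<and> \<F> \<subseteq> \<U> \<and> inf_paths_at \<Lambda> v \<subseteq> \<Union>\<F>"
    using W finite_of_degree_at[OF v] by (intro exI[of _ "W ` of_degree_at \<Lambda> v (vec N)"]) blast
qed

end

section \<open>Unconditional sums in Banach spaces\<close>

lemma summable_on_if_small_tails:
  fixes f :: "'i \<Rightarrow> 'b::banach"
  assumes tails: "\<And>e. 0 < e \<Longrightarrow> \<exists>F0. finite F0 \<and> F0 \<subseteq> A \<and>
      (\<forall>F. finite F \<longrightarrow> F \<subseteq> A - F0 \<longrightarrow> norm (sum f F) \<le> e)"
  shows "f summable_on A"
proof -
  have "\<exists>P. eventually P (finite_subsets_at_top A) \<and> (\<forall>F F'. P F \<and> P F' \<longrightarrow> dist (sum f F) (sum f F') < e)"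
    if e: "0 < e" for e
  proof -
    obtain F0 where F0: "finite F0" "F0 \<subseteq> A"
      "\<And>F. finite F \<Longrightarrow> F \<subseteq> A - F0 \<Longrightarrow> norm (sum f F) \<le> e / 3"
      using tails[of "e / 3"] e by auto
    define P where "P F \<longleftrightarrow> finite F \<and> F0 \<subseteq> F \<and> F \<subseteq> A" for F
    have near: "norm (sum f F - sum f F0) \<le> e / 3" if "P F" for F
    proof -
      have F: "finite F" "F0 \<subseteq> F" "F \<subseteq> A" using that by (auto simp: P_def)
      have "sum f F - sum f F0 = sum f (F - F0)" using F F0 by (simp add: sum_diff)
      then show ?thesis using F0(3)[of "F - F0"] F by auto
    qed
    have "dist (sum f F) (sum f F') < e" if "P F" "P F'" for F F'
    proof -
      have "sum f F - sum f F' = (sum f F - sum f F0) - (sum f F' - sum f F0)" by simp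
      then have "norm (sum f F - sum f F') \<le> e / 3 + e / 3"
        by (simp only:) (rule order_trans[OF norm_triangle_ineq4 add_mono[OF near[OF that(1)] near[OF that(2)]]])
      then show ?thesis using e by (simp add: dist_norm)
    qed
    moreover have "eventually P (finite_subsets_at_top A)"
      unfolding eventually_finite_subsets_at_top P_def using F0 by blast
    ultimately show ?thesis by blast
  qed
  then have "cauchy_filter (filtermap (sum f) (finite_subsets_at_top A))"
    by (simp add: cauchy_filter_metric_filtermap)
  moreover have "complete (UNIV :: 'b set)"
    by (meson Cauchy_convergent UNIV_I complete_def convergent_def)
  ultimately obtain L where "(sum f \<longlongrightarrow> L) (finite_subsets_at_top A)"
    using complete_uniform[where S = UNIV] by (force simp add: filterlim_def)
  then show ?thesis using summable_on_def has_sum_def by blast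
qed

lemma norm_infsum_le_if_partial_sums:
  fixes f :: "'i \<Rightarrow> 'b::real_normed_vector"
  assumes "f summable_on A" and bound: "\<And>F. finite F \<Longrightarrow> F \<subseteq> A \<Longrightarrow> norm (sum f F) \<le> c"
  shows "norm (infsum f A) \<le> c"
proof -
  have "(sum f \<longlongrightarrow> infsum f A) (finite_subsets_at_top A)"
    using has_sum_infsum[OF assms(1)] by (simp add: has_sum_def)
  then show ?thesis
    by (rule Lim_norm_ubound[rotated]) (auto intro!: eventually_finite_subsets_at_top_weakI bound)
qed

lemma infsum_split_finite:
  fixes f :: "'i \<Rightarrow> 'b::banach"
  assumes "f summable_on A" "finite F" "F \<subseteq> A"
  shows "infsum f A = sum f F + infsum f (A - F)"
proof -
  have "A = F \<union> (A - F)" using assms by auto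
  then have "infsum f A = infsum f (F \<union> (A - F))" by simp
  also have "\<dots> = infsum f F + infsum f (A - F)"
    by (rule infsum_Un_disjoint) (use assms in \<open>auto intro: summable_on_subset_banach\<close>)
  finally show ?thesis using assms by simp
qed

section \<open>Continuous functions on compact fibres\<close>

lemma continuous_map_binop:
  fixes f :: "'t \<Rightarrow> 'a::topological_space" and g :: "'t \<Rightarrow> 'b::topological_space"
    and h :: "'a \<times> 'b \<Rightarrow> 'c::topological_space"
  assumes "continuous_map X euclidean f" "continuous_map X euclidean g" "continuous_on UNIV h"
  shows "continuous_map X euclidean (\<lambda>t. h (f t, g t))"
proof -
  have "continuous_map X euclidean (\<lambda>t. (f t, g t))"
    using continuous_map_pairedI[OF assms(1,2)] by (simp add: euclidean_product_topology)
  then show ?thesis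
    using continuous_map_compose[of X euclidean "\<lambda>t. (f t, g t)" euclidean h] assms(3)
    by (simp add: o_def)
qed

lemma continuous_map_unop:
  assumes "continuous_map X euclidean f" "continuous_on UNIV h"
  shows "continuous_map X euclidean (\<lambda>t. h (f t))"
  using continuous_map_compose[of X euclidean f euclidean h] assms by (simp add: o_def)

locale compact_lambda_system = lambda_system \<Lambda> T \<sigma>
  for \<Lambda> :: "('e, 'k::finite) kgraph" and T :: "'e \<Rightarrow> 't topology" and \<sigma> :: "'e \<Rightarrow> 't \<Rightarrow> 't" +
  assumes compact_fibre: "v \<in> vertices \<Lambda> \<Longrightarrow> compact_space (T v)"
begin

text \<open>The decay condition holds automatically, as closed subsets of \<open>T\<^sub>v\<close> are compact.\<close>

lemma C0_iff:
  assumes v: "v \<in> vertices \<Lambda>"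
  shows "f \<in> C0 (T v) \<longleftrightarrow> continuous_map (T v) euclidean f \<and> (\<forall>t. t \<notin> topspace (T v) \<longrightarrow> f t = 0)"
proof -
  have "compactin (T v) {t \<in> topspace (T v). \<epsilon> \<le> cmod (f t)}" if "continuous_map (T v) euclidean f" for \<epsilon>
  proof (rule closedin_compact_space[OF compact_fibre[OF v]])
    have "continuous_map (T v) euclidean (\<lambda>t. cmod (f t))"
      using that by (intro continuous_map_unop[where h = cmod]) (auto intro: continuous_intros)
    then have "closedin (T v) {t \<in> topspace (T v). cmod (f t) \<in> {\<epsilon>..}}"
      by (rule closedin_continuous_map_preimage) auto
    then show "closedin (T v) {t \<in> topspace (T v). \<epsilon> \<le> cmod (f t)}" by simp
  qed
  then show ?thesis by (auto simp: C0_def)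
qed

lemma C0_zero_outside: "f \<in> C0 (T v) \<Longrightarrow> t \<notin> topspace (T v) \<Longrightarrow> f t = 0"
  by (simp add: C0_def)

lemma C0_bounded:
  assumes v: "v \<in> vertices \<Lambda>" and f: "f \<in> C0 (T v)"
  obtains M where "0 \<le> M" "\<And>t. cmod (f t) \<le> M"
proof -
  have "compactin euclidean (f ` topspace (T v))"
    by (rule image_compactin[of "T v"]) (use f C0_iff[OF v] compact_fibre[OF v] in \<open>auto simp: compact_space_def\<close>)
  then have "bounded (f ` topspace (T v))" by (simp add: compact_imp_bounded)
  then obtain M where "0 < M" "\<And>t. t \<in> topspace (T v) \<Longrightarrow> cmod (f t) \<le> M"
    by (auto simp: bounded_pos)
  moreover then have "cmod (f t) \<le> M" for t
    using C0_zero_outside[OF f, of t] by (cases "t \<in> topspace (T v)") auto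
  ultimately show thesis using that[of M] by auto
qed

lemma C0_zero [simp]: "v \<in> vertices \<Lambda> \<Longrightarrow> (\<lambda>_. 0) \<in> C0 (T v)"
  by (simp add: C0_iff)

lemma C0_binop:
  assumes "v \<in> vertices \<Lambda>" "f \<in> C0 (T v)" "g \<in> C0 (T v)" "continuous_on UNIV h" "h (0, 0) = 0"
  shows "(\<lambda>t. h (f t, g t)) \<in> C0 (T v)"
  using assms continuous_map_binop[of "T v" f g h] by (simp add: C0_iff)

lemma C0_unop:
  assumes "v \<in> vertices \<Lambda>" "f \<in> C0 (T v)" "continuous_on UNIV h" "h 0 = 0"
  shows "(\<lambda>t. h (f t)) \<in> C0 (T v)"
  using assms continuous_map_unop[of "T v" f h] by (simp add: C0_iff)

lemma C0_add: "v \<in> vertices \<Lambda> \<Longrightarrow> f \<in> C0 (T v) \<Longrightarrow> g \<in> C0 (T v) \<Longrightarrow> (\<lambda>t. f t + g t) \<in> C0 (T v)"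
  using C0_binop[of v f g "\<lambda>z. fst z + snd z"] by (simp add: continuous_intros)

lemma C0_diff: "v \<in> vertices \<Lambda> \<Longrightarrow> f \<in> C0 (T v) \<Longrightarrow> g \<in> C0 (T v) \<Longrightarrow> (\<lambda>t. f t - g t) \<in> C0 (T v)"
  using C0_binop[of v f g "\<lambda>z. fst z - snd z"] by (simp add: continuous_intros)

lemma C0_mult: "v \<in> vertices \<Lambda> \<Longrightarrow> f \<in> C0 (T v) \<Longrightarrow> g \<in> C0 (T v) \<Longrightarrow> (\<lambda>t. f t * g t) \<in> C0 (T v)"
  using C0_binop[of v f g "\<lambda>z. fst z * snd z"] by (simp add: continuous_intros)

lemma C0_cnj: "v \<in> vertices \<Lambda> \<Longrightarrow> f \<in> C0 (T v) \<Longrightarrow> (\<lambda>t. cnj (f t)) \<in> C0 (T v)"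
  using C0_unop[of v f cnj] by (simp add: continuous_intros)

lemma C0_scale: "v \<in> vertices \<Lambda> \<Longrightarrow> f \<in> C0 (T v) \<Longrightarrow> (\<lambda>t. c * f t) \<in> C0 (T v)"
  using C0_unop[of v f "\<lambda>z. c * z"] by (simp add: continuous_intros)

lemma C0_sum:
  assumes "v \<in> vertices \<Lambda>" "\<And>i. i \<in> I \<Longrightarrow> f i \<in> C0 (T v)"
  shows "(\<lambda>t. \<Sum>i\<in>I. f i t) \<in> C0 (T v)"
  using assms(2) by (induction I rule: infinite_finite_induct) (auto simp: assms(1) C0_add)

definition unit_at :: "'e \<Rightarrow> 't \<Rightarrow> complex" where
  "unit_at v t = (if t \<in> topspace (T v) then 1 else 0)"

lemma unit_at_C0: "v \<in> vertices \<Lambda> \<Longrightarrow> unit_at v \<in> C0 (T v)"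
proof -
  assume v: "v \<in> vertices \<Lambda>"
  have "continuous_map (T v) euclidean (\<lambda>_. 1 :: complex)" by simp
  then have "continuous_map (T v) euclidean (unit_at v)"
    by (rule continuous_map_eq) (simp add: unit_at_def)
  then show ?thesis using v by (simp add: C0_iff unit_at_def)
qed

lemma C0_mult_unit [simp]: "f \<in> C0 (T v) \<Longrightarrow> f t * unit_at v t = f t" "f \<in> C0 (T v) \<Longrightarrow> unit_at v t * f t = f t"
  by (auto simp: unit_at_def C0_zero_outside)

definition pullback :: "'e \<Rightarrow> ('t \<Rightarrow> complex) \<Rightarrow> 't \<Rightarrow> complex" where
  "pullback \<alpha> f t = (if t \<in> topspace (T (src \<Lambda> \<alpha>)) then f (\<sigma> \<alpha> t) else 0)"

lemma sigma_in: "\<alpha> \<in> arrows \<Lambda> \<Longrightarrow> t \<in> topspace (T (src \<Lambda> \<alpha>)) \<Longrightarrow> \<sigma> \<alpha> t \<in> topspace (T (rng \<Lambda> \<alpha>))"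
  using continuous_maps by (auto simp: continuous_map_def Pi_iff)

lemma pullback_C0:
  assumes a: "\<alpha> \<in> arrows \<Lambda>" and f: "f \<in> C0 (T (rng \<Lambda> \<alpha>))"
  shows "pullback \<alpha> f \<in> C0 (T (src \<Lambda> \<alpha>))"
proof -
  have "continuous_map (T (src \<Lambda> \<alpha>)) euclidean (f \<circ> \<sigma> \<alpha>)"
    using continuous_map_compose continuous_maps[OF a] f C0_iff[OF rng_vertex[OF a]] by blast
  then have "continuous_map (T (src \<Lambda> \<alpha>)) euclidean (pullback \<alpha> f)"
    by (rule continuous_map_eq) (simp add: pullback_def)
  then show ?thesis using C0_iff[OF src_vertex[OF a]] by (simp add: pullback_def)
qed

lemma pullback_unit: "\<alpha> \<in> arrows \<Lambda> \<Longrightarrow> pullback \<alpha> (unit_at (rng \<Lambda> \<alpha>)) = unit_at (src \<Lambda> \<alpha>)"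
  by (auto simp: fun_eq_iff pullback_def unit_at_def sigma_in)

lemma mult_pullback: "g \<in> C0 (T (src \<Lambda> \<alpha>)) \<Longrightarrow> pullback \<alpha> f t * g t = f (\<sigma> \<alpha> t) * g t"
  by (auto simp: pullback_def C0_zero_outside)

section \<open>The modules \<open>Y\<^sub>n\<close> in terms of partial sums\<close>

text \<open>For fixed \<open>v\<close> and \<open>t\<close>, a family in \<open>Y\<^sub>n\<close> is an \<open>l\<^sup>2\<close>-sequence indexed by the arrows with source \<open>v\<close>. Its norms over
finite sets \<open>F\<close> control all inner products by the Cauchy-Schwarz inequality.\<close>

definition fibre_norm :: "('e, 't) family \<Rightarrow> 'e set \<Rightarrow> 'e \<Rightarrow> 't \<Rightarrow> real" where
  "fibre_norm y F v t = L2_set (\<lambda>\<alpha>. cmod (y \<alpha> t)) {\<alpha>\<in>F. src \<Lambda> \<alpha> = v}"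

text \<open>Amounts to \<open>Y_norm \<Lambda> n y \<le> M\<close>, by \<open>bounded_by_Y_norm\<close> and \<open>Y_norm_le\<close>.\<close>

definition bounded_by :: "nat ^ 'k \<Rightarrow> ('e, 't) family \<Rightarrow> real \<Rightarrow> bool" where
  "bounded_by n y M \<longleftrightarrow> (\<forall>F v t. finite F \<longrightarrow> F \<subseteq> of_degree \<Lambda> n \<longrightarrow> fibre_norm y F v t \<le> M)"

definition small_tails :: "nat ^ 'k \<Rightarrow> ('e, 't) family \<Rightarrow> bool" where
  "small_tails n y \<longleftrightarrow> (\<forall>\<epsilon>>0. \<exists>F0. finite F0 \<and> F0 \<subseteq> of_degree \<Lambda> n \<and>
     (\<forall>F v t. finite F \<longrightarrow> F \<subseteq> of_degree \<Lambda> n - F0 \<longrightarrow> fibre_norm y F v t \<le> \<epsilon>))"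

definition module_family :: "nat ^ 'k \<Rightarrow> ('e, 't) family \<Rightarrow> bool" where
  "module_family n y \<longleftrightarrow> (\<forall>\<alpha>\<in>of_degree \<Lambda> n. y \<alpha> \<in> C0 (T (src \<Lambda> \<alpha>))) \<and>
     (\<forall>\<alpha>. \<alpha> \<notin> of_degree \<Lambda> n \<longrightarrow> y \<alpha> = (\<lambda>_. 0)) \<and> small_tails n y"

lemma fibre_norm_nonneg [simp]: "0 \<le> fibre_norm y F v t"
  by (simp add: fibre_norm_def)

lemma fibre_norm_add:
  "fibre_norm (\<lambda>\<alpha> t. x \<alpha> t + y \<alpha> t) F v t \<le> fibre_norm x F v t + fibre_norm y F v t"
  unfolding fibre_norm_def
  by (rule order_trans[OF L2_set_mono L2_set_triangle_ineq]) (auto simp: norm_triangle_ineq)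

lemma fibre_norm_scale:
  assumes "\<And>\<alpha>. \<alpha> \<in> F \<Longrightarrow> src \<Lambda> \<alpha> = v \<Longrightarrow> cmod (x \<alpha> t) \<le> C * cmod (y \<alpha> t)" "0 \<le> C"
  shows "fibre_norm x F v t \<le> C * fibre_norm y F v t"
  unfolding fibre_norm_def L2_set_right_distrib[OF assms(2)]
  by (rule L2_set_mono) (use assms in auto)

lemma fibre_norm_square:
  "(fibre_norm y F v t)\<^sup>2 = (\<Sum>\<alpha>\<in>{\<alpha>\<in>F. src \<Lambda> \<alpha> = v}. (cmod (y \<alpha> t))\<^sup>2)"
  by (simp add: fibre_norm_def L2_set_def sum_nonneg)

lemma fibre_norm_Un:
  assumes "finite F" "finite G"
  shows "fibre_norm y (F \<union> G) v t \<le> fibre_norm y F v t + fibre_norm y G v t"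
proof -
  have "fibre_norm y (F \<union> G) v t \<le>
    fibre_norm (\<lambda>\<alpha> t. if \<alpha> \<in> F then y \<alpha> t else 0) (F \<union> G) v t +
    fibre_norm (\<lambda>\<alpha> t. if \<alpha> \<in> F then 0 else y \<alpha> t) (F \<union> G) v t"
    by (rule order_trans[OF _ fibre_norm_add]) (simp add: fibre_norm_def if_distrib if_distribR cong: if_cong)
  also have "fibre_norm (\<lambda>\<alpha> t. if \<alpha> \<in> F then y \<alpha> t else 0) (F \<union> G) v t \<le> fibre_norm y F v t"
  proof -
    have "(\<Sum>\<alpha>\<in>{\<alpha>\<in>F \<union> G. src \<Lambda> \<alpha> = v}. (cmod (if \<alpha> \<in> F then y \<alpha> t else 0))\<^sup>2)
      = (\<Sum>\<alpha>\<in>{\<alpha>\<in>F. src \<Lambda> \<alpha> = v}. (cmod (y \<alpha> t))\<^sup>2)"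
      using assms by (intro sum.mono_neutral_cong_right) auto
    then show ?thesis unfolding fibre_norm_def L2_set_def by simp
  qed
  also have "fibre_norm (\<lambda>\<alpha> t. if \<alpha> \<in> F then 0 else y \<alpha> t) (F \<union> G) v t \<le> fibre_norm y G v t"
  proof -
    have "(\<Sum>\<alpha>\<in>{\<alpha>\<in>F \<union> G. src \<Lambda> \<alpha> = v}. (cmod (if \<alpha> \<in> F then 0 else y \<alpha> t))\<^sup>2)
      = (\<Sum>\<alpha>\<in>{\<alpha>\<in>G - F. src \<Lambda> \<alpha> = v}. (cmod (y \<alpha> t))\<^sup>2)"
      using assms by (intro sum.mono_neutral_cong_right) auto
    also have "\<dots> \<le> (\<Sum>\<alpha>\<in>{\<alpha>\<in>G. src \<Lambda> \<alpha> = v}. (cmod (y \<alpha> t))\<^sup>2)"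
      using assms by (intro sum_mono2) auto
    finally show ?thesis unfolding fibre_norm_def L2_set_def by simp
  qed
  finally show ?thesis by simp
qed

lemma inner_partial_le:
  "cmod (\<Sum>\<alpha>\<in>{\<alpha>\<in>F. src \<Lambda> \<alpha> = v}. cnj (x \<alpha> t) * y \<alpha> t) \<le> fibre_norm x F v t * fibre_norm y F v t"
proof -
  have "cmod (\<Sum>\<alpha>\<in>{\<alpha>\<in>F. src \<Lambda> \<alpha> = v}. cnj (x \<alpha> t) * y \<alpha> t)
    \<le> (\<Sum>\<alpha>\<in>{\<alpha>\<in>F. src \<Lambda> \<alpha> = v}. \<bar>cmod (x \<alpha> t)\<bar> * \<bar>cmod (y \<alpha> t)\<bar>)"
    by (rule sum_norm_le) (simp add: norm_mult)
  also have "\<dots> \<le> fibre_norm x F v t * fibre_norm y F v t"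
    unfolding fibre_norm_def by (rule L2_set_mult_ineq)
  finally show ?thesis .
qed

lemma bounded_byD: "bounded_by n y M \<Longrightarrow> finite F \<Longrightarrow> F \<subseteq> of_degree \<Lambda> n \<Longrightarrow> fibre_norm y F v t \<le> M"
  by (auto simp: bounded_by_def)

lemma bounded_by_nonneg: "bounded_by n y M \<Longrightarrow> 0 \<le> M"
  using bounded_byD[of n y M "{}" undefined undefined] by (simp add: fibre_norm_def)

lemma bounded_by_add:
  "bounded_by n x M \<Longrightarrow> bounded_by n y N \<Longrightarrow> bounded_by n (\<lambda>\<alpha> t. x \<alpha> t + y \<alpha> t) (M + N)"
  unfolding bounded_by_def by (blast intro: order_trans[OF fibre_norm_add add_mono])

lemma bounded_by_scale:
  assumes "bounded_by n y M" "0 \<le> C" "\<And>\<alpha> t. \<alpha> \<in> of_degree \<Lambda> n \<Longrightarrow> cmod (x \<alpha> t) \<le> C * cmod (y \<alpha> t)"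
  shows "bounded_by n x (C * M)"
  unfolding bounded_by_def
proof (intro allI impI)
  fix F v t assume F: "finite F" "F \<subseteq> of_degree \<Lambda> n"
  have "fibre_norm x F v t \<le> C * fibre_norm y F v t"
    by (rule fibre_norm_scale) (use F assms in auto)
  also have "\<dots> \<le> C * M" using bounded_byD[OF assms(1) F] assms(2) by (simp add: mult_left_mono)
  finally show "fibre_norm x F v t \<le> C * M" .
qed

lemma module_familyD:
  assumes "module_family n y"
  shows "\<And>\<alpha>. \<alpha> \<in> of_degree \<Lambda> n \<Longrightarrow> y \<alpha> \<in> C0 (T (src \<Lambda> \<alpha>))"
    and "\<And>\<alpha>. \<alpha> \<notin> of_degree \<Lambda> n \<Longrightarrow> y \<alpha> = (\<lambda>_. 0)" and "small_tails n y"
  using assms by (auto simp: module_family_def)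

lemma small_tailsE:
  assumes "small_tails n y" "0 < \<epsilon>"
  obtains F0 where "finite F0" "F0 \<subseteq> of_degree \<Lambda> n"
    "\<And>F v t. finite F \<Longrightarrow> F \<subseteq> of_degree \<Lambda> n - F0 \<Longrightarrow> fibre_norm y F v t \<le> \<epsilon>"
proof -
  from assms have "\<exists>F0. finite F0 \<and> F0 \<subseteq> of_degree \<Lambda> n \<and>
     (\<forall>F v t. finite F \<longrightarrow> F \<subseteq> of_degree \<Lambda> n - F0 \<longrightarrow> fibre_norm y F v t \<le> \<epsilon>)"
    by (simp add: small_tails_def)
  then obtain F0 where "finite F0 \<and> F0 \<subseteq> of_degree \<Lambda> n \<and>
     (\<forall>F v t. finite F \<longrightarrow> F \<subseteq> of_degree \<Lambda> n - F0 \<longrightarrow> fibre_norm y F v t \<le> \<epsilon>)"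
    by (elim exE)
  then show thesis using that[of F0] by simp
qed

lemma small_tails_dominated:
  assumes "small_tails n y" "0 \<le> C" "\<And>\<alpha> t. \<alpha> \<in> of_degree \<Lambda> n \<Longrightarrow> cmod (x \<alpha> t) \<le> C * cmod (y \<alpha> t)"
  shows "small_tails n x"
  unfolding small_tails_def
proof (intro allI impI)
  fix \<epsilon> :: real assume "0 < \<epsilon>"
  then have "0 < \<epsilon> / (C + 1)" using assms(2) by simp
  then obtain F0 where F0: "finite F0" "F0 \<subseteq> of_degree \<Lambda> n"
    "\<And>F v t. finite F \<Longrightarrow> F \<subseteq> of_degree \<Lambda> n - F0 \<Longrightarrow> fibre_norm y F v t \<le> \<epsilon> / (C + 1)"
    using small_tailsE[OF assms(1)] by blast
  have "fibre_norm x F v t \<le> \<epsilon>" if F: "finite F" "F \<subseteq> of_degree \<Lambda> n - F0" for F v t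
  proof -
    have "fibre_norm x F v t \<le> C * fibre_norm y F v t"
      by (rule fibre_norm_scale) (use F assms in auto)
    also have "\<dots> \<le> C * (\<epsilon> / (C + 1))" using F0(3)[OF F] assms(2) by (rule mult_left_mono)
    also have "\<dots> \<le> \<epsilon>" using assms(2) \<open>0 < \<epsilon>\<close> by (simp add: divide_simps)
    finally show ?thesis .
  qed
  then show "\<exists>F0. finite F0 \<and> F0 \<subseteq> of_degree \<Lambda> n \<and>
      (\<forall>F v t. finite F \<longrightarrow> F \<subseteq> of_degree \<Lambda> n - F0 \<longrightarrow> fibre_norm x F v t \<le> \<epsilon>)"
    using F0 by blast
qed

lemma module_family_add:
  assumes x: "module_family n x" and y: "module_family n y"
  shows "module_family n (\<lambda>\<alpha> t. x \<alpha> t + y \<alpha> t)"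
proof -
  have "small_tails n (\<lambda>\<alpha> t. x \<alpha> t + y \<alpha> t)"
    unfolding small_tails_def
  proof (intro allI impI)
    fix \<epsilon> :: real assume "0 < \<epsilon>"
    then have e: "0 < \<epsilon> / 2" by simp
    obtain F0 where F0: "finite F0" "F0 \<subseteq> of_degree \<Lambda> n"
      "\<And>F v t. finite F \<Longrightarrow> F \<subseteq> of_degree \<Lambda> n - F0 \<Longrightarrow> fibre_norm x F v t \<le> \<epsilon> / 2"
      using small_tailsE[OF module_familyD(3)[OF x] e] by blast
    obtain F1 where F1: "finite F1" "F1 \<subseteq> of_degree \<Lambda> n"
      "\<And>F v t. finite F \<Longrightarrow> F \<subseteq> of_degree \<Lambda> n - F1 \<Longrightarrow> fibre_norm y F v t \<le> \<epsilon> / 2"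
      using small_tailsE[OF module_familyD(3)[OF y] e] by blast
    have "fibre_norm (\<lambda>\<alpha> t. x \<alpha> t + y \<alpha> t) F v t \<le> \<epsilon>"
      if F: "finite F" "F \<subseteq> of_degree \<Lambda> n - (F0 \<union> F1)" for F v t
    proof -
      have "fibre_norm x F v t \<le> \<epsilon> / 2" by (rule F0(3)) (use F in auto)
      moreover have "fibre_norm y F v t \<le> \<epsilon> / 2" by (rule F1(3)) (use F in auto)
      ultimately show ?thesis using fibre_norm_add[of x y F v t] by linarith
    qed
    then show "\<exists>F0. finite F0 \<and> F0 \<subseteq> of_degree \<Lambda> n \<and>
      (\<forall>F v t. finite F \<longrightarrow> F \<subseteq> of_degree \<Lambda> n - F0 \<longrightarrow> fibre_norm (\<lambda>\<alpha> t. x \<alpha> t + y \<alpha> t) F v t \<le> \<epsilon>)"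
      using F0(1,2) F1(1,2) by (intro exI[of _ "F0 \<union> F1"]) blast
  qed
  then show ?thesis
    using module_familyD[OF x] module_familyD[OF y] C0_add[OF src_vertex[OF of_degree_arrow]]
    by (simp add: module_family_def)
qed

lemma module_family_dominated:
  assumes y: "module_family n y" and C: "0 \<le> C"
    and c0: "\<And>\<alpha>. \<alpha> \<in> of_degree \<Lambda> n \<Longrightarrow> x \<alpha> \<in> C0 (T (src \<Lambda> \<alpha>))"
    and zero: "\<And>\<alpha>. \<alpha> \<notin> of_degree \<Lambda> n \<Longrightarrow> x \<alpha> = (\<lambda>_. 0)"
    and le: "\<And>\<alpha> t. \<alpha> \<in> of_degree \<Lambda> n \<Longrightarrow> cmod (x \<alpha> t) \<le> C * cmod (y \<alpha> t)"
  shows "module_family n x"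
  using small_tails_dominated[OF module_familyD(3)[OF y] C le] c0 zero by (simp add: module_family_def)

lemma module_family_scale:
  assumes "module_family n y"
  shows "module_family n (\<lambda>\<alpha> t. c * y \<alpha> t)"
  by (rule module_family_dominated[OF assms, of "cmod c"])
    (auto simp: norm_mult C0_scale src_vertex of_degree_arrow module_familyD[OF assms])

lemma module_family_finite:
  assumes "finite F" "F \<subseteq> of_degree \<Lambda> n" "\<And>\<alpha>. \<alpha> \<in> F \<Longrightarrow> y \<alpha> \<in> C0 (T (src \<Lambda> \<alpha>))"
    and zero: "\<And>\<alpha>. \<alpha> \<notin> F \<Longrightarrow> y \<alpha> = (\<lambda>_. 0)"
  shows "module_family n y"
proof -
  have "fibre_norm y G v t \<le> \<epsilon>" if "0 < \<epsilon>" "G \<subseteq> of_degree \<Lambda> n - F" for G v t and \<epsilon> :: real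
  proof -
    have "fibre_norm y G v t = 0"
      unfolding fibre_norm_def by (rule L2_set_0') (use that zero in auto)
    then show ?thesis using that by simp
  qed
  then have "small_tails n y" unfolding small_tails_def using assms(1,2)
    by (intro allI impI exI[of _ F] conjI) simp_all
  moreover have "y \<alpha> \<in> C0 (T (src \<Lambda> \<alpha>))" if "\<alpha> \<in> of_degree \<Lambda> n" for \<alpha>
    using that assms(3) zero[of \<alpha>] C0_zero[OF src_vertex[OF of_degree_arrow[OF that]]] by (cases "\<alpha> \<in> F") auto
  ultimately show ?thesis using assms by (auto simp: module_family_def)
qed

lemma module_family_bounded:
  assumes y: "module_family n y"
  obtains M where "0 \<le> M" "bounded_by n y M"
proof -
  obtain F0 where F0: "finite F0" "F0 \<subseteq> of_degree \<Lambda> n"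
    "\<And>F v t. finite F \<Longrightarrow> F \<subseteq> of_degree \<Lambda> n - F0 \<Longrightarrow> fibre_norm y F v t \<le> 1"
    using small_tailsE[OF module_familyD(3)[OF y], of 1] by auto
  have "\<exists>m. \<forall>t. cmod (y \<alpha> t) \<le> m" if "\<alpha> \<in> F0" for \<alpha>
    using C0_bounded[OF src_vertex[OF of_degree_arrow] module_familyD(1)[OF y]] F0(2) that by (metis subsetD)
  then obtain m where m: "\<And>\<alpha> t. \<alpha> \<in> F0 \<Longrightarrow> cmod (y \<alpha> t) \<le> m \<alpha>" by metis
  have m0: "0 \<le> m \<alpha>" if "\<alpha> \<in> F0" for \<alpha> using m[OF that] norm_ge_zero order_trans by blast
  have "fibre_norm y F v t \<le> (\<Sum>\<alpha>\<in>F0. m \<alpha>) + 1" if F: "finite F" "F \<subseteq> of_degree \<Lambda> n" for F v t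
  proof -
    have "fibre_norm y (F \<inter> F0) v t \<le> (\<Sum>\<alpha>\<in>{\<alpha>\<in>F \<inter> F0. src \<Lambda> \<alpha> = v}. cmod (y \<alpha> t))"
      unfolding fibre_norm_def by (rule L2_set_le_sum) simp
    also have "\<dots> \<le> (\<Sum>\<alpha>\<in>{\<alpha>\<in>F \<inter> F0. src \<Lambda> \<alpha> = v}. m \<alpha>)" by (rule sum_mono) (simp add: m)
    also have "\<dots> \<le> (\<Sum>\<alpha>\<in>F0. m \<alpha>)" by (rule sum_mono2) (use F0 m0 in auto)
    finally have "fibre_norm y (F \<inter> F0) v t \<le> (\<Sum>\<alpha>\<in>F0. m \<alpha>)" .
    moreover have "fibre_norm y (F - F0) v t \<le> 1" by (rule F0(3)) (use F in auto)
    moreover have "fibre_norm y F v t \<le> fibre_norm y (F \<inter> F0) v t + fibre_norm y (F - F0) v t"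
      using fibre_norm_Un[of "F \<inter> F0" "F - F0" y v t] F by (simp add: Int_Diff_Un)
    ultimately show ?thesis by linarith
  qed
  then have "bounded_by n y ((\<Sum>\<alpha>\<in>F0. m \<alpha>) + 1)" by (simp add: bounded_by_def)
  then show thesis using that bounded_by_nonneg by blast
qed

lemma inner_summable:
  assumes x: "module_family n x" and y: "module_family n y"
  shows "(\<lambda>\<alpha>. cnj (x \<alpha> t) * y \<alpha> t) summable_on {\<alpha>\<in>of_degree \<Lambda> n. src \<Lambda> \<alpha> = v}"
proof (rule summable_on_if_small_tails)
  fix e :: real assume e: "0 < e"
  obtain M where M: "0 \<le> M" "bounded_by n x M" using module_family_bounded[OF x] by blast
  have "0 < e / (M + 1)" using e M by simp
  then obtain F0 where F0: "finite F0" "F0 \<subseteq> of_degree \<Lambda> n"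
    "\<And>F v t. finite F \<Longrightarrow> F \<subseteq> of_degree \<Lambda> n - F0 \<Longrightarrow> fibre_norm y F v t \<le> e / (M + 1)"
    using small_tailsE[OF module_familyD(3)[OF y]] by blast
  let ?A = "{\<alpha>\<in>of_degree \<Lambda> n. src \<Lambda> \<alpha> = v}"
  have "norm (\<Sum>\<alpha>\<in>F. cnj (x \<alpha> t) * y \<alpha> t) \<le> e" if F: "finite F" "F \<subseteq> ?A - {\<alpha>\<in>F0. src \<Lambda> \<alpha> = v}" for F
  proof -
    have "{\<alpha>\<in>F. src \<Lambda> \<alpha> = v} = F" using F by auto
    then have "norm (\<Sum>\<alpha>\<in>F. cnj (x \<alpha> t) * y \<alpha> t) \<le> fibre_norm x F v t * fibre_norm y F v t"
      using inner_partial_le[of x t y F v] by simp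
    also have "\<dots> \<le> M * (e / (M + 1))"
      by (intro mult_mono bounded_byD[OF M(2)] F0(3) M) (use F in auto)
    also have "\<dots> \<le> e" using M e by (simp add: divide_simps)
    finally show ?thesis .
  qed
  then show "\<exists>F0. finite F0 \<and> F0 \<subseteq> ?A \<and>
      (\<forall>F. finite F \<longrightarrow> F \<subseteq> ?A - F0 \<longrightarrow> norm (\<Sum>\<alpha>\<in>F. cnj (x \<alpha> t) * y \<alpha> t) \<le> e)"
    using F0 by (intro exI[of _ "{\<alpha>\<in>F0. src \<Lambda> \<alpha> = v}"]) auto
qed

lemma Y_inner_le:
  assumes x: "module_family n x" and y: "module_family n y" and M: "bounded_by n x M" and N: "bounded_by n y N"
  shows "cmod (Y_inner \<Lambda> n x y v t) \<le> M * N"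
  unfolding Y_inner_def
proof (rule norm_infsum_le_if_partial_sums[OF inner_summable[OF x y]])
  fix F assume F: "finite F" "F \<subseteq> {\<alpha> \<in> of_degree \<Lambda> n. src \<Lambda> \<alpha> = v}"
  then have "{\<alpha>\<in>F. src \<Lambda> \<alpha> = v} = F" by auto
  then have "cmod (\<Sum>\<alpha>\<in>F. cnj (x \<alpha> t) * y \<alpha> t) \<le> fibre_norm x F v t * fibre_norm y F v t"
    using inner_partial_le[of x t y F v] by simp
  also have "\<dots> \<le> M * N"
    by (intro mult_mono bounded_byD[OF M] bounded_byD[OF N]) (use F bounded_by_nonneg[OF M] in auto)
  finally show "cmod (\<Sum>\<alpha>\<in>F. cnj (x \<alpha> t) * y \<alpha> t) \<le> M * N" .
qed

text \<open>The approximation is uniform in \<open>v\<close> and \<open>t\<close>, since \<open>x\<close> is bounded and \<open>y\<close> has small tails.\<close>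

lemma Y_inner_approx:
  assumes x: "module_family n x" and y: "module_family n y" and \<epsilon>: "0 < \<epsilon>"
  obtains F0 where "finite F0" "F0 \<subseteq> of_degree \<Lambda> n"
    "\<And>F v t. finite F \<Longrightarrow> F0 \<subseteq> F \<Longrightarrow> F \<subseteq> of_degree \<Lambda> n \<Longrightarrow>
       cmod (Y_inner \<Lambda> n x y v t - (\<Sum>\<alpha>\<in>{\<alpha>\<in>F. src \<Lambda> \<alpha> = v}. cnj (x \<alpha> t) * y \<alpha> t)) \<le> \<epsilon>"
proof -
  obtain M where M: "0 \<le> M" "bounded_by n x M" using module_family_bounded[OF x] by blast
  have "0 < \<epsilon> / (M + 1)" using \<epsilon> M by simp
  then obtain F0 where F0: "finite F0" "F0 \<subseteq> of_degree \<Lambda> n"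
    "\<And>F v t. finite F \<Longrightarrow> F \<subseteq> of_degree \<Lambda> n - F0 \<Longrightarrow> fibre_norm y F v t \<le> \<epsilon> / (M + 1)"
    using small_tailsE[OF module_familyD(3)[OF y]] by blast
  have "cmod (Y_inner \<Lambda> n x y v t - (\<Sum>\<alpha>\<in>{\<alpha>\<in>F. src \<Lambda> \<alpha> = v}. cnj (x \<alpha> t) * y \<alpha> t)) \<le> \<epsilon>"
    if F: "finite F" "F0 \<subseteq> F" "F \<subseteq> of_degree \<Lambda> n" for F v t
  proof -
    let ?A = "{\<alpha>\<in>of_degree \<Lambda> n. src \<Lambda> \<alpha> = v}" and ?F = "{\<alpha>\<in>F. src \<Lambda> \<alpha> = v}"
    let ?f = "\<lambda>\<alpha>. cnj (x \<alpha> t) * y \<alpha> t"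
    have "Y_inner \<Lambda> n x y v t = sum ?f ?F + infsum ?f (?A - ?F)"
      unfolding Y_inner_def
      by (rule infsum_split_finite[OF inner_summable[OF x y, where t = t and v = v]]) (use F in auto)
    moreover have "cmod (infsum ?f (?A - ?F)) \<le> \<epsilon>"
    proof (rule norm_infsum_le_if_partial_sums)
      show "?f summable_on ?A - ?F" by (rule summable_on_subset_banach[OF inner_summable[OF x y, where v = v]]) auto
      fix G assume G: "finite G" "G \<subseteq> ?A - ?F"
      then have "{\<alpha>\<in>G. src \<Lambda> \<alpha> = v} = G" by auto
      then have "cmod (sum ?f G) \<le> fibre_norm x G v t * fibre_norm y G v t"
        using inner_partial_le[of x t y G v] by simp
      also have "\<dots> \<le> M * (\<epsilon> / (M + 1))"
        by (intro mult_mono bounded_byD[OF M(2)] F0(3) M) (use F G in auto)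
      also have "\<dots> \<le> \<epsilon>" using M \<epsilon> by (simp add: divide_simps)
      finally show "cmod (sum ?f G) \<le> \<epsilon>" .
    qed
    ultimately show ?thesis by simp
  qed
  then show thesis using that F0(1,2) by blast
qed

lemma Y_inner_approx_once:
  assumes x: "module_family n x" and y: "module_family n y" and \<epsilon>: "0 < \<epsilon>"
  obtains F0 where "finite F0" "F0 \<subseteq> of_degree \<Lambda> n"
    "\<And>v t. cmod (Y_inner \<Lambda> n x y v t - (\<Sum>\<alpha>\<in>{\<alpha>\<in>F0. src \<Lambda> \<alpha> = v}. cnj (x \<alpha> t) * y \<alpha> t)) \<le> \<epsilon>"
proof -
  obtain F0 where F0: "finite F0" "F0 \<subseteq> of_degree \<Lambda> n"
    "\<And>F v t. finite F \<Longrightarrow> F0 \<subseteq> F \<Longrightarrow> F \<subseteq> of_degree \<Lambda> n \<Longrightarrow>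
       cmod (Y_inner \<Lambda> n x y v t - (\<Sum>\<alpha>\<in>{\<alpha>\<in>F. src \<Lambda> \<alpha> = v}. cnj (x \<alpha> t) * y \<alpha> t)) \<le> \<epsilon>"
    using Y_inner_approx[OF assms] by blast
  show thesis using that[OF F0(1,2) F0(3)[OF F0(1) order_refl F0(2)]] .
qed

lemma C0_partial_inner:
  assumes x: "module_family n x" and y: "module_family n y" and F: "F \<subseteq> of_degree \<Lambda> n" and v: "v \<in> vertices \<Lambda>"
  shows "(\<lambda>t. \<Sum>\<alpha>\<in>{\<alpha>\<in>F. src \<Lambda> \<alpha> = v}. cnj (x \<alpha> t) * y \<alpha> t) \<in> C0 (T v)"
proof (rule C0_sum[OF v])
  fix \<alpha> assume "\<alpha> \<in> {\<alpha>\<in>F. src \<Lambda> \<alpha> = v}"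
  then have "x \<alpha> \<in> C0 (T v)" "y \<alpha> \<in> C0 (T v)"
    using module_familyD(1)[OF x] module_familyD(1)[OF y] F by auto
  then show "(\<lambda>t. cnj (x \<alpha> t) * y \<alpha> t) \<in> C0 (T v)" using C0_mult[OF v C0_cnj[OF v]] by blast
qed

text \<open>A supremum of at least \<open>\<epsilon>\<close> entails a value of at least \<open>\<epsilon> / 2\<close>, which does no harm as \<open>\<epsilon>\<close> is arbitrary.\<close>

lemma coeff_algebra_iff:
  "a \<in> coeff_algebra \<Lambda> T \<longleftrightarrow> (\<forall>v\<in>vertices \<Lambda>. a v \<in> C0 (T v)) \<and> (\<forall>v. v \<notin> vertices \<Lambda> \<longrightarrow> a v = (\<lambda>_. 0)) \<and>
     (\<forall>\<epsilon>>0. finite {v \<in> vertices \<Lambda>. \<exists>t. \<epsilon> \<le> cmod (a v t)})"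
proof -
  have "(\<forall>\<epsilon>>0. finite {v \<in> vertices \<Lambda>. \<epsilon> \<le> (SUP t. cmod (a v t))}) \<longleftrightarrow>
    (\<forall>\<epsilon>>0. finite {v \<in> vertices \<Lambda>. \<exists>t. \<epsilon> \<le> cmod (a v t)})" if c: "\<forall>v\<in>vertices \<Lambda>. a v \<in> C0 (T v)"
  proof (intro iffI allI impI)
    fix \<epsilon> :: real assume fin: "\<forall>\<epsilon>>0. finite {v \<in> vertices \<Lambda>. \<epsilon> \<le> (SUP t. cmod (a v t))}" and \<epsilon>: "0 < \<epsilon>"
    have "\<epsilon> \<le> (SUP t. cmod (a v t))" if v: "v \<in> vertices \<Lambda>" "\<epsilon> \<le> cmod (a v t)" for v t
    proof -
      obtain M where "\<And>t. cmod (a v t) \<le> M" using C0_bounded[OF v(1)] c v(1) by metis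
      then have "bdd_above (range (\<lambda>t. cmod (a v t)))" by (auto simp: bdd_above_def)
      then show ?thesis using cSUP_upper[of t UNIV "\<lambda>t. cmod (a v t)"] v by simp
    qed
    then have "{v \<in> vertices \<Lambda>. \<exists>t. \<epsilon> \<le> cmod (a v t)} \<subseteq> {v \<in> vertices \<Lambda>. \<epsilon> \<le> (SUP t. cmod (a v t))}" by auto
    then show "finite {v \<in> vertices \<Lambda>. \<exists>t. \<epsilon> \<le> cmod (a v t)}" using fin \<epsilon> finite_subset by blast
  next
    fix \<epsilon> :: real assume fin: "\<forall>\<epsilon>>0. finite {v \<in> vertices \<Lambda>. \<exists>t. \<epsilon> \<le> cmod (a v t)}" and \<epsilon>: "0 < \<epsilon>"
    have "\<exists>t. \<epsilon> / 2 \<le> cmod (a v t)" if "\<epsilon> \<le> (SUP t. cmod (a v t))" for v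
    proof (rule ccontr)
      assume "\<not> ?thesis"
      then have "(SUP t. cmod (a v t)) \<le> \<epsilon> / 2" by (intro cSUP_least) (auto simp: not_le less_imp_le)
      then show False using that \<epsilon> by simp
    qed
    then have "{v \<in> vertices \<Lambda>. \<epsilon> \<le> (SUP t. cmod (a v t))} \<subseteq> {v \<in> vertices \<Lambda>. \<exists>t. \<epsilon> / 2 \<le> cmod (a v t)}" by auto
    moreover have "finite {v \<in> vertices \<Lambda>. \<exists>t. \<epsilon> / 2 \<le> cmod (a v t)}" using fin \<epsilon> half_gt_zero by blast
    ultimately show "finite {v \<in> vertices \<Lambda>. \<epsilon> \<le> (SUP t. cmod (a v t))}" using finite_subset by blast
  qed
  then show ?thesis unfolding coeff_algebra_def mem_Collect_eq by blast
qed

lemma coeff_algebraD: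
  assumes "a \<in> coeff_algebra \<Lambda> T"
  shows "\<And>v. v \<in> vertices \<Lambda> \<Longrightarrow> a v \<in> C0 (T v)" "\<And>v. v \<notin> vertices \<Lambda> \<Longrightarrow> a v = (\<lambda>_. 0)"
    "\<And>\<epsilon>. 0 < \<epsilon> \<Longrightarrow> finite {v \<in> vertices \<Lambda>. \<exists>t. \<epsilon> \<le> cmod (a v t)}"
  using assms unfolding coeff_algebra_iff by blast+

lemma C0_uniform_limit:
  assumes v: "v \<in> vertices \<Lambda>"
    and approx: "\<And>\<epsilon>. 0 < \<epsilon> \<Longrightarrow> \<exists>g\<in>C0 (T v). \<forall>t. cmod (f t - g t) \<le> \<epsilon>"
  shows "f \<in> C0 (T v)"
proof -
  obtain g where g: "\<And>n::nat. g n \<in> C0 (T v)" "\<And>n t. cmod (f t - g n t) \<le> 1 / real (Suc n)"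
    using approx[of "1 / real (Suc n)" for n] by (metis of_nat_0_less_iff zero_less_Suc zero_less_divide_1_iff)
  have "continuous_map (T v) Met_TC.mtopology f"
  proof (rule Met_TC.continuous_map_uniform_limit_alt[where F = sequentially and f = g])
    show "\<forall>\<^sub>F n in sequentially. continuous_map (T v) Met_TC.mtopology (g n)"
      using g(1) C0_iff[OF v] by simp
    fix \<epsilon> :: real assume "0 < \<epsilon>"
    then have "\<forall>\<^sub>F n in sequentially. 1 / real (Suc n) < \<epsilon>"
      using lim_inverse_n' by (intro order_tendstoD(2)[OF LIMSEQ_Suc]) (auto simp: inverse_eq_divide)
    then show "\<forall>\<^sub>F n in sequentially. \<forall>x\<in>topspace (T v). dist (g n x) (f x) < \<epsilon>"
    proof eventually_elim
      case (elim n)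
      then show ?case using g(2)[of _ n] by (auto simp: dist_norm norm_minus_commute intro: le_less_trans)
    qed
  qed auto
  moreover have "f t = 0" if "t \<notin> topspace (T v)" for t
  proof -
    have "cmod (f t) \<le> \<epsilon>" if \<epsilon>: "0 < \<epsilon>" for \<epsilon>
    proof -
      obtain g where "g \<in> C0 (T v)" "cmod (f t - g t) \<le> \<epsilon>" using approx[OF \<epsilon>] by blast
      then show ?thesis using C0_zero_outside[of g v t] \<open>t \<notin> topspace (T v)\<close> by simp
    qed
    then have "cmod (f t) \<le> 0" by (metis field_le_epsilon add_0)
    then show ?thesis by simp
  qed
  ultimately show ?thesis using C0_iff[OF v] by simp
qed

lemma Y_inner_coeff:
  assumes x: "module_family n x" and y: "module_family n y"
  shows "Y_inner \<Lambda> n x y \<in> coeff_algebra \<Lambda> T"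
  unfolding coeff_algebra_iff
proof (intro conjI ballI allI impI)
  fix v assume v: "v \<in> vertices \<Lambda>"
  show "Y_inner \<Lambda> n x y v \<in> C0 (T v)"
  proof (rule C0_uniform_limit[OF v])
    fix \<epsilon> :: real assume "0 < \<epsilon>"
    then obtain F0 where F0: "finite F0" "F0 \<subseteq> of_degree \<Lambda> n"
      "\<And>v t. cmod (Y_inner \<Lambda> n x y v t - (\<Sum>\<alpha>\<in>{\<alpha>\<in>F0. src \<Lambda> \<alpha> = v}. cnj (x \<alpha> t) * y \<alpha> t)) \<le> \<epsilon>"
      using Y_inner_approx_once[OF x y] by blast
    from C0_partial_inner[OF x y F0(2) v] show "\<exists>g\<in>C0 (T v). \<forall>t. cmod (Y_inner \<Lambda> n x y v t - g t) \<le> \<epsilon>"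
      by (rule bexI[rotated]) (simp add: F0(3))
  qed
next
  fix v assume "v \<notin> vertices \<Lambda>"
  then have "{\<alpha>\<in>of_degree \<Lambda> n. src \<Lambda> \<alpha> = v} = {}" using src_vertex of_degree_arrow by blast
  then show "Y_inner \<Lambda> n x y v = (\<lambda>_. 0)" by (simp only: Y_inner_def infsum_empty)
next
  fix \<epsilon> :: real assume "0 < \<epsilon>"
  then have "0 < \<epsilon> / 2" by simp
  then obtain F0 where F0: "finite F0" "F0 \<subseteq> of_degree \<Lambda> n"
      "\<And>v t. cmod (Y_inner \<Lambda> n x y v t - (\<Sum>\<alpha>\<in>{\<alpha>\<in>F0. src \<Lambda> \<alpha> = v}. cnj (x \<alpha> t) * y \<alpha> t)) \<le> \<epsilon> / 2"
    using Y_inner_approx_once[OF x y] by blast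
  have "v \<in> src \<Lambda> ` F0" if "\<epsilon> \<le> cmod (Y_inner \<Lambda> n x y v t)" for v t
  proof (rule ccontr)
    assume "v \<notin> src \<Lambda> ` F0"
    then have e0: "{\<alpha>\<in>F0. src \<Lambda> \<alpha> = v} = {}" by auto
    have "cmod (Y_inner \<Lambda> n x y v t) \<le> \<epsilon> / 2" using F0(3)[of v t] unfolding e0 by simp
    then show False using that \<open>0 < \<epsilon>\<close> by simp
  qed
  then have "{v \<in> vertices \<Lambda>. \<exists>t. \<epsilon> \<le> cmod (Y_inner \<Lambda> n x y v t)} \<subseteq> src \<Lambda> ` F0" by auto
  then show "finite {v \<in> vertices \<Lambda>. \<exists>t. \<epsilon> \<le> cmod (Y_inner \<Lambda> n x y v t)}" using F0(1) finite_subset by blast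
qed

text \<open>The increments of the partial sums of \<open>\<langle>y, y\<rangle>\<close> are squares of \<open>fibre_norm\<close>. So uniform convergence implies small
tails by the Cauchy criterion; conversely small tails give convergence to \<open>Y_inner \<Lambda> n y y\<close>, which lies in \<open>A\<close>
as a uniform limit.\<close>

lemma Y_module_iff: "y \<in> Y_module \<Lambda> T n \<longleftrightarrow> module_family n y"
proof
  assume y: "y \<in> Y_module \<Lambda> T n"
  let ?S = "\<lambda>F (v, t). \<Sum>\<alpha>\<in>{\<alpha>\<in>F. src \<Lambda> \<alpha> = v}. cnj (y \<alpha> t) * y \<alpha> t"
  obtain a where a: "uniform_limit UNIV ?S (\<lambda>(v, t). a v t) (finite_subsets_at_top (of_degree \<Lambda> n))"
    using y unfolding Y_module_def by blast
  have "small_tails n y"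
    unfolding small_tails_def
  proof (intro allI impI)
    fix \<epsilon> :: real assume "0 < \<epsilon>"
    then have "0 < \<epsilon>\<^sup>2 / 2" by simp
    then have "\<forall>\<^sub>F F in finite_subsets_at_top (of_degree \<Lambda> n). \<forall>p\<in>UNIV. dist (?S F p) (case p of (v, t) \<Rightarrow> a v t) < \<epsilon>\<^sup>2 / 2"
      using a unfolding uniform_limit_iff by blast
    then obtain X where X': "finite X \<and> X \<subseteq> of_degree \<Lambda> n \<and> (\<forall>F. finite F \<and> X \<subseteq> F \<and> F \<subseteq> of_degree \<Lambda> n \<longrightarrow>
        (\<forall>p\<in>UNIV. dist (?S F p) (case p of (v, t) \<Rightarrow> a v t) < \<epsilon>\<^sup>2 / 2))"
      unfolding eventually_finite_subsets_at_top by (elim exE)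
    have X: "finite X" "X \<subseteq> of_degree \<Lambda> n"
      "\<And>F v t. finite F \<Longrightarrow> X \<subseteq> F \<Longrightarrow> F \<subseteq> of_degree \<Lambda> n \<Longrightarrow> dist (?S F (v, t)) (a v t) < \<epsilon>\<^sup>2 / 2"
      using X' by auto
    have "fibre_norm y F v t \<le> \<epsilon>" if F: "finite F" "F \<subseteq> of_degree \<Lambda> n - X" for F v t
    proof -
      have "dist (?S (X \<union> F) (v, t)) (a v t) < \<epsilon>\<^sup>2 / 2" "dist (?S X (v, t)) (a v t) < \<epsilon>\<^sup>2 / 2"
        by (rule X(3); use X(1,2) F in auto)+
      then have "dist (?S (X \<union> F) (v, t)) (?S X (v, t)) < \<epsilon>\<^sup>2"
        by (rule dist_triangle_half_l)
      moreover have "?S (X \<union> F) (v, t) = ?S X (v, t) + ?S F (v, t)"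
      proof -
        have "{\<alpha>\<in>X \<union> F. src \<Lambda> \<alpha> = v} = {\<alpha>\<in>X. src \<Lambda> \<alpha> = v} \<union> {\<alpha>\<in>F. src \<Lambda> \<alpha> = v}" by auto
        then show ?thesis using X F by (simp only: prod.case) (intro sum.union_disjoint, auto)
      qed
      moreover have "?S F (v, t) = complex_of_real ((fibre_norm y F v t)\<^sup>2)"
        unfolding fibre_norm_square
        by (simp add: complex_norm_square mult.commute del: of_real_power)
      ultimately have "(fibre_norm y F v t)\<^sup>2 < \<epsilon>\<^sup>2" by (simp add: dist_norm norm_of_real del: of_real_power)
      then show ?thesis using \<open>0 < \<epsilon>\<close> power_less_imp_less_base less_imp_le by blast
    qed
    then show "\<exists>F0. finite F0 \<and> F0 \<subseteq> of_degree \<Lambda> n \<and>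
        (\<forall>F v t. finite F \<longrightarrow> F \<subseteq> of_degree \<Lambda> n - F0 \<longrightarrow> fibre_norm y F v t \<le> \<epsilon>)"
      using X(1,2) by (intro exI[of _ X] conjI allI impI)
  qed
  then show "module_family n y" using y unfolding Y_module_def module_family_def by blast
next
  assume y: "module_family n y"
  have "uniform_limit UNIV (\<lambda>F (v, t). \<Sum>\<alpha>\<in>{\<alpha>\<in>F. src \<Lambda> \<alpha> = v}. cnj (y \<alpha> t) * y \<alpha> t)
              (\<lambda>(v, t). Y_inner \<Lambda> n y y v t) (finite_subsets_at_top (of_degree \<Lambda> n))"
    unfolding uniform_limit_iff
  proof (intro allI impI)
    fix \<epsilon> :: real assume "0 < \<epsilon>"
    then have "0 < \<epsilon> / 2" by simp
    then obtain F0 where F0: "finite F0" "F0 \<subseteq> of_degree \<Lambda> n"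
      "\<And>F v t. finite F \<Longrightarrow> F0 \<subseteq> F \<Longrightarrow> F \<subseteq> of_degree \<Lambda> n \<Longrightarrow>
       cmod (Y_inner \<Lambda> n y y v t - (\<Sum>\<alpha>\<in>{\<alpha>\<in>F. src \<Lambda> \<alpha> = v}. cnj (y \<alpha> t) * y \<alpha> t)) \<le> \<epsilon> / 2"
      using Y_inner_approx[OF y y] by blast
    show "\<forall>\<^sub>F F in finite_subsets_at_top (of_degree \<Lambda> n). \<forall>p\<in>UNIV.
        dist (case p of (v, t) \<Rightarrow> \<Sum>\<alpha>\<in>{\<alpha>\<in>F. src \<Lambda> \<alpha> = v}. cnj (y \<alpha> t) * y \<alpha> t)
          (case p of (v, t) \<Rightarrow> Y_inner \<Lambda> n y y v t) < \<epsilon>"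
      unfolding eventually_finite_subsets_at_top
    proof (intro exI[of _ F0] conjI allI impI ballI F0(1,2))
      fix F and p :: "'e \<times> 't" assume F: "finite F \<and> F0 \<subseteq> F \<and> F \<subseteq> of_degree \<Lambda> n"
      obtain v t where p: "p = (v, t)" by fastforce
      show "dist (case p of (v, t) \<Rightarrow> \<Sum>\<alpha>\<in>{\<alpha>\<in>F. src \<Lambda> \<alpha> = v}. cnj (y \<alpha> t) * y \<alpha> t)
          (case p of (v, t) \<Rightarrow> Y_inner \<Lambda> n y y v t) < \<epsilon>"
        using F0(3)[of F v t] F \<open>0 < \<epsilon>\<close> by (simp add: p dist_norm norm_minus_commute)
    qed
  qed
  then show "y \<in> Y_module \<Lambda> T n"
    using y Y_inner_coeff[OF y y] unfolding Y_module_def module_family_def by blast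
qed

lemma Y_inner_self: "Y_inner \<Lambda> n y y v t = complex_of_real (\<Sum>\<^sub>\<infinity>\<alpha>\<in>{\<alpha>\<in>of_degree \<Lambda> n. src \<Lambda> \<alpha> = v}. (cmod (y \<alpha> t))\<^sup>2)"
proof -
  have eq: "cnj z * z = complex_of_real ((cmod z)\<^sup>2)" for z
    using complex_norm_square[of z] by (simp add: mult.commute)
  show ?thesis
  proof (cases "(\<lambda>\<alpha>. (cmod (y \<alpha> t))\<^sup>2) summable_on {\<alpha>\<in>of_degree \<Lambda> n. src \<Lambda> \<alpha> = v}")
    case True
    then show ?thesis unfolding Y_inner_def eq
      by (intro infsumI has_sum_of_real has_sum_infsum)
  next
    case False
    have "\<not> (\<lambda>\<alpha>. complex_of_real ((cmod (y \<alpha> t))\<^sup>2)) summable_on {\<alpha>\<in>of_degree \<Lambda> n. src \<Lambda> \<alpha> = v}"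
    proof
      assume "(\<lambda>\<alpha>. complex_of_real ((cmod (y \<alpha> t))\<^sup>2)) summable_on {\<alpha>\<in>of_degree \<Lambda> n. src \<Lambda> \<alpha> = v}"
      from summable_on_bounded_linear[OF bounded_linear_Re this] show False using False by simp
    qed
    then show ?thesis using False unfolding Y_inner_def eq by (simp add: infsum_not_exists del: of_real_power)
  qed
qed

lemma fibre_norm_le_Y_inner:
  assumes y: "module_family n y" and F: "finite F" "F \<subseteq> of_degree \<Lambda> n"
  shows "(fibre_norm y F v t)\<^sup>2 \<le> cmod (Y_inner \<Lambda> n y y v t)"
proof -
  let ?A = "{\<alpha>\<in>of_degree \<Lambda> n. src \<Lambda> \<alpha> = v}"
  have "(\<lambda>\<alpha>. Re (cnj (y \<alpha> t) * y \<alpha> t)) summable_on ?A"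
    by (rule summable_on_bounded_linear[OF bounded_linear_Re inner_summable[OF y y]])
  moreover have "Re (cnj (y \<alpha> t) * y \<alpha> t) = (cmod (y \<alpha> t))\<^sup>2" for \<alpha>
    by (simp add: cmod_power2) (simp add: power2_eq_square)
  ultimately have s: "(\<lambda>\<alpha>. (cmod (y \<alpha> t))\<^sup>2) summable_on ?A" by simp
  have "(fibre_norm y F v t)\<^sup>2 \<le> (\<Sum>\<^sub>\<infinity>\<alpha>\<in>?A. (cmod (y \<alpha> t))\<^sup>2)"
    unfolding fibre_norm_square by (rule finite_sum_le_infsum[OF s]) (use F in auto)
  then show ?thesis unfolding Y_inner_self norm_of_real by linarith
qed

lemma bounded_by_Y_norm:
  assumes y: "module_family n y"
  shows "bounded_by n y (Y_norm \<Lambda> n y)"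
  unfolding bounded_by_def
proof (intro allI impI)
  fix F v t assume F: "finite F" "F \<subseteq> of_degree \<Lambda> n"
  obtain M where M: "0 \<le> M" "bounded_by n y M" using module_family_bounded[OF y] by blast
  have "bdd_above (range (\<lambda>(v, t). cmod (Y_inner \<Lambda> n y y v t)))"
    using Y_inner_le[OF y y M(2) M(2)] by (auto simp: bdd_above_def)
  then have "cmod (Y_inner \<Lambda> n y y v t) \<le> sup_norm (Y_inner \<Lambda> n y y)"
    unfolding sup_norm_def using cSUP_upper[of "(v, t)" UNIV "\<lambda>(v, t). cmod (Y_inner \<Lambda> n y y v t)"] by simp
  then have "(fibre_norm y F v t)\<^sup>2 \<le> sup_norm (Y_inner \<Lambda> n y y)"
    using fibre_norm_le_Y_inner[OF y F, of v t] by linarith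
  then show "fibre_norm y F v t \<le> Y_norm \<Lambda> n y" unfolding Y_norm_def by (rule real_le_rsqrt)
qed

lemma Y_norm_le:
  assumes y: "module_family n y" and M: "bounded_by n y M"
  shows "Y_norm \<Lambda> n y \<le> M"
proof -
  have "sup_norm (Y_inner \<Lambda> n y y) \<le> M * M"
    unfolding sup_norm_def by (rule cSUP_least) (auto simp: Y_inner_le[OF y y M M])
  then show ?thesis
    unfolding Y_norm_def using bounded_by_nonneg[OF M] by (simp add: real_le_lsqrt power2_eq_square)
qed

lemma Y_norm_nonneg: "module_family n y \<Longrightarrow> 0 \<le> Y_norm \<Lambda> n y"
  using bounded_by_nonneg bounded_by_Y_norm by blast

lemma module_family_right_action:
  assumes y: "module_family n y" and c0: "\<And>v. v \<in> vertices \<Lambda> \<Longrightarrow> a v \<in> C0 (T v)"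
    and M: "\<And>v t. cmod (a v t) \<le> M"
  shows "module_family n (right_action \<Lambda> y a)"
proof (rule module_family_dominated[OF y, of M])
  show "0 \<le> M" using M[of undefined undefined] norm_ge_zero order_trans by blast
  show "right_action \<Lambda> y a \<alpha> \<in> C0 (T (src \<Lambda> \<alpha>))" if "\<alpha> \<in> of_degree \<Lambda> n" for \<alpha>
    unfolding right_action_def using module_familyD(1)[OF y that] c0 C0_mult src_vertex of_degree_arrow that by blast
  show "right_action \<Lambda> y a \<alpha> = (\<lambda>_. 0)" if "\<alpha> \<notin> of_degree \<Lambda> n" for \<alpha>
    using module_familyD(2)[OF y that] by (simp add: right_action_def)
  show "cmod (right_action \<Lambda> y a \<alpha> t) \<le> M * cmod (y \<alpha> t)" for \<alpha> t
    using mult_left_mono[OF M[of "src \<Lambda> \<alpha>" t], of "cmod (y \<alpha> t)"] by (simp add: right_action_def norm_mult mult.commute)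
qed

definition single :: "'e \<Rightarrow> ('t \<Rightarrow> complex) \<Rightarrow> ('e, 't) family" where
  "single \<alpha> f = (\<lambda>\<beta> t. if \<beta> = \<alpha> then f t else 0)"

lemma single_module: "\<alpha> \<in> of_degree \<Lambda> n \<Longrightarrow> f \<in> C0 (T (src \<Lambda> \<alpha>)) \<Longrightarrow> module_family n (single \<alpha> f)"
  by (rule module_family_finite[of "{\<alpha>}"]) (auto simp: single_def)

lemma unit_single: "\<alpha> \<in> of_degree \<Lambda> n \<Longrightarrow> module_family n (single \<alpha> (unit_at (src \<Lambda> \<alpha>)))"
  by (rule single_module) (auto simp: unit_at_C0 src_vertex of_degree_arrow)

lemma module_family_sum:
  assumes "\<And>i. i \<in> I \<Longrightarrow> module_family n (y i)"
  shows "module_family n (\<lambda>\<alpha> t. \<Sum>i\<in>I. y i \<alpha> t)"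
  using assms
proof (induction I rule: infinite_finite_induct)
  case (insert i I)
  then show ?case using module_family_add[of n "y i" "\<lambda>\<alpha> t. \<Sum>i\<in>I. y i \<alpha> t"] by simp
qed (auto intro!: module_family_finite[of "{}"])

definition restrict_family :: "'e set \<Rightarrow> ('e, 't) family \<Rightarrow> ('e, 't) family" where
  "restrict_family F y = (\<lambda>\<alpha> t. if \<alpha> \<in> F then y \<alpha> t else 0)"

lemma module_family_restrict: "module_family n y \<Longrightarrow> module_family n (restrict_family F y)"
proof (rule module_family_dominated[of n y 1])
  assume y: "module_family n y"
  show "restrict_family F y \<alpha> \<in> C0 (T (src \<Lambda> \<alpha>))" if "\<alpha> \<in> of_degree \<Lambda> n" for \<alpha>
    using module_familyD(1)[OF y that] C0_zero[OF src_vertex[OF of_degree_arrow[OF that]]]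
    by (cases "\<alpha> \<in> F") (simp_all add: restrict_family_def)
qed (auto simp: restrict_family_def module_familyD)

lemma bounded_by_restrict_complement:
  assumes "\<And>G v t. finite G \<Longrightarrow> G \<subseteq> of_degree \<Lambda> n - F \<Longrightarrow> fibre_norm y G v t \<le> \<epsilon>"
  shows "bounded_by n (restrict_family (- F) y) \<epsilon>"
  unfolding bounded_by_def
proof (intro allI impI)
  fix G v t assume G: "finite G" "G \<subseteq> of_degree \<Lambda> n"
  have "(fibre_norm (restrict_family (- F) y) G v t)\<^sup>2 = (fibre_norm y (G - F) v t)\<^sup>2"
    unfolding fibre_norm_square using G
    by (intro sum.mono_neutral_cong_right) (auto simp: restrict_family_def)
  then have "fibre_norm (restrict_family (- F) y) G v t = fibre_norm y (G - F) v t" by simp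
  then show "fibre_norm (restrict_family (- F) y) G v t \<le> \<epsilon>" using assms[of "G - F"] G by auto
qed

text \<open>In degree zero there is exactly one arrow with source \<open>v\<close>, and small tails mean that large values occur at
finitely many vertices only.\<close>

lemma module_family_zero_iff_coeff: "module_family 0 a \<longleftrightarrow> a \<in> coeff_algebra \<Lambda> T"
proof -
  have src: "src \<Lambda> v = v" if "v \<in> vertices \<Lambda>" for v using that vertices_iff by blast
  have fn: "fibre_norm a F v t = (if v \<in> F then cmod (a v t) else 0)" if "F \<subseteq> vertices \<Lambda>" for F v t
  proof -
    have "{\<alpha>\<in>F. src \<Lambda> \<alpha> = v} = (if v \<in> F then {v} else {})" using src that by auto
    then show ?thesis by (simp add: fibre_norm_def)
  qed
  have "small_tails 0 a \<longleftrightarrow> (\<forall>\<epsilon>>0. finite {v \<in> vertices \<Lambda>. \<exists>t. \<epsilon> \<le> cmod (a v t)})"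
  proof
    assume st: "small_tails 0 a"
    show "\<forall>\<epsilon>>0. finite {v \<in> vertices \<Lambda>. \<exists>t. \<epsilon> \<le> cmod (a v t)}"
    proof (intro allI impI)
      fix \<epsilon> :: real assume "0 < \<epsilon>"
      then have e: "0 < \<epsilon> / 2" by simp
      obtain F0 where F0: "finite F0" "F0 \<subseteq> vertices \<Lambda>" "\<And>F v t. finite F \<Longrightarrow> F \<subseteq> vertices \<Lambda> - F0 \<Longrightarrow> fibre_norm a F v t \<le> \<epsilon> / 2"
        using small_tailsE[OF st e] by blast
      have "v \<in> F0" if v: "v \<in> vertices \<Lambda>" "\<epsilon> \<le> cmod (a v t)" for v t
      proof (rule ccontr)
        assume "v \<notin> F0"
        then have "cmod (a v t) \<le> \<epsilon> / 2" using F0(3)[of "{v}" v t] fn[of "{v}" v t] v by simp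
        then show False using v \<open>0 < \<epsilon>\<close> by simp
      qed
      then have "{v \<in> vertices \<Lambda>. \<exists>t. \<epsilon> \<le> cmod (a v t)} \<subseteq> F0" by blast
      then show "finite {v \<in> vertices \<Lambda>. \<exists>t. \<epsilon> \<le> cmod (a v t)}" using F0(1) finite_subset by blast
    qed
  next
    assume fin: "\<forall>\<epsilon>>0. finite {v \<in> vertices \<Lambda>. \<exists>t. \<epsilon> \<le> cmod (a v t)}"
    show "small_tails 0 a"
      unfolding small_tails_def
    proof (intro allI impI)
      fix \<epsilon> :: real assume e: "0 < \<epsilon>"
      let ?F0 = "{v \<in> vertices \<Lambda>. \<exists>t. \<epsilon> \<le> cmod (a v t)}"
      have "fibre_norm a F v t \<le> \<epsilon>" if "F \<subseteq> vertices \<Lambda> - ?F0" for F v t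
      proof -
        have "F \<subseteq> vertices \<Lambda>" using that by blast
        moreover have "cmod (a v t) \<le> \<epsilon>" if v: "v \<in> F"
        proof -
          have "\<not> \<epsilon> \<le> cmod (a v t)" using v \<open>F \<subseteq> vertices \<Lambda> - ?F0\<close> by blast
          then show ?thesis by simp
        qed
        ultimately show ?thesis using e by (simp add: fn)
      qed
      moreover have "finite ?F0" using fin e by blast
      ultimately show "\<exists>F0. finite F0 \<and> F0 \<subseteq> vertices \<Lambda> \<and>
        (\<forall>F v t. finite F \<longrightarrow> F \<subseteq> vertices \<Lambda> - F0 \<longrightarrow> fibre_norm a F v t \<le> \<epsilon>)"
        by (intro exI[of _ ?F0] conjI allI impI) auto
    qed
  qed
  then show ?thesis unfolding module_family_def coeff_algebra_iff using src by auto
qed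

end

section \<open>Cuntz-Krieger families\<close>

context row_finite_k_graph
begin

text \<open>By unique factorization, composition is a bijection from the composable pairs of degrees \<open>m\<close> and \<open>l\<close>.\<close>

lemma sum_of_degree_at_add:
  fixes g :: "'e \<Rightarrow> 'b::comm_monoid_add"
  assumes v: "v \<in> vertices \<Lambda>"
  shows "(\<Sum>\<alpha>\<in>of_degree_at \<Lambda> v (m + l). g \<alpha>) =
    (\<Sum>\<gamma>\<in>of_degree_at \<Lambda> v m. \<Sum>\<delta>\<in>of_degree_at \<Lambda> (src \<Lambda> \<gamma>) l. g (cmp \<Lambda> \<gamma> \<delta>))"
proof -
  let ?S = "Sigma (of_degree_at \<Lambda> v m) (\<lambda>\<gamma>. of_degree_at \<Lambda> (src \<Lambda> \<gamma>) l)"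
  have "bij_betw (\<lambda>(\<gamma>, \<delta>). cmp \<Lambda> \<gamma> \<delta>) ?S (of_degree_at \<Lambda> v (m + l))"
  proof (rule bij_betwI')
    fix p q assume p: "p \<in> ?S" and q: "q \<in> ?S"
    obtain \<gamma> \<delta> where p': "p = (\<gamma>, \<delta>)" by (cases p)
    obtain \<gamma>' \<delta>' where q': "q = (\<gamma>', \<delta>')" by (cases q)
    have "\<gamma> = \<gamma>' \<and> \<delta> = \<delta>'" if "cmp \<Lambda> \<gamma> \<delta> = cmp \<Lambda> \<gamma>' \<delta>'"
    proof (intro conjI)
      have g: "\<gamma> \<in> arrows \<Lambda>" "\<delta> \<in> arrows \<Lambda>" "src \<Lambda> \<gamma> = rng \<Lambda> \<delta>" "deg \<Lambda> \<gamma> = m"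
        using p unfolding p' by (simp_all add: of_degree_at_def of_degree_def)
      have g': "\<gamma>' \<in> arrows \<Lambda>" "\<delta>' \<in> arrows \<Lambda>" "src \<Lambda> \<gamma>' = rng \<Lambda> \<delta>'" "deg \<Lambda> \<gamma>' = m"
        using q unfolding q' by (simp_all add: of_degree_at_def of_degree_def)
      show "\<gamma> = \<gamma>'" "\<delta> = \<delta>'"
        using factorization_unique[OF g(1-3) g'(1-3) that] g(4) g'(4) by simp_all
    qed
    then show "((case p of (\<gamma>, \<delta>) \<Rightarrow> cmp \<Lambda> \<gamma> \<delta>) = (case q of (\<gamma>, \<delta>) \<Rightarrow> cmp \<Lambda> \<gamma> \<delta>)) = (p = q)"
      unfolding p' q' by auto
  next
    fix p assume "p \<in> ?S"
    then show "(case p of (\<gamma>, \<delta>) \<Rightarrow> cmp \<Lambda> \<gamma> \<delta>) \<in> of_degree_at \<Lambda> v (m + l)"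
      by (auto simp: of_degree_at_def of_degree_def cmp_arrow rng_cmp deg_cmp)
  next
    fix \<alpha> assume a: "\<alpha> \<in> of_degree_at \<Lambda> v (m + l)"
    have d: "deg \<Lambda> \<alpha> = m + l" "\<alpha> \<in> arrows \<Lambda>" "rng \<Lambda> \<alpha> = v" using of_degree_atD[OF a] by auto
    have "m \<le> deg \<Lambda> \<alpha>" using d nat_vec_le_add by simp
    then obtain \<gamma> \<delta> where g: "\<gamma> \<in> arrows \<Lambda>" "\<delta> \<in> arrows \<Lambda>" "src \<Lambda> \<gamma> = rng \<Lambda> \<delta>" "cmp \<Lambda> \<gamma> \<delta> = \<alpha>"
      "deg \<Lambda> \<gamma> = m" "deg \<Lambda> \<delta> = deg \<Lambda> \<alpha> - m" using factorization_exists[OF d(2)] by blast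
    have "deg \<Lambda> \<delta> = l" using deg_cmp[OF g(1-3)] g d by simp
    moreover have "rng \<Lambda> \<gamma> = v" using rng_cmp[OF g(1-3)] g d by simp
    ultimately have "(\<gamma>, \<delta>) \<in> ?S" using g by (auto simp: of_degree_at_def of_degree_def)
    then show "\<exists>p\<in>?S. \<alpha> = (case p of (\<gamma>, \<delta>) \<Rightarrow> cmp \<Lambda> \<gamma> \<delta>)" using g(4) by (intro bexI[of _ "(\<gamma>, \<delta>)"]) auto
  qed
  then have "(\<Sum>\<alpha>\<in>of_degree_at \<Lambda> v (m + l). g \<alpha>) = (\<Sum>p\<in>?S. g (case p of (\<gamma>, \<delta>) \<Rightarrow> cmp \<Lambda> \<gamma> \<delta>))"
    by (rule sum.reindex_bij_betw[symmetric])
  also have "\<dots> = (\<Sum>(\<gamma>, \<delta>)\<in>?S. g (cmp \<Lambda> \<gamma> \<delta>))" by (rule sum.cong) auto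
  also have "\<dots> = (\<Sum>\<gamma>\<in>of_degree_at \<Lambda> v m. \<Sum>\<delta>\<in>of_degree_at \<Lambda> (src \<Lambda> \<gamma>) l. g (cmp \<Lambda> \<gamma> \<delta>))"
    by (rule sum.Sigma[symmetric]) (auto intro!: finite_of_degree_at v src_vertex of_degree_atD(1))
  finally show ?thesis .
qed

end

locale cuntz_krieger_family = row_finite_k_graph \<Lambda> for \<Lambda> :: "('e, 'k::finite) kgraph" +
  fixes s :: "'e \<Rightarrow> 'c::cstar_algebra"
  assumes ck: "ck_family \<Lambda> s"
begin

lemma s_cmp: "\<alpha> \<in> arrows \<Lambda> \<Longrightarrow> \<beta> \<in> arrows \<Lambda> \<Longrightarrow> src \<Lambda> \<alpha> = rng \<Lambda> \<beta> \<Longrightarrow> s \<alpha> * s \<beta> = s (cmp \<Lambda> \<alpha> \<beta>)"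
  and adj_s_s: "\<alpha> \<in> arrows \<Lambda> \<Longrightarrow> adj (s \<alpha>) * s \<alpha> = s (src \<Lambda> \<alpha>)"
  and projection_s: "v \<in> vertices \<Lambda> \<Longrightarrow> projection (s v)"
  and s_vertex_orth: "v \<in> vertices \<Lambda> \<Longrightarrow> w \<in> vertices \<Lambda> \<Longrightarrow> v \<noteq> w \<Longrightarrow> s v * s w = 0"
  and s_vertex_sum: "v \<in> vertices \<Lambda> \<Longrightarrow> s v = (\<Sum>\<alpha>\<in>of_degree_at \<Lambda> v n. s \<alpha> * adj (s \<alpha>))"
proof -
  note c = ck[unfolded ck_family_def, THEN conjunct2]
  show "\<alpha> \<in> arrows \<Lambda> \<Longrightarrow> \<beta> \<in> arrows \<Lambda> \<Longrightarrow> src \<Lambda> \<alpha> = rng \<Lambda> \<beta> \<Longrightarrow> s \<alpha> * s \<beta> = s (cmp \<Lambda> \<alpha> \<beta>)"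
    using c[THEN conjunct2, THEN conjunct2, THEN conjunct1] by blast
  show "\<alpha> \<in> arrows \<Lambda> \<Longrightarrow> adj (s \<alpha>) * s \<alpha> = s (src \<Lambda> \<alpha>)"
    using c[THEN conjunct2, THEN conjunct2, THEN conjunct2, THEN conjunct1] by blast
  show "v \<in> vertices \<Lambda> \<Longrightarrow> projection (s v)"
    using c[THEN conjunct1] by blast
  show "v \<in> vertices \<Lambda> \<Longrightarrow> w \<in> vertices \<Lambda> \<Longrightarrow> v \<noteq> w \<Longrightarrow> s v * s w = 0"
    using c[THEN conjunct2, THEN conjunct1] by blast
  show "v \<in> vertices \<Lambda> \<Longrightarrow> s v = (\<Sum>\<alpha>\<in>of_degree_at \<Lambda> v n. s \<alpha> * adj (s \<alpha>))"
    using c[THEN conjunct2, THEN conjunct2, THEN conjunct2, THEN conjunct2] by blast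
qed

lemma s_vertex: "v \<in> vertices \<Lambda> \<Longrightarrow> s v * s v = s v" "v \<in> vertices \<Lambda> \<Longrightarrow> adj (s v) = s v"
  using projection_s by (auto simp: projection_def)

lemma s_rng: "\<alpha> \<in> arrows \<Lambda> \<Longrightarrow> s (rng \<Lambda> \<alpha>) * s \<alpha> = s \<alpha>"
  and s_src: "\<alpha> \<in> arrows \<Lambda> \<Longrightarrow> s \<alpha> * s (src \<Lambda> \<alpha>) = s \<alpha>"
  by (simp_all add: s_cmp rng_arrow src_arrow rng_src src_rng cmp_rng cmp_src)

lemma s_src_adj: "\<alpha> \<in> arrows \<Lambda> \<Longrightarrow> s (src \<Lambda> \<alpha>) * adj (s \<alpha>) = adj (s \<alpha>)"
  and s_rng_adj: "\<alpha> \<in> arrows \<Lambda> \<Longrightarrow> adj (s \<alpha>) * s (rng \<Lambda> \<alpha>) = adj (s \<alpha>)"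
  using s_rng s_src s_vertex rng_vertex src_vertex adj_mult by metis+

lemma s_vertex_left:
  assumes "v \<in> vertices \<Lambda>" "\<alpha> \<in> arrows \<Lambda>"
  shows "s v * s \<alpha> = (if rng \<Lambda> \<alpha> = v then s \<alpha> else 0)"
proof (cases "rng \<Lambda> \<alpha> = v")
  case False
  have "s v * s \<alpha> = s v * s (rng \<Lambda> \<alpha>) * s \<alpha>" using s_rng[OF assms(2)] by (simp add: mult.assoc)
  also have "\<dots> = 0" using s_vertex_orth[OF assms(1) rng_vertex[OF assms(2)]] False by auto
  finally show ?thesis using False by simp
qed (use s_rng[OF assms(2)] in auto)

lemma norm_s_le: "\<alpha> \<in> arrows \<Lambda> \<Longrightarrow> norm (s \<alpha>) \<le> 1"
proof -
  assume a: "\<alpha> \<in> arrows \<Lambda>"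
  have "(norm (s \<alpha>))\<^sup>2 \<le> 1\<^sup>2"
    using cstar_identity[of "s \<alpha>"] adj_s_s[OF a] norm_projection_le[OF projection_s[OF src_vertex[OF a]]] by simp
  then show ?thesis using power2_le_imp_le[of "norm (s \<alpha>)" 1] by simp
qed

lemma projection_range: "\<alpha> \<in> arrows \<Lambda> \<Longrightarrow> projection (s \<alpha> * adj (s \<alpha>))"
proof -
  assume a: "\<alpha> \<in> arrows \<Lambda>"
  have "s \<alpha> * adj (s \<alpha>) * (s \<alpha> * adj (s \<alpha>)) = s \<alpha> * ((adj (s \<alpha>) * s \<alpha>) * adj (s \<alpha>))" by (simp add: mult.assoc)
  also have "\<dots> = s \<alpha> * adj (s \<alpha>)" using adj_s_s[OF a] s_src_adj[OF a] by simp
  finally show ?thesis by (simp add: projection_def adj_mult adj_adj)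
qed

text \<open>The Cuntz-Krieger relation presents the projection at \<open>rng \<Lambda> \<alpha>\<close> as a sum of range projections, which forces
these to be orthogonal.\<close>

lemma s_orth:
  assumes a: "\<alpha> \<in> of_degree \<Lambda> n" and b: "\<beta> \<in> of_degree \<Lambda> n" and ne: "\<alpha> \<noteq> \<beta>"
  shows "adj (s \<alpha>) * s \<beta> = 0"
proof -
  have aa: "\<alpha> \<in> arrows \<Lambda>" and bb: "\<beta> \<in> arrows \<Lambda>" using a b by (auto simp: of_degree_def)
  show ?thesis
  proof (cases "rng \<Lambda> \<alpha> = rng \<Lambda> \<beta>")
    case True
    let ?v = "rng \<Lambda> \<alpha>" and ?p = "\<lambda>\<gamma>. s \<gamma> * adj (s \<gamma>)"
    have v: "?v \<in> vertices \<Lambda>" using rng_vertex aa by blast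
    have "?p \<alpha> * ?p \<beta> = 0"
    proof (rule projections_orthogonal_if_sum_projection[of "of_degree_at \<Lambda> ?v n" ?p])
      show "finite (of_degree_at \<Lambda> ?v n)" using finite_of_degree_at[OF v] .
      fix \<gamma> assume g: "\<gamma> \<in> of_degree_at \<Lambda> ?v n"
      show "projection (?p \<gamma>)" using projection_range of_degree_atD(1)[OF g] .
      have "(\<Sum>\<gamma>\<in>of_degree_at \<Lambda> ?v n. ?p \<gamma>) * ?p \<gamma> = s ?v * ?p \<gamma>" using s_vertex_sum[OF v] by simp
      also have "\<dots> = ?p \<gamma>" using s_rng of_degree_atD[OF g] by (metis mult.assoc)
      finally show "(\<Sum>\<gamma>\<in>of_degree_at \<Lambda> ?v n. ?p \<gamma>) * ?p \<gamma> = ?p \<gamma>" .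
    qed (use a b True ne in \<open>auto simp: of_degree_at_def\<close>)
    moreover have "adj (s \<alpha>) * (?p \<alpha> * ?p \<beta>) * s \<beta> = (adj (s \<alpha>) * s \<alpha> * adj (s \<alpha>)) * (s \<beta> * (adj (s \<beta>) * s \<beta>))"
      by (simp add: mult.assoc)
    ultimately show ?thesis using adj_s_s s_src_adj s_src aa bb by simp
  next
    case False
    have "adj (s \<alpha>) * s \<beta> = (adj (s \<alpha>) * s (rng \<Lambda> \<alpha>)) * (s (rng \<Lambda> \<beta>) * s \<beta>)"
      by (simp only: s_rng_adj[OF aa] s_rng[OF bb])
    also have "\<dots> = adj (s \<alpha>) * (s (rng \<Lambda> \<alpha>) * s (rng \<Lambda> \<beta>)) * s \<beta>" by (simp add: mult.assoc)
    finally show ?thesis using s_vertex_orth[OF rng_vertex[OF aa] rng_vertex[OF bb] False] by simp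
  qed
qed

lemma adj_s_mult_s:
  assumes "\<alpha> \<in> of_degree \<Lambda> n" "\<beta> \<in> of_degree \<Lambda> n"
  shows "adj (s \<alpha>) * s \<beta> = (if \<alpha> = \<beta> then s (src \<Lambda> \<alpha>) else 0)"
  using assms s_orth adj_s_s by (auto simp: of_degree_def)

text \<open>For different arrows of one degree the summands have orthogonal ranges and orthogonal initial spaces.\<close>

lemma norm_block_diagonal_le:
  assumes F: "finite F" "F \<subseteq> of_degree \<Lambda> n" and b: "\<And>\<alpha>. \<alpha> \<in> F \<Longrightarrow> norm (b \<alpha>) \<le> M" and M: "0 \<le> M"
  shows "norm (\<Sum>\<alpha>\<in>F. s \<alpha> * b \<alpha> * adj (s \<alpha>)) \<le> M"
proof (rule norm_sum_orthogonal[OF F(1)])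
  fix \<alpha> \<beta> assume ab: "\<alpha> \<in> F" "\<beta> \<in> F" "\<alpha> \<noteq> \<beta>"
  then have o: "adj (s \<alpha>) * s \<beta> = 0" using s_orth F by blast
  have "adj (s \<alpha> * b \<alpha> * adj (s \<alpha>)) * (s \<beta> * b \<beta> * adj (s \<beta>)) =
    s \<alpha> * adj (b \<alpha>) * (adj (s \<alpha>) * s \<beta>) * (b \<beta> * adj (s \<beta>))"
    by (simp add: adj_mult adj_adj mult.assoc)
  then show "adj (s \<alpha> * b \<alpha> * adj (s \<alpha>)) * (s \<beta> * b \<beta> * adj (s \<beta>)) = 0" using o by simp
  have "s \<alpha> * b \<alpha> * adj (s \<alpha>) * adj (s \<beta> * b \<beta> * adj (s \<beta>)) =
    s \<alpha> * b \<alpha> * (adj (s \<alpha>) * s \<beta>) * (adj (b \<beta>) * adj (s \<beta>))"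
    by (simp add: adj_mult adj_adj mult.assoc)
  then show "s \<alpha> * b \<alpha> * adj (s \<alpha>) * adj (s \<beta> * b \<beta> * adj (s \<beta>)) = 0" using o by simp
next
  fix \<alpha> assume a: "\<alpha> \<in> F"
  then have "norm (s \<alpha>) \<le> 1" using F norm_s_le by (auto simp: of_degree_def)
  have "norm (s \<alpha> * b \<alpha> * adj (s \<alpha>)) \<le> norm (s \<alpha>) * norm (b \<alpha>) * norm (s \<alpha>)"
    using norm_mult_ineq[of "s \<alpha> * b \<alpha>" "adj (s \<alpha>)"] mult_right_mono[OF norm_mult_ineq[of "s \<alpha>" "b \<alpha>"], of "norm (s \<alpha>)"]
    by simp
  also have "\<dots> \<le> 1 * M * 1"
    by (intro mult_mono) (use b[OF a] M \<open>norm (s \<alpha>) \<le> 1\<close> in auto)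
  finally show "norm (s \<alpha> * b \<alpha> * adj (s \<alpha>)) \<le> M" by simp
qed (rule M)

lemma norm_diagonal_le:
  assumes F: "finite F" "F \<subseteq> of_degree \<Lambda> n" and c: "\<And>\<alpha>. \<alpha> \<in> F \<Longrightarrow> cmod (c \<alpha>) \<le> M" and M: "0 \<le> M"
  shows "norm (\<Sum>\<alpha>\<in>F. c \<alpha> *\<^sub>C (s \<alpha> * adj (s \<alpha>))) \<le> M"
proof -
  have "c \<alpha> *\<^sub>C (s \<alpha> * adj (s \<alpha>)) = s \<alpha> * (c \<alpha> *\<^sub>C s (src \<Lambda> \<alpha>)) * adj (s \<alpha>)" if "\<alpha> \<in> F" for \<alpha>
    using F(2) that s_src by (auto simp: mult_scaleC_left mult_scaleC_right of_degree_def)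
  then have "(\<Sum>\<alpha>\<in>F. c \<alpha> *\<^sub>C (s \<alpha> * adj (s \<alpha>))) = (\<Sum>\<alpha>\<in>F. s \<alpha> * (c \<alpha> *\<^sub>C s (src \<Lambda> \<alpha>)) * adj (s \<alpha>))"
    by (rule sum.cong[OF refl])
  also have "norm \<dots> \<le> M"
  proof (rule norm_block_diagonal_le[OF F _ M])
    fix \<alpha> assume a: "\<alpha> \<in> F"
    then have "src \<Lambda> \<alpha> \<in> vertices \<Lambda>" using F src_vertex by (auto simp: of_degree_def)
    then have "norm (s (src \<Lambda> \<alpha>)) \<le> 1" using norm_projection_le projection_s by blast
    then have "norm (c \<alpha> *\<^sub>C s (src \<Lambda> \<alpha>)) \<le> cmod (c \<alpha>) * 1" by (simp add: norm_scaleC mult_left_le)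
    then show "norm (c \<alpha> *\<^sub>C s (src \<Lambda> \<alpha>)) \<le> M" using c[OF a] by simp
  qed
  finally show ?thesis .
qed

end

section \<open>Self-similar systems\<close>

locale self_similar_system = lambda_system \<Lambda> T \<sigma> + row_finite_k_graph \<Lambda>
  for \<Lambda> :: "('e, 'k::finite) kgraph" and T :: "'e \<Rightarrow> 't topology" and \<sigma> :: "'e \<Rightarrow> 't \<Rightarrow> 't" +
  fixes \<Phi> :: "('e, 'k) inf_path \<Rightarrow> 'e \<times> 't"
  assumes intertwining_Phi: "intertwining \<Lambda> T \<sigma> \<Phi>"
    and Phi_surj: "\<Phi> ` inf_paths \<Lambda> = topspace (total_space \<Lambda> T)"
begin

text \<open>Only the point in the fibre is kept, as the other component of \<open>\<Phi> x\<close> is the range of \<open>x\<close>.\<close>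

definition code :: "('e, 'k) inf_path \<Rightarrow> 't" where
  "code x = snd (\<Phi> x)"

lemma Phi_code:
  assumes v: "v \<in> vertices \<Lambda>" and x: "x \<in> inf_paths_at \<Lambda> v"
  shows "\<Phi> x = (v, code x)" "code x \<in> topspace (T v)"
proof -
  have "v \<in> arrows \<Lambda>" "src \<Lambda> v = v" using v vertices_iff by auto
  then have "\<exists>t\<in>topspace (T v). \<Phi> x = (v, t)"
    using intertwining_Phi x unfolding intertwining_def by metis
  then show "\<Phi> x = (v, code x)" "code x \<in> topspace (T v)" by (auto simp: code_def)
qed

lemma code_prepend:
  assumes "\<alpha> \<in> arrows \<Lambda>" "x \<in> inf_paths_at \<Lambda> (src \<Lambda> \<alpha>)"
  shows "code (prepend \<Lambda> \<alpha> x) = \<sigma> \<alpha> (code x)"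
proof -
  have "\<exists>t\<in>topspace (T (src \<Lambda> \<alpha>)). \<Phi> x = (src \<Lambda> \<alpha>, t) \<and> \<Phi> (prepend \<Lambda> \<alpha> x) = (rng \<Lambda> \<alpha>, \<sigma> \<alpha> t)"
    using intertwining_Phi assms unfolding intertwining_def by blast
  then show ?thesis by (auto simp: code_def)
qed

lemma code_image:
  assumes v: "v \<in> vertices \<Lambda>"
  shows "code ` inf_paths_at \<Lambda> v = topspace (T v)"
proof (intro equalityI subsetI)
  fix t assume t: "t \<in> topspace (T v)"
  then have "(v, t) \<in> topspace (total_space \<Lambda> T)" using v by (simp add: total_space_def)
  then obtain x where x: "x \<in> inf_paths \<Lambda>" "\<Phi> x = (v, t)" using Phi_surj by (metis imageE)
  have "x \<in> inf_paths_at \<Lambda> (x (0, 0))" using x by (simp add: inf_paths_at_def)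
  then have "\<Phi> x = (x (0, 0), code x)" using Phi_code inf_path_vertex[OF x(1)] by blast
  then have "x \<in> inf_paths_at \<Lambda> v" "code x = t" using x by (auto simp: inf_paths_at_def)
  then show "t \<in> code ` inf_paths_at \<Lambda> v" by blast
qed (use Phi_code[OF v] in auto)

lemma openin_code_preimage:
  assumes v: "v \<in> vertices \<Lambda>" and W: "openin (T v) W"
  shows "openin (inf_path_space \<Lambda>) {x \<in> inf_paths_at \<Lambda> v. code x \<in> W}"
proof -
  have eq: "{t. (w, t) \<in> {v} \<times> W} = (if w = v then W else {})" for w by auto
  have "{v} \<times> W \<subseteq> Sigma (vertices \<Lambda>) (topspace \<circ> T)" using v openin_subset[OF W] by auto
  then have "openin (total_space \<Lambda> T) ({v} \<times> W)"
    unfolding total_space_def openin_sum_topology using W by (simp only: eq) simp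
  then have "openin (inf_path_space \<Lambda>) {x \<in> topspace (inf_path_space \<Lambda>). \<Phi> x \<in> {v} \<times> W}"
    using intertwining_Phi openin_continuous_map_preimage unfolding intertwining_def by blast
  also have "{x \<in> topspace (inf_path_space \<Lambda>). \<Phi> x \<in> {v} \<times> W} = {x \<in> inf_paths_at \<Lambda> v. code x \<in> W}"
  proof (intro equalityI subsetI)
    fix x assume "x \<in> {x \<in> topspace (inf_path_space \<Lambda>). \<Phi> x \<in> {v} \<times> W}"
    then have x: "x \<in> inf_paths \<Lambda>" "\<Phi> x \<in> {v} \<times> W" by (auto simp: topspace_inf_path_space)
    then have "x \<in> inf_paths_at \<Lambda> (x (0, 0))" by (simp add: inf_paths_at_def)
    then have "\<Phi> x = (x (0, 0), code x)" using Phi_code inf_path_vertex[OF x(1)] by blast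
    then show "x \<in> {x \<in> inf_paths_at \<Lambda> v. code x \<in> W}" using x by (auto simp: inf_paths_at_def)
  next
    fix x assume "x \<in> {x \<in> inf_paths_at \<Lambda> v. code x \<in> W}"
    then show "x \<in> {x \<in> topspace (inf_path_space \<Lambda>). \<Phi> x \<in> {v} \<times> W}"
      using Phi_code(1)[OF v, of x] by (auto simp: topspace_inf_path_space inf_paths_at_def)
  qed
  finally show ?thesis .
qed

text \<open>The fibre is the image of a compact set of infinite paths.\<close>

lemma compact_space_fibre:
  assumes v: "v \<in> vertices \<Lambda>"
  shows "compact_space (T v)"
proof -
  let ?X = "subtopology (inf_path_space \<Lambda>) (inf_paths_at \<Lambda> v)"
  have ts: "topspace ?X = inf_paths_at \<Lambda> v"
    using topspace_inf_path_space by (auto simp: inf_paths_at_def)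
  have "continuous_map ?X (T v) code"
    unfolding continuous_map_def ts
  proof (intro conjI allI impI)
    show "code \<in> inf_paths_at \<Lambda> v \<rightarrow> topspace (T v)" using Phi_code(2)[OF v] by auto
    fix W assume "openin (T v) W"
    then show "openin ?X {x \<in> inf_paths_at \<Lambda> v. code x \<in> W}"
      using openin_code_preimage[OF v] by (auto simp: openin_subtopology)
  qed
  moreover have "compactin ?X (inf_paths_at \<Lambda> v)"
    using compactin_inf_paths_at[OF v] by (simp add: compactin_subtopology)
  ultimately have "compactin (T v) (code ` inf_paths_at \<Lambda> v)" using image_compactin by blast
  then show ?thesis using code_image[OF v] by (simp add: compact_space_def)
qed

sublocale compact_lambda_system
  by unfold_locales (rule compact_space_fibre)

text \<open>By continuity of \<open>f \<circ> \<Phi>\<close>, every infinite path has an initial segment on whose cylinder the oscillation is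
small. Koenig's lemma makes the required length uniform.\<close>

lemma small_oscillation:
  assumes v: "v \<in> vertices \<Lambda>" and f: "f \<in> C0 (T v)" and \<epsilon>: "0 < \<epsilon>"
  shows "\<exists>N. \<forall>n \<alpha>. vec N \<le> n \<longrightarrow> \<alpha> \<in> of_degree_at \<Lambda> v n \<longrightarrow>
    (\<forall>x\<in>cylinder \<Lambda> \<alpha>. \<forall>y\<in>cylinder \<Lambda> \<alpha>. cmod (f (code x) - f (code y)) \<le> \<epsilon>)"
proof (rule koenig[OF v])
  fix \<alpha> \<beta> assume "initial \<beta> \<alpha>" "\<forall>x\<in>cylinder \<Lambda> \<beta>. \<forall>y\<in>cylinder \<Lambda> \<beta>. cmod (f (code x) - f (code y)) \<le> \<epsilon>"
  then show "\<forall>x\<in>cylinder \<Lambda> \<alpha>. \<forall>y\<in>cylinder \<Lambda> \<alpha>. cmod (f (code x) - f (code y)) \<le> \<epsilon>"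
    using cylinder_subset by blast
next
  fix x assume x: "x \<in> inf_paths_at \<Lambda> v"
  let ?W = "{t \<in> topspace (T v). f t \<in> ball (f (code x)) (\<epsilon> / 2)}"
  have "openin (T v) ?W"
    by (rule openin_continuous_map_preimage) (use f C0_iff[OF v] in auto)
  then have "openin (inf_path_space \<Lambda>) {x \<in> inf_paths_at \<Lambda> v. code x \<in> ?W}"
    by (rule openin_code_preimage[OF v])
  moreover have "x \<in> {x \<in> inf_paths_at \<Lambda> v. code x \<in> ?W}" using x Phi_code(2)[OF v x] \<epsilon> by simp
  ultimately obtain n where n: "cylinder \<Lambda> (x (0, n)) \<subseteq> {x \<in> inf_paths_at \<Lambda> v. code x \<in> ?W}"
    by (rule open_contains_cylinder)
  have "cmod (f (code y) - f (code z)) \<le> \<epsilon>"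
    if "y \<in> cylinder \<Lambda> (x (0, n))" "z \<in> cylinder \<Lambda> (x (0, n))" for y z
  proof -
    have "dist (f (code x)) (f (code y)) < \<epsilon> / 2" "dist (f (code x)) (f (code z)) < \<epsilon> / 2"
      using n that by auto
    then have "dist (f (code y)) (f (code z)) < \<epsilon>" by (rule dist_triangle_half_r)
    then show ?thesis by (simp add: dist_norm)
  qed
  then show "\<exists>n. \<forall>y\<in>cylinder \<Lambda> (x (0, n)). \<forall>z\<in>cylinder \<Lambda> (x (0, n)). cmod (f (code y) - f (code z)) \<le> \<epsilon>" by blast
qed

text \<open>An arbitrary sample point of the cylinder. All limits are independent of the choice by \<open>small_oscillation\<close>.\<close>

definition base :: "'e \<Rightarrow> ('e, 'k) inf_path" where
  "base \<alpha> = (SOME x. x \<in> cylinder \<Lambda> \<alpha>)"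

lemma base_in: "\<alpha> \<in> arrows \<Lambda> \<Longrightarrow> base \<alpha> \<in> cylinder \<Lambda> \<alpha>"
  unfolding base_def using cylinder_nonempty by (metis some_in_eq)

end

section \<open>The diagonal representation\<close>

locale self_similar_ck = self_similar_system \<Lambda> T \<sigma> \<Phi> + cuntz_krieger_family \<Lambda> s
  for \<Lambda> :: "('e, 'k::finite) kgraph" and T :: "'e \<Rightarrow> 't topology" and \<sigma> :: "'e \<Rightarrow> 't \<Rightarrow> 't"
    and \<Phi> :: "('e, 'k) inf_path \<Rightarrow> 'e \<times> 't" and s :: "'e \<Rightarrow> 'c::cstar_algebra"
begin

text \<open>The Riemann sum of \<open>f \<circ> \<Phi>\<close> for the partition of the paths with range \<open>v\<close> into the cylinders of degree \<open>n\<close>.\<close>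

definition approx :: "nat ^ 'k \<Rightarrow> 'e \<Rightarrow> ('t \<Rightarrow> complex) \<Rightarrow> 'c" where
  "approx n v f = (\<Sum>\<alpha>\<in>of_degree_at \<Lambda> v n. f (code (base \<alpha>)) *\<^sub>C (s \<alpha> * adj (s \<alpha>)))"

text \<open>The degrees \<open>(N,...,N)\<close> are cofinal, so the limit over all degrees can be taken along this sequence.\<close>

definition iota :: "'e \<Rightarrow> ('t \<Rightarrow> complex) \<Rightarrow> 'c" where
  "iota v f = lim (\<lambda>N. approx (vec N) v f)"

lemma code_base: "\<alpha> \<in> of_degree_at \<Lambda> v n \<Longrightarrow> code (base \<alpha>) \<in> topspace (T v)"
  using base_in[of \<alpha>] cylinder_subset_paths_at[of \<alpha>] Phi_code(2)[OF rng_vertex[of \<alpha>], of "base \<alpha>"] of_degree_atD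
  by auto

lemma approx_add: "approx n v (\<lambda>t. f t + g t) = approx n v f + approx n v g"
  by (simp add: approx_def scaleC_add_left sum.distrib)

lemma approx_scale: "approx n v (\<lambda>t. c * f t) = c *\<^sub>C approx n v f"
  by (simp add: approx_def scaleC_sum_right scaleC_scaleC)

lemma approx_cnj: "approx n v (\<lambda>t. cnj (f t)) = adj (approx n v f)"
  by (simp add: approx_def adj_sum adj_scaleC adj_mult adj_adj)

lemma approx_mult:
  assumes v: "v \<in> vertices \<Lambda>"
  shows "approx n v f * approx n v g = approx n v (\<lambda>t. f t * g t)"
proof -
  let ?E = "of_degree_at \<Lambda> v n" and ?p = "\<lambda>\<alpha>. s \<alpha> * adj (s \<alpha>)"
  have pp: "?p \<alpha> * ?p \<beta> = (if \<beta> = \<alpha> then ?p \<alpha> else 0)" if "\<alpha> \<in> ?E" "\<beta> \<in> ?E" for \<alpha> \<beta>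
  proof -
    have "?p \<alpha> * ?p \<beta> = s \<alpha> * (adj (s \<alpha>) * s \<beta>) * adj (s \<beta>)" by (simp add: mult.assoc)
    then show ?thesis
      using adj_s_mult_s[of \<alpha> n \<beta>] that s_src[of \<alpha>] of_degree_atD by auto
  qed
  have "approx n v f * approx n v g =
    (\<Sum>\<alpha>\<in>?E. \<Sum>\<beta>\<in>?E. (f (code (base \<alpha>)) * g (code (base \<beta>))) *\<^sub>C (?p \<alpha> * ?p \<beta>))"
    by (simp add: approx_def sum_product mult_scaleC_left mult_scaleC_right scaleC_scaleC mult.commute)
  also have "\<dots> = (\<Sum>\<alpha>\<in>?E. \<Sum>\<beta>\<in>?E. if \<beta> = \<alpha> then (f (code (base \<alpha>)) * g (code (base \<alpha>))) *\<^sub>C ?p \<alpha> else 0)"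
    using pp by (intro sum.cong) auto
  also have "\<dots> = approx n v (\<lambda>t. f t * g t)"
    using finite_of_degree_at[OF v] by (simp add: approx_def sum.delta)
  finally show ?thesis .
qed

lemma approx_unit: "v \<in> vertices \<Lambda> \<Longrightarrow> approx n v (unit_at v) = s v"
  using s_vertex_sum[of v n] code_base by (simp add: approx_def unit_at_def)

lemma norm_approx_le:
  assumes v: "v \<in> vertices \<Lambda>" and M: "\<And>t. cmod (f t) \<le> M"
  shows "norm (approx n v f) \<le> M"
  unfolding approx_def
  by (rule norm_diagonal_le[OF finite_of_degree_at[OF v] of_degree_at_subset])
    (use M norm_ge_zero order_trans in blast)+

text \<open>By the Cuntz-Krieger relation at the source of \<open>\<gamma>\<close>, the projection of \<open>\<gamma>\<close> is the sum of the projections of its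
extensions of degree \<open>n\<close>. So the difference is diagonal, and its coefficients compare two values of \<open>f\<close> on
the cylinder of one arrow of degree \<open>m\<close>. The coefficients \<open>c \<gamma>\<close> may come from any sample points because
\<open>iota_s\<close> compares Riemann sums with unrelated sample points.\<close>

lemma norm_approx_diff_le:
  assumes v: "v \<in> vertices \<Lambda>" and mn: "m \<le> n"
    and osc: "\<forall>\<alpha>\<in>of_degree_at \<Lambda> v m. \<forall>x\<in>cylinder \<Lambda> \<alpha>. \<forall>y\<in>cylinder \<Lambda> \<alpha>. cmod (f (code x) - f (code y)) \<le> \<epsilon>"
    and c: "\<And>\<gamma>. \<gamma> \<in> of_degree_at \<Lambda> v m \<Longrightarrow> \<exists>x\<in>cylinder \<Lambda> \<gamma>. c \<gamma> = f (code x)" and \<epsilon>: "0 \<le> \<epsilon>"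
  shows "norm (approx n v f - (\<Sum>\<gamma>\<in>of_degree_at \<Lambda> v m. c \<gamma> *\<^sub>C (s \<gamma> * adj (s \<gamma>)))) \<le> \<epsilon>"
proof -
  let ?l = "n - m" and ?p = "\<lambda>\<alpha>. s \<alpha> * adj (s \<alpha>)"
  define ini where "ini \<alpha> = (THE \<gamma>. initial \<gamma> \<alpha> \<and> deg \<Lambda> \<gamma> = m)" for \<alpha>
  have ini: "ini (cmp \<Lambda> \<gamma> \<delta>) = \<gamma>"
    if "\<gamma> \<in> of_degree_at \<Lambda> v m" "\<delta> \<in> of_degree_at \<Lambda> (src \<Lambda> \<gamma>) l" for \<gamma> \<delta> l
    unfolding ini_def
  proof (rule the_equality)
    show "initial \<gamma> (cmp \<Lambda> \<gamma> \<delta>) \<and> deg \<Lambda> \<gamma> = m" using initialI of_degree_atD that by metis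
    then show "\<gamma>' = \<gamma>" if "initial \<gamma>' (cmp \<Lambda> \<gamma> \<delta>) \<and> deg \<Lambda> \<gamma>' = m" for \<gamma>'
      using that initial_unique by metis
  qed
  have n: "n = m + ?l" using nat_vec_add_diff[OF mn] by simp
  have "(\<Sum>\<gamma>\<in>of_degree_at \<Lambda> v m. c \<gamma> *\<^sub>C ?p \<gamma>) =
    (\<Sum>\<gamma>\<in>of_degree_at \<Lambda> v m. \<Sum>\<delta>\<in>of_degree_at \<Lambda> (src \<Lambda> \<gamma>) ?l. c (ini (cmp \<Lambda> \<gamma> \<delta>)) *\<^sub>C ?p (cmp \<Lambda> \<gamma> \<delta>))"
  proof (rule sum.cong[OF refl])
    fix \<gamma> assume g: "\<gamma> \<in> of_degree_at \<Lambda> v m"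
    then have ga: "\<gamma> \<in> arrows \<Lambda>" using of_degree_atD by blast
    have "?p \<gamma> = s \<gamma> * s (src \<Lambda> \<gamma>) * adj (s \<gamma>)" using s_src[OF ga] by simp
    also have "\<dots> = (\<Sum>\<delta>\<in>of_degree_at \<Lambda> (src \<Lambda> \<gamma>) ?l. s \<gamma> * ?p \<delta> * adj (s \<gamma>))"
      unfolding s_vertex_sum[OF src_vertex[OF ga], of ?l] by (simp add: sum_distrib_left sum_distrib_right)
    also have "\<dots> = (\<Sum>\<delta>\<in>of_degree_at \<Lambda> (src \<Lambda> \<gamma>) ?l. ?p (cmp \<Lambda> \<gamma> \<delta>))"
    proof (rule sum.cong[OF refl])
      fix \<delta> assume d: "\<delta> \<in> of_degree_at \<Lambda> (src \<Lambda> \<gamma>) ?l"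
      then have "s (cmp \<Lambda> \<gamma> \<delta>) = s \<gamma> * s \<delta>" using s_cmp ga of_degree_atD by metis
      then show "s \<gamma> * ?p \<delta> * adj (s \<gamma>) = ?p (cmp \<Lambda> \<gamma> \<delta>)" by (simp add: adj_mult mult.assoc)
    qed
    finally have "c \<gamma> *\<^sub>C ?p \<gamma> = (\<Sum>\<delta>\<in>of_degree_at \<Lambda> (src \<Lambda> \<gamma>) ?l. c \<gamma> *\<^sub>C ?p (cmp \<Lambda> \<gamma> \<delta>))"
      by (simp add: scaleC_sum_right)
    then show "c \<gamma> *\<^sub>C ?p \<gamma> = (\<Sum>\<delta>\<in>of_degree_at \<Lambda> (src \<Lambda> \<gamma>) ?l. c (ini (cmp \<Lambda> \<gamma> \<delta>)) *\<^sub>C ?p (cmp \<Lambda> \<gamma> \<delta>))"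
      using ini[OF g] by simp
  qed
  also have "\<dots> = (\<Sum>\<alpha>\<in>of_degree_at \<Lambda> v n. c (ini \<alpha>) *\<^sub>C ?p \<alpha>)"
    by (subst n) (rule sum_of_degree_at_add[OF v, symmetric])
  finally have "approx n v f - (\<Sum>\<gamma>\<in>of_degree_at \<Lambda> v m. c \<gamma> *\<^sub>C ?p \<gamma>) =
    (\<Sum>\<alpha>\<in>of_degree_at \<Lambda> v n. (f (code (base \<alpha>)) - c (ini \<alpha>)) *\<^sub>C ?p \<alpha>)"
    by (simp add: approx_def scaleC_diff_left sum_subtractf)
  also have "norm \<dots> \<le> \<epsilon>"
  proof (rule norm_diagonal_le[OF finite_of_degree_at[OF v] of_degree_at_subset _ \<epsilon>])
    fix \<alpha> assume a: "\<alpha> \<in> of_degree_at \<Lambda> v n"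
    then have aa: "\<alpha> \<in> arrows \<Lambda>" "deg \<Lambda> \<alpha> = n" "rng \<Lambda> \<alpha> = v" using of_degree_atD by auto
    obtain \<gamma> where g: "initial \<gamma> \<alpha>" "deg \<Lambda> \<gamma> = m" using initial_exists[OF aa(1), of m] aa(2) mn by auto
    have "ini \<alpha> = \<gamma>" unfolding ini_def using g initial_unique by (intro the_equality) auto
    have gm: "\<gamma> \<in> of_degree_at \<Lambda> v m"
      using g initial_arrow[OF g(1)] initial_rng[OF g(1)] aa by (simp add: of_degree_at_def of_degree_def)
    obtain x where x: "x \<in> cylinder \<Lambda> \<gamma>" "c \<gamma> = f (code x)" using c[OF gm] by blast
    have "base \<alpha> \<in> cylinder \<Lambda> \<gamma>" using base_in[OF aa(1)] cylinder_subset[OF g(1)] by blast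
    then show "cmod (f (code (base \<alpha>)) - c (ini \<alpha>)) \<le> \<epsilon>"
      using osc gm x \<open>ini \<alpha> = \<gamma>\<close> by simp
  qed
  finally show ?thesis .
qed

lemma approx_tendsto_iota:
  assumes v: "v \<in> vertices \<Lambda>" and f: "f \<in> C0 (T v)"
  shows "(\<lambda>N. approx (vec N) v f) \<longlonglongrightarrow> iota v f"
proof -
  have "Cauchy (\<lambda>N. approx (vec N) v f)"
  proof (rule metric_CauchyI)
    fix e :: real assume e: "0 < e"
    then have "0 < e / 3" by simp
    then obtain N where N: "\<forall>n \<alpha>. vec N \<le> n \<longrightarrow> \<alpha> \<in> of_degree_at \<Lambda> v n \<longrightarrow>
      (\<forall>x\<in>cylinder \<Lambda> \<alpha>. \<forall>y\<in>cylinder \<Lambda> \<alpha>. cmod (f (code x) - f (code y)) \<le> e / 3)"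
      using small_oscillation[OF v f] by blast
    have near: "norm (approx (vec n) v f - approx (vec N) v f) \<le> e / 3" if "N \<le> n" for n
      unfolding approx_def[of "vec N"]
    proof (rule norm_approx_diff_le[OF v])
      show "vec N \<le> (vec n :: nat ^ 'k)" using that by (simp add: less_eq_vec_def)
      show "\<exists>x\<in>cylinder \<Lambda> \<gamma>. f (code (base \<gamma>)) = f (code x)" if "\<gamma> \<in> of_degree_at \<Lambda> v (vec N)" for \<gamma>
        using base_in[of \<gamma>] of_degree_atD[OF that] by blast
    qed (use N e in auto)
    have "dist (approx (vec n) v f) (approx (vec m) v f) < e" if "N \<le> n" "N \<le> m" for n m
    proof -
      have "norm (approx (vec n) v f - approx (vec m) v f) \<le>
        norm (approx (vec n) v f - approx (vec N) v f) + norm (approx (vec m) v f - approx (vec N) v f)"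
        using norm_triangle_ineq4[of "approx (vec n) v f - approx (vec N) v f" "approx (vec m) v f - approx (vec N) v f"]
        by simp
      also have "\<dots> < e" using near[OF that(1)] near[OF that(2)] e by linarith
      finally show ?thesis by (simp add: dist_norm)
    qed
    then show "\<exists>M. \<forall>m\<ge>M. \<forall>n\<ge>M. dist (approx (vec m) v f) (approx (vec n) v f) < e" by blast
  qed
  then show ?thesis unfolding iota_def by (simp add: Cauchy_convergent_iff convergent_LIMSEQ_iff)
qed

lemma norm_iota_diff_le:
  assumes v: "v \<in> vertices \<Lambda>" and f: "f \<in> C0 (T v)"
    and osc: "\<forall>\<alpha>\<in>of_degree_at \<Lambda> v m. \<forall>x\<in>cylinder \<Lambda> \<alpha>. \<forall>y\<in>cylinder \<Lambda> \<alpha>. cmod (f (code x) - f (code y)) \<le> \<epsilon>"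
    and c: "\<And>\<gamma>. \<gamma> \<in> of_degree_at \<Lambda> v m \<Longrightarrow> \<exists>x\<in>cylinder \<Lambda> \<gamma>. c \<gamma> = f (code x)" and \<epsilon>: "0 \<le> \<epsilon>"
  shows "norm (iota v f - (\<Sum>\<gamma>\<in>of_degree_at \<Lambda> v m. c \<gamma> *\<^sub>C (s \<gamma> * adj (s \<gamma>)))) \<le> \<epsilon>"
proof -
  let ?S = "\<Sum>\<gamma>\<in>of_degree_at \<Lambda> v m. c \<gamma> *\<^sub>C (s \<gamma> * adj (s \<gamma>))"
  obtain N where N: "m \<le> vec N" using ex_le_vec by blast
  have "(\<lambda>N. approx (vec N) v f - ?S) \<longlonglongrightarrow> iota v f - ?S"
    by (intro tendsto_intros approx_tendsto_iota[OF v f])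
  moreover have "\<forall>\<^sub>F n in sequentially. norm (approx (vec n) v f - ?S) \<le> \<epsilon>"
    using eventually_ge_at_top[of N]
    by eventually_elim (rule norm_approx_diff_le[OF v le_vec_mono[OF _ N] osc c \<epsilon>])
  ultimately show ?thesis by (rule Lim_norm_ubound[OF sequentially_bot])
qed

lemma iota_eqI:
  assumes "v \<in> vertices \<Lambda>" "f \<in> C0 (T v)" "(\<lambda>N. approx (vec N) v f) \<longlonglongrightarrow> z"
  shows "iota v f = z"
  using approx_tendsto_iota[OF assms(1,2)] assms(3) LIMSEQ_unique by blast

lemma iota_add:
  assumes "v \<in> vertices \<Lambda>" "f \<in> C0 (T v)" "g \<in> C0 (T v)"
  shows "iota v (\<lambda>t. f t + g t) = iota v f + iota v g"
  by (rule iota_eqI[OF assms(1) C0_add[OF assms]])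
    (simp only: approx_add, intro tendsto_intros approx_tendsto_iota assms)

lemma iota_scale:
  assumes "v \<in> vertices \<Lambda>" "f \<in> C0 (T v)"
  shows "iota v (\<lambda>t. c * f t) = c *\<^sub>C iota v f"
  by (rule iota_eqI[OF assms(1) C0_scale[OF assms]])
    (simp only: approx_scale, intro tendsto_intros approx_tendsto_iota assms)

lemma iota_mult:
  assumes "v \<in> vertices \<Lambda>" "f \<in> C0 (T v)" "g \<in> C0 (T v)"
  shows "iota v f * iota v g = iota v (\<lambda>t. f t * g t)"
  by (rule iota_eqI[OF assms(1) C0_mult[OF assms], symmetric])
    (simp only: approx_mult[OF assms(1), symmetric], intro tendsto_intros approx_tendsto_iota assms)

lemma iota_cnj:
  assumes "v \<in> vertices \<Lambda>" "f \<in> C0 (T v)"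
  shows "iota v (\<lambda>t. cnj (f t)) = adj (iota v f)"
  by (rule iota_eqI[OF assms(1) C0_cnj[OF assms]])
    (simp only: approx_cnj, intro tendsto_intros approx_tendsto_iota assms)

lemma iota_unit: "v \<in> vertices \<Lambda> \<Longrightarrow> iota v (unit_at v) = s v"
  by (rule iota_eqI) (simp_all add: unit_at_C0 approx_unit)

lemma norm_iota_le:
  assumes "v \<in> vertices \<Lambda>" "f \<in> C0 (T v)" "\<And>t. cmod (f t) \<le> M"
  shows "norm (iota v f) \<le> M"
  using approx_tendsto_iota[OF assms(1,2)]
  by (rule Lim_norm_ubound[OF sequentially_bot]) (simp add: norm_approx_le assms)

lemma iota_zero: "v \<in> vertices \<Lambda> \<Longrightarrow> iota v (\<lambda>_. 0) = 0"
  using iota_scale[of v "\<lambda>_. 0" 0] by simp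

lemma iota_diff:
  assumes "v \<in> vertices \<Lambda>" "f \<in> C0 (T v)" "g \<in> C0 (T v)"
  shows "iota v (\<lambda>t. f t - g t) = iota v f - iota v g"
  using iota_add[OF assms(1,2) C0_scale[OF assms(1,3)], of "-1"] iota_scale[OF assms(1,3), of "-1"]
  by (simp add: scaleC_minus1)

lemma iota_sum:
  assumes "v \<in> vertices \<Lambda>" "\<And>i. i \<in> I \<Longrightarrow> f i \<in> C0 (T v)"
  shows "iota v (\<lambda>t. \<Sum>i\<in>I. f i t) = (\<Sum>i\<in>I. iota v (f i))"
  using assms(2)
proof (induction I rule: infinite_finite_induct)
  case (insert i I)
  then show ?case using iota_add[OF assms(1), of "f i" "\<lambda>t. \<Sum>i\<in>I. f i t"] C0_sum[OF assms(1), of I f] by simp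
qed (simp_all add: iota_zero assms(1))

lemma s_iota:
  assumes "v \<in> vertices \<Lambda>" "f \<in> C0 (T v)" "w \<in> vertices \<Lambda>"
  shows "s w * iota v f = (if w = v then iota v f else 0)" "iota v f * s w = (if w = v then iota v f else 0)"
proof -
  have l: "s v * iota v f = iota v f" and r: "iota v f * s v = iota v f"
    using iota_mult[OF assms(1) unit_at_C0[OF assms(1)] assms(2)] iota_mult[OF assms(1,2) unit_at_C0[OF assms(1)]]
      iota_unit[OF assms(1)] assms(2) by simp_all
  show "s w * iota v f = (if w = v then iota v f else 0)"
    using l s_vertex_orth[OF assms(3,1)] by (metis mult.assoc mult_zero_left)
  show "iota v f * s w = (if w = v then iota v f else 0)"
    using r s_vertex_orth[OF assms(1,3)] by (metis mult.assoc mult_zero_right)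
qed

text \<open>Prepending \<open>\<beta>\<close> maps the cylinder of \<open>\<delta>\<close> onto the one of \<open>\<beta>\<delta>\<close>, and \<open>\<Phi>\<close> carries prepending \<open>\<beta>\<close> to \<open>\<sigma>\<^sub>\<beta>\<close>.
Multiplication by \<open>s\<^sub>\<beta>\<close> keeps only the terms \<open>\<beta>\<delta>\<close> of a Riemann sum for \<open>f\<close> and turns it into \<open>s\<^sub>\<beta>\<close> times a
Riemann sum for \<open>f \<circ> \<sigma>\<^sub>\<beta>\<close>.\<close>

lemma iota_s:
  assumes b: "\<beta> \<in> arrows \<Lambda>" and f: "f \<in> C0 (T (rng \<Lambda> \<beta>))"
  shows "iota (rng \<Lambda> \<beta>) f * s \<beta> = s \<beta> * iota (src \<Lambda> \<beta>) (pullback \<beta> f)"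
proof -
  let ?u = "rng \<Lambda> \<beta>" and ?w = "src \<Lambda> \<beta>" and ?g = "pullback \<beta> f" and ?p = "\<lambda>\<alpha>. s \<alpha> * adj (s \<alpha>)"
  have u: "?u \<in> vertices \<Lambda>" and w: "?w \<in> vertices \<Lambda>" using rng_vertex src_vertex b by auto
  have g: "?g \<in> C0 (T ?w)" using pullback_C0[OF b f] .
  have "norm (iota ?u f * s \<beta> - s \<beta> * iota ?w ?g) \<le> 2 * \<epsilon>" if e: "0 < \<epsilon>" for \<epsilon>
  proof -
    obtain N1 where N1: "\<forall>n \<alpha>. vec N1 \<le> n \<longrightarrow> \<alpha> \<in> of_degree_at \<Lambda> ?u n \<longrightarrow>
      (\<forall>x\<in>cylinder \<Lambda> \<alpha>. \<forall>y\<in>cylinder \<Lambda> \<alpha>. cmod (f (code x) - f (code y)) \<le> \<epsilon>)"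
      using small_oscillation[OF u f e] by blast
    obtain N2 where N2: "\<forall>n \<alpha>. vec N2 \<le> n \<longrightarrow> \<alpha> \<in> of_degree_at \<Lambda> ?w n \<longrightarrow>
      (\<forall>x\<in>cylinder \<Lambda> \<alpha>. \<forall>y\<in>cylinder \<Lambda> \<alpha>. cmod (?g (code x) - ?g (code y)) \<le> \<epsilon>)"
      using small_oscillation[OF w g e] by blast
    define n :: "nat ^ 'k" where "n = vec (max N1 N2)"
    have n: "vec N1 \<le> deg \<Lambda> \<beta> + n" "vec N2 \<le> n" by (simp_all add: n_def less_eq_vec_def trans_le_add2)
    define c where "c \<alpha> = f (code (base \<alpha>))" for \<alpha>
    define S where "S = (\<Sum>\<delta>\<in>of_degree_at \<Lambda> ?w n. c (cmp \<Lambda> \<beta> \<delta>) *\<^sub>C ?p \<delta>)"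
    have dist1: "norm (iota ?u f - approx (deg \<Lambda> \<beta> + n) ?u f) \<le> \<epsilon>"
      unfolding approx_def
    proof (rule norm_iota_diff_le[OF u f])
      show "\<exists>x\<in>cylinder \<Lambda> \<gamma>. f (code (base \<gamma>)) = f (code x)" if "\<gamma> \<in> of_degree_at \<Lambda> ?u (deg \<Lambda> \<beta> + n)" for \<gamma>
        using base_in[of \<gamma>] of_degree_atD[OF that] by blast
    qed (use N1 n e in auto)
    have dist2: "norm (iota ?w ?g - S) \<le> \<epsilon>"
      unfolding S_def
    proof (rule norm_iota_diff_le[OF w g])
      fix \<delta> assume d: "\<delta> \<in> of_degree_at \<Lambda> ?w n"
      have da: "\<delta> \<in> arrows \<Lambda>" "?w = rng \<Lambda> \<delta>" using of_degree_atD[OF d] by auto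
      obtain x where x: "x \<in> cylinder \<Lambda> \<delta>" "x \<in> inf_paths_at \<Lambda> ?w" "base (cmp \<Lambda> \<beta> \<delta>) = prepend \<Lambda> \<beta> x"
        using cylinder_prepend[OF b da base_in[OF cmp_arrow[OF b da]]] by blast
      have "c (cmp \<Lambda> \<beta> \<delta>) = f (\<sigma> \<beta> (code x))" using code_prepend[OF b x(2)] x(3) by (simp add: c_def)
      also have "\<dots> = ?g (code x)" using Phi_code(2)[OF w x(2)] by (simp add: pullback_def)
      finally show "\<exists>x\<in>cylinder \<Lambda> \<delta>. c (cmp \<Lambda> \<beta> \<delta>) = ?g (code x)" using x(1) by blast
    qed (use N2 n e in auto)
    have "approx (deg \<Lambda> \<beta> + n) ?u f * s \<beta> = s \<beta> * S"
    proof -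
      have bd: "\<beta> \<in> of_degree_at \<Lambda> ?u (deg \<Lambda> \<beta>)" using b by (simp add: of_degree_at_def of_degree_def)
      have "approx (deg \<Lambda> \<beta> + n) ?u f * s \<beta> =
        (\<Sum>\<gamma>\<in>of_degree_at \<Lambda> ?u (deg \<Lambda> \<beta>). \<Sum>\<delta>\<in>of_degree_at \<Lambda> (src \<Lambda> \<gamma>) n.
           c (cmp \<Lambda> \<gamma> \<delta>) *\<^sub>C (?p (cmp \<Lambda> \<gamma> \<delta>) * s \<beta>))"
        by (simp add: approx_def sum_of_degree_at_add[OF u] c_def sum_distrib_right mult_scaleC_left)
      also have "\<dots> = (\<Sum>\<gamma>\<in>of_degree_at \<Lambda> ?u (deg \<Lambda> \<beta>). if \<gamma> = \<beta> then s \<beta> * S else 0)"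
      proof (rule sum.cong[OF refl])
        fix \<gamma> assume g: "\<gamma> \<in> of_degree_at \<Lambda> ?u (deg \<Lambda> \<beta>)"
        have ga: "\<gamma> \<in> arrows \<Lambda>" using of_degree_atD[OF g] by blast
        have "?p (cmp \<Lambda> \<gamma> \<delta>) * s \<beta> = (if \<gamma> = \<beta> then s \<beta> * ?p \<delta> else 0)" if d: "\<delta> \<in> of_degree_at \<Lambda> (src \<Lambda> \<gamma>) n" for \<delta>
        proof -
          have da: "\<delta> \<in> arrows \<Lambda>" "src \<Lambda> \<gamma> = rng \<Lambda> \<delta>" using of_degree_atD[OF d] by auto
          have "?p (cmp \<Lambda> \<gamma> \<delta>) * s \<beta> = s \<gamma> * s \<delta> * (adj (s \<delta>) * (adj (s \<gamma>) * s \<beta>))"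
            by (simp add: s_cmp[OF ga da, symmetric] adj_mult mult.assoc)
          also have "\<dots> = (if \<gamma> = \<beta> then s \<beta> * ?p \<delta> else 0)"
            using adj_s_mult_s[OF of_degree_atD(4)[OF g] of_degree_atD(4)[OF bd]] s_rng_adj[OF da(1), folded da(2)]
            by (auto simp: mult.assoc)
          finally show ?thesis .
        qed
        then show "(\<Sum>\<delta>\<in>of_degree_at \<Lambda> (src \<Lambda> \<gamma>) n. c (cmp \<Lambda> \<gamma> \<delta>) *\<^sub>C (?p (cmp \<Lambda> \<gamma> \<delta>) * s \<beta>)) =
          (if \<gamma> = \<beta> then s \<beta> * S else 0)"
          by (simp add: S_def sum_distrib_left mult_scaleC_right)
      qed
      also have "\<dots> = s \<beta> * S" using bd finite_of_degree_at[OF u] by (simp add: sum.delta)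
      finally show ?thesis .
    qed
    then have "iota ?u f * s \<beta> - s \<beta> * iota ?w ?g =
      (iota ?u f - approx (deg \<Lambda> \<beta> + n) ?u f) * s \<beta> - s \<beta> * (iota ?w ?g - S)"
      by (simp add: left_diff_distrib right_diff_distrib)
    also have "norm \<dots> \<le> norm (iota ?u f - approx (deg \<Lambda> \<beta> + n) ?u f) * norm (s \<beta>) + norm (s \<beta>) * norm (iota ?w ?g - S)"
      by (rule order_trans[OF norm_triangle_ineq4 add_mono[OF norm_mult_ineq norm_mult_ineq]])
    also have "\<dots> \<le> \<epsilon> * 1 + 1 * \<epsilon>"
      using dist1 dist2 norm_s_le[OF b] e by (intro add_mono mult_mono) auto
    finally show ?thesis by simp
  qed
  then have "norm (iota ?u f * s \<beta> - s \<beta> * iota ?w ?g) \<le> 0 + e" if e: "0 < e" for e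
    using half_gt_zero[OF e] by fastforce
  then have "norm (iota ?u f * s \<beta> - s \<beta> * iota ?w ?g) \<le> 0" by (rule field_le_epsilon)
  then show ?thesis by simp
qed

end

section \<open>Hilbert module structure of \<open>Y\<^sub>n\<close>\<close>

context compact_lambda_system
begin

lemma Y_mult_cmp:
  assumes a: "\<alpha> \<in> of_degree \<Lambda> m" and b: "\<beta> \<in> of_degree \<Lambda> n" and ab: "src \<Lambda> \<alpha> = rng \<Lambda> \<beta>"
  shows "Y_mult \<Lambda> \<sigma> m n x y (cmp \<Lambda> \<alpha> \<beta>) t = x \<alpha> (\<sigma> \<beta> t) * y \<beta> t"
proof -
  have "{(\<alpha>', \<beta>'). \<alpha>' \<in> of_degree \<Lambda> m \<and> \<beta>' \<in> of_degree \<Lambda> n \<and> src \<Lambda> \<alpha>' = rng \<Lambda> \<beta>' \<and>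
      cmp \<Lambda> \<alpha>' \<beta>' = cmp \<Lambda> \<alpha> \<beta>} = {(\<alpha>, \<beta>)}"
  proof (intro equalityI subsetI)
    fix p assume "p \<in> {(\<alpha>', \<beta>'). \<alpha>' \<in> of_degree \<Lambda> m \<and> \<beta>' \<in> of_degree \<Lambda> n \<and> src \<Lambda> \<alpha>' = rng \<Lambda> \<beta>' \<and>
      cmp \<Lambda> \<alpha>' \<beta>' = cmp \<Lambda> \<alpha> \<beta>}"
    then obtain \<alpha>' \<beta>' where p: "p = (\<alpha>', \<beta>')" "\<alpha>' \<in> arrows \<Lambda>" "\<beta>' \<in> arrows \<Lambda>" "src \<Lambda> \<alpha>' = rng \<Lambda> \<beta>'"
      "cmp \<Lambda> \<alpha>' \<beta>' = cmp \<Lambda> \<alpha> \<beta>" "deg \<Lambda> \<alpha>' = m" by (auto simp: of_degree_def)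
    have "\<alpha>' = \<alpha>" "\<beta>' = \<beta>"
      using factorization_unique[OF p(2-4) of_degree_arrow[OF a] of_degree_arrow[OF b] ab p(5)] a p(6)
      by (simp_all add: of_degree_def)
    then show "p \<in> {(\<alpha>, \<beta>)}" using p(1) by simp
  qed (use assms in auto)
  then show ?thesis by (simp add: Y_mult_def)
qed

lemma inner_cnj: "cnj (Y_inner \<Lambda> n x y v t) = Y_inner \<Lambda> n y x v t"
  unfolding Y_inner_def infsum_cnj[symmetric] by (simp add: mult.commute)

lemma inner_single_left:
  assumes a: "\<alpha> \<in> of_degree \<Lambda> n"
  shows "Y_inner \<Lambda> n (single \<alpha> f) y v t = (if src \<Lambda> \<alpha> = v then cnj (f t) * y \<alpha> t else 0)"
proof -
  have "Y_inner \<Lambda> n (single \<alpha> f) y v t =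
    (\<Sum>\<^sub>\<infinity>\<beta>\<in>{\<beta>\<in>{\<alpha>}. src \<Lambda> \<beta> = v}. cnj (single \<alpha> f \<beta> t) * y \<beta> t)"
    unfolding Y_inner_def by (rule infsum_cong_neutral) (use a in \<open>auto simp: single_def\<close>)
  also have "{\<beta>\<in>{\<alpha>}. src \<Lambda> \<beta> = v} = (if src \<Lambda> \<alpha> = v then {\<alpha>} else {})" by auto
  finally show ?thesis by (simp add: single_def)
qed

lemma inner_add_right:
  assumes "module_family n x" "module_family n y" "module_family n z"
  shows "Y_inner \<Lambda> n x (\<lambda>\<alpha> t. y \<alpha> t + z \<alpha> t) v t = Y_inner \<Lambda> n x y v t + Y_inner \<Lambda> n x z v t"
  unfolding Y_inner_def distrib_left by (rule infsum_add) (rule inner_summable; fact)+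

lemma inner_right_action: "Y_inner \<Lambda> n x (right_action \<Lambda> y a) v t = Y_inner \<Lambda> n x y v t * a v t"
proof -
  have "Y_inner \<Lambda> n x (right_action \<Lambda> y a) v t =
    (\<Sum>\<^sub>\<infinity>\<alpha>\<in>{\<alpha>\<in>of_degree \<Lambda> n. src \<Lambda> \<alpha> = v}. cnj (x \<alpha> t) * y \<alpha> t * a v t)"
    unfolding Y_inner_def by (rule infsum_cong) (simp add: right_action_def)
  also have "\<dots> = Y_inner \<Lambda> n x y v t * a v t" unfolding Y_inner_def by (rule infsum_cmult_left')
  finally show ?thesis .
qed

lemma inner_zero_right: "Y_inner \<Lambda> n x (\<lambda>_ _. 0) v t = 0"
  by (simp add: Y_inner_def)

lemma module_family_zero: "module_family n (\<lambda>_ _. 0)"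
  by (rule module_family_finite[of "{}"]) auto

lemma module_family_diff:
  assumes "module_family n x" "module_family n y"
  shows "module_family n (\<lambda>\<alpha> t. x \<alpha> t - y \<alpha> t)"
  using module_family_add[OF assms(1) module_family_scale[OF assms(2), of "-1"]] by simp

lemma Y_norm_add_le:
  assumes "module_family n x" "module_family n y"
  shows "Y_norm \<Lambda> n (\<lambda>\<alpha> t. x \<alpha> t + y \<alpha> t) \<le> Y_norm \<Lambda> n x + Y_norm \<Lambda> n y"
  by (rule Y_norm_le[OF module_family_add[OF assms] bounded_by_add[OF bounded_by_Y_norm bounded_by_Y_norm]])
    (use assms in auto)

lemma Y_norm_minus:
  assumes "module_family n x"
  shows "Y_norm \<Lambda> n (\<lambda>\<alpha> t. - x \<alpha> t) \<le> Y_norm \<Lambda> n x"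
proof -
  have "module_family n (\<lambda>\<alpha> t. - x \<alpha> t)" using module_family_scale[OF assms, of "-1"] by simp
  moreover have "bounded_by n (\<lambda>\<alpha> t. - x \<alpha> t) (1 * Y_norm \<Lambda> n x)"
    by (rule bounded_by_scale[OF bounded_by_Y_norm[OF assms]]) auto
  ultimately show ?thesis using Y_norm_le by simp
qed

lemma Y_norm_square_le:
  assumes K: "\<And>v t. cmod (Y_inner \<Lambda> n u u v t) \<le> K"
  shows "(Y_norm \<Lambda> n u)\<^sup>2 \<le> K"
proof -
  have "sup_norm (Y_inner \<Lambda> n u u) \<le> K" unfolding sup_norm_def by (rule cSUP_least) (auto simp: K)
  moreover have "0 \<le> sup_norm (Y_inner \<Lambda> n u u)"
  proof -
    have "bdd_above (range (\<lambda>(v, t). cmod (Y_inner \<Lambda> n u u v t)))" using K by (auto simp: bdd_above_def)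
    then have "cmod (Y_inner \<Lambda> n u u undefined undefined) \<le> sup_norm (Y_inner \<Lambda> n u u)"
      unfolding sup_norm_def using cSUP_upper[of "(undefined, undefined)" UNIV "\<lambda>(v, t). cmod (Y_inner \<Lambda> n u u v t)"] by simp
    then show ?thesis using norm_ge_zero order_trans by blast
  qed
  ultimately show ?thesis by (simp add: Y_norm_def)
qed

lemma module_family_right_action_coeff:
  assumes y: "module_family n y" and a: "a \<in> coeff_algebra \<Lambda> T"
  shows "module_family n (right_action \<Lambda> y a)"
proof -
  obtain M where M: "0 \<le> M" "bounded_by 0 a M"
    using module_family_bounded a module_family_zero_iff_coeff by blast
  have "cmod (a v t) \<le> M" for v t
  proof (cases "v \<in> vertices \<Lambda>")
    case True
    then have "{\<alpha>\<in>{v}. src \<Lambda> \<alpha> = v} = {v}" using vertex_facts by auto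
    then have "fibre_norm a {v} v t = cmod (a v t)" by (simp add: fibre_norm_def)
    then show ?thesis using bounded_byD[OF M(2), of "{v}" v t] True by simp
  qed (use M coeff_algebraD(2)[OF a] in simp)
  then show ?thesis by - (rule module_family_right_action[OF y, of a M]; simp add: coeff_algebraD(1)[OF a])
qed

lemma coeff_mult:
  assumes a: "a \<in> coeff_algebra \<Lambda> T" and b: "b \<in> coeff_algebra \<Lambda> T"
  shows "(\<lambda>v t. a v t * b v t) \<in> coeff_algebra \<Lambda> T"
proof -
  have "right_action \<Lambda> a b = (\<lambda>v t. a v t * b v t)"
  proof (intro ext)
    fix v t
    show "right_action \<Lambda> a b v t = a v t * b v t"
      using coeff_algebraD(2)[OF a, of v] vertex_facts(3)[of v] by (cases "v \<in> vertices \<Lambda>") (simp_all add: right_action_def)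
  qed
  then show ?thesis
    using module_family_right_action_coeff[of 0 a b] a b module_family_zero_iff_coeff by simp
qed

lemma coeff_unop:
  assumes a: "a \<in> coeff_algebra \<Lambda> T" and h: "continuous_on UNIV h" "h 0 = 0" "\<And>z. cmod (h z) \<le> cmod z"
  shows "(\<lambda>v t. h (a v t)) \<in> coeff_algebra \<Lambda> T"
  unfolding coeff_algebra_iff
proof (intro conjI ballI allI impI)
  fix v assume "v \<in> vertices \<Lambda>"
  then show "(\<lambda>t. h (a v t)) \<in> C0 (T v)" using C0_unop coeff_algebraD(1)[OF a] h by blast
next
  fix v assume "v \<notin> vertices \<Lambda>"
  then show "(\<lambda>t. h (a v t)) = (\<lambda>_. 0)" using coeff_algebraD(2)[OF a] h(2) by simp
next
  fix \<epsilon> :: real assume "0 < \<epsilon>"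
  then have "finite {v \<in> vertices \<Lambda>. \<exists>t. \<epsilon> \<le> cmod (a v t)}" by (rule coeff_algebraD(3)[OF a])
  moreover have "{v \<in> vertices \<Lambda>. \<exists>t. \<epsilon> \<le> cmod (h (a v t))} \<subseteq> {v \<in> vertices \<Lambda>. \<exists>t. \<epsilon> \<le> cmod (a v t)}"
    using h(3) order_trans by blast
  ultimately show "finite {v \<in> vertices \<Lambda>. \<exists>t. \<epsilon> \<le> cmod (h (a v t))}" using finite_subset by blast
qed

lemma coeff_scale:
  assumes "a \<in> coeff_algebra \<Lambda> T" shows "(\<lambda>v t. c * a v t) \<in> coeff_algebra \<Lambda> T"
  using assms module_family_scale[of 0 a c] module_family_zero_iff_coeff by blast

lemma single_coeff: "v \<in> vertices \<Lambda> \<Longrightarrow> f \<in> C0 (T v) \<Longrightarrow> single v f \<in> coeff_algebra \<Lambda> T"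
  using single_module[of v 0 f] vertex_facts(3) module_family_zero_iff_coeff by auto

text \<open>A finite-rank operator is given by the list of its rank-one summands, because the element \<open>ketbra\<close> of the
graph algebra that belongs to it is written down from such a list.\<close>

definition finite_rank :: "nat ^ 'k \<Rightarrow> (('e, 't) family \<times> ('e, 't) family) list \<Rightarrow> ('e, 't) family \<Rightarrow> ('e, 't) family" where
  "finite_rank n ps w = (\<lambda>\<alpha> t. \<Sum>(x, y)\<leftarrow>ps. right_action \<Lambda> x (Y_inner \<Lambda> n y w) \<alpha> t)"

definition module_pairs :: "nat ^ 'k \<Rightarrow> (('e, 't) family \<times> ('e, 't) family) list \<Rightarrow> bool" where
  "module_pairs n ps \<longleftrightarrow> (\<forall>(x, y)\<in>set ps. module_family n x \<and> module_family n y)"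

lemma finite_rank_Nil: "finite_rank n [] w = (\<lambda>_ _. 0)"
  and finite_rank_Cons: "finite_rank n ((x, y) # ps) w =
    (\<lambda>\<alpha> t. right_action \<Lambda> x (Y_inner \<Lambda> n y w) \<alpha> t + finite_rank n ps w \<alpha> t)"
  by (simp_all add: finite_rank_def)

lemma module_pairs_Cons: "module_pairs n ((x, y) # ps) \<longleftrightarrow> module_family n x \<and> module_family n y \<and> module_pairs n ps"
  by (auto simp: module_pairs_def)

lemma module_family_finite_rank:
  assumes "module_pairs n ps" "module_family n w"
  shows "module_family n (finite_rank n ps w)"
  using assms(1)
proof (induction ps)
  case (Cons p ps)
  obtain x y where p: "p = (x, y)" by (cases p)
  show ?case
    using Cons unfolding p finite_rank_Cons module_pairs_Cons
    by (intro module_family_add module_family_right_action_coeff Y_inner_coeff assms(2)) auto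
qed (simp add: finite_rank_Nil module_family_zero)

lemma inner_finite_rank_adjoint:
  assumes ps: "module_pairs n ps" and w: "module_family n w" and u: "module_family n u"
  shows "Y_inner \<Lambda> n w (finite_rank n ps u) v t = Y_inner \<Lambda> n (finite_rank n (map prod.swap ps) w) u v t"
  using ps
proof (induction ps)
  case Nil
  then show ?case
    using inner_cnj[of n u "\<lambda>_ _. 0" v t] by (simp add: finite_rank_Nil inner_zero_right)
next
  case (Cons p ps)
  obtain x y where p: "p = (x, y)" by (cases p)
  have m: "module_family n x" "module_family n y" "module_pairs n ps" using Cons(2) unfolding p module_pairs_Cons by auto
  have ms: "module_pairs n (map prod.swap ps)" using m(3) by (auto simp: module_pairs_def)
  have "Y_inner \<Lambda> n w (finite_rank n (p # ps) u) v t =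
    Y_inner \<Lambda> n w x v t * Y_inner \<Lambda> n y u v t + Y_inner \<Lambda> n w (finite_rank n ps u) v t"
    unfolding p finite_rank_Cons
    by (subst inner_add_right[OF w module_family_right_action_coeff[OF m(1) Y_inner_coeff[OF m(2) u]]
          module_family_finite_rank[OF m(3) u]]) (simp add: inner_right_action)
  moreover have "Y_inner \<Lambda> n u (finite_rank n (map prod.swap (p # ps)) w) v t =
    Y_inner \<Lambda> n u y v t * Y_inner \<Lambda> n x w v t + Y_inner \<Lambda> n u (finite_rank n (map prod.swap ps) w) v t"
    unfolding p list.map swap_simp finite_rank_Cons
    by (subst inner_add_right[OF u module_family_right_action_coeff[OF m(2) Y_inner_coeff[OF m(1) w]]
          module_family_finite_rank[OF ms w]]) (simp add: inner_right_action)
  then have "Y_inner \<Lambda> n (finite_rank n (map prod.swap (p # ps)) w) u v t =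
    Y_inner \<Lambda> n y u v t * Y_inner \<Lambda> n w x v t + Y_inner \<Lambda> n (finite_rank n (map prod.swap ps) w) u v t"
    by (metis complex_cnj_add complex_cnj_mult inner_cnj)
  ultimately show ?case using Cons.IH[OF m(3)] by (simp add: mult.commute)
qed

text \<open>With \<open>D\<close> the operator of \<open>ps\<close> and \<open>E\<close> its adjoint, \<open>\<langle>Ew, Ew\<rangle> = \<langle>w, DEw\<rangle>\<close> is bounded by \<open>C\<close> times the norms of \<open>w\<close>
and \<open>Ew\<close>.\<close>

lemma finite_rank_adjoint_norm_le:
  assumes ps: "module_pairs n ps" and C: "0 \<le> C"
    and le: "\<And>w. module_family n w \<Longrightarrow> Y_norm \<Lambda> n (finite_rank n ps w) \<le> C * Y_norm \<Lambda> n w"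
    and w: "module_family n w"
  shows "Y_norm \<Lambda> n (finite_rank n (map prod.swap ps) w) \<le> C * Y_norm \<Lambda> n w"
proof -
  let ?u = "finite_rank n (map prod.swap ps) w"
  have "module_pairs n (map prod.swap ps)" using ps by (auto simp: module_pairs_def)
  then have u: "module_family n ?u" using w by (rule module_family_finite_rank)
  have "(Y_norm \<Lambda> n ?u)\<^sup>2 \<le> Y_norm \<Lambda> n w * (C * Y_norm \<Lambda> n ?u)"
  proof (rule Y_norm_square_le)
    fix v t
    have "Y_inner \<Lambda> n ?u ?u v t = Y_inner \<Lambda> n w (finite_rank n ps ?u) v t"
      using inner_finite_rank_adjoint[OF ps w u] by simp
    also have "cmod \<dots> \<le> Y_norm \<Lambda> n w * Y_norm \<Lambda> n (finite_rank n ps ?u)"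
      by (intro Y_inner_le bounded_by_Y_norm w module_family_finite_rank ps u)
    also have "\<dots> \<le> Y_norm \<Lambda> n w * (C * Y_norm \<Lambda> n ?u)"
      using le[OF u] Y_norm_nonneg[OF w] by (rule mult_left_mono)
    finally show "cmod (Y_inner \<Lambda> n ?u ?u v t) \<le> Y_norm \<Lambda> n w * (C * Y_norm \<Lambda> n ?u)" .
  qed
  then have "Y_norm \<Lambda> n ?u * Y_norm \<Lambda> n ?u \<le> (C * Y_norm \<Lambda> n w) * Y_norm \<Lambda> n ?u"
    by (simp add: power2_eq_square mult_ac)
  then show ?thesis
    using Y_norm_nonneg[OF u] Y_norm_nonneg[OF w] C by (cases "Y_norm \<Lambda> n ?u = 0") auto
qed

lemma finite_rank_append:
  "finite_rank n (ps @ qs) w = (\<lambda>\<alpha> t. finite_rank n ps w \<alpha> t + finite_rank n qs w \<alpha> t)"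
  by (simp add: finite_rank_def)

definition negate_pairs :: "(('e, 't) family \<times> ('e, 't) family) list \<Rightarrow> (('e, 't) family \<times> ('e, 't) family) list" where
  "negate_pairs ps = map (\<lambda>(x, y). (\<lambda>\<alpha> t. - x \<alpha> t, y)) ps"

lemma finite_rank_negate: "finite_rank n (negate_pairs ps) w = (\<lambda>\<alpha> t. - finite_rank n ps w \<alpha> t)"
  by (induction ps) (auto simp: negate_pairs_def finite_rank_def right_action_def fun_eq_iff)

lemma module_pairs_negate: "module_pairs n ps \<Longrightarrow> module_pairs n (negate_pairs ps)"
proof -
  assume ps: "module_pairs n ps"
  have "module_family n (\<lambda>\<alpha> t. - x \<alpha> t)" if "module_family n x" for x
    using module_family_scale[OF that, of "-1"] by simp
  then show ?thesis using ps by (auto simp: module_pairs_def negate_pairs_def)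
qed

lemma compact_operator_approx:
  assumes S: "S \<in> compact_operators \<Lambda> T n" and \<epsilon>: "0 < \<epsilon>"
  obtains ps where "module_pairs n ps"
    "\<And>w. module_family n w \<Longrightarrow> Y_norm \<Lambda> n (\<lambda>\<alpha> t. S w \<alpha> t - finite_rank n ps w \<alpha> t) \<le> \<epsilon> * Y_norm \<Lambda> n w"
proof -
  obtain N :: nat and x y where xy: "\<forall>i<N. x i \<in> Y_module \<Lambda> T n \<and> y i \<in> Y_module \<Lambda> T n"
    "\<forall>z\<in>Y_module \<Lambda> T n. Y_norm \<Lambda> n (\<lambda>\<alpha> t. S z \<alpha> t - (\<Sum>i<N. rank_one \<Lambda> T n (x i) (y i) z \<alpha> t)) \<le> \<epsilon> * Y_norm \<Lambda> n z"
    using S \<epsilon> unfolding compact_operators_def by blast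
  define ps where "ps = map (\<lambda>i. (x i, y i)) [0..<N]"
  have "module_pairs n ps" using xy(1) by (auto simp: module_pairs_def ps_def Y_module_iff)
  moreover have "Y_norm \<Lambda> n (\<lambda>\<alpha> t. S w \<alpha> t - finite_rank n ps w \<alpha> t) \<le> \<epsilon> * Y_norm \<Lambda> n w"
    if w: "module_family n w" for w
  proof -
    have "finite_rank n ps w = (\<lambda>\<alpha> t. \<Sum>i<N. rank_one \<Lambda> T n (x i) (y i) w \<alpha> t)"
      using w by (simp add: finite_rank_def ps_def rank_one_def Y_module_iff o_def interv_sum_list_conv_sum_set_nat atLeast0LessThan)
    then show ?thesis using xy(2) w by (simp add: Y_module_iff)
  qed
  ultimately show thesis using that by blast
qed

lemma compact_operator_module: "S \<in> compact_operators \<Lambda> T n \<Longrightarrow> module_family n w \<Longrightarrow> module_family n (S w)"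
  by (simp add: compact_operators_def Y_module_iff)

end

section \<open>The representation of the product system in a graph algebra\<close>

locale self_similar_graph_algebra = self_similar_ck \<Lambda> T \<sigma> \<Phi> s
  for \<Lambda> :: "('e, 'k::finite) kgraph" and T :: "'e \<Rightarrow> 't topology" and \<sigma> :: "'e \<Rightarrow> 't \<Rightarrow> 't"
    and \<Phi> :: "('e, 'k) inf_path \<Rightarrow> 'e \<times> 't" and s :: "'e \<Rightarrow> 'c::cstar_algebra" +
  assumes generating: "generates_cstar (s ` arrows \<Lambda>)"
begin

text \<open>If \<open>s\<^sub>v z = 0\<close> for all \<open>v\<close> then all generators and their adjoints annihilate \<open>z\<close>, as \<open>s\<^sub>\<alpha> = s\<^sub>\<alpha> s\<^bsub>src \<alpha>\<^esub>\<close>. This replaces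
the unit of the graph algebra when there are infinitely many vertices.\<close>

lemma eq_if_eq_at_vertices:
  assumes "\<And>v. v \<in> vertices \<Lambda> \<Longrightarrow> s v * x = s v * y"
  shows "x = y"
proof -
  have "x - y = 0"
  proof (rule zero_if_annihilated_by_generators[OF generating])
    fix g assume "g \<in> s ` arrows \<Lambda>"
    then obtain \<alpha> where a: "\<alpha> \<in> arrows \<Lambda>" "g = s \<alpha>" by auto
    have z: "s v * (x - y) = 0" if "v \<in> vertices \<Lambda>" for v using assms[OF that] by (simp add: right_diff_distrib)
    have "s \<alpha> * (x - y) = s \<alpha> * (s (src \<Lambda> \<alpha>) * (x - y))" using s_src[OF a(1)] by (simp flip: mult.assoc)
    moreover have "adj (s \<alpha>) * (x - y) = adj (s \<alpha>) * (s (rng \<Lambda> \<alpha>) * (x - y))" using s_rng_adj[OF a(1)] by (simp flip: mult.assoc)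
    ultimately show "g * (x - y) = 0 \<and> adj g * (x - y) = 0"
      using z src_vertex[OF a(1)] rng_vertex[OF a(1)] a(2) by simp
  qed
  then show ?thesis by simp
qed

definition summand :: "('e, 't) family \<Rightarrow> 'e \<Rightarrow> 'c" where
  "summand y \<alpha> = s \<alpha> * iota (src \<Lambda> \<alpha>) (y \<alpha>)"

text \<open>The sum of all \<open>summand y \<alpha>\<close> may be infinite, but multiplication by a vertex projection leaves finitely many
terms and these products determine the element. Defining \<open>rho\<close> by them reduces its algebraic properties to
finite sums; the description as an infinite sum is \<open>rho_eq_infsum\<close>.\<close>

definition rho :: "nat ^ 'k \<Rightarrow> ('e, 't) family \<Rightarrow> 'c" where
  "rho n y = (THE z. \<forall>v\<in>vertices \<Lambda>. s v * z = (\<Sum>\<alpha>\<in>of_degree_at \<Lambda> v n. summand y \<alpha>))"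

lemma rho_eqI:
  assumes "\<And>v. v \<in> vertices \<Lambda> \<Longrightarrow> s v * z = (\<Sum>\<alpha>\<in>of_degree_at \<Lambda> v n. summand y \<alpha>)"
  shows "rho n y = z"
  unfolding rho_def
proof (rule the_equality)
  fix z' assume "\<forall>v\<in>vertices \<Lambda>. s v * z' = (\<Sum>\<alpha>\<in>of_degree_at \<Lambda> v n. summand y \<alpha>)"
  then show "z' = z" using assms by - (rule eq_if_eq_at_vertices; simp)
qed (use assms in blast)

lemma iota_orth:
  assumes "v \<in> vertices \<Lambda>" "w \<in> vertices \<Lambda>" "f \<in> C0 (T v)" "g \<in> C0 (T w)" "v \<noteq> w"
  shows "iota v f * iota w g = 0"
  using s_iota[OF assms(1,3,1)] s_iota[OF assms(2,4,1)] assms(5) by (metis mult.assoc mult_zero_right)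

lemma adj_summand_mult_summand:
  assumes x: "module_family n x" and y: "module_family n y" and a: "\<alpha> \<in> of_degree \<Lambda> n" and b: "\<beta> \<in> of_degree \<Lambda> n"
  shows "adj (summand x \<alpha>) * summand y \<beta> =
    (if \<alpha> = \<beta> then iota (src \<Lambda> \<alpha>) (\<lambda>t. cnj (x \<alpha> t) * y \<alpha> t) else 0)"
proof -
  have sv: "src \<Lambda> \<alpha> \<in> vertices \<Lambda>" using src_vertex[OF of_degree_arrow[OF a]] .
  have "adj (summand x \<alpha>) * summand y \<beta> =
    adj (iota (src \<Lambda> \<alpha>) (x \<alpha>)) * ((adj (s \<alpha>) * s \<beta>) * iota (src \<Lambda> \<beta>) (y \<beta>))"
    by (simp add: summand_def adj_mult mult.assoc)
  also have "\<dots> = (if \<alpha> = \<beta> then adj (iota (src \<Lambda> \<alpha>) (x \<alpha>)) * iota (src \<Lambda> \<alpha>) (y \<alpha>) else 0)"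
    using adj_s_mult_s[OF a b] s_iota(1)[OF sv module_familyD(1)[OF y a] sv] by auto
  also have "\<dots> = (if \<alpha> = \<beta> then iota (src \<Lambda> \<alpha>) (\<lambda>t. cnj (x \<alpha> t) * y \<alpha> t) else 0)"
    using iota_cnj[OF sv module_familyD(1)[OF x a]]
      iota_mult[OF sv C0_cnj[OF sv module_familyD(1)[OF x a]] module_familyD(1)[OF y a]] by auto
  finally show ?thesis .
qed

lemma adj_partial_mult_partial:
  assumes x: "module_family n x" and y: "module_family n y" and F: "finite F" "F \<subseteq> of_degree \<Lambda> n"
  shows "adj (sum (summand x) F) * sum (summand y) F =
    (\<Sum>v\<in>src \<Lambda> ` F. iota v (\<lambda>t. \<Sum>\<alpha>\<in>{\<alpha>\<in>F. src \<Lambda> \<alpha> = v}. cnj (x \<alpha> t) * y \<alpha> t))"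
proof -
  have "adj (sum (summand x) F) * sum (summand y) F = (\<Sum>\<alpha>\<in>F. \<Sum>\<beta>\<in>F. adj (summand x \<alpha>) * summand y \<beta>)"
    by (simp add: adj_sum sum_product)
  also have "\<dots> = (\<Sum>\<alpha>\<in>F. \<Sum>\<beta>\<in>F. if \<alpha> = \<beta> then iota (src \<Lambda> \<alpha>) (\<lambda>t. cnj (x \<alpha> t) * y \<alpha> t) else 0)"
    by (intro sum.cong refl adj_summand_mult_summand[OF x y]) (use F(2) in auto)
  also have "\<dots> = (\<Sum>\<alpha>\<in>F. iota (src \<Lambda> \<alpha>) (\<lambda>t. cnj (x \<alpha> t) * y \<alpha> t))"
    using F(1) by (simp add: sum.delta')
  also have "\<dots> = (\<Sum>v\<in>src \<Lambda> ` F. \<Sum>\<alpha>\<in>{\<alpha>\<in>F. src \<Lambda> \<alpha> = v}. iota (src \<Lambda> \<alpha>) (\<lambda>t. cnj (x \<alpha> t) * y \<alpha> t))"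
    using F(1) by (rule sum.image_gen)
  also have "\<dots> = (\<Sum>v\<in>src \<Lambda> ` F. iota v (\<lambda>t. \<Sum>\<alpha>\<in>{\<alpha>\<in>F. src \<Lambda> \<alpha> = v}. cnj (x \<alpha> t) * y \<alpha> t))"
  proof (rule sum.cong[OF refl])
    fix v assume "v \<in> src \<Lambda> ` F"
    then have v: "v \<in> vertices \<Lambda>" using F(2) src_vertex of_degree_arrow by blast
    have "iota v (\<lambda>t. \<Sum>\<alpha>\<in>{\<alpha>\<in>F. src \<Lambda> \<alpha> = v}. cnj (x \<alpha> t) * y \<alpha> t) =
      (\<Sum>\<alpha>\<in>{\<alpha>\<in>F. src \<Lambda> \<alpha> = v}. iota v (\<lambda>t. cnj (x \<alpha> t) * y \<alpha> t))"
    proof (rule iota_sum[OF v])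
      fix \<alpha> assume "\<alpha> \<in> {\<alpha>\<in>F. src \<Lambda> \<alpha> = v}"
      then have "x \<alpha> \<in> C0 (T v)" "y \<alpha> \<in> C0 (T v)"
        using module_familyD(1)[OF x] module_familyD(1)[OF y] F(2) by auto
      then show "(\<lambda>t. cnj (x \<alpha> t) * y \<alpha> t) \<in> C0 (T v)" using C0_mult[OF v C0_cnj[OF v]] by blast
    qed
    then show "(\<Sum>\<alpha>\<in>{\<alpha>\<in>F. src \<Lambda> \<alpha> = v}. iota (src \<Lambda> \<alpha>) (\<lambda>t. cnj (x \<alpha> t) * y \<alpha> t)) =
      iota v (\<lambda>t. \<Sum>\<alpha>\<in>{\<alpha>\<in>F. src \<Lambda> \<alpha> = v}. cnj (x \<alpha> t) * y \<alpha> t)" by simp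
  qed
  finally show ?thesis .
qed

text \<open>The square of the norm is the norm of a sum of elements \<open>iota v g\<^sub>v\<close>, where \<open>g\<^sub>v\<close> is the inner product of \<open>y\<close> with
itself over \<open>F\<close>. These are orthogonal for different \<open>v\<close>.\<close>

lemma norm_partial_le:
  assumes y: "module_family n y" and F: "finite F" "F \<subseteq> of_degree \<Lambda> n"
    and M: "\<And>v t. fibre_norm y F v t \<le> M" and M0: "0 \<le> M"
  shows "norm (sum (summand y) F) \<le> M"
proof -
  let ?g = "\<lambda>v t. \<Sum>\<alpha>\<in>{\<alpha>\<in>F. src \<Lambda> \<alpha> = v}. cnj (y \<alpha> t) * y \<alpha> t"
  have v: "v \<in> vertices \<Lambda>" if "v \<in> src \<Lambda> ` F" for v using F(2) src_vertex of_degree_arrow that by blast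
  have g: "?g v \<in> C0 (T v)" if "v \<in> src \<Lambda> ` F" for v using C0_partial_inner[OF y y F(2) v[OF that]] .
  have "(norm (sum (summand y) F))\<^sup>2 = norm (\<Sum>v\<in>src \<Lambda> ` F. iota v (?g v))"
    using cstar_identity[of "sum (summand y) F"] adj_partial_mult_partial[OF y y F] by simp
  also have "\<dots> \<le> M\<^sup>2"
  proof (rule norm_sum_orthogonal_selfadj)
    fix u assume u: "u \<in> src \<Lambda> ` F"
    have "(\<lambda>t. cnj (?g u t)) = ?g u" by (simp add: mult.commute)
    then show "adj (iota u (?g u)) = iota u (?g u)" using iota_cnj[OF v[OF u] g[OF u]] by simp
    show "norm (iota u (?g u)) \<le> M\<^sup>2"
    proof (rule norm_iota_le[OF v[OF u] g[OF u]])
      fix t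
      have "cmod (?g u t) \<le> fibre_norm y F u t * fibre_norm y F u t" by (rule inner_partial_le)
      also have "\<dots> \<le> M * M" using M M0 by (intro mult_mono) auto
      finally show "cmod (?g u t) \<le> M\<^sup>2" by (simp add: power2_eq_square)
    qed
  next
    fix u w assume "u \<in> src \<Lambda> ` F" "w \<in> src \<Lambda> ` F" "u \<noteq> w"
    then show "iota u (?g u) * iota w (?g w) = 0" using iota_orth v g by blast
  qed (use F in auto)
  finally show ?thesis using M0 power2_le_imp_le by blast
qed

lemma summand_summable:
  assumes y: "module_family n y"
  shows "summand y summable_on of_degree \<Lambda> n"
proof (rule summable_on_if_small_tails)
  fix e :: real assume e: "0 < e"
  obtain F0 where F0: "finite F0" "F0 \<subseteq> of_degree \<Lambda> n"
    "\<And>F v t. finite F \<Longrightarrow> F \<subseteq> of_degree \<Lambda> n - F0 \<Longrightarrow> fibre_norm y F v t \<le> e"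
    using small_tailsE[OF module_familyD(3)[OF y] e] by blast
  have "norm (sum (summand y) F) \<le> e" if "finite F" "F \<subseteq> of_degree \<Lambda> n - F0" for F
    by (rule norm_partial_le[OF y]) (use that F0(3)[OF that] e in auto)
  then show "\<exists>F0. finite F0 \<and> F0 \<subseteq> of_degree \<Lambda> n \<and>
      (\<forall>F. finite F \<longrightarrow> F \<subseteq> of_degree \<Lambda> n - F0 \<longrightarrow> norm (sum (summand y) F) \<le> e)" using F0(1,2) by blast
qed

lemma s_summand:
  assumes a: "\<alpha> \<in> of_degree \<Lambda> n" and v: "v \<in> vertices \<Lambda>"
  shows "s v * summand y \<alpha> = (if rng \<Lambda> \<alpha> = v then summand y \<alpha> else 0)"
  using s_vertex_left[OF v of_degree_arrow[OF a]] unfolding summand_def by (simp flip: mult.assoc)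

lemma s_mult_infsum_summand:
  assumes y: "module_family n y" and v: "v \<in> vertices \<Lambda>"
  shows "s v * infsum (summand y) (of_degree \<Lambda> n) = (\<Sum>\<alpha>\<in>of_degree_at \<Lambda> v n. summand y \<alpha>)"
proof -
  have "((\<lambda>\<alpha>. s v * summand y \<alpha>) has_sum s v * infsum (summand y) (of_degree \<Lambda> n)) (of_degree \<Lambda> n)"
    by (rule has_sum_bounded_linear[OF bounded_linear_mult_right has_sum_infsum[OF summand_summable[OF y]]])
  also have "?this \<longleftrightarrow> (summand y has_sum s v * infsum (summand y) (of_degree \<Lambda> n)) (of_degree_at \<Lambda> v n)"
    by (rule has_sum_cong_neutral) (auto simp: s_summand[where n = n, OF _ v] of_degree_at_def)
  finally show ?thesis using finite_of_degree_at[OF v] by (metis has_sum_finite has_sum_unique)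
qed

lemma rho_eq_infsum: "module_family n y \<Longrightarrow> rho n y = infsum (summand y) (of_degree \<Lambda> n)"
  by (rule rho_eqI) (rule s_mult_infsum_summand)

lemma s_rho: "module_family n y \<Longrightarrow> v \<in> vertices \<Lambda> \<Longrightarrow> s v * rho n y = (\<Sum>\<alpha>\<in>of_degree_at \<Lambda> v n. summand y \<alpha>)"
  using rho_eq_infsum s_mult_infsum_summand by simp

lemma norm_rho_le:
  assumes y: "module_family n y" and M: "bounded_by n y M"
  shows "norm (rho n y) \<le> M"
  unfolding rho_eq_infsum[OF y]
proof (rule norm_infsum_le_if_partial_sums[OF summand_summable[OF y]])
  fix F assume "finite F" "F \<subseteq> of_degree \<Lambda> n"
  then show "norm (sum (summand y) F) \<le> M"
    using norm_partial_le[OF y] bounded_byD[OF M] bounded_by_nonneg[OF M] by blast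
qed

lemma rho_tendsto:
  "module_family n y \<Longrightarrow> (sum (summand y) \<longlongrightarrow> rho n y) (finite_subsets_at_top (of_degree \<Lambda> n))"
  using has_sum_infsum[OF summand_summable] rho_eq_infsum by (metis has_sum_def)

lemma summand_add:
  assumes "module_family n x" "module_family n y" "\<alpha> \<in> of_degree \<Lambda> n"
  shows "summand (\<lambda>\<alpha> t. x \<alpha> t + y \<alpha> t) \<alpha> = summand x \<alpha> + summand y \<alpha>"
  unfolding summand_def
  using iota_add[OF src_vertex[OF of_degree_arrow[OF assms(3)]] module_familyD(1)[OF assms(1,3)] module_familyD(1)[OF assms(2,3)]]
  by (simp add: distrib_left)

lemma summand_scale:
  assumes "module_family n y" "\<alpha> \<in> of_degree \<Lambda> n"
  shows "summand (\<lambda>\<alpha> t. c * y \<alpha> t) \<alpha> = c *\<^sub>C summand y \<alpha>"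
  unfolding summand_def
  using iota_scale[OF src_vertex[OF of_degree_arrow[OF assms(2)]] module_familyD(1)[OF assms]]
  by (simp add: mult_scaleC_right)

lemma rho_add:
  assumes "module_family n x" "module_family n y"
  shows "rho n (\<lambda>\<alpha> t. x \<alpha> t + y \<alpha> t) = rho n x + rho n y"
  by (rule rho_eqI)
    (simp add: distrib_left s_rho assms sum.distrib[symmetric] summand_add[OF assms of_degree_atD(4)])

lemma rho_scale:
  assumes "module_family n y"
  shows "rho n (\<lambda>\<alpha> t. c * y \<alpha> t) = c *\<^sub>C rho n y"
  by (rule rho_eqI)
    (simp add: mult_scaleC_right s_rho assms scaleC_sum_right summand_scale[OF assms of_degree_atD(4)])

lemma rho_zero: "rho n (\<lambda>_ _. 0) = 0"
  using rho_scale[OF module_family_zero, where c = 0 and n = n] by simp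

lemma rho_minus: "module_family n y \<Longrightarrow> rho n (\<lambda>\<alpha> t. - y \<alpha> t) = - rho n y"
  using rho_scale[of n y "-1"] by (simp add: scaleC_minus1)

lemma rho_diff:
  assumes "module_family n x" "module_family n y"
  shows "rho n (\<lambda>\<alpha> t. x \<alpha> t - y \<alpha> t) = rho n x - rho n y"
  using rho_add[OF assms(1) module_family_scale[OF assms(2), of "-1"]] rho_scale[OF assms(2), of "-1"]
  by (simp add: scaleC_minus1)

lemma summand_vertex:
  assumes v: "v \<in> vertices \<Lambda>" and a: "a v \<in> C0 (T v)"
  shows "(\<Sum>\<alpha>\<in>of_degree_at \<Lambda> v 0. summand a \<alpha>) = iota v (a v)"
  using s_iota(1)[OF v a v] by (simp add: of_degree_at_zero[OF v] summand_def vertex_facts[OF v])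

lemma s_rho_zero: "a \<in> coeff_algebra \<Lambda> T \<Longrightarrow> v \<in> vertices \<Lambda> \<Longrightarrow> s v * rho 0 a = iota v (a v)"
  using s_rho[of 0 a v] summand_vertex[of v a] coeff_algebraD(1)[of a v] module_family_zero_iff_coeff by simp

lemma rho_zero_s:
  assumes a: "a \<in> coeff_algebra \<Lambda> T" and v: "v \<in> vertices \<Lambda>"
  shows "rho 0 a * s v = iota v (a v)"
proof (rule eq_if_eq_at_vertices)
  fix w assume w: "w \<in> vertices \<Lambda>"
  have "s w * (rho 0 a * s v) = iota w (a w) * s v" using s_rho_zero[OF a w] by (simp flip: mult.assoc)
  also have "\<dots> = s w * iota v (a v)"
    using s_iota(2)[OF w coeff_algebraD(1)[OF a w] v] s_iota(1)[OF v coeff_algebraD(1)[OF a v] w] by auto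
  finally show "s w * (rho 0 a * s v) = s w * iota v (a v)" .
qed

lemma rho_zero_eqI:
  assumes "\<And>v. v \<in> vertices \<Lambda> \<Longrightarrow> a v \<in> C0 (T v)" "\<And>v. v \<in> vertices \<Lambda> \<Longrightarrow> s v * z = iota v (a v)"
  shows "rho 0 a = z"
  by (rule rho_eqI) (simp add: summand_vertex assms)

lemma rho_zero_mult:
  assumes a: "a \<in> coeff_algebra \<Lambda> T" and b: "b \<in> coeff_algebra \<Lambda> T"
  shows "rho 0 (\<lambda>v t. a v t * b v t) = rho 0 a * rho 0 b"
proof (rule rho_zero_eqI)
  fix v assume v: "v \<in> vertices \<Lambda>"
  note av = coeff_algebraD(1)[OF a v] and bv = coeff_algebraD(1)[OF b v]
  show "(\<lambda>t. a v t * b v t) \<in> C0 (T v)" using C0_mult[OF v av bv] .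
  have "s v * (rho 0 a * rho 0 b) = iota v (a v) * s v * rho 0 b"
    using s_rho_zero[OF a v] s_iota(2)[OF v av v] by (simp flip: mult.assoc)
  also have "\<dots> = iota v (a v) * iota v (b v)" using s_rho_zero[OF b v] by (simp add: mult.assoc)
  finally show "s v * (rho 0 a * rho 0 b) = iota v (\<lambda>t. a v t * b v t)" using iota_mult[OF v av bv] by simp
qed

lemma rho_zero_adj:
  assumes a: "a \<in> coeff_algebra \<Lambda> T"
  shows "rho 0 (\<lambda>v t. cnj (a v t)) = adj (rho 0 a)"
proof (rule rho_zero_eqI)
  fix v assume v: "v \<in> vertices \<Lambda>"
  note av = coeff_algebraD(1)[OF a v]
  show "(\<lambda>t. cnj (a v t)) \<in> C0 (T v)" using C0_cnj[OF v av] .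
  have "s v * adj (rho 0 a) = adj (rho 0 a * s v)" using s_vertex(2)[OF v] by (simp add: adj_mult)
  also have "\<dots> = iota v (\<lambda>t. cnj (a v t))" using rho_zero_s[OF a v] iota_cnj[OF v av] by simp
  finally show "s v * adj (rho 0 a) = iota v (\<lambda>t. cnj (a v t))" .
qed

lemma summand_mult_rho:
  assumes x: "module_family n x" and a: "\<alpha> \<in> of_degree \<Lambda> n"
  shows "summand x \<alpha> * z = s \<alpha> * (iota (src \<Lambda> \<alpha>) (x \<alpha>) * (s (src \<Lambda> \<alpha>) * z))"
  using s_iota(2)[OF src_vertex[OF of_degree_arrow[OF a]] module_familyD(1)[OF x a] src_vertex[OF of_degree_arrow[OF a]]]
  by (simp add: summand_def flip: mult.assoc)

text \<open>The commutation rule \<open>iota_s\<close> moves \<open>iota (x \<alpha>)\<close> past \<open>s\<^sub>\<beta>\<close> and produces the factor \<open>x \<alpha> \<circ> \<sigma>\<^sub>\<beta>\<close> of the product in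
\<open>Y\<close>.\<close>

lemma rho_mult:
  assumes x: "module_family n x" and y: "module_family m y"
  shows "rho (n + m) (Y_mult \<Lambda> \<sigma> n m x y) = rho n x * rho m y"
proof (rule rho_eqI)
  fix v assume v: "v \<in> vertices \<Lambda>"
  have "s v * (rho n x * rho m y) = (\<Sum>\<alpha>\<in>of_degree_at \<Lambda> v n. summand x \<alpha> * rho m y)"
    using s_rho[OF x v] by (simp add: sum_distrib_right flip: mult.assoc)
  also have "\<dots> = (\<Sum>\<alpha>\<in>of_degree_at \<Lambda> v n. \<Sum>\<beta>\<in>of_degree_at \<Lambda> (src \<Lambda> \<alpha>) m. summand (Y_mult \<Lambda> \<sigma> n m x y) (cmp \<Lambda> \<alpha> \<beta>))"
  proof (rule sum.cong[OF refl])
    fix \<alpha> assume "\<alpha> \<in> of_degree_at \<Lambda> v n"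
    then have a: "\<alpha> \<in> of_degree \<Lambda> n" "\<alpha> \<in> arrows \<Lambda>" using of_degree_atD by auto
    let ?u = "src \<Lambda> \<alpha>"
    have u: "?u \<in> vertices \<Lambda>" using src_vertex a by blast
    have "summand x \<alpha> * rho m y = (\<Sum>\<beta>\<in>of_degree_at \<Lambda> ?u m. s \<alpha> * (iota ?u (x \<alpha>) * summand y \<beta>))"
      using summand_mult_rho[OF x a(1)] s_rho[OF y u] by (simp add: sum_distrib_left)
    also have "\<dots> = (\<Sum>\<beta>\<in>of_degree_at \<Lambda> ?u m. summand (Y_mult \<Lambda> \<sigma> n m x y) (cmp \<Lambda> \<alpha> \<beta>))"
    proof (rule sum.cong[OF refl])
      fix \<beta> assume "\<beta> \<in> of_degree_at \<Lambda> ?u m"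
      then have b: "\<beta> \<in> of_degree \<Lambda> m" "\<beta> \<in> arrows \<Lambda>" "rng \<Lambda> \<beta> = ?u" using of_degree_atD by auto
      let ?w = "src \<Lambda> \<beta>"
      have w: "?w \<in> vertices \<Lambda>" using src_vertex b by blast
      have xa: "x \<alpha> \<in> C0 (T (rng \<Lambda> \<beta>))" using module_familyD(1)[OF x a(1)] b by simp
      have pb: "pullback \<beta> (x \<alpha>) \<in> C0 (T ?w)" using pullback_C0[OF b(2) xa] .
      have "s \<alpha> * (iota ?u (x \<alpha>) * summand y \<beta>) = s \<alpha> * ((iota ?u (x \<alpha>) * s \<beta>) * iota ?w (y \<beta>))"
        by (simp add: summand_def mult.assoc)
      also have "\<dots> = (s \<alpha> * s \<beta>) * (iota ?w (pullback \<beta> (x \<alpha>)) * iota ?w (y \<beta>))"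
        using iota_s[OF b(2) xa] b(3) by (simp add: mult.assoc)
      also have "\<dots> = s (cmp \<Lambda> \<alpha> \<beta>) * iota ?w (\<lambda>t. pullback \<beta> (x \<alpha>) t * y \<beta> t)"
        using s_cmp[OF a(2) b(2)] b(3) iota_mult[OF w pb module_familyD(1)[OF y b(1)]] by simp
      also have "(\<lambda>t. pullback \<beta> (x \<alpha>) t * y \<beta> t) = Y_mult \<Lambda> \<sigma> n m x y (cmp \<Lambda> \<alpha> \<beta>)"
        using Y_mult_cmp[OF a(1) b(1)] b(3) mult_pullback[OF module_familyD(1)[OF y b(1)]] by (simp add: fun_eq_iff)
      finally show "s \<alpha> * (iota ?u (x \<alpha>) * summand y \<beta>) = summand (Y_mult \<Lambda> \<sigma> n m x y) (cmp \<Lambda> \<alpha> \<beta>)"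
        using src_cmp[OF a(2) b(2)] b(3) by (simp add: summand_def)
    qed
    finally show "summand x \<alpha> * rho m y = (\<Sum>\<beta>\<in>of_degree_at \<Lambda> ?u m. summand (Y_mult \<Lambda> \<sigma> n m x y) (cmp \<Lambda> \<alpha> \<beta>))" .
  qed
  also have "\<dots> = (\<Sum>\<gamma>\<in>of_degree_at \<Lambda> v (n + m). summand (Y_mult \<Lambda> \<sigma> n m x y) \<gamma>)"
    by (rule sum_of_degree_at_add[OF v, symmetric])
  finally show "s v * (rho n x * rho m y) = (\<Sum>\<gamma>\<in>of_degree_at \<Lambda> v (n + m). summand (Y_mult \<Lambda> \<sigma> n m x y) \<gamma>)" .
qed

lemma rho_right_action:
  assumes x: "module_family n x" and a: "a \<in> coeff_algebra \<Lambda> T"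
  shows "rho n (right_action \<Lambda> x a) = rho n x * rho 0 a"
proof (rule rho_eqI)
  fix v assume v: "v \<in> vertices \<Lambda>"
  have "s v * (rho n x * rho 0 a) = (\<Sum>\<alpha>\<in>of_degree_at \<Lambda> v n. summand x \<alpha> * rho 0 a)"
    using s_rho[OF x v] by (simp add: sum_distrib_right flip: mult.assoc)
  also have "\<dots> = (\<Sum>\<alpha>\<in>of_degree_at \<Lambda> v n. summand (right_action \<Lambda> x a) \<alpha>)"
  proof (rule sum.cong[OF refl])
    fix \<alpha> assume "\<alpha> \<in> of_degree_at \<Lambda> v n"
    then have al: "\<alpha> \<in> of_degree \<Lambda> n" "\<alpha> \<in> arrows \<Lambda>" using of_degree_atD by auto
    have u: "src \<Lambda> \<alpha> \<in> vertices \<Lambda>" using src_vertex al by blast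
    have "summand x \<alpha> * rho 0 a = s \<alpha> * (iota (src \<Lambda> \<alpha>) (x \<alpha>) * iota (src \<Lambda> \<alpha>) (a (src \<Lambda> \<alpha>)))"
      using summand_mult_rho[OF x al(1)] s_rho_zero[OF a u] by simp
    then show "summand x \<alpha> * rho 0 a = summand (right_action \<Lambda> x a) \<alpha>"
      using iota_mult[OF u module_familyD(1)[OF x al(1)] coeff_algebraD(1)[OF a u]]
      by (simp add: summand_def right_action_def)
  qed
  finally show "s v * (rho n x * rho 0 a) = (\<Sum>\<alpha>\<in>of_degree_at \<Lambda> v n. summand (right_action \<Lambda> x a) \<alpha>)" .
qed

lemma rho_left_action:
  assumes y: "module_family n y" and a: "a \<in> coeff_algebra \<Lambda> T"
  shows "rho n (left_action \<Lambda> T \<sigma> n a y) = rho 0 a * rho n y"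
proof (rule rho_eqI)
  fix v assume v: "v \<in> vertices \<Lambda>"
  note av = coeff_algebraD(1)[OF a v]
  have "s v * (rho 0 a * rho n y) = iota v (a v) * (s v * rho n y)"
    using s_rho_zero[OF a v] s_iota(2)[OF v av v] by (simp flip: mult.assoc)
  also have "\<dots> = (\<Sum>\<alpha>\<in>of_degree_at \<Lambda> v n. iota v (a v) * summand y \<alpha>)"
    using s_rho[OF y v] by (simp add: sum_distrib_left)
  also have "\<dots> = (\<Sum>\<alpha>\<in>of_degree_at \<Lambda> v n. summand (left_action \<Lambda> T \<sigma> n a y) \<alpha>)"
  proof (rule sum.cong[OF refl])
    fix \<alpha> assume "\<alpha> \<in> of_degree_at \<Lambda> v n"
    then have al: "\<alpha> \<in> of_degree \<Lambda> n" "\<alpha> \<in> arrows \<Lambda>" "rng \<Lambda> \<alpha> = v" using of_degree_atD by auto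
    have u: "src \<Lambda> \<alpha> \<in> vertices \<Lambda>" using src_vertex al by blast
    have av': "a v \<in> C0 (T (rng \<Lambda> \<alpha>))" using av al by simp
    have "iota v (a v) * summand y \<alpha> = s \<alpha> * (iota (src \<Lambda> \<alpha>) (pullback \<alpha> (a v)) * iota (src \<Lambda> \<alpha>) (y \<alpha>))"
      using iota_s[OF al(2) av'] al(3) by (simp add: summand_def flip: mult.assoc)
    also have "\<dots> = s \<alpha> * iota (src \<Lambda> \<alpha>) (\<lambda>t. pullback \<alpha> (a v) t * y \<alpha> t)"
      using iota_mult[OF u pullback_C0[OF al(2) av'] module_familyD(1)[OF y al(1)]] by simp
    also have "(\<lambda>t. pullback \<alpha> (a v) t * y \<alpha> t) = left_action \<Lambda> T \<sigma> n a y \<alpha>"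
      using y mult_pullback[OF module_familyD(1)[OF y al(1)]] al(3)
      by (simp add: left_action_def Y_module_iff fun_eq_iff)
    finally show "iota v (a v) * summand y \<alpha> = summand (left_action \<Lambda> T \<sigma> n a y) \<alpha>" by (simp add: summand_def)
  qed
  finally show "s v * (rho 0 a * rho n y) = (\<Sum>\<alpha>\<in>of_degree_at \<Lambda> v n. summand (left_action \<Lambda> T \<sigma> n a y) \<alpha>)" .
qed

lemma rho_inner:
  assumes x: "module_family n x" and y: "module_family n y"
  shows "rho 0 (Y_inner \<Lambda> n x y) = adj (rho n x) * rho n y"
proof (rule rho_zero_eqI)
  let ?FS = "finite_subsets_at_top (of_degree \<Lambda> n)"
  fix v assume v: "v \<in> vertices \<Lambda>"
  let ?i = "Y_inner \<Lambda> n x y v"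
  let ?g = "\<lambda>F t. \<Sum>\<alpha>\<in>{\<alpha>\<in>F. src \<Lambda> \<alpha> = v}. cnj (x \<alpha> t) * y \<alpha> t"
  show i: "?i \<in> C0 (T v)" using coeff_algebraD(1)[OF Y_inner_coeff[OF x y] v] .
  have sF: "s v * (adj (sum (summand x) F) * sum (summand y) F) = iota v (?g F)"
    if F: "finite F" "F \<subseteq> of_degree \<Lambda> n" for F
  proof -
    have "s v * (adj (sum (summand x) F) * sum (summand y) F) =
      (\<Sum>w\<in>src \<Lambda> ` F. s v * iota w (\<lambda>t. \<Sum>\<alpha>\<in>{\<alpha>\<in>F. src \<Lambda> \<alpha> = w}. cnj (x \<alpha> t) * y \<alpha> t))"
      unfolding adj_partial_mult_partial[OF x y F] by (rule sum_distrib_left)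
    also have "\<dots> = (\<Sum>w\<in>src \<Lambda> ` F. if w = v then iota v (?g F) else 0)"
    proof (rule sum.cong[OF refl])
      fix w assume "w \<in> src \<Lambda> ` F"
      then have w: "w \<in> vertices \<Lambda>" using F(2) src_vertex of_degree_arrow by blast
      show "s v * iota w (\<lambda>t. \<Sum>\<alpha>\<in>{\<alpha>\<in>F. src \<Lambda> \<alpha> = w}. cnj (x \<alpha> t) * y \<alpha> t) = (if w = v then iota v (?g F) else 0)"
        using s_iota(1)[OF w C0_partial_inner[OF x y F(2) w] v] by auto
    qed
    also have "\<dots> = iota v (?g F)"
    proof (cases "v \<in> src \<Lambda> ` F")
      case False
      then have e: "{\<alpha>\<in>F. src \<Lambda> \<alpha> = v} = {}" by auto
      have "iota v (?g F) = 0" unfolding e using iota_zero[OF v] by simp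
      moreover have "(\<Sum>w\<in>src \<Lambda> ` F. if w = v then iota v (?g F) else 0) = 0"
        by (rule sum.neutral) (use False in auto)
      ultimately show ?thesis by simp
    qed (use F in \<open>simp add: sum.delta\<close>)
    finally show ?thesis .
  qed
  have "((\<lambda>F. s v * (adj (sum (summand x) F) * sum (summand y) F)) \<longlongrightarrow> s v * (adj (rho n x) * rho n y)) ?FS"
    by (intro tendsto_intros rho_tendsto x y)
  moreover have "((\<lambda>F. s v * (adj (sum (summand x) F) * sum (summand y) F)) \<longlongrightarrow> iota v ?i) ?FS"
    unfolding tendsto_iff
  proof (intro allI impI)
    fix e :: real assume e: "0 < e"
    then have e2: "0 < e / 2" by simp
    obtain F0 where F0: "finite F0" "F0 \<subseteq> of_degree \<Lambda> n"
      "\<And>F v t. finite F \<Longrightarrow> F0 \<subseteq> F \<Longrightarrow> F \<subseteq> of_degree \<Lambda> n \<Longrightarrow>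
       cmod (Y_inner \<Lambda> n x y v t - (\<Sum>\<alpha>\<in>{\<alpha>\<in>F. src \<Lambda> \<alpha> = v}. cnj (x \<alpha> t) * y \<alpha> t)) \<le> e / 2"
      using Y_inner_approx[OF x y e2] by blast
    have "dist (s v * (adj (sum (summand x) F) * sum (summand y) F)) (iota v ?i) < e"
      if F: "finite F" "F0 \<subseteq> F" "F \<subseteq> of_degree \<Lambda> n" for F
    proof -
      have g: "?g F \<in> C0 (T v)" using C0_partial_inner[OF x y F(3) v] .
      have "iota v ?i - iota v (?g F) = iota v (\<lambda>t. ?i t - ?g F t)" using iota_diff[OF v i g] by simp
      moreover have "norm (iota v (\<lambda>t. ?i t - ?g F t)) \<le> e / 2"
        by (rule norm_iota_le[OF v C0_diff[OF v i g]]) (rule F0(3)[OF F])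
      ultimately show ?thesis using sF[OF F(1,3)] e by (simp add: dist_norm norm_minus_commute)
    qed
    then show "\<forall>\<^sub>F F in ?FS. dist (s v * (adj (sum (summand x) F) * sum (summand y) F)) (iota v ?i) < e"
      unfolding eventually_finite_subsets_at_top using F0(1,2) by blast
  qed
  ultimately show "s v * (adj (rho n x) * rho n y) = iota v ?i"
    using tendsto_unique finite_subsets_at_top_neq_bot by blast
qed

theorem representation_rho: "representation \<Lambda> T \<sigma> rho"
  unfolding representation_def Y_module_iff
proof (intro conjI allI ballI)
qed (simp_all add: rho_add rho_scale rho_zero_mult rho_zero_adj rho_mult rho_inner Y_module_iff)

section \<open>Covariance\<close>

lemma rho_single:
  assumes a: "\<alpha> \<in> of_degree \<Lambda> n" and f: "f \<in> C0 (T (src \<Lambda> \<alpha>))"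
  shows "rho n (single \<alpha> f) = s \<alpha> * iota (src \<Lambda> \<alpha>) f"
proof (rule rho_eqI)
  fix v assume v: "v \<in> vertices \<Lambda>"
  have aa: "\<alpha> \<in> arrows \<Lambda>" using of_degree_arrow[OF a] .
  have z: "summand (single \<alpha> f) \<beta> = (if \<beta> = \<alpha> then s \<alpha> * iota (src \<Lambda> \<alpha>) f else 0)"
    if "\<beta> \<in> of_degree_at \<Lambda> v n" for \<beta>
    using iota_zero[OF src_vertex[OF of_degree_atD(1)[OF that]]] by (auto simp: summand_def single_def)
  have "(\<Sum>\<beta>\<in>of_degree_at \<Lambda> v n. summand (single \<alpha> f) \<beta>) =
    (\<Sum>\<beta>\<in>of_degree_at \<Lambda> v n. if \<beta> = \<alpha> then s \<alpha> * iota (src \<Lambda> \<alpha>) f else 0)"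
    by (rule sum.cong[OF refl z])
  also have "\<dots> = (if rng \<Lambda> \<alpha> = v then s \<alpha> * iota (src \<Lambda> \<alpha>) f else 0)"
    using finite_of_degree_at[OF v] a by (simp add: sum.delta of_degree_at_def)
  also have "\<dots> = s v * (s \<alpha> * iota (src \<Lambda> \<alpha>) f)"
    using s_vertex_left[OF v aa] by (simp flip: mult.assoc)
  finally show "s v * (s \<alpha> * iota (src \<Lambda> \<alpha>) f) = (\<Sum>\<beta>\<in>of_degree_at \<Lambda> v n. summand (single \<alpha> f) \<beta>)" by simp
qed

lemma rho_unit_single: "\<alpha> \<in> of_degree \<Lambda> n \<Longrightarrow> rho n (single \<alpha> (unit_at (src \<Lambda> \<alpha>))) = s \<alpha>"
  using rho_single[of \<alpha> n] unit_at_C0 iota_unit s_src src_vertex of_degree_arrow by metis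

text \<open>Elements of the graph algebra are determined by their products with \<open>rho n w\<close> (\<open>eq_if_eq_on_rho\<close>), so
linearity and multiplicativity of \<open>kappa\<close> are inherited from the action of operators on \<open>Y\<^sub>n\<close>.\<close>

definition kappa :: "nat ^ 'k \<Rightarrow> (('e, 't) family \<Rightarrow> ('e, 't) family) \<Rightarrow> 'c" where
  "kappa n S = (THE z. \<forall>w. module_family n w \<longrightarrow> z * rho n w = rho n (S w))"

text \<open>Since \<open>rho n 1\<^sub>\<alpha> = s\<^sub>\<alpha>\<close>, the hypothesis gives \<open>z s\<^sub>\<alpha> = z' s\<^sub>\<alpha>\<close> for all \<open>\<alpha>\<close> of degree \<open>n\<close>, and the Cuntz-Krieger relation
yields \<open>z s\<^sub>v = z' s\<^sub>v\<close>.\<close>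

lemma eq_if_eq_on_rho:
  assumes "\<And>w. module_family n w \<Longrightarrow> z * rho n w = z' * rho n w"
  shows "z = z'"
proof -
  have zs: "z * s \<alpha> = z' * s \<alpha>" if "\<alpha> \<in> of_degree \<Lambda> n" for \<alpha>
    using assms[OF unit_single[OF that]] rho_unit_single[OF that] by simp
  have "adj z = adj z'"
  proof (rule eq_if_eq_at_vertices)
    fix v assume v: "v \<in> vertices \<Lambda>"
    have "y * s v = (\<Sum>\<alpha>\<in>of_degree_at \<Lambda> v n. (y * s \<alpha>) * adj (s \<alpha>))" for y
      unfolding s_vertex_sum[OF v, of n] by (simp add: sum_distrib_left mult.assoc)
    then have "z * s v = z' * s v" using zs of_degree_atD(4) by simp
    then have "adj (z * s v) = adj (z' * s v)" by simp
    then show "s v * adj z = s v * adj z'" by (simp add: adj_mult s_vertex(2)[OF v])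
  qed
  then show ?thesis by (metis adj_adj)
qed

lemma kappa_eqI:
  assumes "\<And>w. module_family n w \<Longrightarrow> z * rho n w = rho n (S w)"
  shows "kappa n S = z"
  unfolding kappa_def
proof (rule the_equality)
  fix z' assume z': "\<forall>w. module_family n w \<longrightarrow> z' * rho n w = rho n (S w)"
  show "z' = z" by (rule eq_if_eq_on_rho[of n]) (simp add: assms z')
qed (simp add: assms)

definition ketbra :: "nat ^ 'k \<Rightarrow> (('e, 't) family \<times> ('e, 't) family) list \<Rightarrow> 'c" where
  "ketbra n ps = (\<Sum>(x, y)\<leftarrow>ps. rho n x * adj (rho n y))"

lemma rank_one_rho:
  assumes "module_family n x" "module_family n y" "module_family n w"
  shows "rho n x * adj (rho n y) * rho n w = rho n (right_action \<Lambda> x (Y_inner \<Lambda> n y w))"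
  using rho_inner[OF assms(2,3)] rho_right_action[OF assms(1) Y_inner_coeff[OF assms(2,3)]]
  by (simp add: mult.assoc)

lemma ketbra_rho:
  assumes "module_pairs n ps" "module_family n w"
  shows "ketbra n ps * rho n w = rho n (finite_rank n ps w)"
  using assms(1)
proof (induction ps)
  case (Cons p ps)
  obtain x y where p: "p = (x, y)" by (cases p)
  have m: "module_family n x" "module_family n y" "module_pairs n ps" using Cons(2) unfolding p module_pairs_Cons by auto
  have "rho n (finite_rank n (p # ps) w) =
    rho n (right_action \<Lambda> x (Y_inner \<Lambda> n y w)) + rho n (finite_rank n ps w)"
    unfolding p finite_rank_Cons
    by (rule rho_add[OF module_family_right_action_coeff[OF m(1) Y_inner_coeff[OF m(2) assms(2)]]
          module_family_finite_rank[OF m(3) assms(2)]])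
  then show ?case
    using Cons.IH[OF m(3)] rank_one_rho[OF m(1,2) assms(2)] by (simp add: p ketbra_def distrib_right)
qed (simp add: ketbra_def finite_rank_Nil rho_zero)

lemma adj_ketbra: "adj (ketbra n ps) = ketbra n (map prod.swap ps)"
  by (induction ps) (auto simp: ketbra_def adj_add adj_mult adj_adj)

lemma ketbra_append_negate:
  assumes "module_pairs n qs"
  shows "ketbra n (ps @ negate_pairs qs) = ketbra n ps - ketbra n qs"
proof -
  have "ketbra n (negate_pairs qs) = - ketbra n qs"
    using assms
  proof (induction qs)
    case (Cons q qs)
    obtain x y where q: "q = (x, y)" by (cases q)
    have "module_family n x" "module_pairs n qs" using Cons(2) unfolding q module_pairs_Cons by auto
    then show ?case using Cons.IH rho_minus by (simp add: q ketbra_def negate_pairs_def)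
  qed (simp add: ketbra_def negate_pairs_def)
  then show ?thesis by (simp add: ketbra_def)
qed

lemma norm_rho_le_Y_norm: "module_family n y \<Longrightarrow> norm (rho n y) \<le> Y_norm \<Lambda> n y"
  using norm_rho_le bounded_by_Y_norm by blast

text \<open>Let \<open>D\<close> be the operator of \<open>ps\<close>, \<open>E\<close> its adjoint, \<open>z = ketbra n ps\<close> and \<open>h = z z\<^sup>*\<close>. As \<open>h\<close> acts on the range of \<open>rho n\<close>
through \<open>D E\<close>, the power \<open>h\<^bsup>k+1\<^esup>\<close> is the sum of the \<open>rho n ((D E)\<^sup>k D y) (rho n x)\<^sup>*\<close> over the pairs \<open>(x, y)\<close> in \<open>ps\<close>.
Its norm is therefore at most \<open>K (C\<^sup>2)\<^sup>k\<close>, with a constant \<open>K\<close> that depends on the list but not on \<open>k\<close>, and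
for self-adjoint \<open>h\<close> this implies \<open>norm h \<le> C\<^sup>2\<close>.\<close>

lemma norm_ketbra_le:
  assumes ps: "module_pairs n ps" and C: "0 < C"
    and le: "\<And>w. module_family n w \<Longrightarrow> Y_norm \<Lambda> n (finite_rank n ps w) \<le> C * Y_norm \<Lambda> n w"
  shows "norm (ketbra n ps) \<le> C"
proof -
  let ?z = "ketbra n ps" and ?D = "finite_rank n ps" and ?E = "finite_rank n (map prod.swap ps)"
  have qs: "module_pairs n (map prod.swap ps)" using ps by (auto simp: module_pairs_def)
  define h where "h = ?z * adj ?z"
  have hsa: "adj h = h" by (simp add: h_def adj_mult adj_adj)
  define it where "it k w = ((\<lambda>w. ?D (?E w)) ^^ k) w" for k w
  have it: "module_family n (it k w) \<and> Y_norm \<Lambda> n (it k w) \<le> (C * C) ^ k * Y_norm \<Lambda> n w"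
    if w: "module_family n w" for k w
  proof (induction k)
    case (Suc k)
    have e: "it (Suc k) w = ?D (?E (it k w))" by (simp add: it_def)
    have m: "module_family n (?E (it k w))" using Suc module_family_finite_rank[OF qs] by blast
    have "Y_norm \<Lambda> n (it (Suc k) w) \<le> C * Y_norm \<Lambda> n (?E (it k w))" unfolding e by (rule le[OF m])
    also have "Y_norm \<Lambda> n (?E (it k w)) \<le> C * Y_norm \<Lambda> n (it k w)"
      using finite_rank_adjoint_norm_le[OF ps _ le] Suc C by simp
    also have "Y_norm \<Lambda> n (it k w) \<le> (C * C) ^ k * Y_norm \<Lambda> n w" using Suc by blast
    finally have "Y_norm \<Lambda> n (it (Suc k) w) \<le> C * (C * ((C * C) ^ k * Y_norm \<Lambda> n w))" using C by simp
    then show ?case unfolding e using module_family_finite_rank[OF ps m] by (simp add: mult_ac)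
  qed (simp add: it_def w)
  have hrho: "h * rho n w = rho n (?D (?E w))" if w: "module_family n w" for w
  proof -
    have "h * rho n w = ?z * rho n (?E w)"
      using ketbra_rho[OF qs w] by (simp add: h_def adj_ketbra mult.assoc)
    then show ?thesis using ketbra_rho[OF ps module_family_finite_rank[OF qs w]] by simp
  qed
  have hpow: "((*) h ^^ k) (rho n w * u) = rho n (it k w) * u" if w: "module_family n w" for k w u
  proof (induction k)
    case (Suc k)
    then show ?case using hrho[of "it k w"] it[OF w, of k] by (simp add: it_def flip: mult.assoc)
  qed (simp add: it_def)
  have pow_sum: "((*) h ^^ k) (a + b) = ((*) h ^^ k) a + ((*) h ^^ k) b" for k a b
    by (induction k) (simp_all add: distrib_left)
  have pow_zero: "((*) h ^^ k) 0 = 0" for k by (induction k) simp_all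
  have bound: "\<exists>K. \<forall>k. norm (((*) h ^^ k) (?z * adj (ketbra n qs))) \<le> K * (C * C) ^ k"
    if "module_pairs n qs" for qs
    using that
  proof (induction qs)
    case Nil
    then show ?case by (intro exI[of _ 0]) (simp add: ketbra_def pow_zero)
  next
    case (Cons q qs)
    obtain x y where q: "q = (x, y)" by (cases q)
    have m: "module_family n x" "module_family n y" "module_pairs n qs" using Cons(2) unfolding q module_pairs_Cons by auto
    obtain K where K: "\<And>k. norm (((*) h ^^ k) (?z * adj (ketbra n qs))) \<le> K * (C * C) ^ k"
      using Cons.IH[OF m(3)] by blast
    have Dy: "module_family n (?D y)" using module_family_finite_rank[OF ps m(2)] .
    have "?z * adj (ketbra n (q # qs)) = rho n (?D y) * adj (rho n x) + ?z * adj (ketbra n qs)"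
      using ketbra_rho[OF ps m(2)]
      by (simp add: q ketbra_def adj_add adj_mult adj_adj distrib_left flip: mult.assoc)
    then have "((*) h ^^ k) (?z * adj (ketbra n (q # qs))) =
      rho n (it k (?D y)) * adj (rho n x) + ((*) h ^^ k) (?z * adj (ketbra n qs))" for k
      using hpow[OF Dy] pow_sum by simp
    moreover have "norm (rho n (it k (?D y)) * adj (rho n x)) \<le> (C * C) ^ k * Y_norm \<Lambda> n (?D y) * norm (rho n x)" for k
    proof -
      have "norm (rho n (it k (?D y)) * adj (rho n x)) \<le> norm (rho n (it k (?D y))) * norm (rho n x)"
        using norm_mult_ineq[of "rho n (it k (?D y))" "adj (rho n x)"] by simp
      moreover have "norm (rho n (it k (?D y))) \<le> (C * C) ^ k * Y_norm \<Lambda> n (?D y)"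
        using it[OF Dy, of k] norm_rho_le_Y_norm[of n "it k (?D y)"] by simp
      ultimately show ?thesis using mult_right_mono[OF _ norm_ge_zero] order_trans by blast
    qed
    ultimately have "norm (((*) h ^^ k) (?z * adj (ketbra n (q # qs)))) \<le>
      (C * C) ^ k * Y_norm \<Lambda> n (?D y) * norm (rho n x) + K * (C * C) ^ k" for k
      using norm_triangle_mono K by metis
    then show ?case
      by (intro exI[of _ "Y_norm \<Lambda> n (?D y) * norm (rho n x) + K"]) (simp add: algebra_simps)
  qed
  obtain K where K: "\<And>k. norm (((*) h ^^ k) h) \<le> K * (C * C) ^ k"
    using bound[OF ps] unfolding h_def by blast
  have "norm h \<le> C * C"
  proof (rule norm_le_if_powers_bounded[OF hsa, where K = "K / (C * C)"])
    show "norm (((*) h ^^ k) h) \<le> K / (C * C) * (C * C) ^ Suc k" for k using K[of k] C by simp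
  qed (use C in simp)
  then have "(norm ?z)\<^sup>2 \<le> C\<^sup>2" using norm_mult_adj[of ?z] by (simp add: h_def power2_eq_square)
  then show ?thesis using C power2_le_imp_le by (metis less_imp_le)
qed

text \<open>The elements belonging to finite-rank approximations of \<open>S\<close> form a Cauchy sequence by \<open>norm_ketbra_le\<close>.\<close>

lemma kappa_exists:
  assumes S: "S \<in> compact_operators \<Lambda> T n"
  shows "\<exists>z. \<forall>w. module_family n w \<longrightarrow> z * rho n w = rho n (S w)"
proof -
  have "\<exists>ps. module_pairs n ps \<and> (\<forall>w. module_family n w \<longrightarrow>
    Y_norm \<Lambda> n (\<lambda>\<alpha> t. S w \<alpha> t - finite_rank n ps w \<alpha> t) \<le> 1 / real (Suc j) * Y_norm \<Lambda> n w)" for j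
  proof -
    have "0 < 1 / real (Suc j)" by simp
    from compact_operator_approx[OF S this] show ?thesis by blast
  qed
  then obtain ps where ps: "\<And>j. module_pairs n (ps j)"
    and ap: "\<And>j w. module_family n w \<Longrightarrow> Y_norm \<Lambda> n (\<lambda>\<alpha> t. S w \<alpha> t - finite_rank n (ps j) w \<alpha> t) \<le> 1 / real (Suc j) * Y_norm \<Lambda> n w"
    by metis
  define z where "z j = ketbra n (ps j)" for j
  have near: "norm (z i - z j) \<le> 1 / real (Suc i) + 1 / real (Suc j)" for i j
  proof -
    let ?qs = "ps i @ negate_pairs (ps j)"
    have "norm (ketbra n ?qs) \<le> 1 / real (Suc i) + 1 / real (Suc j)"
    proof (rule norm_ketbra_le)
      show "module_pairs n ?qs" using ps[of i] module_pairs_negate[OF ps[of j]] by (auto simp: module_pairs_def)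
      show "0 < 1 / real (Suc i) + 1 / real (Suc j)" by (simp add: add_pos_pos)
      fix w assume w: "module_family n w"
      have Sw: "module_family n (S w)" using compact_operator_module[OF S w] .
      let ?di = "\<lambda>\<alpha> t. S w \<alpha> t - finite_rank n (ps i) w \<alpha> t" and ?dj = "\<lambda>\<alpha> t. S w \<alpha> t - finite_rank n (ps j) w \<alpha> t"
      have di: "module_family n ?di" and dj: "module_family n ?dj"
        using module_family_diff[OF Sw module_family_finite_rank[OF ps w]] by auto
      have ndi: "module_family n (\<lambda>\<alpha> t. - ?di \<alpha> t)" using module_family_scale[OF di, of "-1"] by simp
      have "finite_rank n ?qs w = (\<lambda>\<alpha> t. - ?di \<alpha> t + ?dj \<alpha> t)"
        by (simp add: finite_rank_append finite_rank_negate fun_eq_iff)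
      then have "Y_norm \<Lambda> n (finite_rank n ?qs w) \<le> Y_norm \<Lambda> n (\<lambda>\<alpha> t. - ?di \<alpha> t) + Y_norm \<Lambda> n ?dj"
        using Y_norm_add_le[OF ndi dj] by simp
      also have "\<dots> \<le> 1 / real (Suc i) * Y_norm \<Lambda> n w + 1 / real (Suc j) * Y_norm \<Lambda> n w"
        using Y_norm_minus[OF di] ap[OF w, of i] ap[OF w, of j] by linarith
      finally show "Y_norm \<Lambda> n (finite_rank n ?qs w) \<le> (1 / real (Suc i) + 1 / real (Suc j)) * Y_norm \<Lambda> n w"
        by (simp add: distrib_right)
    qed
    then show ?thesis using ketbra_append_negate[OF ps] by (simp add: z_def)
  qed
  have "Cauchy z"
  proof (rule metric_CauchyI)
    fix e :: real assume "0 < e"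
    then obtain M where M: "1 / real (Suc M) < e / 2" using nat_approx_posE[of "e / 2"] by auto
    have "dist (z i) (z j) < e" if "M \<le> i" "M \<le> j" for i j
    proof -
      have "1 / real (Suc i) \<le> 1 / real (Suc M)" "1 / real (Suc j) \<le> 1 / real (Suc M)"
        using that by (simp_all add: frac_le)
      then show ?thesis using near[of i j] M unfolding dist_norm by linarith
    qed
    then show "\<exists>M. \<forall>m\<ge>M. \<forall>n\<ge>M. dist (z m) (z n) < e" by blast
  qed
  then obtain l where l: "z \<longlonglongrightarrow> l" using Cauchy_convergent_iff convergent_def by blast
  have "l * rho n w = rho n (S w)" if w: "module_family n w" for w
  proof -
    have Sw: "module_family n (S w)" using compact_operator_module[OF S w] .
    have "(\<lambda>j. z j * rho n w) \<longlonglongrightarrow> l * rho n w" by (intro tendsto_intros l)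
    moreover have "(\<lambda>j. z j * rho n w) \<longlonglongrightarrow> rho n (S w)"
    proof (rule LIMSEQ_I)
      fix e :: real assume e: "0 < e"
      have "(\<lambda>j. 1 / real (Suc j) * Y_norm \<Lambda> n w) \<longlonglongrightarrow> 0 * Y_norm \<Lambda> n w"
        by (intro tendsto_intros LIMSEQ_Suc[OF lim_1_over_n])
      then have "\<forall>\<^sub>F j in sequentially. 1 / real (Suc j) * Y_norm \<Lambda> n w < e"
        using e order_tendstoD(2) by fastforce
      moreover have "norm (z j * rho n w - rho n (S w)) \<le> 1 / real (Suc j) * Y_norm \<Lambda> n w" for j
      proof -
        have m: "module_family n (finite_rank n (ps j) w)" using module_family_finite_rank[OF ps w] .
        have "rho n (S w) - z j * rho n w = rho n (\<lambda>\<alpha> t. S w \<alpha> t - finite_rank n (ps j) w \<alpha> t)"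
          using rho_diff[OF Sw m] ketbra_rho[OF ps w] by (simp add: z_def)
        then have "norm (rho n (S w) - z j * rho n w) \<le> 1 / real (Suc j) * Y_norm \<Lambda> n w"
          using norm_rho_le_Y_norm[OF module_family_diff[OF Sw m]] ap[OF w, of j] by simp
        then show ?thesis by (simp only: norm_minus_commute)
      qed
      ultimately show "\<exists>no. \<forall>j\<ge>no. norm (z j * rho n w - rho n (S w)) < e"
        unfolding eventually_sequentially by (meson le_less_trans)
    qed
    ultimately show ?thesis by (rule LIMSEQ_unique)
  qed
  then show ?thesis by blast
qed

lemma kappa_rho:
  assumes "S \<in> compact_operators \<Lambda> T n" "module_family n w"
  shows "kappa n S * rho n w = rho n (S w)"
proof -
  obtain z where z: "\<And>w. module_family n w \<Longrightarrow> z * rho n w = rho n (S w)" using kappa_exists[OF assms(1)] by blast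
  then have "kappa n S = z" by (rule kappa_eqI)
  then show ?thesis using z[OF assms(2)] by simp
qed

text \<open>Both sides are compared after multiplication by \<open>s\<^sub>\<alpha>\<^sup>* = (rho n 1\<^sub>\<alpha>)\<^sup>*\<close>, which turns products into inner products.\<close>

lemma kappa_adjoint:
  assumes S: "S \<in> compact_operators \<Lambda> T n" and R: "R \<in> compact_operators \<Lambda> T n"
    and adjoint: "\<And>x y. module_family n x \<Longrightarrow> module_family n y \<Longrightarrow> Y_inner \<Lambda> n (S x) y = Y_inner \<Lambda> n x (R y)"
  shows "kappa n R = adj (kappa n S)"
proof (rule kappa_eqI)
  fix w assume w: "module_family n w"
  have Rw: "module_family n (R w)" using compact_operator_module[OF R w] .
  show "adj (kappa n S) * rho n w = rho n (R w)"
  proof (rule eq_if_eq_at_vertices)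
    fix v assume v: "v \<in> vertices \<Lambda>"
    have "adj (s \<alpha>) * (adj (kappa n S) * rho n w) = adj (s \<alpha>) * rho n (R w)" if a: "\<alpha> \<in> of_degree \<Lambda> n" for \<alpha>
    proof -
      let ?u = "single \<alpha> (unit_at (src \<Lambda> \<alpha>))"
      have u: "module_family n ?u" using unit_single[OF a] .
      have "adj (s \<alpha>) * (adj (kappa n S) * rho n w) = adj (kappa n S * rho n ?u) * rho n w"
        using rho_unit_single[OF a] by (simp add: adj_mult mult.assoc)
      also have "\<dots> = rho 0 (Y_inner \<Lambda> n (S ?u) w)"
        using kappa_rho[OF S u] rho_inner[OF compact_operator_module[OF S u] w] by simp
      also have "\<dots> = adj (rho n ?u) * rho n (R w)" using adjoint[OF u w] rho_inner[OF u Rw] by simp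
      finally show ?thesis using rho_unit_single[OF a] by simp
    qed
    then have "(\<Sum>\<alpha>\<in>of_degree_at \<Lambda> v n. s \<alpha> * (adj (s \<alpha>) * (adj (kappa n S) * rho n w))) =
      (\<Sum>\<alpha>\<in>of_degree_at \<Lambda> v n. s \<alpha> * (adj (s \<alpha>) * rho n (R w)))"
      using of_degree_atD(4) by (intro sum.cong refl) simp
    moreover have "s v * y = (\<Sum>\<alpha>\<in>of_degree_at \<Lambda> v n. s \<alpha> * (adj (s \<alpha>) * y))" for y
      unfolding s_vertex_sum[OF v, of n] by (simp add: sum_distrib_right mult.assoc)
    ultimately show "s v * (adj (kappa n S) * rho n w) = s v * rho n (R w)" by simp
  qed
qed

lemma induced_hom_kappa: "induced_hom \<Lambda> T rho n (kappa n)"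
  unfolding induced_hom_def Y_module_iff
proof (intro conjI ballI allI impI)
  fix S R assume S: "S \<in> compact_operators \<Lambda> T n" and R: "R \<in> compact_operators \<Lambda> T n"
  show "kappa n (\<lambda>z \<alpha> t. S z \<alpha> t + R z \<alpha> t) = kappa n S + kappa n R"
    by (rule kappa_eqI)
      (simp add: distrib_right kappa_rho S R rho_add compact_operator_module)
  show "kappa n (S \<circ> R) = kappa n S * kappa n R"
    by (rule kappa_eqI) (simp add: mult.assoc kappa_rho S R compact_operator_module)
  assume "\<forall>x\<in>Y_module \<Lambda> T n. \<forall>y\<in>Y_module \<Lambda> T n. Y_inner \<Lambda> n (S x) y = Y_inner \<Lambda> n x (R y)"
  then show "kappa n R = adj (kappa n S)" using kappa_adjoint[OF S R] by (simp add: Y_module_iff)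
next
  fix c S assume S: "S \<in> compact_operators \<Lambda> T n"
  show "kappa n (\<lambda>z \<alpha> t. c * S z \<alpha> t) = c *\<^sub>C kappa n S"
    by (rule kappa_eqI) (simp add: mult_scaleC_left kappa_rho S rho_scale compact_operator_module)
next
  fix x y assume "x \<in> Y_module \<Lambda> T n" "y \<in> Y_module \<Lambda> T n"
  then show "kappa n (rank_one \<Lambda> T n x y) = rho n x * adj (rho n y)"
    by (intro kappa_eqI) (simp add: Y_module_iff rank_one_rho rank_one_def)
qed

theorem cp_covariant_rho: "cp_covariant \<Lambda> T \<sigma> rho"
  unfolding cp_covariant_def
proof (intro allI exI conjI ballI)
  fix n a assume a: "a \<in> coeff_algebra \<Lambda> T"
  show "kappa n (left_action \<Lambda> T \<sigma> n a) = rho 0 a"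
    by (rule kappa_eqI) (simp add: rho_left_action a)
qed (rule induced_hom_kappa)

end

section \<open>The graph algebra relations in a covariant representation\<close>

locale cp_representation = self_similar_system \<Lambda> T \<sigma> \<Phi>
  for \<Lambda> :: "('e, 'k::finite) kgraph" and T :: "'e \<Rightarrow> 't topology" and \<sigma> :: "'e \<Rightarrow> 't \<Rightarrow> 't"
    and \<Phi> :: "('e, 'k) inf_path \<Rightarrow> 'e \<times> 't" +
  fixes \<psi> :: "nat ^ 'k \<Rightarrow> ('e, 't) family \<Rightarrow> 'o::cstar_algebra"
  assumes rep: "representation \<Lambda> T \<sigma> \<psi>" and cov: "cp_covariant \<Lambda> T \<sigma> \<psi>"
begin

lemma psi_add: "module_family n x \<Longrightarrow> module_family n y \<Longrightarrow> \<psi> n (\<lambda>\<alpha> t. x \<alpha> t + y \<alpha> t) = \<psi> n x + \<psi> n y"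
  and psi_scale: "module_family n x \<Longrightarrow> \<psi> n (\<lambda>\<alpha> t. c * x \<alpha> t) = c *\<^sub>C \<psi> n x"
  and psi_zero_mult: "a \<in> coeff_algebra \<Lambda> T \<Longrightarrow> b \<in> coeff_algebra \<Lambda> T \<Longrightarrow> \<psi> 0 (\<lambda>v t. a v t * b v t) = \<psi> 0 a * \<psi> 0 b"
  and psi_zero_adj: "a \<in> coeff_algebra \<Lambda> T \<Longrightarrow> \<psi> 0 (\<lambda>v t. cnj (a v t)) = adj (\<psi> 0 a)"
  and psi_mult: "module_family n x \<Longrightarrow> module_family m y \<Longrightarrow> \<psi> n x * \<psi> m y = \<psi> (n + m) (Y_mult \<Lambda> \<sigma> n m x y)"
  and psi_inner: "module_family n x \<Longrightarrow> module_family n y \<Longrightarrow> adj (\<psi> n x) * \<psi> n y = \<psi> 0 (Y_inner \<Lambda> n x y)"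
proof -
  note r = rep[unfolded representation_def]
  show "module_family n x \<Longrightarrow> module_family n y \<Longrightarrow> \<psi> n (\<lambda>\<alpha> t. x \<alpha> t + y \<alpha> t) = \<psi> n x + \<psi> n y"
    using r[THEN conjunct1] by (simp add: Y_module_iff)
  note r = r[THEN conjunct2]
  show "module_family n x \<Longrightarrow> \<psi> n (\<lambda>\<alpha> t. c * x \<alpha> t) = c *\<^sub>C \<psi> n x"
    using r[THEN conjunct1] by (simp add: Y_module_iff)
  note r = r[THEN conjunct2]
  show "a \<in> coeff_algebra \<Lambda> T \<Longrightarrow> b \<in> coeff_algebra \<Lambda> T \<Longrightarrow> \<psi> 0 (\<lambda>v t. a v t * b v t) = \<psi> 0 a * \<psi> 0 b"
    using r[THEN conjunct1] by simp
  note r = r[THEN conjunct2]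
  show "a \<in> coeff_algebra \<Lambda> T \<Longrightarrow> \<psi> 0 (\<lambda>v t. cnj (a v t)) = adj (\<psi> 0 a)"
    using r[THEN conjunct1] by simp
  note r = r[THEN conjunct2]
  show "module_family n x \<Longrightarrow> module_family m y \<Longrightarrow> \<psi> n x * \<psi> m y = \<psi> (n + m) (Y_mult \<Lambda> \<sigma> n m x y)"
    using r[THEN conjunct1] by (simp add: Y_module_iff)
  show "module_family n x \<Longrightarrow> module_family n y \<Longrightarrow> adj (\<psi> n x) * \<psi> n y = \<psi> 0 (Y_inner \<Lambda> n x y)"
    using r[THEN conjunct2] by (simp add: Y_module_iff)
qed

lemma psi_zero_family: "\<psi> n (\<lambda>_ _. 0) = 0"
  using psi_scale[OF module_family_zero, where c = 0 and n = n] by simp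

lemma psi_diff:
  assumes "module_family n x" "module_family n y"
  shows "\<psi> n (\<lambda>\<alpha> t. x \<alpha> t - y \<alpha> t) = \<psi> n x - \<psi> n y"
  using psi_add[OF assms(1) module_family_scale[OF assms(2), of "-1"]] psi_scale[OF assms(2), of "-1"]
  by (simp add: scaleC_minus1)

lemma psi_sum:
  assumes "\<And>i. i \<in> I \<Longrightarrow> module_family n (y i)"
  shows "\<psi> n (\<lambda>\<alpha> t. \<Sum>i\<in>I. y i \<alpha> t) = (\<Sum>i\<in>I. \<psi> n (y i))"
  using assms
proof (induction I rule: infinite_finite_induct)
  case (insert i I)
  then show ?case using psi_add[of n "y i" "\<lambda>\<alpha> t. \<Sum>i\<in>I. y i \<alpha> t"] module_family_sum[of I n y] by simp
qed (simp_all add: psi_zero_family)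

text \<open>The function \<open>b = 1 - sqrt (1 - a\<^sup>2)\<close> belongs to \<open>A\<close> because it vanishes where \<open>a\<close> does and \<open>\<bar>b\<bar> \<le> \<bar>a\<bar>\<close>. It satisfies
\<open>a\<^sup>2 + b\<^sup>2 = 2b\<close>, a relation that \<open>\<psi> 0\<close> preserves.\<close>

lemma norm_psi_zero_real_le_1:
  assumes a: "a \<in> coeff_algebra \<Lambda> T" and real: "\<And>v t. cnj (a v t) = a v t" and le: "\<And>v t. cmod (a v t) \<le> 1"
  shows "norm (\<psi> 0 a) \<le> 1"
proof -
  \<comment> \<open>The minimum only serves to make \<open>h\<close> continuous on the whole plane.\<close>
  define h where "h z = complex_of_real (1 - sqrt (1 - (min 1 (cmod z))\<^sup>2))" for z
  have hle: "cmod (h z) \<le> cmod z" for z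
  proof -
    define r where "r = min 1 (cmod z)"
    have r: "0 \<le> r" "r \<le> 1" "r \<le> cmod z" by (auto simp: r_def)
    then have r2: "0 \<le> 1 - r\<^sup>2" "1 - r\<^sup>2 \<le> 1" by (simp_all add: power_le_one)
    have "1 - r\<^sup>2 \<le> sqrt (1 - r\<^sup>2)"
      by (rule real_le_rsqrt) (use r2 in \<open>simp add: power2_eq_square mult_left_le\<close>)
    moreover have "r\<^sup>2 \<le> r" using r by (simp add: power2_eq_square mult_left_le)
    moreover have "sqrt (1 - r\<^sup>2) \<le> 1" using r2 by simp
    ultimately have "\<bar>1 - sqrt (1 - r\<^sup>2)\<bar> \<le> cmod z" using r by linarith
    then show ?thesis unfolding h_def r_def[symmetric] by (simp only: norm_of_real)
  qed
  define b where "b = (\<lambda>v t. h (a v t))"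
  have b: "b \<in> coeff_algebra \<Lambda> T"
    unfolding b_def
    by (rule coeff_unop[OF a _ _ hle]) (auto simp: h_def intro!: continuous_intros)
  have bb: "a v t * a v t + b v t * b v t = b v t + b v t" for v t
  proof -
    obtain r where r: "a v t = complex_of_real r" using real[of v t] by (metis Reals_cases complex_cnj_cancel_iff Reals_cnj_iff)
    have r2: "r\<^sup>2 \<le> 1" using le[of v t] r by (simp add: abs_square_le_1)
    have "min 1 (cmod (a v t)) = \<bar>r\<bar>" using le[of v t] r by simp
    then have bq: "b v t = complex_of_real (1 - sqrt (1 - r\<^sup>2))" by (simp add: b_def h_def)
    define q where "q = sqrt (1 - r\<^sup>2)"
    have "q * q = 1 - r\<^sup>2" using r2 by (simp add: q_def)
    then have "r * r + (1 - q) * (1 - q) = (1 - q) + (1 - q)" by (simp add: algebra_simps power2_eq_square)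
    then show ?thesis unfolding bq r q_def[symmetric] by (metis of_real_add of_real_mult)
  qed
  show ?thesis
  proof (rule norm_le_1_of_squares[of "\<psi> 0 a" "\<psi> 0 b"])
    show "adj (\<psi> 0 a) = \<psi> 0 a" using psi_zero_adj[OF a, symmetric] by (simp add: real)
    show "adj (\<psi> 0 b) = \<psi> 0 b" using psi_zero_adj[OF b, symmetric] by (simp add: b_def h_def)
    show "\<psi> 0 a * \<psi> 0 b = \<psi> 0 b * \<psi> 0 a"
    proof -
      have "\<psi> 0 a * \<psi> 0 b = \<psi> 0 (\<lambda>v t. a v t * b v t)" by (rule psi_zero_mult[OF a b, symmetric])
      also have "(\<lambda>v t. a v t * b v t) = (\<lambda>v t. b v t * a v t)" by (intro ext mult.commute)
      also have "\<psi> 0 \<dots> = \<psi> 0 b * \<psi> 0 a" by (rule psi_zero_mult[OF b a])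
      finally show ?thesis .
    qed
    have "\<psi> 0 a * \<psi> 0 a + \<psi> 0 b * \<psi> 0 b = \<psi> 0 (\<lambda>v t. a v t * a v t + b v t * b v t)"
      using psi_add[of 0 "\<lambda>v t. a v t * a v t" "\<lambda>v t. b v t * b v t"] coeff_mult[OF a a] coeff_mult[OF b b]
        psi_zero_mult[OF a a] psi_zero_mult[OF b b] module_family_zero_iff_coeff by simp
    also have "(\<lambda>v t. a v t * a v t + b v t * b v t) = (\<lambda>v t. b v t + b v t)" by (intro ext bb)
    also have "\<psi> 0 \<dots> = \<psi> 0 b + \<psi> 0 b"
      by (rule psi_add) (use b module_family_zero_iff_coeff in blast)+
    finally show "\<psi> 0 a * \<psi> 0 a + \<psi> 0 b * \<psi> 0 b = \<psi> 0 b + \<psi> 0 b" .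
  qed
qed

lemma norm_psi_zero_le:
  assumes a: "a \<in> coeff_algebra \<Lambda> T" and le: "\<And>v t. cmod (a v t) \<le> M"
  shows "norm (\<psi> 0 a) \<le> M"
proof -
  have M0: "0 \<le> M" using le[of undefined undefined] norm_ge_zero order_trans by blast
  have bound: "norm (\<psi> 0 a) \<le> K" if K: "0 < K" "M \<le> K" for K
  proof -
    define c where "c = complex_of_real (1 / (K * K))"
    define b where "b = (\<lambda>v t. c * (cnj (a v t) * a v t))"
    have ca: "(\<lambda>v t. cnj (a v t)) \<in> coeff_algebra \<Lambda> T" by (rule coeff_unop[OF a]) (auto intro!: continuous_intros)
    have aa: "(\<lambda>v t. cnj (a v t) * a v t) \<in> coeff_algebra \<Lambda> T" by (rule coeff_mult[OF ca a])
    have "norm (\<psi> 0 b) \<le> 1"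
    proof (rule norm_psi_zero_real_le_1)
      show "b \<in> coeff_algebra \<Lambda> T" unfolding b_def by (rule coeff_scale[OF aa])
      show "cnj (b v t) = b v t" for v t by (simp add: b_def c_def mult.commute)
      fix v t
      have "cmod (a v t) \<le> K" using le[of v t] K by linarith
      then have "cmod (a v t) * cmod (a v t) \<le> K * K" by (intro mult_mono) (use K in auto)
      then show "cmod (b v t) \<le> 1" using K by (simp add: b_def c_def norm_mult norm_divide)
    qed
    moreover have "\<psi> 0 b = c *\<^sub>C (adj (\<psi> 0 a) * \<psi> 0 a)"
      unfolding b_def using psi_scale[of 0 "\<lambda>v t. cnj (a v t) * a v t"] aa module_family_zero_iff_coeff
        psi_zero_mult[OF ca a] psi_zero_adj[OF a] by simp
    ultimately have "1 / (K * K) * (norm (\<psi> 0 a))\<^sup>2 \<le> 1"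
      using K by (simp add: c_def norm_scaleC cstar_identity norm_divide norm_mult)
    then have "(norm (\<psi> 0 a))\<^sup>2 \<le> K\<^sup>2" using K by (simp add: divide_simps power2_eq_square)
    then show ?thesis using K by (auto intro: power2_le_imp_le[OF _ order_less_imp_le])
  qed
  have "norm (\<psi> 0 a) \<le> M + e" if "0 < e" for e using bound[of "M + e"] that M0 by simp
  then show ?thesis by (rule field_le_epsilon)
qed

lemma norm_psi_le:
  assumes y: "module_family n y" and M: "bounded_by n y M"
  shows "norm (\<psi> n y) \<le> M"
proof -
  have "(norm (\<psi> n y))\<^sup>2 = norm (\<psi> 0 (Y_inner \<Lambda> n y y))"
    using psi_inner[OF y y] cstar_identity[of "\<psi> n y"] by simp
  also have "\<dots> \<le> M * M" by (rule norm_psi_zero_le[OF Y_inner_coeff[OF y y] Y_inner_le[OF y y M M]])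
  finally show ?thesis by - (rule power2_le_imp_le[OF _ bounded_by_nonneg[OF M]]; simp add: power2_eq_square)
qed

lemma psi_right_action:
  assumes x: "module_family n x" and a: "a \<in> coeff_algebra \<Lambda> T"
  shows "\<psi> n x * \<psi> 0 a = \<psi> n (right_action \<Lambda> x a)"
proof -
  have "Y_mult \<Lambda> \<sigma> n 0 x a \<gamma> t = right_action \<Lambda> x a \<gamma> t" for \<gamma> t
  proof (cases "\<gamma> \<in> of_degree \<Lambda> n")
    case True
    then have ga: "\<gamma> \<in> arrows \<Lambda>" by (rule of_degree_arrow)
    have s: "src \<Lambda> \<gamma> \<in> vertices \<Lambda>" "src \<Lambda> \<gamma> = rng \<Lambda> (src \<Lambda> \<gamma>)" using src_vertex[OF ga] rng_src[OF ga] by auto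
    have "Y_mult \<Lambda> \<sigma> n 0 x a (cmp \<Lambda> \<gamma> (src \<Lambda> \<gamma>)) t = x \<gamma> (\<sigma> (src \<Lambda> \<gamma>) t) * a (src \<Lambda> \<gamma>) t"
      by (rule Y_mult_cmp[OF True s])
    also have "\<dots> = x \<gamma> t * a (src \<Lambda> \<gamma>) t"
      using maps_vertex[OF s(1), of t] C0_zero_outside[OF coeff_algebraD(1)[OF a s(1)], of t]
      by (cases "t \<in> topspace (T (src \<Lambda> \<gamma>))") auto
    finally show ?thesis by (simp add: cmp_src[OF ga] right_action_def)
  next
    case False
    then have "{(\<alpha>, \<beta>). \<alpha> \<in> of_degree \<Lambda> n \<and> \<beta> \<in> vertices \<Lambda> \<and> src \<Lambda> \<alpha> = rng \<Lambda> \<beta> \<and> cmp \<Lambda> \<alpha> \<beta> = \<gamma>} = {}"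
      by (auto simp: of_degree_def deg_cmp cmp_arrow)
    then have "Y_mult \<Lambda> \<sigma> n 0 x a \<gamma> t = 0" unfolding Y_mult_def by (simp only: sum.empty)
    then show ?thesis using module_familyD(2)[OF x False] by (simp add: right_action_def)
  qed
  then have "Y_mult \<Lambda> \<sigma> n 0 x a = right_action \<Lambda> x a" by blast
  then show ?thesis using psi_mult[OF x, of 0 a] a module_family_zero_iff_coeff by simp
qed

definition gen :: "'e \<Rightarrow> 'o" where
  "gen \<alpha> = \<psi> (deg \<Lambda> \<alpha>) (single \<alpha> (unit_at (src \<Lambda> \<alpha>)))"

lemma gen_eq: "\<alpha> \<in> of_degree \<Lambda> n \<Longrightarrow> gen \<alpha> = \<psi> n (single \<alpha> (unit_at (src \<Lambda> \<alpha>)))"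
  by (simp add: gen_def of_degree_def)

lemma gen_vertex: "v \<in> vertices \<Lambda> \<Longrightarrow> gen v = \<psi> 0 (single v (unit_at v))"
  using gen_eq[of v 0] vertex_facts(3)[of v] by simp

lemma gen_mult_psi_zero:
  assumes a: "\<alpha> \<in> of_degree \<Lambda> n" and f: "f \<in> C0 (T (src \<Lambda> \<alpha>))"
  shows "gen \<alpha> * \<psi> 0 (single (src \<Lambda> \<alpha>) f) = \<psi> n (single \<alpha> f)"
proof -
  have "right_action \<Lambda> (single \<alpha> (unit_at (src \<Lambda> \<alpha>))) (single (src \<Lambda> \<alpha>) f) = single \<alpha> f"
    using f by (auto simp: right_action_def single_def fun_eq_iff)
  then show ?thesis
    using psi_right_action[OF unit_single[OF a] single_coeff[OF src_vertex[OF of_degree_arrow[OF a]] f]] gen_eq[OF a] by simp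
qed

lemma adj_gen_mult_gen:
  assumes a: "\<alpha> \<in> of_degree \<Lambda> n" and b: "\<beta> \<in> of_degree \<Lambda> n"
  shows "adj (gen \<alpha>) * gen \<beta> = (if \<alpha> = \<beta> then gen (src \<Lambda> \<alpha>) else 0)"
proof -
  have "adj (gen \<alpha>) * gen \<beta> = \<psi> 0 (Y_inner \<Lambda> n (single \<alpha> (unit_at (src \<Lambda> \<alpha>))) (single \<beta> (unit_at (src \<Lambda> \<beta>))))"
    using psi_inner[OF unit_single[OF a] unit_single[OF b]] gen_eq[OF a] gen_eq[OF b] by simp
  also have "Y_inner \<Lambda> n (single \<alpha> (unit_at (src \<Lambda> \<alpha>))) (single \<beta> (unit_at (src \<Lambda> \<beta>))) =
    (if \<alpha> = \<beta> then single (src \<Lambda> \<alpha>) (unit_at (src \<Lambda> \<alpha>)) else (\<lambda>_ _. 0))"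
    unfolding fun_eq_iff inner_single_left[OF a] by (auto simp: single_def unit_at_def)
  finally show ?thesis
    using gen_vertex[OF src_vertex[OF of_degree_arrow[OF a]]] psi_zero_family[of 0] by (cases "\<alpha> = \<beta>") simp_all
qed

lemma gen_cmp:
  assumes a: "\<alpha> \<in> arrows \<Lambda>" and b: "\<beta> \<in> arrows \<Lambda>" and ab: "src \<Lambda> \<alpha> = rng \<Lambda> \<beta>"
  shows "gen \<alpha> * gen \<beta> = gen (cmp \<Lambda> \<alpha> \<beta>)"
proof -
  let ?n = "deg \<Lambda> \<alpha>" and ?m = "deg \<Lambda> \<beta>"
  let ?x = "single \<alpha> (unit_at (src \<Lambda> \<alpha>))" and ?y = "single \<beta> (unit_at (src \<Lambda> \<beta>))"
  have ad: "\<alpha> \<in> of_degree \<Lambda> ?n" and bd: "\<beta> \<in> of_degree \<Lambda> ?m" using a b by (auto simp: of_degree_def)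
  have "Y_mult \<Lambda> \<sigma> ?n ?m ?x ?y \<gamma> t = single (cmp \<Lambda> \<alpha> \<beta>) (unit_at (src \<Lambda> \<beta>)) \<gamma> t" for \<gamma> t
  proof (cases "\<exists>\<alpha>' \<beta>'. \<alpha>' \<in> of_degree \<Lambda> ?n \<and> \<beta>' \<in> of_degree \<Lambda> ?m \<and> src \<Lambda> \<alpha>' = rng \<Lambda> \<beta>' \<and> cmp \<Lambda> \<alpha>' \<beta>' = \<gamma>")
    case True
    then obtain \<alpha>' \<beta>' where g: "\<alpha>' \<in> of_degree \<Lambda> ?n" "\<beta>' \<in> of_degree \<Lambda> ?m" "src \<Lambda> \<alpha>' = rng \<Lambda> \<beta>'" "cmp \<Lambda> \<alpha>' \<beta>' = \<gamma>" by blast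
    have eq: "\<gamma> = cmp \<Lambda> \<alpha> \<beta> \<longleftrightarrow> \<alpha>' = \<alpha> \<and> \<beta>' = \<beta>"
    proof
      assume "\<gamma> = cmp \<Lambda> \<alpha> \<beta>"
      then have "cmp \<Lambda> \<alpha>' \<beta>' = cmp \<Lambda> \<alpha> \<beta>" using g(4) by simp
      then show "\<alpha>' = \<alpha> \<and> \<beta>' = \<beta>"
        using factorization_unique[OF of_degree_arrow[OF g(1)] of_degree_arrow[OF g(2)] g(3) a b ab] g(1)
        by (simp add: of_degree_def)
    qed (use g(4) in simp)
    have "Y_mult \<Lambda> \<sigma> ?n ?m ?x ?y \<gamma> t = ?x \<alpha>' (\<sigma> \<beta>' t) * ?y \<beta>' t"
      using Y_mult_cmp[OF g(1-3), of ?x ?y t] g(4) by simp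
    also have "\<dots> = single (cmp \<Lambda> \<alpha> \<beta>) (unit_at (src \<Lambda> \<beta>)) \<gamma> t"
    proof (cases "\<gamma> = cmp \<Lambda> \<alpha> \<beta>")
      case True
      then show ?thesis using eq sigma_in[OF b, of t] ab by (simp add: single_def unit_at_def)
    next
      case False
      then show ?thesis using eq by (auto simp: single_def)
    qed
    finally show ?thesis .
  next
    case False
    then have "{(\<alpha>', \<beta>'). \<alpha>' \<in> of_degree \<Lambda> ?n \<and> \<beta>' \<in> of_degree \<Lambda> ?m \<and> src \<Lambda> \<alpha>' = rng \<Lambda> \<beta>' \<and> cmp \<Lambda> \<alpha>' \<beta>' = \<gamma>} = {}" by blast
    then have "Y_mult \<Lambda> \<sigma> ?n ?m ?x ?y \<gamma> t = 0" unfolding Y_mult_def by (simp only: sum.empty)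
    moreover have "\<gamma> \<noteq> cmp \<Lambda> \<alpha> \<beta>" using False ad bd ab by blast
    ultimately show ?thesis by (simp add: single_def)
  qed
  then have "Y_mult \<Lambda> \<sigma> ?n ?m ?x ?y = single (cmp \<Lambda> \<alpha> \<beta>) (unit_at (src \<Lambda> (cmp \<Lambda> \<alpha> \<beta>)))"
    using src_cmp[OF a b ab] by (simp add: fun_eq_iff)
  then show ?thesis
    using psi_mult[OF unit_single[OF ad] unit_single[OF bd]] deg_cmp[OF a b ab] by (simp add: gen_def)
qed

lemma induced_hom_finite_sum:
  assumes \<kappa>: "induced_hom \<Lambda> T \<psi> n \<kappa>" and I: "finite I"
    and xy: "\<And>i. i \<in> I \<Longrightarrow> module_family n (x i)" "\<And>i. i \<in> I \<Longrightarrow> module_family n (y i)"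
  shows "(\<lambda>z \<alpha> t. \<Sum>i\<in>I. rank_one \<Lambda> T n (x i) (y i) z \<alpha> t) \<in> compact_operators \<Lambda> T n"
    and "\<kappa> (\<lambda>z \<alpha> t. \<Sum>i\<in>I. rank_one \<Lambda> T n (x i) (y i) z \<alpha> t) = (\<Sum>i\<in>I. \<psi> n (x i) * adj (\<psi> n (y i)))"
proof -
  have comp: "(\<lambda>z \<alpha> t. \<Sum>i\<in>J. rank_one \<Lambda> T n (x i) (y i) z \<alpha> t) \<in> compact_operators \<Lambda> T n" if J: "J \<subseteq> I" for J
    unfolding compact_operators_def mem_Collect_eq
  proof (intro conjI ballI allI impI)
    fix z assume z: "z \<in> Y_module \<Lambda> T n"
    have "module_family n (\<lambda>\<alpha> t. \<Sum>i\<in>J. rank_one \<Lambda> T n (x i) (y i) z \<alpha> t)"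
    proof (rule module_family_sum)
      fix i assume "i \<in> J"
      then show "module_family n (rank_one \<Lambda> T n (x i) (y i) z)"
        using module_family_right_action_coeff[OF xy(1) Y_inner_coeff[OF xy(2)]] z J by (auto simp: rank_one_def Y_module_iff)
    qed
    then show "(\<lambda>\<alpha> t. \<Sum>i\<in>J. rank_one \<Lambda> T n (x i) (y i) z \<alpha> t) \<in> Y_module \<Lambda> T n" by (simp add: Y_module_iff)
  next
    fix z assume "z \<notin> Y_module \<Lambda> T n"
    then show "(\<lambda>\<alpha> t. \<Sum>i\<in>J. rank_one \<Lambda> T n (x i) (y i) z \<alpha> t) = (\<lambda>_ _. 0)" by (simp add: rank_one_def)
  next
    fix \<epsilon> :: real assume "0 < \<epsilon>"
    have "finite J" using J I finite_subset by blast
    then obtain h where h: "bij_betw h {..<card J} J" using ex_bij_betw_nat_finite atLeast0LessThan by metis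
    have "Y_norm \<Lambda> n (\<lambda>\<alpha> t. (\<Sum>i\<in>J. rank_one \<Lambda> T n (x i) (y i) z \<alpha> t) -
        (\<Sum>i<card J. rank_one \<Lambda> T n (x (h i)) (y (h i)) z \<alpha> t)) \<le> \<epsilon> * Y_norm \<Lambda> n z"
      if z: "z \<in> Y_module \<Lambda> T n" for z
    proof -
      have "(\<Sum>i\<in>J. rank_one \<Lambda> T n (x i) (y i) z \<alpha> t) = (\<Sum>i<card J. rank_one \<Lambda> T n (x (h i)) (y (h i)) z \<alpha> t)" for \<alpha> t
        using sum.reindex_bij_betw[OF h, of "\<lambda>i. rank_one \<Lambda> T n (x i) (y i) z \<alpha> t"] by simp
      moreover have "Y_norm \<Lambda> n (\<lambda>(_ :: 'e) (_ :: 't). 0) = 0" by (simp add: Y_norm_def sup_norm_def Y_inner_def case_prod_unfold)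
      moreover have "0 \<le> \<epsilon> * Y_norm \<Lambda> n z" using \<open>0 < \<epsilon>\<close> Y_norm_nonneg z by (simp add: Y_module_iff)
      ultimately show ?thesis by simp
    qed
    moreover have "x (h i) \<in> Y_module \<Lambda> T n \<and> y (h i) \<in> Y_module \<Lambda> T n" if "i < card J" for i
      using xy[of "h i"] bij_betwE[OF h] that J by (auto simp: Y_module_iff)
    ultimately show "\<exists>N::nat. \<exists>x' y'. (\<forall>i<N. x' i \<in> Y_module \<Lambda> T n \<and> y' i \<in> Y_module \<Lambda> T n) \<and>
        (\<forall>z\<in>Y_module \<Lambda> T n. Y_norm \<Lambda> n (\<lambda>\<alpha> t. (\<Sum>i\<in>J. rank_one \<Lambda> T n (x i) (y i) z \<alpha> t) -
          (\<Sum>i<N. rank_one \<Lambda> T n (x' i) (y' i) z \<alpha> t)) \<le> \<epsilon> * Y_norm \<Lambda> n z)"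
      by - (rule exI[of _ "card J"], rule exI[of _ "\<lambda>i. x (h i)"], rule exI[of _ "\<lambda>i. y (h i)"], blast)
  qed
  show "(\<lambda>z \<alpha> t. \<Sum>i\<in>I. rank_one \<Lambda> T n (x i) (y i) z \<alpha> t) \<in> compact_operators \<Lambda> T n" by (rule comp) simp
  have "\<kappa> (\<lambda>z \<alpha> t. \<Sum>i\<in>J. rank_one \<Lambda> T n (x i) (y i) z \<alpha> t) = (\<Sum>i\<in>J. \<psi> n (x i) * adj (\<psi> n (y i)))"
    if "finite J" "J \<subseteq> I" for J
    using that
  proof (induction J)
    case empty
    have "(\<lambda>z \<alpha> t. 0) \<in> compact_operators \<Lambda> T n" using comp[of "{}"] by simp
    then have "\<kappa> (\<lambda>z \<alpha> t. 0) = 0 *\<^sub>C \<kappa> (\<lambda>z \<alpha> t. 0)"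
      using \<kappa>[unfolded induced_hom_def, THEN conjunct2, THEN conjunct1, rule_format, of _ 0] by simp
    then show ?case by simp
  next
    case (insert j J)
    have 1: "rank_one \<Lambda> T n (x j) (y j) \<in> compact_operators \<Lambda> T n"
      using comp[of "{j}"] insert.prems by simp
    have 2: "(\<lambda>z \<alpha> t. \<Sum>i\<in>J. rank_one \<Lambda> T n (x i) (y i) z \<alpha> t) \<in> compact_operators \<Lambda> T n"
      using comp insert.prems by simp
    have 3: "\<kappa> (rank_one \<Lambda> T n (x j) (y j)) = \<psi> n (x j) * adj (\<psi> n (y j))"
      using \<kappa>[unfolded induced_hom_def, THEN conjunct2, THEN conjunct2] xy[of j] insert.prems
      by (simp add: Y_module_iff)
    have "\<kappa> (\<lambda>z \<alpha> t. rank_one \<Lambda> T n (x j) (y j) z \<alpha> t + (\<Sum>i\<in>J. rank_one \<Lambda> T n (x i) (y i) z \<alpha> t)) =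
      \<kappa> (rank_one \<Lambda> T n (x j) (y j)) + \<kappa> (\<lambda>z \<alpha> t. \<Sum>i\<in>J. rank_one \<Lambda> T n (x i) (y i) z \<alpha> t)"
      using \<kappa>[unfolded induced_hom_def, THEN conjunct1, rule_format, OF 1 2] by simp
    then show ?case using insert 3 by simp
  qed
  then show "\<kappa> (\<lambda>z \<alpha> t. \<Sum>i\<in>I. rank_one \<Lambda> T n (x i) (y i) z \<alpha> t) = (\<Sum>i\<in>I. \<psi> n (x i) * adj (\<psi> n (y i)))"
    using I by blast
qed

text \<open>Evaluation of covariance at \<open>f\<close>: its left action on \<open>Y\<^sub>n\<close> is the finite sum of the rank-one operators
given by \<open>f \<circ> \<sigma>\<^sub>\<alpha>\<close> and \<open>1\<^sub>\<alpha>\<close> in the summands \<open>X\<^sub>\<alpha>\<close>, \<open>\<alpha> \<in> v\<Lambda>\<^sup>n\<close>.\<close>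

lemma psi_zero_single:
  assumes v: "v \<in> vertices \<Lambda>" and f: "f \<in> C0 (T v)"
  shows "\<psi> 0 (single v f) = (\<Sum>\<alpha>\<in>of_degree_at \<Lambda> v n. \<psi> n (single \<alpha> (pullback \<alpha> f)) * adj (gen \<alpha>))"
proof -
  let ?E = "of_degree_at \<Lambda> v n"
  let ?x = "\<lambda>\<alpha>. single \<alpha> (pullback \<alpha> f)" and ?y = "\<lambda>\<alpha>. single \<alpha> (unit_at (src \<Lambda> \<alpha>))"
  obtain \<kappa> where \<kappa>: "induced_hom \<Lambda> T \<psi> n \<kappa>"
    "\<And>a. a \<in> coeff_algebra \<Lambda> T \<Longrightarrow> \<kappa> (left_action \<Lambda> T \<sigma> n a) = \<psi> 0 a"
    using cov unfolding cp_covariant_def by blast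
  have pb: "pullback \<alpha> f \<in> C0 (T (src \<Lambda> \<alpha>))" if "\<alpha> \<in> ?E" for \<alpha>
    using pullback_C0[of \<alpha> f] f of_degree_atD[OF that] by simp
  have x: "module_family n (?x \<alpha>)" if "\<alpha> \<in> ?E" for \<alpha>
    using single_module[OF of_degree_atD(4)[OF that] pb[OF that]] .
  have y: "module_family n (?y \<alpha>)" if "\<alpha> \<in> ?E" for \<alpha>
    using unit_single[OF of_degree_atD(4)[OF that]] .
  have "left_action \<Lambda> T \<sigma> n (single v f) z \<beta> t = (\<Sum>\<alpha>\<in>?E. rank_one \<Lambda> T n (?x \<alpha>) (?y \<alpha>) z \<beta> t)" for z \<beta> t
  proof (cases "z \<in> Y_module \<Lambda> T n")
    case True
    then have z: "module_family n z" by (simp add: Y_module_iff)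
    have "rank_one \<Lambda> T n (?x \<alpha>) (?y \<alpha>) z \<beta> t = (if \<beta> = \<alpha> then f (\<sigma> \<beta> t) * z \<beta> t else 0)" if a: "\<alpha> \<in> ?E" for \<alpha>
    proof (cases "\<beta> = \<alpha>")
      case eq: True
      have za: "z \<alpha> \<in> C0 (T (src \<Lambda> \<alpha>))" using module_familyD(1)[OF z of_degree_atD(4)[OF a]] .
      have "rank_one \<Lambda> T n (?x \<alpha>) (?y \<alpha>) z \<beta> t = pullback \<alpha> f t * (cnj (unit_at (src \<Lambda> \<alpha>) t) * z \<alpha> t)"
        unfolding rank_one_def right_action_def if_P[OF True] inner_single_left[OF of_degree_atD(4)[OF a]]
        using eq by (simp add: single_def)
      also have "cnj (unit_at (src \<Lambda> \<alpha>) t) * z \<alpha> t = z \<alpha> t" using C0_zero_outside[OF za, of t] by (auto simp: unit_at_def)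
      also have "pullback \<alpha> f t * z \<alpha> t = f (\<sigma> \<alpha> t) * z \<alpha> t" by (rule mult_pullback[OF za])
      finally show ?thesis using eq by simp
    next
      case False
      then show ?thesis using True by (simp add: rank_one_def right_action_def single_def)
    qed
    then have "(\<Sum>\<alpha>\<in>?E. rank_one \<Lambda> T n (?x \<alpha>) (?y \<alpha>) z \<beta> t) = (\<Sum>\<alpha>\<in>?E. if \<beta> = \<alpha> then f (\<sigma> \<beta> t) * z \<beta> t else 0)"
      by (rule sum.cong[OF refl])
    also have "\<dots> = (if \<beta> \<in> ?E then f (\<sigma> \<beta> t) * z \<beta> t else 0)"
      using finite_of_degree_at[OF v] by (simp add: sum.delta')
    also have "\<dots> = left_action \<Lambda> T \<sigma> n (single v f) z \<beta> t"
      using True module_familyD(2)[OF z, of \<beta>] by (auto simp: left_action_def single_def of_degree_at_def)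
    finally show ?thesis by simp
  qed (simp add: left_action_def rank_one_def)
  then have la: "left_action \<Lambda> T \<sigma> n (single v f) = (\<lambda>z \<beta> t. \<Sum>\<alpha>\<in>?E. rank_one \<Lambda> T n (?x \<alpha>) (?y \<alpha>) z \<beta> t)"
    by (simp add: fun_eq_iff)
  have "\<psi> 0 (single v f) = \<kappa> (left_action \<Lambda> T \<sigma> n (single v f))" using \<kappa>(2)[OF single_coeff[OF v f]] by simp
  also have "\<dots> = (\<Sum>\<alpha>\<in>?E. \<psi> n (?x \<alpha>) * adj (\<psi> n (?y \<alpha>)))"
    unfolding la by (rule induced_hom_finite_sum(2)[OF \<kappa>(1) finite_of_degree_at[OF v] x y])
  also have "\<dots> = (\<Sum>\<alpha>\<in>?E. \<psi> n (?x \<alpha>) * adj (gen \<alpha>))"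
    using gen_eq[OF of_degree_atD(4)] by (intro sum.cong refl) simp
  finally show ?thesis .
qed

text \<open>The products \<open>(gen \<alpha>)\<^sup>* gen \<beta>\<close> are inner products in \<open>Y\<close>, and the sum relation is \<open>psi_zero_single\<close> for \<open>f = 1\<^sub>v\<close>.\<close>

theorem ck_family_gen: "ck_family \<Lambda> gen"
  unfolding ck_family_def
proof (intro conjI ballI allI impI)
  have adj_gen: "adj (gen \<alpha>) * gen \<alpha> = gen (src \<Lambda> \<alpha>)" if "\<alpha> \<in> arrows \<Lambda>" for \<alpha>
    using adj_gen_mult_gen[of \<alpha> "deg \<Lambda> \<alpha>" \<alpha>] that by (simp add: of_degree_def)
  show "adj (gen \<alpha>) * gen \<alpha> = gen (src \<Lambda> \<alpha>)" if "\<alpha> \<in> arrows \<Lambda>" for \<alpha> by (rule adj_gen[OF that])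
  show "partial_isometry (gen \<alpha>)" if a: "\<alpha> \<in> arrows \<Lambda>" for \<alpha>
  proof -
    have "gen \<alpha> * adj (gen \<alpha>) * gen \<alpha> = gen \<alpha> * gen (src \<Lambda> \<alpha>)" using adj_gen[OF a] by (simp add: mult.assoc)
    also have "\<dots> = gen \<alpha>" using gen_cmp[OF a src_arrow[OF a]] rng_src[OF a] cmp_src[OF a] by simp
    finally show ?thesis by (simp add: partial_isometry_def)
  qed
  show "projection (gen v)" if v: "v \<in> vertices \<Lambda>" for v
  proof -
    have "adj (gen v) * gen v = gen v" using adj_gen vertex_facts[OF v] by simp
    then have "adj (gen v) = gen v" by (metis adj_adj adj_mult)
    then show ?thesis using \<open>adj (gen v) * gen v = gen v\<close> by (simp add: projection_def)
  qed
  show "gen v * gen w = 0" if vw: "v \<in> vertices \<Lambda>" "w \<in> vertices \<Lambda>" "v \<noteq> w" for v w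
  proof -
    have "adj (gen v) * gen v = gen v" using adj_gen vertex_facts[OF vw(1)] by simp
    then have "adj (gen v) = gen v" by (metis adj_adj adj_mult)
    then show ?thesis using adj_gen_mult_gen[OF vw(1,2)] vw(3) by simp
  qed
  show "gen \<alpha> * gen \<beta> = gen (cmp \<Lambda> \<alpha> \<beta>)" if "\<alpha> \<in> arrows \<Lambda>" "\<beta> \<in> arrows \<Lambda>" "src \<Lambda> \<alpha> = rng \<Lambda> \<beta>" for \<alpha> \<beta>
    using gen_cmp that by blast
  show "gen v = (\<Sum>\<alpha>\<in>of_degree_at \<Lambda> v n. gen \<alpha> * adj (gen \<alpha>))" if v: "v \<in> vertices \<Lambda>" for v n
  proof -
    have "gen v = (\<Sum>\<alpha>\<in>of_degree_at \<Lambda> v n. \<psi> n (single \<alpha> (pullback \<alpha> (unit_at v))) * adj (gen \<alpha>))"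
      using psi_zero_single[OF v unit_at_C0[OF v]] gen_vertex[OF v] by simp
    also have "\<dots> = (\<Sum>\<alpha>\<in>of_degree_at \<Lambda> v n. gen \<alpha> * adj (gen \<alpha>))"
    proof (rule sum.cong[OF refl])
      fix \<alpha> assume a: "\<alpha> \<in> of_degree_at \<Lambda> v n"
      have "pullback \<alpha> (unit_at v) = unit_at (src \<Lambda> \<alpha>)" using pullback_unit[of \<alpha>] of_degree_atD[OF a] by simp
      then show "\<psi> n (single \<alpha> (pullback \<alpha> (unit_at v))) * adj (gen \<alpha>) = gen \<alpha> * adj (gen \<alpha>)"
        using gen_eq[OF of_degree_atD(4)[OF a]] by simp
    qed
    finally show ?thesis .
  qed
qed

end

section \<open>The isomorphism\<close>

locale universal_pair = self_similar_graph_algebra \<Lambda> T \<sigma> \<Phi> s + cp_representation \<Lambda> T \<sigma> \<Phi> \<psi>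
  for \<Lambda> :: "('e, 'k::finite) kgraph" and T :: "'e \<Rightarrow> 't topology" and \<sigma> :: "'e \<Rightarrow> 't \<Rightarrow> 't"
    and \<Phi> :: "('e, 'k) inf_path \<Rightarrow> 'e \<times> 't" and s :: "'e \<Rightarrow> 'c::cstar_algebra"
    and \<psi> :: "nat ^ 'k \<Rightarrow> ('e, 't) family \<Rightarrow> 'o::cstar_algebra"
begin

text \<open>Covariance writes \<open>\<psi>(f)\<close> as the sum of \<open>gen \<alpha> \<psi>(f \<circ> \<sigma>\<^sub>\<alpha>) (gen \<alpha>)\<^sup>*\<close> over \<open>\<alpha> \<in> v\<Lambda>\<^sup>n\<close>. The points \<open>\<sigma>\<^sub>\<alpha> t\<close> are images of paths in
the cylinder of \<open>\<alpha>\<close>, so for large \<open>n\<close> the function \<open>f \<circ> \<sigma>\<^sub>\<alpha>\<close> differs little from the value of \<open>f\<close> at the sample point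
of that cylinder. With these values in place of \<open>f \<circ> \<sigma>\<^sub>\<alpha>\<close> the sum is the image under \<open>\<pi>\<close> of a Riemann sum.\<close>

lemma hom_iota:
  assumes hom: "star_hom \<pi>" and \<pi>: "\<And>\<alpha>. \<alpha> \<in> arrows \<Lambda> \<Longrightarrow> \<pi> (s \<alpha>) = gen \<alpha>"
    and v: "v \<in> vertices \<Lambda>" and f: "f \<in> C0 (T v)"
  shows "\<pi> (iota v f) = \<psi> 0 (single v f)"
proof -
  interpret G: cuntz_krieger_family \<Lambda> gen by unfold_locales (rule ck_family_gen)
  have close: "\<forall>\<^sub>F N in sequentially. norm (\<psi> 0 (single v f) - \<pi> (approx (vec N) v f)) \<le> \<epsilon>" if e: "0 < \<epsilon>" for \<epsilon>
  proof -
    obtain N where N: "\<forall>n \<alpha>. vec N \<le> n \<longrightarrow> \<alpha> \<in> of_degree_at \<Lambda> v n \<longrightarrow>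
      (\<forall>x\<in>cylinder \<Lambda> \<alpha>. \<forall>y\<in>cylinder \<Lambda> \<alpha>. cmod (f (code x) - f (code y)) \<le> \<epsilon>)"
      using small_oscillation[OF v f e] by blast
    have "norm (\<psi> 0 (single v f) - \<pi> (approx (vec M) v f)) \<le> \<epsilon>" if M: "N \<le> M" for M
    proof -
      let ?n = "vec M :: nat ^ 'k" and ?E = "of_degree_at \<Lambda> v (vec M)"
      define c where "c \<alpha> = f (code (base \<alpha>))" for \<alpha>
      define g where "g \<alpha> t = pullback \<alpha> f t - c \<alpha> * unit_at (src \<Lambda> \<alpha>) t" for \<alpha> t
      have "vec N \<le> ?n" using M by (simp add: less_eq_vec_def)
      then have osc: "cmod (f (code x) - f (code y)) \<le> \<epsilon>"
        if "\<alpha> \<in> ?E" "x \<in> cylinder \<Lambda> \<alpha>" "y \<in> cylinder \<Lambda> \<alpha>" for \<alpha> x y using N that by blast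
      have gc: "g \<alpha> \<in> C0 (T (src \<Lambda> \<alpha>))" if "\<alpha> \<in> ?E" for \<alpha>
      proof -
        have w: "src \<Lambda> \<alpha> \<in> vertices \<Lambda>" using src_vertex of_degree_atD(1)[OF that] by blast
        have "pullback \<alpha> f \<in> C0 (T (src \<Lambda> \<alpha>))" using pullback_C0[of \<alpha> f] f of_degree_atD[OF that] by simp
        then show ?thesis unfolding g_def using C0_diff[OF w _ C0_scale[OF w unit_at_C0[OF w]]] by blast
      qed
      have "\<pi> (approx ?n v f) = (\<Sum>\<alpha>\<in>?E. c \<alpha> *\<^sub>C (gen \<alpha> * adj (gen \<alpha>)))"
        unfolding approx_def star_hom_sum[OF hom]
        by (intro sum.cong refl) (simp add: star_homD[OF hom] \<pi> of_degree_atD(1) c_def)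
      then have "\<psi> 0 (single v f) - \<pi> (approx ?n v f) =
        (\<Sum>\<alpha>\<in>?E. \<psi> ?n (single \<alpha> (pullback \<alpha> f)) * adj (gen \<alpha>) - c \<alpha> *\<^sub>C (gen \<alpha> * adj (gen \<alpha>)))"
        by (simp add: psi_zero_single[OF v f, of ?n] sum_subtractf)
      also have "\<dots> = (\<Sum>\<alpha>\<in>?E. gen \<alpha> * \<psi> 0 (single (src \<Lambda> \<alpha>) (g \<alpha>)) * adj (gen \<alpha>))"
      proof (rule sum.cong[OF refl])
        fix \<alpha> assume a: "\<alpha> \<in> ?E"
        have ad: "\<alpha> \<in> of_degree \<Lambda> ?n" and w: "src \<Lambda> \<alpha> \<in> vertices \<Lambda>"
          using of_degree_atD[OF a] src_vertex by auto
        have pb: "pullback \<alpha> f \<in> C0 (T (src \<Lambda> \<alpha>))" using pullback_C0[of \<alpha> f] f of_degree_atD[OF a] by simp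
        have sg: "single \<alpha> (g \<alpha>) = (\<lambda>\<beta> t. single \<alpha> (pullback \<alpha> f) \<beta> t - c \<alpha> * single \<alpha> (unit_at (src \<Lambda> \<alpha>)) \<beta> t)"
          by (auto simp: single_def g_def fun_eq_iff)
        have "gen \<alpha> * \<psi> 0 (single (src \<Lambda> \<alpha>) (g \<alpha>)) = \<psi> ?n (single \<alpha> (g \<alpha>))" by (rule gen_mult_psi_zero[OF ad gc[OF a]])
        also have "\<dots> = \<psi> ?n (single \<alpha> (pullback \<alpha> f)) - c \<alpha> *\<^sub>C gen \<alpha>"
          unfolding sg gen_eq[OF ad]
          using psi_diff[OF single_module[OF ad pb] module_family_scale[OF unit_single[OF ad]]] psi_scale[OF unit_single[OF ad]]
          by simp
        finally show "\<psi> ?n (single \<alpha> (pullback \<alpha> f)) * adj (gen \<alpha>) - c \<alpha> *\<^sub>C (gen \<alpha> * adj (gen \<alpha>)) =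
          gen \<alpha> * \<psi> 0 (single (src \<Lambda> \<alpha>) (g \<alpha>)) * adj (gen \<alpha>)"
          by (simp add: left_diff_distrib mult_scaleC_left)
      qed
      also have "norm \<dots> \<le> \<epsilon>"
      proof (rule G.norm_block_diagonal_le[OF finite_of_degree_at[OF v] of_degree_at_subset])
        fix \<alpha> assume a: "\<alpha> \<in> ?E"
        have aa: "\<alpha> \<in> arrows \<Lambda>" and w: "src \<Lambda> \<alpha> \<in> vertices \<Lambda>" using of_degree_atD[OF a] src_vertex by auto
        show "norm (\<psi> 0 (single (src \<Lambda> \<alpha>) (g \<alpha>))) \<le> \<epsilon>"
        proof (rule norm_psi_zero_le[OF single_coeff[OF w gc[OF a]]])
          fix u t
          show "cmod (single (src \<Lambda> \<alpha>) (g \<alpha>) u t) \<le> \<epsilon>"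
          proof (cases "u = src \<Lambda> \<alpha> \<and> t \<in> topspace (T (src \<Lambda> \<alpha>))")
            case True
            then obtain x where x: "x \<in> inf_paths_at \<Lambda> (src \<Lambda> \<alpha>)" "t = code x" using code_image[OF w] by blast
            have "prepend \<Lambda> \<alpha> x \<in> cylinder \<Lambda> \<alpha>" using x(1) by (simp add: cylinder_def)
            then have "cmod (f (code (prepend \<Lambda> \<alpha> x)) - c \<alpha>) \<le> \<epsilon>"
              unfolding c_def using osc[OF a _ base_in[OF aa]] by blast
            then show ?thesis
              using True x(2) code_prepend[OF aa x(1)] by (simp add: single_def g_def pullback_def unit_at_def)
          next
            case False
            then show ?thesis using e by (auto simp: single_def g_def pullback_def unit_at_def)
          qed
        qed
      qed (use e in simp)
      finally show ?thesis .
    qed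
    then show ?thesis unfolding eventually_sequentially by blast
  qed
  have "(\<lambda>N. \<psi> 0 (single v f) - \<pi> (approx (vec N) v f)) \<longlonglongrightarrow> \<psi> 0 (single v f) - \<pi> (iota v f)"
    by (intro tendsto_intros bounded_linear.tendsto[OF bounded_linear_star_hom[OF hom]] approx_tendsto_iota v f)
  then have "norm (\<psi> 0 (single v f) - \<pi> (iota v f)) \<le> 0 + e" if "0 < e" for e
    using Lim_norm_ubound[OF sequentially_bot _ close[OF that]] by simp
  then have "norm (\<psi> 0 (single v f) - \<pi> (iota v f)) \<le> 0" by (rule field_le_epsilon)
  then show ?thesis by simp
qed

text \<open>Both sides are limits of the sums over finite sets of arrows: the left one because \<open>rho\<close> is an infinite sum and \<open>\<pi>\<close>
is bounded, the right one because \<open>\<psi> n\<close> is contractive and \<open>y\<close> has small tails.\<close>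

lemma hom_rho:
  assumes hom: "star_hom \<pi>" and \<pi>: "\<And>\<alpha>. \<alpha> \<in> arrows \<Lambda> \<Longrightarrow> \<pi> (s \<alpha>) = gen \<alpha>" and y: "module_family n y"
  shows "\<pi> (rho n y) = \<psi> n y"
proof -
  let ?FS = "finite_subsets_at_top (of_degree \<Lambda> n)"
  have part: "\<pi> (sum (summand y) F) = \<psi> n (restrict_family F y)" if F: "finite F" "F \<subseteq> of_degree \<Lambda> n" for F
  proof -
    have "\<pi> (sum (summand y) F) = (\<Sum>\<alpha>\<in>F. \<psi> n (single \<alpha> (y \<alpha>)))"
      unfolding star_hom_sum[OF hom]
    proof (rule sum.cong[OF refl])
      fix \<alpha> assume "\<alpha> \<in> F"
      then have a: "\<alpha> \<in> of_degree \<Lambda> n" "\<alpha> \<in> arrows \<Lambda>" using F of_degree_arrow by auto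
      have ya: "y \<alpha> \<in> C0 (T (src \<Lambda> \<alpha>))" using module_familyD(1)[OF y a(1)] .
      show "\<pi> (summand y \<alpha>) = \<psi> n (single \<alpha> (y \<alpha>))"
        using hom_iota[OF hom \<pi> src_vertex[OF a(2)] ya] \<pi>[OF a(2)] gen_mult_psi_zero[OF a(1) ya]
        by (simp add: summand_def star_homD[OF hom])
    qed
    also have "\<dots> = \<psi> n (\<lambda>\<beta> t. \<Sum>\<alpha>\<in>F. single \<alpha> (y \<alpha>) \<beta> t)"
      by (rule psi_sum[symmetric]) (use F module_familyD(1)[OF y] single_module in blast)
    also have "(\<lambda>\<beta> t. \<Sum>\<alpha>\<in>F. single \<alpha> (y \<alpha>) \<beta> t) = restrict_family F y"
      using F(1) by (auto simp: single_def restrict_family_def fun_eq_iff sum.delta')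
    finally show ?thesis .
  qed
  have "((\<lambda>F. \<pi> (sum (summand y) F)) \<longlongrightarrow> \<pi> (rho n y)) ?FS"
    by (intro bounded_linear.tendsto[OF bounded_linear_star_hom[OF hom]] rho_tendsto y)
  moreover have "((\<lambda>F. \<pi> (sum (summand y) F)) \<longlongrightarrow> \<psi> n y) ?FS"
    unfolding tendsto_iff
  proof (intro allI impI)
    fix e :: real assume e: "0 < e"
    then have e2: "0 < e / 2" by simp
    obtain F0 where F0: "finite F0" "F0 \<subseteq> of_degree \<Lambda> n"
      "\<And>F v t. finite F \<Longrightarrow> F \<subseteq> of_degree \<Lambda> n - F0 \<Longrightarrow> fibre_norm y F v t \<le> e / 2"
      using small_tailsE[OF module_familyD(3)[OF y] e2] by blast
    have "dist (\<pi> (sum (summand y) F)) (\<psi> n y) < e" if F: "finite F \<and> F0 \<subseteq> F \<and> F \<subseteq> of_degree \<Lambda> n" for F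
    proof -
      have "(\<lambda>\<alpha> t. y \<alpha> t - restrict_family F y \<alpha> t) = restrict_family (- F) y"
        by (auto simp: restrict_family_def fun_eq_iff)
      then have "\<psi> n y - \<psi> n (restrict_family F y) = \<psi> n (restrict_family (- F) y)"
        using psi_diff[OF y module_family_restrict[OF y]] by metis
      moreover have "norm (\<psi> n (restrict_family (- F) y)) \<le> e / 2"
      proof (rule norm_psi_le[OF module_family_restrict[OF y] bounded_by_restrict_complement])
        show "fibre_norm y G v t \<le> e / 2" if "finite G" "G \<subseteq> of_degree \<Lambda> n - F" for G v t
          by (rule F0(3)) (use that F in auto)
      qed
      ultimately have "norm (\<psi> n y - \<pi> (sum (summand y) F)) \<le> e / 2" using part F by simp
      then show ?thesis using e by (simp add: dist_norm norm_minus_commute)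
    qed
    then show "\<forall>\<^sub>F F in ?FS. dist (\<pi> (sum (summand y) F)) (\<psi> n y) < e"
      unfolding eventually_finite_subsets_at_top using F0(1,2) by blast
  qed
  ultimately show ?thesis using tendsto_unique finite_subsets_at_top_neq_bot by blast
qed

end

theorem theorem3p23:
  fixes \<Lambda> :: "('e, 'k::finite) kgraph"
    and T :: "'e \<Rightarrow> 't topology"
    and \<sigma> :: "'e \<Rightarrow> 't \<Rightarrow> 't"
    and s :: "'e \<Rightarrow> 'c::cstar_algebra"
    and \<psi> :: "nat ^ 'k \<Rightarrow> ('e, 't) family \<Rightarrow> 'o::cstar_algebra"
  assumes "k_graph \<Lambda>"
    and "row_finite_no_sources \<Lambda>"
    and "lambda_system \<Lambda> T \<sigma>"
    and "k_regular \<Lambda> T \<sigma>"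
    and "self_similar \<Lambda> T \<sigma>"
    and "universal_ck_family TYPE('o) \<Lambda> s"
    and "universal_cp_representation TYPE('c) \<Lambda> T \<sigma> \<psi>"
  shows "star_isomorphic TYPE('o) TYPE('c)"
proof -
  obtain \<Phi> where \<Phi>: "intertwining \<Lambda> T \<sigma> \<Phi>" "\<Phi> ` inf_paths \<Lambda> = topspace (total_space \<Lambda> T)"
    using assms(5) unfolding self_similar_def by blast
  have s: "ck_family \<Lambda> s" "generates_cstar (s ` arrows \<Lambda>)"
    "\<And>t :: 'e \<Rightarrow> 'o. ck_family \<Lambda> t \<Longrightarrow> \<exists>\<pi>. star_hom \<pi> \<and> (\<forall>\<alpha>\<in>arrows \<Lambda>. \<pi> (s \<alpha>) = t \<alpha>)"
    using assms(6) unfolding universal_ck_family_def by blast+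
  have \<psi>: "representation \<Lambda> T \<sigma> \<psi>" "cp_covariant \<Lambda> T \<sigma> \<psi>" "generates_cstar (\<Union>n. \<psi> n ` Y_module \<Lambda> T n)"
    "\<And>\<rho> :: nat ^ 'k \<Rightarrow> ('e, 't) family \<Rightarrow> 'c. representation \<Lambda> T \<sigma> \<rho> \<Longrightarrow> cp_covariant \<Lambda> T \<sigma> \<rho> \<Longrightarrow>
       \<exists>\<pi>. star_hom \<pi> \<and> (\<forall>n. \<forall>y\<in>Y_module \<Lambda> T n. \<pi> (\<psi> n y) = \<rho> n y)"
    using assms(7) unfolding universal_cp_representation_def by blast+
  interpret L: lambda_system \<Lambda> T \<sigma> by (rule assms(3))
  interpret universal_pair \<Lambda> T \<sigma> \<Phi> s \<psi>
    by unfold_locales (use assms(2) \<Phi> s \<psi> in auto)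
  obtain p :: "'c \<Rightarrow> 'o" where p: "star_hom p" "\<And>\<alpha>. \<alpha> \<in> arrows \<Lambda> \<Longrightarrow> p (s \<alpha>) = gen \<alpha>"
    using s(3)[OF ck_family_gen] by blast
  obtain q :: "'o \<Rightarrow> 'c" where q: "star_hom q" "\<And>n y. module_family n y \<Longrightarrow> q (\<psi> n y) = rho n y"
    using \<psi>(4)[OF representation_rho cp_covariant_rho] by (auto simp: Y_module_iff)
  have "(q \<circ> p) x = x" for x
  proof (rule star_homs_eq_on_generators[OF s(2) star_hom_comp[OF p(1) q(1)] star_hom_id])
    fix g assume "g \<in> s ` arrows \<Lambda>"
    then obtain \<alpha> where a: "\<alpha> \<in> arrows \<Lambda>" "g = s \<alpha>" by blast
    then have ad: "\<alpha> \<in> of_degree \<Lambda> (deg \<Lambda> \<alpha>)" by (simp add: of_degree_def)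
    show "(q \<circ> p) g = g" using p(2)[OF a(1)] a(2) q(2)[OF unit_single[OF ad]] gen_eq[OF ad] rho_unit_single[OF ad] by simp
  qed
  moreover have "(p \<circ> q) x = x" for x
  proof (rule star_homs_eq_on_generators[OF \<psi>(3) star_hom_comp[OF q(1) p(1)] star_hom_id])
    fix g assume "g \<in> (\<Union>n. \<psi> n ` Y_module \<Lambda> T n)"
    then obtain n y where y: "module_family n y" "g = \<psi> n y" by (auto simp: Y_module_iff)
    then show "(p \<circ> q) g = g" using hom_rho[OF p y(1)] q(2)[OF y(1)] by simp
  qed
  ultimately have "bij q" by (intro o_bij[of p]) auto
  then show ?thesis unfolding star_isomorphic_def using q(1) by blast
qed

end
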